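(* Let $\mathcal T\in\mathrm{Tree}(N)$ with $n=|[N]\cap\mathcal T|\ge2$. Let $(\mathcal A,E)$ be a $\mathcal B$-valued probability space, let $\tilde{\mathcal A}$ be the $\mathcal T$-free product of $N$ copies of $\mathcal A$, and let $\lambda_{\mathcal T,j}:\mathcal A\to\tilde{\mathcal A}$ be the map from the $j$th factor into the product. Then for all $\ell\ge1$ and $a_1,\dots,a_\ell\in\mathcal A$, \[ K_{\mathcal T,\ell}\Bigl[\sum_{j=1}^N\lambda_{\mathcal T,j}(a_1),\dots,\sum_{j=1}^N\lambda_{\mathcal T,j}(a_\ell)\Bigr]=n\,K_{\mathcal T,\ell}[a_1,\dots,a_\ell], \] where the cumulants on the left are those of $\tilde{\mathcal A}$ and those on the right are those of $\mathcal A$.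
   Context: $\mathcal B$ is a unital $C^*$-algebra. A $\mathcal B$-valued probability space $(\mathcal A,E)$ is a unital $C^*$-algebra $\mathcal A$ containing $\mathcal B$ unitally with a unital completely positive $\mathcal B$-$\mathcal B$-bimodule map $E:\mathcal A\to\mathcal B$ such that $E[a_1aa_2]=0$ for all $a_1,a_2$ implies $a=0$. $L^2(\mathcal A,E)$ is the separation-completion of $\mathcal A$ for $\langle a_1,a_2\rangle=E[a_1^*a_2]$, on which $\mathcal A$ acts by left multiplication. Trees: $[N]=\{1,\dots,N\}$. A string on $[N]$ is alternating if consecutive letters differ. $\mathcal T_{N,\mathrm{free}}$ is the graph whose vertices are the alternating strings on $[N]$ (including the empty string $\emptyset$), with an edge between $s$ and $js$ whenever $js$ is alternating, rooted at $\emptyset$. $\mathrm{Tree}(N)$ is the set of connected subgraphs containing $\emptyset$, each identified with its vertex set; $[N]\cap\mathcal T$ is the set of one-letter strings in $\mathcal T$. $\mathcal T$-free product of $(\mathcal A_1,E_1),\dots,(\mathcal A_N,E_N)$: let $\mathcal H_j=L^2(\mathcal A_j,E_j)$, $\xi_j$ the class of $1$, $\mathcal H_j^\circ=\{h:\langle h,\xi_j\rangle=0\}$, so $\mathcal H_j=\mathcal B\xi_j\oplus\mathcal H_j^\circ$. Let $\mathcal H=\bigoplus_{s\in\mathcal T}\mathcal H_s^\circ$, $\mathcal H_\emptyset^\circ=\mathcal B$, $\mathcal H^\circ_{j_1\cdots j_m}=\mathcal H_{j_1}^\circ\otimes_{\mathcal B}\cdots\otimes_{\mathcal B}\mathcal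 H_{j_m}^\circ$, $\xi=1\in\mathcal H_\emptyset^\circ$. For $x$ a bounded adjointable right-$\mathcal B$-modular operator on $\mathcal H_j$, $\lambda_{\mathcal T,j}(x)$ acts on $\mathcal H_s^\circ\oplus\mathcal H_{js}^\circ\cong\mathcal H_j\otimes_{\mathcal B}\mathcal H_s^\circ$ as $x\otimes\mathrm{id}$ when $s\in\mathcal T$ does not begin with $j$ and $js\in\mathcal T$, and as zero on $\mathcal H_s^\circ$ when $s\in\mathcal T$ does not begin with $j$ and $js\notin\mathcal T$. The $\mathcal T$-free product is the unital $C^*$-algebra of operators on $\mathcal H$ generated by the $\lambda_{\mathcal T,j}(\mathcal A_j)$ (containing $\mathcal B$ as left multiplications), with expectation $a\mapsto\langle\xi,a\xi\rangle$. Partitions: $\mathcal{NC}(S)$ is the set of non-crossing partitions of a finite totally ordered set $S$, $\mathcal{NC}(\ell)=\mathcal{NC}([\ell])$, $|\pi|$ the number of blocks. $W\prec V$ ($V$ nested inside $W$) if there are $j,k\in W$ with $j<v<k$ for all $v\in V$. $\mathrm{chain}(V)=(V,V_1,\dots,V_d)$, where $V\succ V_1\succ\cdots\succ V_d$ are all blocks in which $V$ is nested. $\mathrm{graph}(\pi)$ is the rooted tree on $\pi\sqcup\{\emptyset\}$ with $\emptyset$ joined to the $\prec$-minimal blocks and $V,W$ joined if $V\prec W$ with no block strictly between. For a coloring $\chi\in[N]^\pi$, the $\chi$-components of $\pi$ are the connected components of the graph obtained from $\mathrm{graph}(\pi)$ by deleting the root and all edges between blocks of different colors; each is regarded as a non-crossing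 partition of the union of its blocks. $\mathrm{red}(s)$ is the string obtained by replacing each run of equal consecutive letters by a single one. $\mathcal X_w(\pi,\mathcal T)$ is the set of $\chi\in[N]^\pi$ with $\mathrm{red}(\chi(V)\chi(V_1)\cdots\chi(V_d))\in\mathcal T$ for every $V\in\pi$ with $\mathrm{chain}(V)=(V,V_1,\dots,V_d)$. The coefficients $\alpha_{\mathcal T,\pi}$ are the unique numbers with $\alpha_{\mathcal T,\pi}=1$ if $|\pi|=1$ and $\alpha_{\mathcal T,\pi}=n^{-|\pi|}\sum_{\chi\in\mathcal X_w(\pi,\mathcal T)}\prod_{\chi\text{-components }\pi'}\alpha_{\mathcal T,\pi'}$ for all $\pi$. Cumulants: $\Lambda:\mathcal A^\ell\to\mathcal B$ is $\mathcal B$-quasi-multilinear if it is multilinear, $\Lambda[ba_1,\dots]=b\Lambda[a_1,\dots]$, $\Lambda[\dots,a_\ell b]=\Lambda[\dots,a_\ell]b$, $\Lambda[\dots,a_jb,a_{j+1},\dots]=\Lambda[\dots,a_j,ba_{j+1},\dots]$. For a sequence $(\Lambda_\ell)$ of such maps, $\Lambda_\pi$ is defined recursively: it is $1$ for the empty partition, and for an interval block $V=\{j+1,\dots,k\}$ of $\pi\in\mathcal{NC}(\ell)$, $\Lambda_\pi[a_1,\dots,a_\ell]=\Lambda_{\pi\setminus V}[a_1,\dots,a_j,\Lambda_{k-j}[a_{j+1},\dots,a_k]a_{k+1},\dots,a_\ell]$ if $k<\ell$ and $=\Lambda_{\pi\setminus V}[a_1,\dots,a_j]\Lambda_{\ell-j}[a_{j+1},\dots,a_\ell]$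 if $k=\ell$. The $\mathcal T$-free cumulants $K_{\mathcal T,\ell}:\mathcal A^\ell\to\mathcal B$ are the unique $\mathcal B$-quasi-multilinear maps with $E[a_1\cdots a_\ell]=\sum_{\pi\in\mathcal{NC}(\ell)}\alpha_{\mathcal T,\pi}K_{\mathcal T,\pi}[a_1,\dots,a_\ell]$ for all $\ell\ge 1$. *)

theory Defs
  imports "HOL-Analysis.Analysis" "HOL-Library.Disjoint_Sets" "HOL-Library.FuncSet"
begin

section \<open>Unital C*-algebras and B-valued probability spaces\<close>

class cstar_algebra = real_normed_algebra_1 + banach +
  fixes scaleC :: "complex \<Rightarrow> 'a \<Rightarrow> 'a"
    and adj :: "'a \<Rightarrow> 'a"
  assumes scaleC_add_right: "scaleC c (x + y) = scaleC c x + scaleC c y"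
    and scaleC_add_left: "scaleC (c + d) x = scaleC c x + scaleC d x"
    and scaleC_scaleC: "scaleC c (scaleC d x) = scaleC (c * d) x"
    and scaleC_of_real: "scaleC (complex_of_real r) x = r *\<^sub>R x"
    and mult_scaleC_left: "scaleC c x * y = scaleC c (x * y)"
    and mult_scaleC_right: "x * scaleC c y = scaleC c (x * y)"
    and norm_scaleC: "norm (scaleC c x) = cmod c * norm x"
    and adj_adj: "adj (adj x) = x"
    and adj_add: "adj (x + y) = adj x + adj y"
    and adj_scaleC: "adj (scaleC c x) = scaleC (cnj c) (adj x)"
    and adj_mult: "adj (x * y) = adj y * adj x"
    and norm_adj_mult: "norm (adj x * x) = (norm x)\<^sup>2"

definition cstar_positive :: "'a::cstar_algebra \<Rightarrow> bool" where
  "cstar_positive x \<longleftrightarrow> (\<exists>y. x = adj y * y)"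

text \<open>Positivity in the matrix C*-algebra of size \<open>m\<close> (entries with indices below \<open>m\<close>).\<close>

definition mat_positive :: "nat \<Rightarrow> (nat \<Rightarrow> nat \<Rightarrow> 'a::cstar_algebra) \<Rightarrow> bool" where
  "mat_positive m X \<longleftrightarrow> (\<exists>Y. \<forall>i<m. \<forall>j<m. X i j = (\<Sum>k<m. adj (Y k i) * Y k j))"

definition completely_positive :: "('a::cstar_algebra \<Rightarrow> 'b::cstar_algebra) \<Rightarrow> bool" where
  "completely_positive E \<longleftrightarrow>
     (\<forall>m X. mat_positive m X \<longrightarrow> mat_positive m (\<lambda>i j. E (X i j)))"

text \<open>The unital inclusion of \<open>\<B>\<close> into \<open>\<A>\<close> is an injective unital *-homomorphism \<open>\<iota>\<close>.\<close>

locale bvalued_prob_space =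
  fixes \<iota> :: "'b::cstar_algebra \<Rightarrow> 'a::cstar_algebra" and E :: "'a \<Rightarrow> 'b"
  assumes incl_add: "\<iota> (b + c) = \<iota> b + \<iota> c"
    and incl_scaleC: "\<iota> (scaleC z b) = scaleC z (\<iota> b)"
    and incl_mult: "\<iota> (b * c) = \<iota> b * \<iota> c"
    and incl_adj: "\<iota> (adj b) = adj (\<iota> b)"
    and incl_one: "\<iota> 1 = 1"
    and incl_inj: "inj \<iota>"
    and E_add: "E (x + y) = E x + E y"
    and E_scaleC: "E (scaleC z x) = scaleC z (E x)"
    and E_one: "E 1 = 1"
    and E_cp: "completely_positive E"
    and E_left: "E (\<iota> b * x) = b * E x"
    and E_right: "E (x * \<iota> b) = E x * b"
    and E_faithful: "(\<And>x\<^sub>1 x\<^sub>2. E (x\<^sub>1 * x * x\<^sub>2) = 0) \<Longrightarrow> x = 0"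

section \<open>Hilbert C*-modules\<close>

record ('h, 'b) hilbert_structure =
  ract :: "'h \<Rightarrow> 'b \<Rightarrow> 'h"
  ip :: "'h \<Rightarrow> 'h \<Rightarrow> 'b"

text \<open>Completeness is provided by the class \<open>banach\<close>; complex scalars act through \<open>\<B>\<close>.\<close>

locale hilbert_module =
  fixes M :: "('h::banach, 'b::cstar_algebra, 'z) hilbert_structure_scheme"
  assumes ract_add_left: "ract M (h + k) b = ract M h b + ract M k b"
    and ract_add_right: "ract M h (b + c) = ract M h b + ract M h c"
    and ract_mult: "ract M h (b * c) = ract M (ract M h b) c"
    and ract_of_real: "ract M h (of_real r) = r *\<^sub>R h"
    and ip_add_right: "ip M h (k + l) = ip M h k + ip M h l"
    and ip_ract_right: "ip M h (ract M k b) = ip M h k * b"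
    and ip_adj: "adj (ip M h k) = ip M k h"
    and ip_positive: "cstar_positive (ip M h h)"
    and norm_ip: "norm h = sqrt (norm (ip M h h))"

definition adjoint_pair ::
  "('h, 'b, 'z) hilbert_structure_scheme \<Rightarrow> ('h \<Rightarrow> 'h) \<Rightarrow> ('h \<Rightarrow> 'h) \<Rightarrow> bool" where
  "adjoint_pair M f g \<longleftrightarrow> (\<forall>h k. ip M (f h) k = ip M h (g k))"

definition adjointable ::
  "('h::real_normed_vector, 'b, 'z) hilbert_structure_scheme \<Rightarrow> ('h \<Rightarrow> 'h) \<Rightarrow> bool" where
  "adjointable M f \<longleftrightarrow> bounded_linear f \<and> (\<forall>h b. f (ract M h b) = ract M (f h) b)
     \<and> (\<exists>g. adjoint_pair M f g)"

definition cscale ::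
  "('h, 'b::cstar_algebra, 'z) hilbert_structure_scheme \<Rightarrow> complex \<Rightarrow> 'h \<Rightarrow> 'h" where
  "cscale M c h = ract M h (scaleC c 1)"

definition operator_cstar_algebra ::
  "('h::real_normed_vector, 'b::cstar_algebra, 'z) hilbert_structure_scheme
     \<Rightarrow> ('h \<Rightarrow> 'h) set \<Rightarrow> bool" where
  "operator_cstar_algebra M S \<longleftrightarrow>
     S \<subseteq> Collect (adjointable M) \<and> id \<in> S
     \<and> (\<forall>f\<in>S. \<forall>g\<in>S. (\<lambda>v. f v + g v) \<in> S \<and> f \<circ> g \<in> S)
     \<and> (\<forall>f\<in>S. \<forall>c. (\<lambda>v. cscale M c (f v)) \<in> S)
     \<and> (\<forall>f\<in>S. \<forall>g. adjoint_pair M f g \<longrightarrow> g \<in> S)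
     \<and> (\<forall>F f. (\<forall>i. F i \<in> S) \<and> adjointable M f
            \<and> (\<lambda>i. onorm (\<lambda>v. F i v - f v)) \<longlonglongrightarrow> 0 \<longrightarrow> f \<in> S)"

definition generated_cstar_algebra ::
  "('h::real_normed_vector, 'b::cstar_algebra, 'z) hilbert_structure_scheme
     \<Rightarrow> ('h \<Rightarrow> 'h) set \<Rightarrow> ('h \<Rightarrow> 'h) set" where
  "generated_cstar_algebra M G = \<Inter> {S. operator_cstar_algebra M S \<and> G \<subseteq> S}"

text \<open>
  \<open>Q\<close> is the interior tensor product of \<open>X\<close> and \<open>P\<close> over \<open>\<B>\<close> with elementary tensors
  \<open>\<tau> h v\<close>, where \<open>l\<close> is the left action of \<open>\<B>\<close> on \<open>P\<close>.  As usual it is the separation-completion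
  of the algebraic tensor product, which determines \<open>Q\<close> and \<open>\<tau>\<close> up to unitary isomorphism.
\<close>

definition interior_tensor ::
  "('k, 'b, 'z) hilbert_structure_scheme \<Rightarrow> 'k::real_normed_vector set
   \<Rightarrow> ('h, 'b, 'y) hilbert_structure_scheme \<Rightarrow> ('b \<Rightarrow> 'h \<Rightarrow> 'h) \<Rightarrow> 'h::real_normed_vector set
   \<Rightarrow> 'h set \<Rightarrow> ('k \<Rightarrow> 'h \<Rightarrow> 'h) \<Rightarrow> bool" where
  "interior_tensor L X H l P Q \<tau> \<longleftrightarrow>
     (\<forall>h\<in>X. \<forall>k\<in>X. \<forall>v\<in>P. \<tau> (h + k) v = \<tau> h v + \<tau> k v)
     \<and> (\<forall>h\<in>X. \<forall>v\<in>P. \<forall>w\<in>P. \<tau> h (v + w) = \<tau> h v + \<tau> h w)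
     \<and> (\<forall>h\<in>X. \<forall>v\<in>P. \<forall>b. \<tau> (ract L h b) v = \<tau> h (l b v))
     \<and> (\<forall>h\<in>X. \<forall>v\<in>P. \<forall>b. \<tau> h (ract H v b) = ract H (\<tau> h v) b)
     \<and> (\<forall>h\<in>X. \<forall>k\<in>X. \<forall>v\<in>P. \<forall>w\<in>P. ip H (\<tau> h v) (\<tau> k w) = ip H v (l (ip L h k) w))
     \<and> Q = closure (span {\<tau> h v |h v. h \<in> X \<and> v \<in> P})"

text \<open>
  \<open>L\<close> is \<open>L\<^sup>2(\<A>, E)\<close>: the Hilbert module of which the classes \<open>cls L x\<close> form a dense submodule with
  inner product \<open>E[x\<^sup>* y]\<close>, with \<open>\<A>\<close> acting by \<open>lmul L\<close>.
\<close>

record ('a, 'k, 'b) L2_structure = "('k, 'b) hilbert_structure" +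
  cls :: "'a \<Rightarrow> 'k"
  lmul :: "'a \<Rightarrow> 'k \<Rightarrow> 'k"

locale L2_module = hilbert_module L
  for \<iota> :: "'b::cstar_algebra \<Rightarrow> 'a::cstar_algebra" and E :: "'a \<Rightarrow> 'b"
    and L :: "('a, 'k::banach, 'b) L2_structure" +
  assumes cls_add: "cls L (x + y) = cls L x + cls L y"
    and cls_ract: "cls L (x * \<iota> b) = ract L (cls L x) b"
    and cls_ip: "ip L (cls L x) (cls L y) = E (adj x * y)"
    and cls_dense: "closure (range (cls L)) = UNIV"
    and lmul_adjointable: "adjointable L (lmul L x)"
    and lmul_cls: "lmul L x (cls L y) = cls L (x * y)"

definition centred :: "('a::one, 'k, 'b::zero) L2_structure \<Rightarrow> 'k set" where
  "centred L = {h. ip L h (cls L 1) = 0}"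

section \<open>Trees\<close>

definition free_tree :: "nat \<Rightarrow> nat list set" where
  "free_tree N = {s. set s \<subseteq> {1..N} \<and> distinct_adj s}"

definition tree_edge :: "nat list \<Rightarrow> nat list \<Rightarrow> bool" where
  "tree_edge s t \<longleftrightarrow> (\<exists>j. t = j # s) \<or> (\<exists>j. s = j # t)"

definition Tree :: "nat \<Rightarrow> nat list set set" where
  "Tree N = {T. T \<subseteq> free_tree N \<and> [] \<in> T
     \<and> (\<forall>s\<in>T. \<forall>t\<in>T. (s, t) \<in> {(u, v). u \<in> T \<and> v \<in> T \<and> tree_edge u v}\<^sup>*)}"

definition root_degree :: "nat \<Rightarrow> nat list set \<Rightarrow> nat" where
  "root_degree N T = card {j \<in> {1..N}. [j] \<in> T}"

section \<open>The Hilbert module of the tree-free product\<close>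

text \<open>
  \<open>summand H s\<close> is the summand indexed by \<open>s\<close>, \<open>vac H\<close> is the vacuum vector, \<open>lact H\<close> is left
  multiplication by \<open>\<B>\<close>, and \<open>tens H j h v\<close> is \<open>h \<otimes> v\<close> in the summand \<open>j # s\<close> for \<open>h\<close> in the
  centred part of the \<open>j\<close>-th factor and \<open>v\<close> in the summand \<open>s\<close>.  All factors are copies of the
  same \<open>L\<^sup>2\<close> module.
\<close>

record ('k, 'h, 'b) product_structure = "('h, 'b) hilbert_structure" +
  vac :: "'h"
  lact :: "'b \<Rightarrow> 'h \<Rightarrow> 'h"
  summand :: "nat list \<Rightarrow> 'h set"
  tens :: "nat \<Rightarrow> 'k \<Rightarrow> 'h \<Rightarrow> 'h"

locale tree_product_module = hilbert_module H
  for T :: "nat list set" and \<iota> :: "'b::cstar_algebra \<Rightarrow> 'a::cstar_algebra"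
    and L :: "('a, 'k::banach, 'b) L2_structure"
    and H :: "('k, 'h::banach, 'b) product_structure" +
  assumes vac_ip: "ip H (vac H) (vac H) = 1"
    and summand_Nil: "summand H [] = range (ract H (vac H))"
    and summand_Cons: "j # s \<in> T \<Longrightarrow>
          interior_tensor L (centred L) H (lact H) (summand H s) (summand H (j # s)) (tens H j)"
    and summand_orthogonal: "\<lbrakk>s \<in> T; t \<in> T; s \<noteq> t; v \<in> summand H s; w \<in> summand H t\<rbrakk> \<Longrightarrow> ip H v w = 0"
    and summand_dense: "closure (span (\<Union>s\<in>T. summand H s)) = UNIV"
    and lact_adjointable: "adjointable H (lact H b)"
    and lact_vac: "lact H b (ract H (vac H) c) = ract H (vac H) (b * c)"
    and lact_tens: "\<lbrakk>j # s \<in> T; h \<in> centred L; v \<in> summand H s\<rbrakk> \<Longrightarrow>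
          lact H b (tens H j h v) = tens H j (lmul L (\<iota> b) h) v"

text \<open>
  The image of \<open>h \<otimes> v\<close> under the identification of the tensor product of the whole \<open>j\<close>-th factor
  and the summand \<open>s\<close> with the sum of the summands \<open>s\<close> and \<open>j # s\<close>; here \<open>h\<close> is decomposed as
  \<open>\<xi> \<langle>\<xi>, h\<rangle>\<close> plus a centred vector, and \<open>\<xi> b \<otimes> v\<close> corresponds to \<open>b v\<close>.
\<close>

definition attach ::
  "('a::one, 'k::minus, 'b) L2_structure \<Rightarrow> ('k, 'h::plus, 'b) product_structure
     \<Rightarrow> nat \<Rightarrow> 'k \<Rightarrow> 'h \<Rightarrow> 'h" where
  "attach L H j h v = lact H (ip L (cls L 1) h) v
     + tens H j (h - ract L (cls L 1) (ip L (cls L 1) h)) v"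

text \<open>\<open>f\<close> is the operator \<open>\<lambda>\<close> of the \<open>j\<close>-th factor applied to \<open>x\<close>; strings in \<open>T\<close> beginning with
  \<open>j\<close> are covered by the first clause, because \<open>T\<close> is connected.\<close>

definition tree_lambda ::
  "nat list set \<Rightarrow> ('a::one, 'k::minus, 'b) L2_structure
     \<Rightarrow> ('k, 'h::real_normed_vector, 'b) product_structure
     \<Rightarrow> nat \<Rightarrow> ('k \<Rightarrow> 'k) \<Rightarrow> ('h \<Rightarrow> 'h) \<Rightarrow> bool" where
  "tree_lambda T L H j x f \<longleftrightarrow> adjointable H f
     \<and> (\<forall>s\<in>T. \<not> (s \<noteq> [] \<and> hd s = j) \<longrightarrow>
          (if j # s \<in> T then \<forall>h. \<forall>v\<in>summand H s. f (attach L H j h v) = attach L H j (x h) v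
           else \<forall>v\<in>summand H s. f v = 0))"

section \<open>Non-crossing partitions and the coefficients of a tree\<close>

definition noncrossing :: "nat set set \<Rightarrow> bool" where
  "noncrossing \<pi> \<longleftrightarrow> (\<forall>V\<in>\<pi>. \<forall>W\<in>\<pi>. V \<noteq> W \<longrightarrow>
     \<not> (\<exists>a\<in>V. \<exists>b\<in>W. \<exists>c\<in>V. \<exists>d\<in>W. a < b \<and> b < c \<and> c < d))"

definition NC :: "nat set \<Rightarrow> nat set set set" where
  "NC S = {\<pi>. partition_on S \<pi> \<and> noncrossing \<pi>}"

definition encloses :: "nat set \<Rightarrow> nat set \<Rightarrow> bool" where
  "encloses W V \<longleftrightarrow> (\<exists>j\<in>W. \<exists>k\<in>W. \<forall>v\<in>V. j < v \<and> v < k)"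

definition is_chain :: "nat set set \<Rightarrow> nat set \<Rightarrow> nat set list \<Rightarrow> bool" where
  "is_chain \<pi> V Vs \<longleftrightarrow> sorted_wrt (\<lambda>X Y. encloses Y X) (V # Vs) \<and> set Vs = {W\<in>\<pi>. encloses W V}"

definition covers :: "nat set set \<Rightarrow> nat set \<Rightarrow> nat set \<Rightarrow> bool" where
  "covers \<pi> V W \<longleftrightarrow> V \<in> \<pi> \<and> W \<in> \<pi> \<and> encloses V W \<and> \<not> (\<exists>X\<in>\<pi>. encloses V X \<and> encloses X W)"

definition mono_edges :: "nat set set \<Rightarrow> (nat set \<Rightarrow> nat) \<Rightarrow> (nat set \<times> nat set) set" where
  "mono_edges \<pi> \<kappa> = {(V, W). (covers \<pi> V W \<or> covers \<pi> W V) \<and> \<kappa> V = \<kappa> W}"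

definition color_components :: "nat set set \<Rightarrow> (nat set \<Rightarrow> nat) \<Rightarrow> nat set set set" where
  "color_components \<pi> \<kappa> = (\<lambda>V. {W. (V, W) \<in> (mono_edges \<pi> \<kappa>)\<^sup>*}) ` \<pi>"

text \<open>\<open>remdups_adj\<close> is the reduction \<open>red\<close> of strings.\<close>

definition weak_colorings ::
  "nat \<Rightarrow> nat list set \<Rightarrow> nat set set \<Rightarrow> (nat set \<Rightarrow> nat) set" where
  "weak_colorings N T \<pi> = {\<kappa> \<in> \<pi> \<rightarrow>\<^sub>E {1..N}.
     \<forall>V\<in>\<pi>. \<forall>Vs. is_chain \<pi> V Vs \<longrightarrow> remdups_adj (map \<kappa> (V # Vs)) \<in> T}"

text \<open>The coefficients are indexed by the non-crossing partitions of all finite sets of naturals, so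
  that components need not be relabelled.\<close>

definition tree_coefficients ::
  "nat \<Rightarrow> nat list set \<Rightarrow> (nat set set \<Rightarrow> real) \<Rightarrow> bool" where
  "tree_coefficients N T \<alpha> \<longleftrightarrow> (\<forall>S \<pi>. finite S \<and> \<pi> \<in> NC S \<longrightarrow>
     (card \<pi> = 1 \<longrightarrow> \<alpha> \<pi> = 1)
     \<and> \<alpha> \<pi> = (\<Sum>\<kappa>\<in>weak_colorings N T \<pi>. \<Prod>\<pi>'\<in>color_components \<pi> \<kappa>. \<alpha> \<pi>')
               / real (root_degree N T) ^ card \<pi>)"

lemma color_components_le:
  assumes "\<pi>' \<in> color_components \<pi> \<kappa>"
  shows "\<pi>' \<subseteq> \<pi>"
proof -
  obtain V where V: "V \<in> \<pi>" and p: "\<pi>' = {W. (V, W) \<in> (mono_edges \<pi> \<kappa>)\<^sup>*}"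
    using assms by (auto simp: color_components_def)
  have "W \<in> \<pi>" if "(V, W) \<in> (mono_edges \<pi> \<kappa>)\<^sup>*" for W
    using that by induction (use V in \<open>auto simp: mono_edges_def covers_def\<close>)
  then show ?thesis using p by auto
qed

lemma color_components_eq_iff:
  assumes "\<pi> \<in> color_components \<pi> \<kappa>"
  shows "color_components \<pi> \<kappa> = {\<pi>}"
proof -
  let ?R = "mono_edges \<pi> \<kappa>"
  from assms obtain V where V: "V \<in> \<pi>" and "{W. (V, W) \<in> ?R\<^sup>*} = \<pi>"
    unfolding color_components_def by (metis (no_types, lifting) imageE)
  then have p: "W \<in> \<pi> \<longleftrightarrow> (V, W) \<in> ?R\<^sup>*" for W by blast
  have sym: "sym (?R\<^sup>*)" by (rule sym_rtrancl) (auto simp: sym_def mono_edges_def)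
  have "{X. (W, X) \<in> ?R\<^sup>*} = \<pi>" if "W \<in> \<pi>" for W
  proof -
    have VW: "(V, W) \<in> ?R\<^sup>*" using that p by blast
    then have WV: "(W, V) \<in> ?R\<^sup>*" using sym by (meson symD)
    have "(W, X) \<in> ?R\<^sup>* \<longleftrightarrow> (V, X) \<in> ?R\<^sup>*" for X
      using VW WV by (meson rtrancl_trans)
    then show ?thesis using p by blast
  qed
  then have "(\<lambda>W. {X. (W, X) \<in> ?R\<^sup>*}) ` \<pi> = (\<lambda>W. \<pi>) ` \<pi>" by (rule image_cong[OF refl])
  also have "\<dots> = {\<pi>}" using V by blast
  finally show ?thesis unfolding color_components_def .
qed

lemma color_components_mono:
  assumes "color_components \<pi> \<kappa> = {\<pi>}" "V \<in> \<pi>" "W \<in> \<pi>"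
  shows "\<kappa> V = \<kappa> W"
proof -
  have "{W. (V, W) \<in> (mono_edges \<pi> \<kappa>)\<^sup>*} \<in> {\<pi>}"
    unfolding assms(1)[symmetric] color_components_def using assms(2) by (rule imageI)
  then have "(V, W) \<in> (mono_edges \<pi> \<kappa>)\<^sup>*" using assms(3) by blast
  then show ?thesis
    by (induction rule: rtrancl_induct) (simp_all add: mono_edges_def)
qed

lemma finite_weak_colorings: "finite \<pi> \<Longrightarrow> finite (weak_colorings N T \<pi>)"
  unfolding weak_colorings_def by (intro finite_Collect_conjI disjI1) (simp add: finite_PiE)

lemma NC_finite:
  assumes "finite S" "\<pi> \<in> NC S"
  shows "finite \<pi>" "{} \<notin> \<pi>"
  using assms finite_elements by (auto simp: NC_def partition_on_def)

lemma card_monochromatic_le: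
  assumes "finite \<pi>" "\<pi> \<noteq> {}" "{} \<notin> \<pi>"
  shows "card {\<kappa>\<in>weak_colorings N T \<pi>. color_components \<pi> \<kappa> = {\<pi>}} \<le> root_degree N T"
proof -
  let ?C = "{\<kappa>\<in>weak_colorings N T \<pi>. color_components \<pi> \<kappa> = {\<pi>}}"
  have ne: "\<Union>\<pi> \<noteq> {}" using assms by auto
  define m where "m = (LEAST m. m \<in> \<Union>\<pi>)"
  have m: "m \<in> \<Union>\<pi>" "\<And>x. x \<in> \<Union>\<pi> \<Longrightarrow> m \<le> x"
    unfolding m_def using ne by (auto intro: LeastI Least_le)
  then obtain V where V: "V \<in> \<pi>" "m \<in> V" by auto
  have "\<not> encloses W V" if "W \<in> \<pi>" for W
  proof
    assume "encloses W V"
    then obtain j where "j \<in> W" "j < m" using V by (auto simp: encloses_def)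
    moreover have "m \<le> j" using m(2)[of j] \<open>j \<in> W\<close> that by blast
    ultimately show False by simp
  qed
  then have "is_chain \<pi> V []" by (auto simp: is_chain_def)
  then have "(\<lambda>\<kappa>. \<kappa> V) ` ?C \<subseteq> {j \<in> {1..N}. [j] \<in> T}"
    using V by (fastforce simp: weak_colorings_def)
  moreover have "inj_on (\<lambda>\<kappa>. \<kappa> V) ?C"
  proof (rule inj_onI)
    fix \<kappa> \<psi> assume *: "\<kappa> \<in> ?C" "\<psi> \<in> ?C" "\<kappa> V = \<psi> V"
    then have "\<kappa> W = \<psi> W" if "W \<in> \<pi>" for W
      using color_components_mono[of \<pi> \<kappa> W V] color_components_mono[of \<pi> \<psi> W V] V that by auto
    moreover have "\<kappa> \<in> extensional \<pi>" "\<psi> \<in> extensional \<pi>"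
      using * by (auto simp: weak_colorings_def PiE_def)
    ultimately show "\<kappa> = \<psi>" by (meson extensionalityI)
  qed
  ultimately show ?thesis
    unfolding root_degree_def by (intro card_inj_on_le) auto
qed

lemma weak_colorings_single:
  assumes "V \<noteq> {}"
  shows "card (weak_colorings N T {V}) = root_degree N T"
proof -
  have "\<not> encloses V V"
  proof
    assume "encloses V V"
    then obtain j where "j \<in> V" "\<forall>v\<in>V. j < v" unfolding encloses_def by blast
    then show False by blast
  qed
  then have *: "{W \<in> {V}. encloses W V} = {}" by blast
  have chain: "is_chain {V} V Vs \<longleftrightarrow> Vs = []" for Vs
    unfolding is_chain_def * by auto
  have iff: "\<kappa> \<in> weak_colorings N T {V} \<longleftrightarrow>
      \<kappa> \<in> {V} \<rightarrow>\<^sub>E {1..N} \<and> [\<kappa> V] \<in> T" for \<kappa>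
    by (simp add: weak_colorings_def chain)
  have "bij_betw (\<lambda>j. \<lambda>W\<in>{V}. j) {j \<in> {1..N}. [j] \<in> T} (weak_colorings N T {V})"
  proof (rule bij_betwI[where g = "\<lambda>\<kappa>. \<kappa> V"])
    show "(\<lambda>j. \<lambda>W\<in>{V}. j) \<in> {j \<in> {1..N}. [j] \<in> T} \<rightarrow> weak_colorings N T {V}"
      by (simp add: Pi_iff iff)
    show "(\<lambda>\<kappa>. \<kappa> V) \<in> weak_colorings N T {V} \<rightarrow> {j \<in> {1..N}. [j] \<in> T}"
      by (simp add: Pi_iff iff PiE_iff)
    show "(\<lambda>W\<in>{V}. j) V = j" for j :: nat by simp
    show "(\<lambda>W\<in>{V}. \<kappa> V) = \<kappa>" if "\<kappa> \<in> weak_colorings N T {V}" for \<kappa>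
    proof
      fix W show "(\<lambda>W\<in>{V}. \<kappa> V) W = \<kappa> W"
        using that unfolding iff by (cases "W = V") (auto simp: PiE_iff extensional_def)
    qed
  qed
  from bij_betw_same_card[OF this] show ?thesis by (simp add: root_degree_def)
qed

lemma color_components_single: "color_components {V} \<kappa> = {{V}}"
proof -
  let ?P = "{W. (V, W) \<in> (mono_edges {V} \<kappa>)\<^sup>*}"
  have eq: "color_components {V} \<kappa> = {?P}"
    unfolding color_components_def by (simp only: image_insert image_empty)
  then have "?P \<subseteq> {V}" by (intro color_components_le[of ?P "{V}" \<kappa>]) blast
  moreover have "V \<in> ?P" by simp
  ultimately have "?P = {V}" by blast
  with eq show ?thesis by (simp only:)
qed

text \<open>Existence of the coefficients: the defining equation is solved for the term \<open>\<alpha> \<pi>\<close> on its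
  right-hand side, which occurs for the colorings with \<open>\<pi>\<close> as their only component.\<close>

function coeff_rec :: "nat \<Rightarrow> nat list set \<Rightarrow> nat set set \<Rightarrow> real" where
  "coeff_rec N T \<pi> = (if finite \<pi> \<and> card \<pi> \<noteq> 1 then
     (\<Sum>\<kappa>\<in>{\<kappa>\<in>weak_colorings N T \<pi>. color_components \<pi> \<kappa> \<noteq> {\<pi>}}.
        \<Prod>\<pi>'\<in>color_components \<pi> \<kappa>. if \<pi>' \<subset> \<pi> then coeff_rec N T \<pi>' else 1)
     / (real (root_degree N T) ^ card \<pi>
        - real (card {\<kappa>\<in>weak_colorings N T \<pi>. color_components \<pi> \<kappa> = {\<pi>}})) else 1)"
  by pat_completeness auto
termination
  by (relation "Wellfounded.measure (\<lambda>(N, T, \<pi>). card \<pi>)") (simp_all add: psubset_card_mono)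

declare coeff_rec.simps [simp del]

lemma tree_coefficients_exist:
  assumes n: "root_degree N T \<ge> 2"
  shows "tree_coefficients N T (coeff_rec N T)"
  unfolding tree_coefficients_def
proof (intro allI impI, elim conjE)
  fix S \<pi> assume "finite S" "\<pi> \<in> NC S"
  then have fin: "finite \<pi>" and ne: "{} \<notin> \<pi>" using NC_finite by auto
  let ?n = "real (root_degree N T)" and ?\<alpha> = "coeff_rec N T"
  let ?f = "\<lambda>\<kappa>. \<Prod>\<pi>'\<in>color_components \<pi> \<kappa>. ?\<alpha> \<pi>'"
  let ?X = "weak_colorings N T \<pi>"
  let ?C = "{\<kappa>\<in>?X. color_components \<pi> \<kappa> = {\<pi>}}" and ?D = "{\<kappa>\<in>?X. color_components \<pi> \<kappa> \<noteq> {\<pi>}}"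
  have one: "?\<alpha> \<pi> = 1" if "card \<pi> = 1" using that by (subst coeff_rec.simps) simp
  have "?\<alpha> \<pi> = sum ?f ?X / ?n ^ card \<pi>"
  proof (cases "card \<pi> = 1")
    case True
    then obtain V where V: "\<pi> = {V}" by (meson card_1_singletonE)
    then have "sum ?f ?X = ?n"
      using one[OF True] ne by (simp add: color_components_single weak_colorings_single)
    then show ?thesis using one[OF True] True n by simp
  next
    case False
    have lt: "real (card ?C) < ?n ^ card \<pi>"
    proof (cases "\<pi> = {}")
      case True then show ?thesis by (simp add: color_components_def)
    next
      case ne': False
      with False fin have c: "card \<pi> > 1"
        by (metis card_0_eq less_one linorder_neqE_nat)
      have "real (card ?C) \<le> ?n" using card_monochromatic_le[OF fin ne' ne] by simp
      also have "?n < ?n ^ card \<pi>" using power_strict_increasing[OF c, of ?n] n by simp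
      finally show ?thesis .
    qed
    have split: "sum ?f ?X = sum ?f ?C + sum ?f ?D"
      using finite_weak_colorings[OF fin, of N T]
      by (subst sum.union_disjoint[symmetric]) (auto intro!: sum.cong)
    have C: "sum ?f ?C = real (card ?C) * ?\<alpha> \<pi>" by simp
    have D: "?\<alpha> \<pi> = sum ?f ?D / (?n ^ card \<pi> - real (card ?C))"
    proof -
      have "\<pi>' \<subset> \<pi>" if "\<pi>' \<in> color_components \<pi> \<kappa>" "color_components \<pi> \<kappa> \<noteq> {\<pi>}" for \<pi>' \<kappa>
        using that color_components_le color_components_eq_iff by blast
      then show ?thesis using fin False
        by (subst coeff_rec.simps)
           (auto intro!: arg_cong2[where f = "(/)"] sum.cong prod.cong)
    qed
    have "sum ?f ?X = ?\<alpha> \<pi> * ?n ^ card \<pi>"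
    proof -
      have "d * (q - c) = y" if "c < q" "d = y / (q - c)" for c d q y :: real
        using that by simp
      from this[OF lt D] have "sum ?f ?D = ?\<alpha> \<pi> * (?n ^ card \<pi> - real (card ?C))" ..
      then show ?thesis unfolding split C by (simp only: ring_distribs) simp
    qed
    then show ?thesis using n by simp
  qed
  with one show "(card \<pi> = 1 \<longrightarrow> ?\<alpha> \<pi> = 1) \<and> ?\<alpha> \<pi> = sum ?f ?X / ?n ^ card \<pi>" by blast
qed

lemma tree_coefficients_unique:
  assumes n: "root_degree N T \<ge> 2" and "tree_coefficients N T \<alpha>" "tree_coefficients N T \<beta>"
    and "finite S" "\<pi> \<in> NC S"
  shows "\<alpha> \<pi> = \<beta> \<pi>"
  using assms(4,5)
proof (induction "card \<pi>" arbitrary: \<pi> S rule: less_induct)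
  case less
  then have fin: "finite \<pi>" and ne: "{} \<notin> \<pi>" using NC_finite by auto
  let ?n = "real (root_degree N T)" and ?X = "weak_colorings N T \<pi>"
  let ?C = "{\<kappa>\<in>?X. color_components \<pi> \<kappa> = {\<pi>}}" and ?D = "{\<kappa>\<in>?X. color_components \<pi> \<kappa> \<noteq> {\<pi>}}"
  let ?f = "\<lambda>\<alpha> \<kappa>. \<Prod>\<pi>'\<in>color_components \<pi> \<kappa>. \<alpha> \<pi>' :: real"
  show ?case
  proof (cases "card \<pi> \<le> 1")
    case True
    then consider "\<pi> = {}" | "card \<pi> = 1" using fin by (cases "card \<pi>") auto
    then show ?thesis
    proof cases
      case 1
      then have "\<gamma> \<pi> = real (card ?X)" if "tree_coefficients N T \<gamma>" for \<gamma>
        using that less.prems by (auto simp: tree_coefficients_def color_components_def)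
      from this[OF assms(2)] this[OF assms(3)] show ?thesis by simp
    next
      case 2 then show ?thesis using assms less.prems by (auto simp: tree_coefficients_def)
    qed
  next
    case False
    then have c: "card \<pi> > 1" and ne': "\<pi> \<noteq> {}" by auto
    have "real (card ?C) \<le> ?n" using card_monochromatic_le[OF fin ne' ne] by simp
    also have "?n < ?n ^ card \<pi>" using power_strict_increasing[OF c, of ?n] n by simp
    finally have lt: "real (card ?C) < ?n ^ card \<pi>" .
    have split: "sum (?f \<gamma>) ?X = real (card ?C) * \<gamma> \<pi> + sum (?f \<gamma>) ?D" for \<gamma>
    proof -
      have "sum (?f \<gamma>) ?X = sum (?f \<gamma>) ?C + sum (?f \<gamma>) ?D"
        using finite_weak_colorings[OF fin, of N T]
        by (subst sum.union_disjoint[symmetric]) (auto intro!: sum.cong)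
      then show ?thesis by simp
    qed
    have eq: "\<gamma> \<pi> * (?n ^ card \<pi> - real (card ?C)) = sum (?f \<gamma>) ?D"
      if "tree_coefficients N T \<gamma>" for \<gamma>
    proof -
      have "\<gamma> \<pi> = sum (?f \<gamma>) ?X / ?n ^ card \<pi>"
        using that less.prems by (auto simp: tree_coefficients_def)
      then show ?thesis using n unfolding split by (simp add: field_simps)
    qed
    have "\<alpha> \<pi>' = \<beta> \<pi>'" if "\<pi>' \<in> color_components \<pi> \<kappa>" "color_components \<pi> \<kappa> \<noteq> {\<pi>}" for \<pi>' \<kappa>
    proof (rule less.hyps)
      have sub: "\<pi>' \<subset> \<pi>" using that color_components_le color_components_eq_iff by blast
      show "card \<pi>' < card \<pi>" using sub fin by (rule psubset_card_mono[rotated])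
      have nc: "noncrossing \<pi>" and dj: "disjoint \<pi>" using less.prems(2) by (auto simp: NC_def partition_on_def)
      have in\<pi>: "V \<in> \<pi>" if "V \<in> \<pi>'" for V using sub that by blast
      have "noncrossing \<pi>'"
        unfolding noncrossing_def
        by (intro ballI) (rule nc[unfolded noncrossing_def, THEN bspec, THEN bspec, OF in\<pi> in\<pi>])
      moreover have "disjoint \<pi>'" using dj sub by (auto intro: pairwise_subset)
      ultimately show "\<pi>' \<in> NC (\<Union>\<pi>')" using sub ne by (auto simp: NC_def partition_on_def)
      have "\<Union>\<pi>' \<subseteq> S" using sub less.prems(2) by (auto simp: NC_def partition_on_def)
      then show "finite (\<Union>\<pi>')" using less.prems(1) by (rule finite_subset)
    qed
    then have "sum (?f \<alpha>) ?D = sum (?f \<beta>) ?D" by (intro sum.cong prod.cong) auto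
    then have "\<alpha> \<pi> * (?n ^ card \<pi> - real (card ?C)) = \<beta> \<pi> * (?n ^ card \<pi> - real (card ?C))"
      using eq assms by simp
    then show ?thesis using lt by simp
  qed
qed

definition tree_coeff :: "nat \<Rightarrow> nat list set \<Rightarrow> nat set set \<Rightarrow> real" where
  "tree_coeff N T = (SOME \<alpha>. tree_coefficients N T \<alpha>)"

lemma tree_coefficients_tree_coeff:
  "root_degree N T \<ge> 2 \<Longrightarrow> tree_coefficients N T (tree_coeff N T)"
  unfolding tree_coeff_def by (rule someI[of _ "coeff_rec N T"], rule tree_coefficients_exist)

section \<open>Cumulants\<close>

text \<open>
  The data of a \<open>\<B>\<close>-valued probability space that enter the definition of cumulants, for an algebra
  given by an explicit carrier, such as an algebra of operators.
\<close>

record ('x, 'b) valued_algebra =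
  carr :: "'x set"
  plus_alg :: "'x \<Rightarrow> 'x \<Rightarrow> 'x"
  scale_alg :: "complex \<Rightarrow> 'x \<Rightarrow> 'x"
  mult_alg :: "'x \<Rightarrow> 'x \<Rightarrow> 'x"
  one_alg :: "'x"
  incl_alg :: "'b \<Rightarrow> 'x"
  expect :: "'x \<Rightarrow> 'b"

definition type_algebra ::
  "('b \<Rightarrow> 'a) \<Rightarrow> ('a \<Rightarrow> 'b) \<Rightarrow> ('a::cstar_algebra, 'b) valued_algebra" where
  "type_algebra \<iota> E = \<lparr>carr = UNIV, plus_alg = (+), scale_alg = scaleC, mult_alg = (*),
     one_alg = 1, incl_alg = \<iota>, expect = E\<rparr>"

text \<open>
  Left multiplications by \<open>\<B>\<close> are included among the generators; as soon as \<open>T\<close> contains a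
  one-letter string they already lie in the unital C*-algebra generated by the \<open>\<Lambda> j x\<close>.
\<close>

definition tree_product_algebra ::
  "nat \<Rightarrow> ('k, 'h::real_normed_vector, 'b::cstar_algebra) product_structure
     \<Rightarrow> (nat \<Rightarrow> 'a \<Rightarrow> 'h \<Rightarrow> 'h) \<Rightarrow> ('h \<Rightarrow> 'h, 'b) valued_algebra" where
  "tree_product_algebra N H \<Lambda> = \<lparr>
     carr = generated_cstar_algebra H ((\<Union>j\<in>{1..N}. range (\<Lambda> j)) \<union> range (lact H)),
     plus_alg = (\<lambda>f g v. f v + g v), scale_alg = (\<lambda>c f v. cscale H c (f v)), mult_alg = (\<circ>),
     one_alg = id, incl_alg = lact H, expect = (\<lambda>f. ip H (vac H) (f (vac H)))\<rparr>"

text \<open>A sequence of maps \<open>\<Lambda>\<^sub>\<ell>\<close> is a function on lists; only non-empty lists matter.\<close>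

definition quasi_multilinear ::
  "('x, 'b::cstar_algebra) valued_algebra \<Rightarrow> ('x list \<Rightarrow> 'b) \<Rightarrow> bool" where
  "quasi_multilinear A \<Lambda> \<longleftrightarrow>
     (\<forall>us\<in>lists (carr A). \<forall>vs\<in>lists (carr A). \<forall>x\<in>carr A. \<forall>y\<in>carr A. \<forall>b c.
        \<Lambda> (us @ [plus_alg A x y] @ vs) = \<Lambda> (us @ [x] @ vs) + \<Lambda> (us @ [y] @ vs)
        \<and> \<Lambda> (us @ [scale_alg A c x] @ vs) = scaleC c (\<Lambda> (us @ [x] @ vs))
        \<and> \<Lambda> (mult_alg A (incl_alg A b) x # vs) = b * \<Lambda> (x # vs)
        \<and> \<Lambda> (us @ [mult_alg A x (incl_alg A b)]) = \<Lambda> (us @ [x]) * b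
        \<and> \<Lambda> (us @ [mult_alg A x (incl_alg A b), y] @ vs)
            = \<Lambda> (us @ [x, mult_alg A (incl_alg A b) y] @ vs))"

definition interval_block :: "nat set set \<Rightarrow> nat set \<Rightarrow> bool" where
  "interval_block \<pi> V \<longleftrightarrow> V \<in> \<pi> \<and> (\<forall>x\<in>\<Union>\<pi>. \<forall>j\<in>V. \<forall>k\<in>V. j < x \<and> x < k \<longrightarrow> x \<in> V)"

text \<open>
  \<open>\<Lambda>\<^sub>\<pi>\<close> for a non-crossing partition \<open>\<pi>\<close> of a finite set \<open>S\<close>, with arguments indexed by \<open>S\<close>, so that
  \<open>\<pi> - {V}\<close> need not be relabelled.  An interval block \<open>V\<close> is a block that is an interval of \<open>S\<close>, and
  \<open>R\<close> consists of the indices to the right of \<open>V\<close>.  For quasi-multilinear \<open>\<Lambda>\<close> the value does not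
  depend on the choice of the interval block.
\<close>

function nested_eval ::
  "('x, 'b::cstar_algebra) valued_algebra \<Rightarrow> ('x list \<Rightarrow> 'b) \<Rightarrow> nat set set \<Rightarrow> (nat \<Rightarrow> 'x) \<Rightarrow> 'b"
where
  "nested_eval A \<Lambda> \<pi> a =
     (if finite \<pi> \<and> (\<exists>V. interval_block \<pi> V) then
        let V = (SOME V. interval_block \<pi> V);
            R = {i \<in> \<Union>\<pi>. \<forall>v\<in>V. v < i};
            b = \<Lambda> (map a (sorted_list_of_set V))
        in if R = {} then nested_eval A \<Lambda> (\<pi> - {V}) a * b
           else nested_eval A \<Lambda> (\<pi> - {V})
                  (a(Min R := mult_alg A (incl_alg A b) (a (Min R))))
      else 1)"
  by pat_completeness auto
termination
proof (relation "Wellfounded.measure (\<lambda>(A, \<Lambda>, \<pi>, a). card \<pi>)", goal_cases)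
  case 1
  show ?case by simp
next
  case (2 A \<Lambda> \<pi> a V R b)
  then have "interval_block \<pi> V" using someI_ex[of "interval_block \<pi>"] by simp
  then have "V \<in> \<pi>" by (simp add: interval_block_def)
  then have "card (\<pi> - {V}) < card \<pi>" using 2 by (intro card_Diff1_less) auto
  then show ?case by simp
next
  case (3 A \<Lambda> \<pi> a V R b)
  then have "interval_block \<pi> V" using someI_ex[of "interval_block \<pi>"] by simp
  then have "V \<in> \<pi>" by (simp add: interval_block_def)
  then have "card (\<pi> - {V}) < card \<pi>" using 3 by (intro card_Diff1_less) auto
  then show ?case by simp
qed

declare nested_eval.simps [simp del]

text \<open>The entry \<open>as ! (i - 1)\<close> is the argument \<open>a\<^sub>i\<close>, as partitions live on \<open>{1..\<ell>}\<close>.\<close>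

definition tree_cumulants ::
  "nat \<Rightarrow> nat list set \<Rightarrow> ('x, 'b::cstar_algebra) valued_algebra \<Rightarrow> ('x list \<Rightarrow> 'b) \<Rightarrow> bool" where
  "tree_cumulants N T A K \<longleftrightarrow> quasi_multilinear A K
     \<and> (\<forall>as\<in>lists (carr A). as \<noteq> [] \<longrightarrow>
          expect A (foldr (mult_alg A) as (one_alg A))
            = (\<Sum>\<pi>\<in>NC {1..length as}.
                 tree_coeff N T \<pi> *\<^sub>R nested_eval A K \<pi> (\<lambda>i. as ! (i - 1))))"

end

theory Submission
  imports Defs
begin

text \<open>
  Since the coefficients \<open>\<alpha>\<close> are multiplicative under concatenation of partitions, the Boolean cumulants
  of \<open>\<A>\<close> are the sums of \<open>\<alpha>\<^sub>\<tau> K\<^sub>\<tau>\<close> over the partitions \<open>\<tau>\<close> with a single outer block.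
  Apply a word in the \<open>\<lambda>\<^sub>j\<close> to the vacuum from right to left: the elementary tensor reached after each
  letter is a stack of open blocks of a non-crossing partition, and the colors on the stack spell
  the current string of \<open>T\<close>.  Hence the mixed moments are sums of Boolean cumulants over pairs of a
  partition \<open>\<pi>\<close> and a coloring whose unreduced chain strings lie in \<open>T\<close>.  Splitting every
  block of \<open>\<pi>\<close> into a partition with a single outer block produces a weak coloring of a
  refinement \<open>\<sigma>\<close> with the blocks of \<open>\<pi>\<close> as its color components, and every weak coloring arises
  once in this way.  By the recursion for \<open>\<alpha>\<close>, the moments of the sums \<open>\<Sum>\<^sub>j \<lambda>\<^sub>j(a)\<close> are therefore
  the sums of \<open>n\<^bsup>|\<sigma>|\<^esup> \<alpha>\<^sub>\<sigma> K\<^sub>\<sigma>\<close>, that is, those of the cumulants \<open>n K\<close>, and moments determine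
  cumulants.
\<close>

section \<open>Geometry of non-crossing partitions\<close>

text \<open>Two points shape the argument. \<open>nested_eval\<close> removes an interval block
  picked by Hilbert choice, while the inductions have to remove blocks of their own: a block of a
  subpartition, the image of a block under relabelling, the block that closes at the current letter.
  Independence of the choice therefore comes early, by showing that two removals commute. Boolean
  cumulants are the intermediate object because they arise from the action itself with coefficient
  one: a letter applied to an elementary tensor either emits an expectation or leaves a centred
  vector, and the alternating product of letters and centrings is what a tensor slot has accumulated
  when its block closes. The colorings seen by the action are strict, with different colors on a
  block and its parent. The condition n \<ge> 2 acts through the coefficients: at most n colorings
  have \<pi> as their only component, fewer than n^|\<pi>| once |\<pi>| \<ge> 2, so the recursion
  can be solved for \<alpha> at \<pi>. In the final comparison only the one-block partition involves
  the top cumulant, and its coefficient is 1.\<close>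

definition nc_part :: "nat set set \<Rightarrow> bool" where
  "nc_part \<pi> \<longleftrightarrow> finite (\<Union>\<pi>) \<and> \<pi> \<in> NC (\<Union>\<pi>)"

text \<open>The ground set is recovered as the union of the blocks, so color components,
  restrictions to a block and stacks of remnants can be handled without carrying a ground set
  along.\<close>

lemma nc_part_NC: "finite S \<Longrightarrow> \<pi> \<in> NC S \<longleftrightarrow> nc_part \<pi> \<and> \<Union>\<pi> = S"
  by (auto simp: nc_part_def NC_def partition_on_def)

lemma nc_part_iff:
  "nc_part \<pi> \<longleftrightarrow> finite (\<Union>\<pi>) \<and> disjoint \<pi> \<and> {} \<notin> \<pi> \<and> noncrossing \<pi>"
  by (auto simp: nc_part_def NC_def partition_on_def)

lemma
  assumes "nc_part \<pi>"
  shows nc_part_finite: "finite \<pi>" and nc_part_finite_Union: "finite (\<Union>\<pi>)"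
    and nc_part_nonempty: "V \<in> \<pi> \<Longrightarrow> V \<noteq> {}"
    and nc_part_finite_block: "V \<in> \<pi> \<Longrightarrow> finite V"
  using assms by (auto simp: nc_part_iff finite_UnionD intro: finite_subset[of V "\<Union>\<pi>"])

lemma nc_part_disjoint:
  "\<lbrakk>nc_part \<pi>; V \<in> \<pi>; W \<in> \<pi>; x \<in> V; x \<in> W\<rbrakk> \<Longrightarrow> V = W"
  by (auto simp: nc_part_iff disjoint_def)

lemma nc_part_crossing:
  "\<lbrakk>nc_part \<pi>; V \<in> \<pi>; W \<in> \<pi>; a \<in> V; b \<in> W; c \<in> V; d \<in> W; a < b; b < c; c < d\<rbrakk> \<Longrightarrow> V = W"
  unfolding nc_part_iff noncrossing_def by blast

lemma nc_part_subset:
  assumes nc: "nc_part \<pi>" and sub: "\<sigma> \<subseteq> \<pi>"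
  shows "nc_part \<sigma>"
proof -
  have "noncrossing \<sigma>"
    unfolding noncrossing_def using nc_part_crossing[OF nc] sub by blast
  moreover have "finite (\<Union>\<sigma>)"
    using nc_part_finite_Union[OF nc] sub by (meson Union_mono finite_subset)
  moreover have "disjoint \<sigma>" using nc sub by (auto simp: nc_part_iff intro: pairwise_subset)
  ultimately show ?thesis using nc sub by (auto simp: nc_part_iff)
qed

lemma encloses_irrefl: "V \<noteq> {} \<Longrightarrow> \<not> encloses V V"
  unfolding encloses_def by blast

lemma encloses_trans: "\<lbrakk>encloses U V; encloses V W; W \<noteq> {}\<rbrakk> \<Longrightarrow> encloses U W"
  unfolding encloses_def by (meson all_not_in_conv order_less_trans)

text \<open>Non-crossing turns one point between \<open>j\<close> and \<open>k\<close> into nesting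
  of the whole block: another point beyond \<open>k\<close> gives the crossing j < w < k < w', and
  one before \<open>j\<close> gives w' < j < w < k.\<close>

lemma encloses_between:
  assumes "nc_part \<pi>" "V \<in> \<pi>" "W \<in> \<pi>" "V \<noteq> W" "j \<in> V" "k \<in> V" "w \<in> W" "j < w" "w < k"
  shows "encloses V W"
proof -
  have "j < w' \<and> w' < k" if w': "w' \<in> W" for w'
  proof -
    have "w' \<noteq> j" "w' \<noteq> k" using assms nc_part_disjoint w' by blast+
    moreover have "\<not> w' > k" using assms nc_part_crossing[of \<pi> V W j w k w'] w' by blast
    moreover have "\<not> w' < j" using assms nc_part_crossing[of \<pi> W V w' j w k] w' by blast
    ultimately show ?thesis by linarith
  qed
  then show ?thesis using assms(5,6) unfolding encloses_def by blast
qed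

section \<open>Nesting of the blocks of a fixed non-crossing partition\<close>

context
  fixes \<pi> :: "nat set set"
  assumes nc: "nc_part \<pi>"
begin

lemma nc_encloses_trans:
  "\<lbrakk>encloses U V; encloses V W; W \<in> \<pi>\<rbrakk> \<Longrightarrow> encloses U W"
  using encloses_trans nc_part_nonempty[OF nc] by blast

lemma nc_encloses_irrefl: "V \<in> \<pi> \<Longrightarrow> \<not> encloses V V"
  using encloses_irrefl nc_part_nonempty[OF nc] by blast

text \<open>Two blocks around the same point \<open>v\<close> are compared by their last points seen
  to the left of \<open>v\<close>: if j < j', then j' lies between \<open>j\<close> and
  \<open>k\<close>, since j' < v < k, and \<open>encloses_between\<close> applies.\<close>

lemma encloses_linear:
  assumes "X \<in> \<pi>" "Y \<in> \<pi>" "V \<in> \<pi>" "encloses X V" "encloses Y V" "X \<noteq> Y"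
  shows "encloses X Y \<or> encloses Y X"
proof -
  obtain v where v: "v \<in> V" using assms(3) nc_part_nonempty[OF nc] by auto
  obtain j k where jk: "j \<in> X" "k \<in> X" "j < v" "v < k" using assms(4) v by (auto simp: encloses_def)
  obtain j' k' where jk': "j' \<in> Y" "k' \<in> Y" "j' < v" "v < k'" using assms(5) v by (auto simp: encloses_def)
  have "j \<noteq> j'" using nc_part_disjoint[OF nc] assms jk jk' by blast
  then consider "j < j'" | "j' < j" by linarith
  then show ?thesis
  proof cases
    case 1 then show ?thesis
      using encloses_between[OF nc assms(1,2,6), of j k j'] jk jk' by force
  next
    case 2 then show ?thesis
      using encloses_between[OF nc assms(2,1) assms(6)[symmetric], of j' k' j] jk jk' by force
  qed
qed

text \<open>Induction on the number of blocks strictly between \<open>X\<close> and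
  \<open>V\<close>. The clause relating \<open>P\<close> to \<open>X\<close> keeps the parent inside
  \<open>X\<close>, which is needed when a component is traced back to its outermost block.\<close>

lemma covers_exists:
  assumes "X \<in> \<pi>" "V \<in> \<pi>" "encloses X V"
  shows "\<exists>P. covers \<pi> P V \<and> (P = X \<or> encloses X P)"
  using assms
proof (induction "card {U\<in>\<pi>. encloses X U \<and> encloses U V}" arbitrary: X rule: less_induct)
  case less
  show ?case
  proof (cases "covers \<pi> X V")
    case False
    then obtain U where U: "U \<in> \<pi>" "encloses X U" "encloses U V" using less.prems by (auto simp: covers_def)
    have "{W\<in>\<pi>. encloses U W \<and> encloses W V} \<subset> {W\<in>\<pi>. encloses X W \<and> encloses W V}"
      using U nc_encloses_trans[OF U(2)] nc_encloses_irrefl[OF U(1)] by blast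
    then have "card {W\<in>\<pi>. encloses U W \<and> encloses W V} < card {W\<in>\<pi>. encloses X W \<and> encloses W V}"
      using nc_part_finite[OF nc] by (intro psubset_card_mono) auto
    from less.hyps[OF this U(1) less.prems(2) U(3)] obtain P where
      P: "covers \<pi> P V" "P = U \<or> encloses U P" by blast
    then have "encloses X P" using U(2) nc_encloses_trans[OF U(2)] by (auto simp: covers_def)
    then show ?thesis using P by blast
  qed blast
qed

lemma covers_unique:
  assumes "covers \<pi> P V" "covers \<pi> Q V"
  shows "P = Q"
  using assms encloses_linear[of P Q V] unfolding covers_def by blast

lemma covers_encloses_cases:
  assumes "covers \<pi> P V" "X \<in> \<pi>" "encloses X V"
  shows "X = P \<or> encloses X P"
  using assms encloses_linear[of X P V] unfolding covers_def by blast

lemma is_chain_Nil_iff: "V \<in> \<pi> \<Longrightarrow> is_chain \<pi> V [] \<longleftrightarrow> (\<forall>W\<in>\<pi>. \<not> encloses W V)"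
  by (auto simp: is_chain_def)

text \<open>Makes chains recursive: a block is followed by its parent and then by the chain of the
  parent. Later statements about chain strings are proved by list induction on this form.\<close>

lemma is_chain_Cons_iff:
  assumes V: "V \<in> \<pi>"
  shows "is_chain \<pi> V (P # Ps) \<longleftrightarrow> covers \<pi> P V \<and> is_chain \<pi> P Ps"
proof
  assume ch: "is_chain \<pi> V (P # Ps)"
  then have PV: "encloses P V" "P \<in> \<pi>" and set: "insert P (set Ps) = {W\<in>\<pi>. encloses W V}"
    and Ps: "\<And>X. X \<in> set Ps \<Longrightarrow> encloses X P" and srt: "sorted_wrt (\<lambda>X Y. encloses Y X) (P # Ps)"
    by (auto simp: is_chain_def)
  have "\<not> (encloses P X \<and> encloses X V)" if "X \<in> \<pi>" for X
  proof
    assume X: "encloses P X \<and> encloses X V"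
    then have "X \<in> insert P (set Ps)" using that set by blast
    then have "encloses X X" using X Ps nc_encloses_trans that by blast
    then show False using nc_encloses_irrefl that by blast
  qed
  then have cov: "covers \<pi> P V" using PV V by (auto simp: covers_def)
  moreover have "set Ps = {W\<in>\<pi>. encloses W P}"
  proof
    show "set Ps \<subseteq> {W\<in>\<pi>. encloses W P}" using Ps set by blast
    show "{W\<in>\<pi>. encloses W P} \<subseteq> set Ps"
    proof
      fix W assume W: "W \<in> {W\<in>\<pi>. encloses W P}"
      then have "encloses W V" using PV nc_encloses_trans V by blast
      then have "W \<in> insert P (set Ps)" using W set by blast
      then show "W \<in> set Ps" using W nc_encloses_irrefl by blast
    qed
  qed
  ultimately show "covers \<pi> P V \<and> is_chain \<pi> P Ps" using srt by (simp add: is_chain_def)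
next
  assume *: "covers \<pi> P V \<and> is_chain \<pi> P Ps"
  then have P: "P \<in> \<pi>" "encloses P V" by (auto simp: covers_def)
  have set: "set Ps = {W\<in>\<pi>. encloses W P}" using * unfolding is_chain_def by blast
  have "insert P (set Ps) \<subseteq> {W\<in>\<pi>. encloses W V}"
    using nc_encloses_trans[OF _ P(2) V] P unfolding set by blast
  moreover have "{W\<in>\<pi>. encloses W V} \<subseteq> insert P (set Ps)"
    using covers_encloses_cases[of P V] * unfolding set by blast
  ultimately have "set (P # Ps) = {W\<in>\<pi>. encloses W V}" by auto
  moreover have "\<forall>X\<in>set Ps. encloses X V"
    using set nc_encloses_trans[OF _ P(2) V] by blast
  moreover have "sorted_wrt (\<lambda>X Y. encloses Y X) (P # Ps)" using * unfolding is_chain_def by blast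
  ultimately show "is_chain \<pi> V (P # Ps)"
    using P(2) unfolding is_chain_def sorted_wrt.simps(2)[of _ V] by simp
qed

lemma is_chain_exists:
  assumes "V \<in> \<pi>"
  shows "\<exists>Vs. is_chain \<pi> V Vs"
  using assms
proof (induction "card {U\<in>\<pi>. encloses U V}" arbitrary: V rule: less_induct)
  case less
  show ?case
  proof (cases "\<exists>X\<in>\<pi>. encloses X V")
    case True
    then obtain P where P: "covers \<pi> P V" using covers_exists less.prems by blast
    then have P': "P \<in> \<pi>" "encloses P V" by (auto simp: covers_def)
    have "{U\<in>\<pi>. encloses U P} \<subset> {U\<in>\<pi>. encloses U V}"
      using P' less.prems nc_encloses_trans[OF _ P'(2)] nc_encloses_irrefl by blast
    then have "card {U\<in>\<pi>. encloses U P} < card {U\<in>\<pi>. encloses U V}"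
      using nc_part_finite[OF nc] by (intro psubset_card_mono) auto
    from less.hyps[OF this P'(1)] show ?thesis using P is_chain_Cons_iff less.prems by blast
  qed (use less.prems is_chain_Nil_iff in blast)
qed

lemma is_chain_unique:
  assumes "V \<in> \<pi>" "is_chain \<pi> V Vs" "is_chain \<pi> V Ws"
  shows "Vs = Ws"
  using assms
proof (induction Vs arbitrary: V Ws)
  case Nil
  then show ?case by (cases Ws) (auto simp: is_chain_def)
next
  case (Cons P Ps)
  then show ?case
  proof (cases Ws)
    case Nil
    then show ?thesis using Cons.prems by (auto simp: is_chain_def)
  next
    case (Cons Q Qs)
    then have "covers \<pi> P V" "is_chain \<pi> P Ps" "covers \<pi> Q V" "is_chain \<pi> Q Qs"
      using Cons.prems is_chain_Cons_iff Cons.prems(1) by auto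
    moreover from this have "P = Q" using covers_unique by blast
    moreover from calculation have "P \<in> \<pi>" by (simp add: covers_def)
    ultimately show ?thesis using Cons.IH Cons by blast
  qed
qed

end

section \<open>Evaluation along non-crossing partitions\<close>

text \<open>The block with the largest minimum is an interval: a foreign point between two of its
  points would belong to a block nested in it, whose minimum would be larger still.\<close>

lemma interval_block_exists:
  assumes "nc_part \<pi>" "\<pi> \<noteq> {}"
  shows "\<exists>V. interval_block \<pi> V"
proof -
  have fin: "finite \<pi>" using assms nc_part_finite by blast
  have "Max (Min ` \<pi>) \<in> Min ` \<pi>" using fin assms(2) by (intro Max_in) auto
  then obtain V where V: "V \<in> \<pi>" "Min V = Max (Min ` \<pi>)" by (metis imageE)
  have "x \<in> V" if x: "x \<in> W" "W \<in> \<pi>" and jk: "j \<in> V" "k \<in> V" "j < x" "x < k" for x W j k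
  proof (rule ccontr)
    assume "x \<notin> V"
    then have "encloses V W" using encloses_between[OF assms(1) V(1) x(2) _ jk(1,2) x(1) jk(3,4)] x by blast
    then obtain j where "j \<in> V" "\<forall>w\<in>W. j < w" by (auto simp: encloses_def)
    moreover have fW: "finite W" "W \<noteq> {}" "finite V"
      using x V assms(1) nc_part_finite_block nc_part_nonempty by auto
    ultimately have "Min V < Min W" by (metis Min_in Min_le le_less_trans)
    moreover have "Min W \<le> Max (Min ` \<pi>)" using fin x by simp
    ultimately show False using V by simp
  qed
  then show ?thesis using V unfolding interval_block_def by blast
qed

lemma interval_blockD:
  "\<lbrakk>interval_block \<pi> V; x \<in> \<Union>\<pi>; j \<in> V; k \<in> V; j < x; x < k\<rbrakk> \<Longrightarrow> x \<in> V"
  unfolding interval_block_def by blast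

lemma interval_block_subset:
  "interval_block \<pi> V \<Longrightarrow> \<sigma> \<subseteq> \<pi> \<Longrightarrow> V \<in> \<sigma> \<Longrightarrow> interval_block \<sigma> V"
  using Union_mono[of \<sigma> \<pi>] unfolding interval_block_def by (auto simp: subset_iff)

lemma Union_remove_block: "nc_part \<pi> \<Longrightarrow> V \<in> \<pi> \<Longrightarrow> \<Union>(\<pi> - {V}) = \<Union>\<pi> - V"
  by (auto dest: nc_part_disjoint)

lemma interval_blocks_ordered:
  assumes nc: "nc_part \<pi>" and U: "interval_block \<pi> U" and V: "interval_block \<pi> V" and "U \<noteq> V"
  shows "(\<forall>u\<in>U. \<forall>v\<in>V. u < v) \<or> (\<forall>u\<in>U. \<forall>v\<in>V. v < u)"
proof (rule ccontr)
  assume "\<not> ?thesis"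
  then obtain u v u' v' where *: "u \<in> U" "v \<in> V" "\<not> u < v" "u' \<in> U" "v' \<in> V" "\<not> v' < u'" by blast
  have mem: "U \<in> \<pi>" "V \<in> \<pi>" using U V by (auto simp: interval_block_def)
  have ne: "\<And>x y. x \<in> U \<Longrightarrow> y \<in> V \<Longrightarrow> x \<noteq> y" using mem nc_part_disjoint[OF nc] assms(4) by blast
  have "v < u" "u' < v'" using * ne by (auto simp: not_less_iff_gr_or_eq)
  have "v \<in> \<Union>\<pi>" "u' \<in> \<Union>\<pi>" using * mem by blast+
  then have "\<not> (u' < v \<and> v < u)" "\<not> (v < u' \<and> u' < v')"
    using U V *(1,2,4,5) ne unfolding interval_block_def by metis+
  moreover have "u' \<noteq> v" using ne * by blast
  ultimately show False using \<open>v < u\<close> \<open>u' < v'\<close> by linarith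
qed

definition right_of :: "nat set set \<Rightarrow> nat set \<Rightarrow> nat set" where
  "right_of \<pi> V = {i \<in> \<Union>\<pi>. \<forall>v\<in>V. v < i}"

lemma right_of_finite: "nc_part \<pi> \<Longrightarrow> finite (right_of \<pi> V)"
  unfolding right_of_def by (rule finite_subset[OF _ nc_part_finite_Union]) auto

lemma nested_eval_empty: "nested_eval A \<Lambda> {} a = 1"
  by (subst nested_eval.simps) (auto simp: interval_block_def)

text \<open>One step of the recursion of \<open>nested_eval\<close>, with the removed block
  \<open>V\<close> and the evaluation \<open>g\<close> of the rest as parameters. In this form
  independence of the chosen block becomes a commutation of two such steps.\<close>

definition absorb :: "('x, 'b::cstar_algebra) valued_algebra \<Rightarrow> ('x list \<Rightarrow> 'b) \<Rightarrow> nat set set \<Rightarrow> nat set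
    \<Rightarrow> ((nat \<Rightarrow> 'x) \<Rightarrow> 'b) \<Rightarrow> (nat \<Rightarrow> 'x) \<Rightarrow> 'b" where
  "absorb A \<Lambda> \<pi> V g a =
     (let b = \<Lambda> (map a (sorted_list_of_set V)); r = Min (right_of \<pi> V)
      in if right_of \<pi> V = {} then g a * b else g (a(r := mult_alg A (incl_alg A b) (a r))))"

definition first_block :: "nat set set \<Rightarrow> nat set" where
  "first_block \<pi> = (SOME V. interval_block \<pi> V)"

lemma interval_first_block: "\<lbrakk>nc_part \<pi>; \<pi> \<noteq> {}\<rbrakk> \<Longrightarrow> interval_block \<pi> (first_block \<pi>)"
  unfolding first_block_def using interval_block_exists by (rule someI_ex)

lemma nested_eval_first_block:
  assumes "nc_part \<pi>" "\<pi> \<noteq> {}"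
  shows "nested_eval A \<Lambda> \<pi> a
    = absorb A \<Lambda> \<pi> (first_block \<pi>) (nested_eval A \<Lambda> (\<pi> - {first_block \<pi>})) a"
  using interval_block_exists[OF assms] nc_part_finite[OF assms(1)]
  unfolding nested_eval.simps[of A \<Lambda> \<pi> a] absorb_def right_of_def Let_def first_block_def by simp

lemma nested_eval_cong:
  assumes "nc_part \<pi>" "\<And>i. i \<in> \<Union>\<pi> \<Longrightarrow> a i = a' i"
  shows "nested_eval A \<Lambda> \<pi> a = nested_eval A \<Lambda> \<pi> a'"
  using assms
proof (induction "card \<pi>" arbitrary: \<pi> a a' rule: less_induct)
  case less
  show ?case
  proof (cases "\<pi> = {}")
    case False
    define V where "V = first_block \<pi>"
    have V: "interval_block \<pi> V" unfolding V_def by (rule interval_first_block[OF less.prems(1) False])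
    have eq: "nested_eval A \<Lambda> \<pi> a = absorb A \<Lambda> \<pi> V (nested_eval A \<Lambda> (\<pi> - {V})) a" for a
      unfolding V_def by (rule nested_eval_first_block[OF less.prems(1) False])
    have V\<pi>: "V \<in> \<pi>" using V by (simp add: interval_block_def)
    note fin = nc_part_finite[OF less.prems(1)]
    have card: "card (\<pi> - {V}) < card \<pi>" using V\<pi> fin by (rule card_Diff1_less[rotated])
    have nc: "nc_part (\<pi> - {V})" using less.prems(1) by (rule nc_part_subset) auto
    have b: "map a (sorted_list_of_set V) = map a' (sorted_list_of_set V)"
      using V\<pi> nc_part_finite_block[OF less.prems(1)] by (intro map_cong refl less.prems) auto
    have R: "a (Min (right_of \<pi> V)) = a' (Min (right_of \<pi> V))" if "right_of \<pi> V \<noteq> {}"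
      using Min_in[OF right_of_finite[OF less.prems(1)] that]
      by (intro less.prems) (simp add: right_of_def)
    have IH: "nested_eval A \<Lambda> (\<pi> - {V}) a1 = nested_eval A \<Lambda> (\<pi> - {V}) a2"
      if "\<And>i. i \<in> \<Union>\<pi> \<Longrightarrow> a1 i = a2 i" for a1 a2 using that by (intro less.hyps card nc) auto
    have "nested_eval A \<Lambda> (\<pi> - {V}) a = nested_eval A \<Lambda> (\<pi> - {V}) a'"
      by (rule IH) (rule less.prems(2))
    moreover have "nested_eval A \<Lambda> (\<pi> - {V}) (a(r := x)) = nested_eval A \<Lambda> (\<pi> - {V}) (a'(r := x))" for r x
      by (rule IH) (simp add: less.prems(2))
    ultimately show ?thesis unfolding eq absorb_def b Let_def using R by simp
  qed (simp add: nested_eval_empty)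
qed

section \<open>Independence of the evaluation from the removed interval block\<close>

context bvalued_prob_space
begin

abbreviation part_eval :: "('a list \<Rightarrow> 'b) \<Rightarrow> nat set set \<Rightarrow> (nat \<Rightarrow> 'a) \<Rightarrow> 'b" where
  "part_eval \<equiv> nested_eval (type_algebra \<iota> E)"

text \<open>The share of quasi-multilinearity on which evaluation along partitions rests: the value
  of an inner block always enters the next argument from the left. Real scalars match the real
  coefficients \<open>tree_coeff\<close>. Both the given cumulants and the Boolean cumulants have
  this property.\<close>

definition left_multilinear :: "('a list \<Rightarrow> 'b) \<Rightarrow> bool" where
  "left_multilinear \<Lambda> \<longleftrightarrow> (\<forall>us vs x y b r.
      \<Lambda> (us @ (x + y) # vs) = \<Lambda> (us @ x # vs) + \<Lambda> (us @ y # vs)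
      \<and> \<Lambda> (us @ (r *\<^sub>R x) # vs) = r *\<^sub>R \<Lambda> (us @ x # vs)
      \<and> \<Lambda> ((\<iota> b * x) # vs) = b * \<Lambda> (x # vs))"

lemma left_multilinearD:
  assumes "left_multilinear \<Lambda>"
  shows "\<Lambda> (us @ (x + y) # vs) = \<Lambda> (us @ x # vs) + \<Lambda> (us @ y # vs)"
    and "\<Lambda> (us @ (r *\<^sub>R x) # vs) = r *\<^sub>R \<Lambda> (us @ x # vs)"
    and "\<Lambda> ((\<iota> b * x) # vs) = b * \<Lambda> (x # vs)"
  using assms unfolding left_multilinear_def by blast+

lemma quasi_multilinear_left_multilinear:
  assumes "quasi_multilinear (type_algebra \<iota> E) \<Lambda>"
  shows "left_multilinear \<Lambda>"
proof -
  have *: "\<Lambda> (us @ (x + y) # vs) = \<Lambda> (us @ x # vs) + \<Lambda> (us @ y # vs)"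
    "\<Lambda> (us @ scaleC c x # vs) = scaleC c (\<Lambda> (us @ x # vs))"
    "\<Lambda> ((\<iota> b * x) # vs) = b * \<Lambda> (x # vs)" for us vs x y b c
    using assms unfolding quasi_multilinear_def type_algebra_def by simp_all
  show ?thesis
    unfolding left_multilinear_def scaleC_of_real[symmetric] using * by blast
qed

abbreviation absorb_block :: "('a list \<Rightarrow> 'b) \<Rightarrow> nat set set \<Rightarrow> nat set \<Rightarrow> ((nat \<Rightarrow> 'a) \<Rightarrow> 'b) \<Rightarrow> (nat \<Rightarrow> 'a) \<Rightarrow> 'b" where
  "absorb_block \<equiv> absorb (type_algebra \<iota> E)"

lemma absorb_block_def:
  "absorb_block \<Lambda> \<pi> V g a =
     (let b = \<Lambda> (map a (sorted_list_of_set V)); r = Min (right_of \<pi> V)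
      in if right_of \<pi> V = {} then g a * b else g (a(r := \<iota> b * a r)))"
  by (simp add: absorb_def type_algebra_def Let_def)

text \<open>Let \<open>r\<close> be the first index to the right of \<open>U\<close>. If
  \<open>r\<close> is not in \<open>V\<close>, the two removals modify different arguments. If it
  is, then \<open>r\<close> is the minimum of \<open>V\<close>; removing \<open>U\<close> first puts
  its value in front of the first argument of \<open>V\<close>, from where left linearity carries it
  out, and removing \<open>V\<close> first lets both values meet at the next index. Either way the
  product \<open>bU * bV\<close> arises in this order.\<close>

lemma absorb_commute:
  assumes lin: "left_multilinear \<Lambda>" and nc: "nc_part \<pi>"
    and U: "interval_block \<pi> U" and V: "interval_block \<pi> V"
    and less: "\<And>u v. u \<in> U \<Longrightarrow> v \<in> V \<Longrightarrow> u < v"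
    and g: "\<And>a a'. (\<And>i. i \<notin> U \<union> V \<Longrightarrow> a i = a' i) \<Longrightarrow> g a = g a'"
  shows "absorb_block \<Lambda> \<pi> U (absorb_block \<Lambda> (\<pi> - {U}) V g) a = absorb_block \<Lambda> \<pi> V (absorb_block \<Lambda> (\<pi> - {V}) U g) a"
proof -
  have mem: "U \<in> \<pi>" "V \<in> \<pi>" using U V by (auto simp: interval_block_def)
  have ne: "U \<noteq> {}" "V \<noteq> {}" and fin: "finite U" "finite V"
    using nc mem nc_part_nonempty nc_part_finite_block by auto
  let ?RU = "right_of \<pi> U" and ?RV = "right_of \<pi> V"
  define r where "r = Min ?RU"
  define s where "s = Min ?RV"
  define bU where "bU = \<Lambda> (map a (sorted_list_of_set U))"
  define bV where "bV = \<Lambda> (map a (sorted_list_of_set V))"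
  define a1 where "a1 = a(r := \<iota> bU * a r)"
  have RV': "right_of (\<pi> - {U}) V = ?RV"
  proof -
    have "x \<notin> U" if "\<forall>v\<in>V. v < x" for x using that less ne by force
    then show ?thesis unfolding right_of_def Union_remove_block[OF nc mem(1)] by blast
  qed
  have RU': "right_of (\<pi> - {V}) U = ?RU - V"
    unfolding right_of_def Union_remove_block[OF nc mem(2)] by blast
  have VRU: "V \<subseteq> ?RU" using less mem by (auto simp: right_of_def)
  then have RUne: "?RU \<noteq> {}" using ne by auto
  have finU: "finite ?RU" and finV: "finite ?RV" using right_of_finite[OF nc] by auto
  have rle: "r \<le> v" if "v \<in> V" for v unfolding r_def using that VRU finU by auto
  have rRU: "r \<in> ?RU" unfolding r_def using Min_in finU RUne by blast
  have rU: "r \<notin> U" using rRU by (auto simp: right_of_def)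
  have sRV: "s \<in> ?RV" if "?RV \<noteq> {}" unfolding s_def using Min_in finV that by blast
  have s: "s \<notin> U" "s \<notin> V" "s \<noteq> r" if "?RV \<noteq> {}"
  proof -
    have sv: "v < s" if "v \<in> V" for v using sRV[OF \<open>?RV \<noteq> {}\<close>] that by (auto simp: right_of_def)
    then show "s \<notin> V" by blast
    show "s \<notin> U" using sv less ne(2) by (meson all_not_in_conv less_asym)
    show "s \<noteq> r" using sv rle ne(2) by (metis all_not_in_conv leD)
  qed
  have mapU: "map (a(s := x)) (sorted_list_of_set U) = map a (sorted_list_of_set U)" if "?RV \<noteq> {}" for x
    using s(1)[OF that] fin by (auto)
  show ?thesis
  proof (cases "r \<in> V")
    case False
    have mapV: "map a1 (sorted_list_of_set V) = map a (sorted_list_of_set V)"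
      unfolding a1_def using False fin by auto
    have "Min (?RU - V) = r"
      using rRU False finU unfolding r_def by (intro Min_eqI) auto
    moreover have "?RU - V \<noteq> {}" using rRU False by blast
    ultimately show ?thesis
      using RUne s
      by (auto simp: absorb_block_def RV' RU' Let_def r_def[symmetric] s_def[symmetric] a1_def[symmetric]
          bU_def[symmetric] bV_def[symmetric] mapV mapU) (auto simp: a1_def fun_upd_twist)
  next
    case True
    then have rV: "r = Min V" using rle fin by (intro Min_eqI[symmetric]) auto
    \<comment> \<open>\<open>V\<close> is an interval whose first point is the first point beyond
      \<open>U\<close>, so everything beyond \<open>U\<close> and outside \<open>V\<close> lies
      beyond all of \<open>V\<close>. After removal of \<open>V\<close>, both blocks therefore pass
      their values to the same index.\<close>
    have RUV: "?RU - V = ?RV"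
    proof
      show "?RV \<subseteq> ?RU - V"
        using less ne by (auto simp: right_of_def intro: less_trans)
      show "?RU - V \<subseteq> ?RV"
      proof
        fix x assume x: "x \<in> ?RU - V"
        then have "r < x" using finU True unfolding r_def by (metis DiffE Min_le le_neq_implies_less r_def)
        moreover have "x \<in> \<Union>\<pi>" using x by (simp add: right_of_def)
        ultimately have "\<not> x < v" if "v \<in> V" for v
          using interval_blockD[OF V _ True that, of x] x by blast
        moreover have "x \<noteq> v" if "v \<in> V" for v using x that by blast
        ultimately have "\<forall>v\<in>V. v < x" by (meson linorder_neqE_nat)
        then show "x \<in> ?RV" using \<open>x \<in> \<Union>\<pi>\<close> by (simp add: right_of_def)
      qed
    qed
    have V_list: "sorted_list_of_set V = r # sorted_list_of_set (V - {r})"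
      unfolding rV using fin ne by (intro sorted_list_of_set_nonempty)
    have "\<Lambda> (map a1 (sorted_list_of_set V)) = bU * bV"
    proof -
      have m: "map a1 (sorted_list_of_set (V - {r})) = map a (sorted_list_of_set (V - {r}))"
        unfolding a1_def using fin by auto
      show ?thesis
        unfolding bV_def V_list list.map m by (simp add: a1_def left_multilinearD(3)[OF lin])
    qed
    moreover have "g (a1(s := \<iota> (bU * bV) * a1 s)) = g (a(s := \<iota> bU * (\<iota> bV * a s)))" if "?RV \<noteq> {}"
      using True s[OF that] by (intro g) (auto simp: a1_def incl_mult mult.assoc)
    moreover have "g a1 = g a" using True by (intro g) (auto simp: a1_def)
    ultimately show ?thesis
      using RUne s
      by (auto simp: absorb_block_def RV' RU' RUV Let_def r_def[symmetric] s_def[symmetric] a1_def[symmetric]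
          bU_def[symmetric] bV_def[symmetric] mapU mult.assoc)
  qed
qed

lemma part_eval_cong:
  "\<lbrakk>nc_part \<pi>; \<And>i. i \<in> \<Union>\<pi> \<Longrightarrow> a i = a' i\<rbrakk> \<Longrightarrow> part_eval \<Lambda> \<pi> a = part_eval \<Lambda> \<pi> a'"
  by (rule nested_eval_cong)

lemma absorb_cong:
  "(\<And>a. g a = g' a) \<Longrightarrow> absorb_block \<Lambda> \<pi> V g = absorb_block \<Lambda> \<pi> V g'"
  unfolding absorb_block_def by presburger

text \<open>If the block chosen by \<open>nested_eval\<close> is not \<open>V\<close>, the induction
  hypothesis lets \<open>V\<close> be removed second on one side and the chosen block be removed
  second on the other; \<open>absorb_commute\<close> then exchanges the two removals.\<close>

lemma part_eval_absorb:
  assumes lin: "left_multilinear \<Lambda>" and "nc_part \<pi>" "interval_block \<pi> V"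
  shows "part_eval \<Lambda> \<pi> a = absorb_block \<Lambda> \<pi> V (part_eval \<Lambda> (\<pi> - {V})) a"
  using assms(2,3)
proof (induction "card \<pi>" arbitrary: \<pi> V a rule: less_induct)
  case less
  note nc = less.prems(1)
  have V\<pi>: "V \<in> \<pi>" using less.prems(2) by (simp add: interval_block_def)
  then have ne: "\<pi> \<noteq> {}" by auto
  define U where "U = first_block \<pi>"
  have U: "interval_block \<pi> U" unfolding U_def by (rule interval_first_block[OF nc ne])
  then have U\<pi>: "U \<in> \<pi>" by (simp add: interval_block_def)
  have eq: "part_eval \<Lambda> \<pi> a = absorb_block \<Lambda> \<pi> U (part_eval \<Lambda> (\<pi> - {U})) a" unfolding U_def by (rule nested_eval_first_block[OF nc ne])
  show ?case
  proof (cases "U = V")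
    case False
    have card: "card (\<pi> - {W}) < card \<pi>" if "W \<in> \<pi>" for W
      using that nc_part_finite[OF nc] by (rule card_Diff1_less[rotated])
    have ncd: "nc_part (\<pi> - W)" for W using nc by (rule nc_part_subset) auto
    have "interval_block (\<pi> - {U}) V"
      using interval_block_subset[OF less.prems(2)] V\<pi> False by simp
    note 1 = less.hyps[OF card[OF U\<pi>] ncd this]
    have "interval_block (\<pi> - {V}) U"
      using interval_block_subset[OF U] U\<pi> False by simp
    moreover have "\<pi> - {V} - {U} = \<pi> - {U} - {V}" by auto
    ultimately have 2: "part_eval \<Lambda> (\<pi> - {V}) a = absorb_block \<Lambda> (\<pi> - {V}) U (part_eval \<Lambda> (\<pi> - {U} - {V})) a" for a
      using less.hyps[OF card[OF V\<pi>] ncd] by metis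
    have g: "part_eval \<Lambda> (\<pi> - {U} - {V}) a = part_eval \<Lambda> (\<pi> - {U} - {V}) a'"
      if "\<And>i. i \<notin> U \<union> V \<Longrightarrow> a i = a' i" for a a'
    proof (rule part_eval_cong)
      show "nc_part (\<pi> - {U} - {V})" using nc by (rule nc_part_subset) auto
      show "a i = a' i" if "i \<in> \<Union>(\<pi> - {U} - {V})" for i
        using that nc_part_disjoint[OF nc] U\<pi> V\<pi> by (intro \<open>\<And>i. i \<notin> U \<union> V \<Longrightarrow> a i = a' i\<close>) blast
    qed
    have "absorb_block \<Lambda> \<pi> U (absorb_block \<Lambda> (\<pi> - {U}) V (part_eval \<Lambda> (\<pi> - {U} - {V}))) a
        = absorb_block \<Lambda> \<pi> V (absorb_block \<Lambda> (\<pi> - {V}) U (part_eval \<Lambda> (\<pi> - {U} - {V}))) a"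
      using interval_blocks_ordered[OF nc U less.prems(2) False]
      by (elim disjE) (blast intro: absorb_commute[OF lin nc U less.prems(2)] g
        absorb_commute[OF lin nc less.prems(2) U, symmetric])+
    then show ?thesis unfolding eq absorb_cong[OF 1] absorb_cong[OF 2] .
  qed (use eq in simp)
qed

end

lemma Min_right_of:
  assumes "nc_part \<pi>" "V \<in> \<pi>" "right_of \<pi> V \<noteq> {}"
  shows "Min (right_of \<pi> V) \<in> \<Union>(\<pi> - {V})" "Min (right_of \<pi> V) \<notin> V"
proof -
  have "Min (right_of \<pi> V) \<in> right_of \<pi> V" using Min_in[OF right_of_finite[OF assms(1)] assms(3)] .
  then show "Min (right_of \<pi> V) \<in> \<Union>(\<pi> - {V})" "Min (right_of \<pi> V) \<notin> V"
    unfolding Union_remove_block[OF assms(1,2)] by (auto simp: right_of_def)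
qed

section \<open>Linearity of the evaluation and evaluation of unions\<close>

context bvalued_prob_space
begin

lemma incl_scaleR: "\<iota> (r *\<^sub>R b) = r *\<^sub>R \<iota> b"
  unfolding scaleC_of_real[symmetric] by (rule incl_scaleC)

lemma E_scaleR: "E (r *\<^sub>R x) = r *\<^sub>R E x"
  unfolding scaleC_of_real[symmetric] by (rule E_scaleC)

text \<open>Additivity and homogeneity share one induction, because the changed index may lie in the
  removed block, may be the index that receives its value, or may be elsewhere, and the three cases
  are treated alike for both.\<close>

lemma part_eval_linear:
  assumes lin: "left_multilinear \<Lambda>" and "nc_part \<pi>" "r \<in> \<Union>\<pi>"
  shows "part_eval \<Lambda> \<pi> (a(r := x + y)) = part_eval \<Lambda> \<pi> (a(r := x)) + part_eval \<Lambda> \<pi> (a(r := y)) \<and>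
    part_eval \<Lambda> \<pi> (a(r := c *\<^sub>R x)) = c *\<^sub>R part_eval \<Lambda> \<pi> (a(r := x))"
  using assms(2,3)
proof (induction "card \<pi>" arbitrary: \<pi> a r x y rule: less_induct)
  case less
  note nc = less.prems(1)
  have ne: "\<pi> \<noteq> {}" using less.prems(2) by auto
  define V where "V = first_block \<pi>"
  have V: "interval_block \<pi> V" unfolding V_def by (rule interval_first_block[OF nc ne])
  have eq: "part_eval \<Lambda> \<pi> a = absorb_block \<Lambda> \<pi> V (part_eval \<Lambda> (\<pi> - {V})) a" for a
    unfolding V_def by (rule nested_eval_first_block[OF nc ne])
  have V\<pi>: "V \<in> \<pi>" using V by (simp add: interval_block_def)
  note fin = nc_part_finite[OF nc]
  have card: "card (\<pi> - {V}) < card \<pi>" using V\<pi> fin by (rule card_Diff1_less[rotated])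
  have ncd: "nc_part (\<pi> - {V})" using nc by (rule nc_part_subset) auto
  note IH = less.hyps[OF card ncd]
  note U = Union_remove_block[OF nc V\<pi>]
  define s where "s = Min (right_of \<pi> V)"
  have s: "s \<in> \<Union>(\<pi> - {V})" "s \<notin> V" if "right_of \<pi> V \<noteq> {}"
    using Min_right_of[OF nc V\<pi> that] by (auto simp: s_def)
  have finV: "finite V" using nc V\<pi> nc_part_finite_block by blast
  show ?case
  proof (cases "r \<in> V")
    case True
    then obtain us vs where uv: "sorted_list_of_set V = us @ r # vs"
      using finV by (metis set_sorted_list_of_set split_list)
    have "distinct (us @ r # vs)" unfolding uv[symmetric] by simp
    then have m: "map (a(r := z)) (sorted_list_of_set V) = map a us @ z # map a vs" for z
      unfolding uv by auto
    have g: "part_eval \<Lambda> (\<pi> - {V}) (a(r := z)) = part_eval \<Lambda> (\<pi> - {V}) a" for z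
      by (rule part_eval_cong[OF ncd]) (use True U in auto)
    have g': "part_eval \<Lambda> (\<pi> - {V}) (a(r := z, s := w)) = part_eval \<Lambda> (\<pi> - {V}) (a(s := w))" for z w
      by (rule part_eval_cong[OF ncd]) (use True U in auto)
    note l = left_multilinearD[OF lin]
    show ?thesis
    proof (cases "right_of \<pi> V = {}")
      case R: True
      show ?thesis unfolding eq absorb_block_def m Let_def g by (simp add: R l distrib_left)
    next
      case R: False
      then have "r \<noteq> s" using s True by blast
      \<comment> \<open>The changed argument is consumed by \<open>V\<close>, so linearity is passed
        on to the index \<open>s\<close> that receives the value of \<open>V\<close>: the induction
        hypothesis is used at \<open>s\<close>, not at \<open>r\<close>.\<close>
      then show ?thesis unfolding eq absorb_block_def m Let_def s_def[symmetric] g'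
        using R IH[OF s(1)[OF R]] by (simp add: l incl_add incl_scaleR distrib_right)
    qed
  next
    case False
    then have r: "r \<in> \<Union>(\<pi> - {V})" using less.prems(2) U by blast
    have m: "map (a(r := z)) (sorted_list_of_set V) = map a (sorted_list_of_set V)" for z
      using False finV by auto
    define b where "b = \<Lambda> (map a (sorted_list_of_set V))"
    show ?thesis
    proof (cases "right_of \<pi> V = {}")
      case R: True
      show ?thesis unfolding eq absorb_block_def m Let_def using R IH[OF r] by (simp add: distrib_right)
    next
      case R: False
      show ?thesis
      proof (cases "s = r")
        case True
        show ?thesis unfolding eq absorb_block_def m Let_def s_def[symmetric] b_def[symmetric]
          using R IH[OF r] True by (simp add: distrib_left)
      next
        case False
        show ?thesis unfolding eq absorb_block_def m Let_def s_def[symmetric] b_def[symmetric]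
          using R IH[OF r, of "a(s := \<iota> b * a s)" x y] False by (simp add: fun_upd_twist)
      qed
    qed
  qed
qed

lemma part_eval_add:
  "\<lbrakk>left_multilinear \<Lambda>; nc_part \<pi>; r \<in> \<Union>\<pi>\<rbrakk> \<Longrightarrow>
    part_eval \<Lambda> \<pi> (a(r := x + y)) = part_eval \<Lambda> \<pi> (a(r := x)) + part_eval \<Lambda> \<pi> (a(r := y))"
  using part_eval_linear by blast

lemma part_eval_scaleR:
  "\<lbrakk>left_multilinear \<Lambda>; nc_part \<pi>; r \<in> \<Union>\<pi>\<rbrakk> \<Longrightarrow>
    part_eval \<Lambda> \<pi> (a(r := c *\<^sub>R x)) = c *\<^sub>R part_eval \<Lambda> \<pi> (a(r := x))"
  using part_eval_linear by blast

lemma part_eval_sum: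
  assumes "left_multilinear \<Lambda>" "nc_part \<pi>" "r \<in> \<Union>\<pi>"
  shows "part_eval \<Lambda> \<pi> (a(r := (\<Sum>i\<in>I. c i *\<^sub>R x i))) = (\<Sum>i\<in>I. c i *\<^sub>R part_eval \<Lambda> \<pi> (a(r := x i)))"
proof (cases "finite I")
  case True
  have "part_eval \<Lambda> \<pi> (a(r := 0)) = 0" using part_eval_scaleR[OF assms, of a 0 0] by simp
  with True show ?thesis
    by (induction I rule: finite_induct) (simp_all add: part_eval_add[OF assms] part_eval_scaleR[OF assms])
next
  case False
  then show ?thesis using part_eval_scaleR[OF assms, of a 0 0] by simp
qed

text \<open>The blocks of \<open>\<tau>\<close> are stripped off one at a time. Since
  \<open>\<sigma>\<close> lies to the left, an interval block of \<open>\<tau>\<close> stays one in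
  the union and passes its value to the same place, so the factor of \<open>\<sigma>\<close> is
  never touched.\<close>

lemma part_eval_Un_right:
  assumes lin: "left_multilinear \<Lambda>" and "nc_part (\<sigma> \<union> \<tau>)" "\<sigma> \<inter> \<tau> = {}"
    and "\<And>s t. s \<in> \<Union>\<sigma> \<Longrightarrow> t \<in> \<Union>\<tau> \<Longrightarrow> s < t"
  shows "part_eval \<Lambda> (\<sigma> \<union> \<tau>) a = part_eval \<Lambda> \<sigma> a * part_eval \<Lambda> \<tau> a"
  using assms(2-4)
proof (induction "card \<tau>" arbitrary: \<tau> a rule: less_induct)
  case less
  note nc = less.prems(1)
  have nc\<tau>: "nc_part \<tau>" and nc\<sigma>: "nc_part \<sigma>" using nc nc_part_subset by auto
  show ?case
  proof (cases "\<tau> = {}")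
    case False
    define U where "U = first_block \<tau>"
    have U: "interval_block \<tau> U" unfolding U_def by (rule interval_first_block[OF nc\<tau> False])
    have U\<tau>: "U \<in> \<tau>" using U by (simp add: interval_block_def)
    have Une: "U \<noteq> {}" using nc_part_nonempty[OF nc\<tau> U\<tau>] .
    have U': "interval_block (\<sigma> \<union> \<tau>) U"
    proof -
      have "x \<in> U" if x: "x \<in> \<Union>(\<sigma> \<union> \<tau>)" "j \<in> U" "k \<in> U" "j < x" "x < k" for x j k
      proof -
        have "x \<notin> \<Union>\<sigma>" using less.prems(3)[of x j] x(2,4) U\<tau> by force
        then show ?thesis using interval_blockD[OF U _ x(2-5)] x(1) by auto
      qed
      then show ?thesis using U\<tau> unfolding interval_block_def by blast
    qed
    have eq: "part_eval \<Lambda> \<tau> a = absorb_block \<Lambda> \<tau> U (part_eval \<Lambda> (\<tau> - {U})) a" by (rule part_eval_absorb[OF lin nc\<tau> U])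
    have eq': "part_eval \<Lambda> (\<sigma> \<union> \<tau>) a = absorb_block \<Lambda> (\<sigma> \<union> \<tau>) U (part_eval \<Lambda> (\<sigma> \<union> \<tau> - {U})) a"
      by (rule part_eval_absorb[OF lin nc U'])
    have dif: "\<sigma> \<union> \<tau> - {U} = \<sigma> \<union> (\<tau> - {U})" using less.prems(2) U\<tau> by auto
    have R: "right_of (\<sigma> \<union> \<tau>) U = right_of \<tau> U"
    proof -
      have "\<not> (\<forall>u\<in>U. u < x)" if "x \<in> \<Union>\<sigma>" for x
        using less.prems(3)[OF that] U\<tau> Une by (meson UnionI all_not_in_conv less_asym)
      then show ?thesis unfolding right_of_def by auto
    qed
    have card: "card (\<tau> - {U}) < card \<tau>"
      using U\<tau> nc_part_finite[OF nc\<tau>] by (rule card_Diff1_less[rotated])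
    have IH: "part_eval \<Lambda> (\<sigma> \<union> (\<tau> - {U})) a = part_eval \<Lambda> \<sigma> a * part_eval \<Lambda> (\<tau> - {U}) a" for a
    proof (rule less.hyps[OF card])
      show "nc_part (\<sigma> \<union> (\<tau> - {U}))" using nc by (rule nc_part_subset) auto
      show "\<sigma> \<inter> (\<tau> - {U}) = {}" using less.prems(2) by auto
      show "s < t" if "s \<in> \<Union>\<sigma>" "t \<in> \<Union>(\<tau> - {U})" for s t
        using that(2) by (intro less.prems(3)[OF that(1)]) auto
    qed
    define s where "s = Min (right_of \<tau> U)"
    have "part_eval \<Lambda> \<sigma> (a(s := w)) = part_eval \<Lambda> \<sigma> a" if "right_of \<tau> U \<noteq> {}" for w
    proof (rule part_eval_cong[OF nc\<sigma>])
      fix i assume i: "i \<in> \<Union>\<sigma>"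
      have "s \<in> \<Union>\<tau>" using Min_right_of(1)[OF nc\<tau> U\<tau> that] unfolding s_def by blast
      then show "(a(s := w)) i = a i" using less.prems(3)[OF i] by force
    qed
    then show ?thesis
      unfolding eq eq' absorb_block_def R dif IH Let_def s_def[symmetric] by (simp add: mult.assoc)
  qed (simp add: nested_eval_empty)
qed

text \<open>Here \<open>\<tau>\<close> fills the place directly before \<open>r\<close>, with all of
  \<open>\<sigma>\<close> either before \<open>\<tau>\<close> or at and beyond \<open>r\<close>.
  Stripping blocks of \<open>\<tau>\<close> as before, the values that would have been right factors
  of \<open>part_eval \<Lambda> \<tau> a\<close> are received by the argument at
  \<open>r\<close>.\<close>

lemma part_eval_Un_inner:
  assumes lin: "left_multilinear \<Lambda>" and "nc_part (\<sigma> \<union> \<tau>)" "\<sigma> \<inter> \<tau> = {}"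
    and r: "r \<in> \<Union>\<sigma>" and "\<And>t. t \<in> \<Union>\<tau> \<Longrightarrow> t < r"
    and "\<And>s t. s \<in> \<Union>\<sigma> \<Longrightarrow> s < r \<Longrightarrow> t \<in> \<Union>\<tau> \<Longrightarrow> s < t"
  shows "part_eval \<Lambda> (\<sigma> \<union> \<tau>) a = part_eval \<Lambda> \<sigma> (a(r := \<iota> (part_eval \<Lambda> \<tau> a) * a r))"
  using assms(2,3,5,6)
proof (induction "card \<tau>" arbitrary: \<tau> a rule: less_induct)
  case less
  note nc = less.prems(1)
  have nc\<tau>: "nc_part \<tau>" and nc\<sigma>: "nc_part \<sigma>" using nc nc_part_subset by auto
  show ?case
  proof (cases "\<tau> = {}")
    case False
    define U where "U = first_block \<tau>"
    have U: "interval_block \<tau> U" unfolding U_def by (rule interval_first_block[OF nc\<tau> False])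
    have U\<tau>: "U \<in> \<tau>" using U by (simp add: interval_block_def)
    have Une: "U \<noteq> {}" using nc_part_nonempty[OF nc\<tau> U\<tau>] .
    have \<sigma>: "s < t" if "s \<in> \<Union>\<sigma>" "t \<in> \<Union>\<tau>" "\<not> r \<le> s" for s t
      using less.prems(4)[OF that(1) _ that(2)] that(3) by simp
    have U': "interval_block (\<sigma> \<union> \<tau>) U"
    proof -
      have "x \<in> U" if x: "x \<in> \<Union>(\<sigma> \<union> \<tau>)" "j \<in> U" "k \<in> U" "j < x" "x < k" for x j k
      proof -
        have "j \<in> \<Union>\<tau>" "k \<in> \<Union>\<tau>" using x U\<tau> by auto
        then have "x \<notin> \<Union>\<sigma>" using \<sigma>[of x j] less.prems(3)[of k] x(4,5) by fastforce
        then show ?thesis using interval_blockD[OF U _ x(2-5)] x(1) by auto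
      qed
      then show ?thesis using U\<tau> unfolding interval_block_def by blast
    qed
    have eq: "part_eval \<Lambda> \<tau> a = absorb_block \<Lambda> \<tau> U (part_eval \<Lambda> (\<tau> - {U})) a" by (rule part_eval_absorb[OF lin nc\<tau> U])
    have eq': "part_eval \<Lambda> (\<sigma> \<union> \<tau>) a = absorb_block \<Lambda> (\<sigma> \<union> \<tau>) U (part_eval \<Lambda> (\<sigma> \<union> \<tau> - {U})) a"
      by (rule part_eval_absorb[OF lin nc U'])
    have dif: "\<sigma> \<union> \<tau> - {U} = \<sigma> \<union> (\<tau> - {U})" using less.prems(2) U\<tau> by auto
    have finR: "finite (right_of (\<sigma> \<union> \<tau>) U)" using nc by (rule right_of_finite)
    have rR: "r \<in> right_of (\<sigma> \<union> \<tau>) U"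
      using r less.prems(3) U\<tau> by (auto simp: right_of_def)
    have Rr: "r \<le> x" if "x \<in> right_of (\<sigma> \<union> \<tau>) U" "x \<in> \<Union>\<sigma>" for x
    proof (rule ccontr)
      assume "\<not> r \<le> x"
      then have "x < u" if "u \<in> U" for u using \<sigma>[OF \<open>x \<in> \<Union>\<sigma>\<close>] that U\<tau> by blast
      then show False using that(1) Une unfolding right_of_def by (metis (mono_tags, lifting) all_not_in_conv less_asym mem_Collect_eq)
    qed
    have card: "card (\<tau> - {U}) < card \<tau>"
      using U\<tau> nc_part_finite[OF nc\<tau>] by (rule card_Diff1_less[rotated])
    have IH: "part_eval \<Lambda> (\<sigma> \<union> (\<tau> - {U})) a = part_eval \<Lambda> \<sigma> (a(r := \<iota> (part_eval \<Lambda> (\<tau> - {U}) a) * a r))" for a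
    proof (rule less.hyps[OF card])
      show "nc_part (\<sigma> \<union> (\<tau> - {U}))" using nc by (rule nc_part_subset) auto
      show "\<sigma> \<inter> (\<tau> - {U}) = {}" using less.prems(2) by auto
      show "t < r" if "t \<in> \<Union>(\<tau> - {U})" for t
        using that by (intro less.prems(3)) auto
      show "s < t" if "s \<in> \<Union>\<sigma>" "s < r" "t \<in> \<Union>(\<tau> - {U})" for s t
        using that(3) by (intro less.prems(4)[OF that(1,2)]) auto
    qed
    have nc\<tau>': "nc_part (\<tau> - {U})" using nc\<tau> by (rule nc_part_subset) auto
    have r\<tau>: "r \<notin> \<Union>\<tau>" using less.prems(3) by blast
    show ?thesis
    proof (cases "right_of \<tau> U = {}")
      case True
      have "right_of (\<sigma> \<union> \<tau>) U \<subseteq> \<Union>\<sigma>" using True by (auto simp: right_of_def)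
      \<comment> \<open>Nothing of \<open>\<tau>\<close> remains to the right of \<open>U\<close>,
        and the first index of \<open>\<sigma>\<close> beyond \<open>\<tau>\<close> is
        \<open>r\<close>.\<close>
      then have M: "Min (right_of (\<sigma> \<union> \<tau>) U) = r"
        using rR Rr by (intro Min_eqI[OF finR]) auto
      have "part_eval \<Lambda> (\<tau> - {U}) (a(r := w)) = part_eval \<Lambda> (\<tau> - {U}) a" for w
        by (rule part_eval_cong[OF nc\<tau>']) (use r\<tau> in auto)
      then show ?thesis using rR True
        unfolding eq eq' absorb_block_def M dif IH Let_def by (auto simp: incl_mult mult.assoc)
    next
      case False
      define s where "s = Min (right_of \<tau> U)"
      have s: "s \<in> right_of \<tau> U" unfolding s_def using Min_in[OF right_of_finite[OF nc\<tau>] False] .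
      then have s\<tau>: "s \<in> \<Union>\<tau>" by (simp add: right_of_def)
      have M: "Min (right_of (\<sigma> \<union> \<tau>) U) = s"
      proof (rule Min_eqI[OF finR])
        show "s \<in> right_of (\<sigma> \<union> \<tau>) U" using s by (auto simp: right_of_def)
        fix x assume x: "x \<in> right_of (\<sigma> \<union> \<tau>) U"
        then consider "x \<in> \<Union>\<sigma>" | "x \<in> right_of \<tau> U" by (auto simp: right_of_def)
        then show "s \<le> x"
        proof cases
          case 1 then show ?thesis using Rr[OF x] less.prems(3)[OF s\<tau>] by simp
        next
          case 2 then show ?thesis unfolding s_def using right_of_finite[OF nc\<tau>] by simp
        qed
      qed
      have sr: "s \<noteq> r" using less.prems(3)[OF s\<tau>] by simp
      have "s \<notin> \<Union>\<sigma>"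
        using less.prems(2) s\<tau> nc_part_disjoint[OF nc] by blast
      then have "part_eval \<Lambda> \<sigma> (a(s := v, r := w)) = part_eval \<Lambda> \<sigma> (a(r := w))" for v w
        by (intro part_eval_cong[OF nc\<sigma>]) auto
      then show ?thesis using rR False sr
        unfolding eq eq' absorb_block_def M dif IH Let_def s_def[symmetric] by auto
    qed
  qed (simp add: nested_eval_empty incl_one)
qed

end

section \<open>The coefficients under relabelling and concatenation\<close>

lemma color_components_cong:
  assumes "\<And>V. V \<in> \<pi> \<Longrightarrow> \<kappa> V = \<psi> V"
  shows "color_components \<pi> \<kappa> = color_components \<pi> \<psi>"
proof -
  have "mono_edges \<pi> \<kappa> = mono_edges \<pi> \<psi>" using assms by (auto simp: mono_edges_def covers_def)
  then show ?thesis by (simp add: color_components_def)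
qed

lemma is_chain_set: "is_chain \<pi> V Vs \<Longrightarrow> set Vs = {W\<in>\<pi>. encloses W V}"
  unfolding is_chain_def by (rule conjunct2)

lemma is_chain_sorted: "is_chain \<pi> V Vs \<Longrightarrow> sorted_wrt (\<lambda>X Y. encloses Y X) (V # Vs)"
  unfolding is_chain_def by (rule conjunct1)

lemma is_chain_subset: "is_chain \<pi> V Vs \<Longrightarrow> set Vs \<subseteq> \<pi>"
  using is_chain_set by blast

lemma weak_coloringsD:
  assumes "\<kappa> \<in> weak_colorings N T \<pi>"
  shows "V \<in> \<pi> \<Longrightarrow> is_chain \<pi> V Vs \<Longrightarrow> remdups_adj (map \<kappa> (V # Vs)) \<in> T"
    and "\<kappa> \<in> \<pi> \<rightarrow>\<^sub>E {1..N}"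
  using assms unfolding weak_colorings_def by blast+

lemma weak_coloringsI:
  assumes "\<kappa> \<in> \<pi> \<rightarrow>\<^sub>E {1..N}"
    and "\<And>V Vs. V \<in> \<pi> \<Longrightarrow> is_chain \<pi> V Vs \<Longrightarrow> remdups_adj (map \<kappa> (V # Vs)) \<in> T"
  shows "\<kappa> \<in> weak_colorings N T \<pi>"
  using assms unfolding weak_colorings_def by blast

lemma map_restrict: "set xs \<subseteq> A \<Longrightarrow> map (restrict g A) xs = map g xs"
  by (rule map_cong[OF refl]) (auto simp: restrict_apply')

section \<open>Invariance of the coefficients under increasing relabelling\<close>

context
  fixes f :: "nat \<Rightarrow> nat"
  assumes mono: "strict_mono f"
begin

private lemma inj: "inj f" using mono by (rule strict_mono_imp_inj_on)
private lemma injF: "inj (image f)" using inj by (simp add: inj_on_image_Pow inj_on_def inj_image_eq_iff)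
private lemma lt: "f x < f y \<longleftrightarrow> x < y" using mono by (rule strict_mono_less)

lemma encloses_relabel: "encloses (f ` W) (f ` V) \<longleftrightarrow> encloses W V"
  by (simp add: encloses_def lt)

lemma covers_relabel: "covers (image f ` \<pi>) (f ` V) (f ` W) \<longleftrightarrow> covers \<pi> V W"
  by (simp add: covers_def encloses_relabel inj_image_mem_iff[OF injF])

lemma nc_part_relabel: "nc_part \<pi> \<Longrightarrow> nc_part (image f ` \<pi>)"
proof -
  assume nc: "nc_part \<pi>"
  have "V = W" if "V \<in> \<pi>" "W \<in> \<pi>" "a \<in> V" "b \<in> W" "c \<in> V" "d \<in> W" "f a < f b" "f b < f c" "f c < f d" for V W a b c d
    using that nc_part_crossing[OF nc] by (simp add: lt)
  then have "noncrossing (image f ` \<pi>)" unfolding noncrossing_def by blast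
  moreover have "disjoint (image f ` \<pi>)"
  proof (rule pairwiseI, clarsimp simp: disjnt_def)
    fix V W x assume *: "V \<in> \<pi>" "W \<in> \<pi>" "f ` V \<noteq> f ` W"
    then have "V \<inter> W = {}" using nc_part_disjoint[OF nc] by blast
    then show "f ` V \<inter> f ` W = {}" using inj by (simp add: image_Int[symmetric])
  qed
  moreover have "finite (\<Union>(image f ` \<pi>))"
    using nc_part_finite[OF nc] nc_part_finite_block[OF nc] by auto
  ultimately show ?thesis using nc_part_nonempty[OF nc] unfolding nc_part_iff by auto
qed

lemma Union_relabel: "\<Union>(image f ` \<pi>) = f ` \<Union>\<pi>"
  by auto

lemma is_chain_relabel:
  "is_chain (image f ` \<pi>) (f ` V) Ws \<longleftrightarrow> (\<exists>Vs. Ws = map (image f) Vs \<and> is_chain \<pi> V Vs)"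
proof
  have enc: "{W\<in>image f ` \<pi>. encloses W (f ` V)} = image f ` {W\<in>\<pi>. encloses W V}"
    using encloses_relabel by blast
  {
    assume ch: "is_chain (image f ` \<pi>) (f ` V) Ws"
    then have "set Ws \<subseteq> range (image f)" using is_chain_subset by blast
    then obtain Vs where Vs: "Ws = map (image f) Vs"
      by (metis ex_map_conv image_iff subset_iff)
    have "image f ` set Vs = image f ` {W\<in>\<pi>. encloses W V}"
      using is_chain_set[OF ch] unfolding enc Vs set_map .
    then have "set Vs = {W\<in>\<pi>. encloses W V}" using injF by (simp only: inj_image_eq_iff)
    moreover have "sorted_wrt (\<lambda>X Y. encloses Y X) (V # Vs)"
      using is_chain_sorted[OF ch] unfolding Vs list.map(2)[symmetric] sorted_wrt_map encloses_relabel .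
    ultimately show "\<exists>Vs. Ws = map (image f) Vs \<and> is_chain \<pi> V Vs" using Vs unfolding is_chain_def by blast
  }
  assume "\<exists>Vs. Ws = map (image f) Vs \<and> is_chain \<pi> V Vs"
  then obtain Vs where Vs: "Ws = map (image f) Vs" and ch: "is_chain \<pi> V Vs" by blast
  have "sorted_wrt (\<lambda>X Y. encloses Y X) (f ` V # Ws)"
    using is_chain_sorted[OF ch] unfolding Vs list.map(2)[symmetric] sorted_wrt_map encloses_relabel .
  moreover have "set Ws = {W\<in>image f ` \<pi>. encloses W (f ` V)}"
    unfolding enc Vs set_map is_chain_set[OF ch] ..
  ultimately show "is_chain (image f ` \<pi>) (f ` V) Ws" unfolding is_chain_def by blast
qed

lemma color_components_relabel:
  "color_components (image f ` \<pi>) \<kappa> = image (image f) ` color_components \<pi> (\<kappa> \<circ> image f)"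
proof -
  let ?M = "mono_edges (image f ` \<pi>) \<kappa>" and ?M' = "mono_edges \<pi> (\<kappa> \<circ> image f)"
  have edge: "(f ` V, f ` W) \<in> ?M \<longleftrightarrow> (V, W) \<in> ?M'" for V W
    by (simp add: mono_edges_def covers_relabel)
  have 1: "\<exists>W. X = f ` W \<and> (V, W) \<in> ?M'\<^sup>*" if "(f ` V, X) \<in> ?M\<^sup>*" for V X
    using that
  proof induction
    case (step Y Z)
    then obtain W where W: "Y = f ` W" "(V, W) \<in> ?M'\<^sup>*" by blast
    moreover have "Z \<in> image f ` \<pi>" using step(2) by (auto simp: mono_edges_def covers_def)
    then obtain U where "Z = f ` U" by blast
    ultimately show ?case using step(2) edge by (metis rtrancl.rtrancl_into_rtrancl)
  qed auto
  have 2: "(f ` V, f ` W) \<in> ?M\<^sup>*" if "(V, W) \<in> ?M'\<^sup>*" for V W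
    using that by induction (auto simp: edge[symmetric] intro: rtrancl.rtrancl_into_rtrancl)
  have "{X. (f ` V, X) \<in> ?M\<^sup>*} = image f ` {W. (V, W) \<in> ?M'\<^sup>*}" for V
    using 1 2 by blast
  then show ?thesis unfolding color_components_def by (simp add: image_image)
qed

lemma weak_colorings_relabel:
  "bij_betw (\<lambda>\<kappa>. \<lambda>V\<in>\<pi>. \<kappa> (f ` V)) (weak_colorings N T (image f ` \<pi>)) (weak_colorings N T \<pi>)"
proof (rule bij_betwI[where g = "\<lambda>\<kappa>. \<lambda>V\<in>image f ` \<pi>. \<kappa> (the_inv (image f) V)"])
  have set: "set Vs \<subseteq> \<pi>" if "is_chain \<pi> V Vs" for V Vs by (rule is_chain_subset[OF that])
  have inv: "the_inv (image f) (f ` V) = V" for V by (rule the_inv_f_f[OF injF])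
  have m: "map (\<lambda>V\<in>\<pi>. \<kappa> (f ` V)) (V # Vs) = map \<kappa> (f ` V # map (image f) Vs)"
    if "is_chain \<pi> V Vs" "V \<in> \<pi>" for \<kappa> V Vs
  proof -
    have "set (V # Vs) \<subseteq> \<pi>" using set[OF that(1)] that(2) by simp
    from map_restrict[OF this, of "\<lambda>V. \<kappa> (f ` V)"] show ?thesis
      by (simp only: list.map map_map comp_def)
  qed
  show "(\<lambda>\<kappa>. \<lambda>V\<in>\<pi>. \<kappa> (f ` V)) \<in> weak_colorings N T (image f ` \<pi>) \<rightarrow> weak_colorings N T \<pi>"
  proof
    fix \<kappa> assume *: "\<kappa> \<in> weak_colorings N T (image f ` \<pi>)"
    show "(\<lambda>V\<in>\<pi>. \<kappa> (f ` V)) \<in> weak_colorings N T \<pi>"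
    proof (rule weak_coloringsI)
      fix V Vs assume V: "V \<in> \<pi>" "is_chain \<pi> V Vs"
      then have "is_chain (image f ` \<pi>) (f ` V) (map (image f) Vs)" using is_chain_relabel by blast
      then show "remdups_adj (map (\<lambda>V\<in>\<pi>. \<kappa> (f ` V)) (V # Vs)) \<in> T"
        unfolding m[OF V(2,1)] using V(1) by (intro weak_coloringsD(1)[OF *]) auto
    qed (use weak_coloringsD(2)[OF *] in \<open>auto simp: PiE_iff\<close>)
  qed
  show "(\<lambda>\<kappa>. \<lambda>V\<in>image f ` \<pi>. \<kappa> (the_inv (image f) V)) \<in> weak_colorings N T \<pi> \<rightarrow> weak_colorings N T (image f ` \<pi>)"
  proof
    fix \<kappa> assume *: "\<kappa> \<in> weak_colorings N T \<pi>"
    let ?\<kappa> = "\<lambda>V\<in>image f ` \<pi>. \<kappa> (the_inv (image f) V)"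
    show "?\<kappa> \<in> weak_colorings N T (image f ` \<pi>)"
    proof (rule weak_coloringsI)
      fix X Ws assume X: "X \<in> image f ` \<pi>" "is_chain (image f ` \<pi>) X Ws"
      then obtain V where V: "V \<in> \<pi>" "X = f ` V" by blast
      then obtain Vs where Vs: "Ws = map (image f) Vs" "is_chain \<pi> V Vs"
        using X(2) is_chain_relabel by blast
      have "set (f ` V # map (image f) Vs) \<subseteq> image f ` \<pi>"
        using set[OF Vs(2)] V(1) unfolding list.set set_map by blast
      from map_restrict[OF this, of "\<lambda>V. \<kappa> (the_inv (image f) V)"]
      have eq: "map ?\<kappa> (f ` V # map (image f) Vs) = map \<kappa> (V # Vs)"
        by (simp only: list.map map_map comp_def inv)
      show "remdups_adj (map ?\<kappa> (X # Ws)) \<in> T"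
        unfolding V(2) Vs(1) eq by (rule weak_coloringsD(1)[OF * V(1) Vs(2)])
    qed (use weak_coloringsD(2)[OF *] inv in \<open>auto simp: PiE_iff\<close>)
  qed
  show "(\<lambda>V\<in>image f ` \<pi>. (\<lambda>V\<in>\<pi>. \<kappa> (f ` V)) (the_inv (image f) V)) = \<kappa>"
    if "\<kappa> \<in> weak_colorings N T (image f ` \<pi>)" for \<kappa>
    using that inv unfolding weak_colorings_def by (auto simp: fun_eq_iff PiE_iff extensional_def)
  show "(\<lambda>V\<in>\<pi>. (\<lambda>V\<in>image f ` \<pi>. \<kappa> (the_inv (image f) V)) (f ` V)) = \<kappa>"
    if "\<kappa> \<in> weak_colorings N T \<pi>" for \<kappa>
    using that inv unfolding weak_colorings_def by (auto simp: fun_eq_iff PiE_iff extensional_def)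
qed

text \<open>Nesting, covering, chains and color components only see the order of the points, so the
  transported family solves the same recursion. Uniqueness of the coefficients then gives their
  invariance without an induction on partitions.\<close>

lemma tree_coefficients_relabel:
  assumes "tree_coefficients N T \<alpha>"
  shows "tree_coefficients N T (\<lambda>\<pi>. \<alpha> (image f ` \<pi>))"
  unfolding tree_coefficients_def
proof (intro allI impI, elim conjE)
  fix S \<pi> assume "finite S" "\<pi> \<in> NC S"
  then have nc: "nc_part \<pi>" using nc_part_NC by blast
  then have "nc_part (image f ` \<pi>)" by (rule nc_part_relabel)
  then have *: "card (image f ` \<pi>) = 1 \<longrightarrow> \<alpha> (image f ` \<pi>) = 1"
    "\<alpha> (image f ` \<pi>) = (\<Sum>\<kappa>\<in>weak_colorings N T (image f ` \<pi>).
        \<Prod>\<pi>'\<in>color_components (image f ` \<pi>) \<kappa>. \<alpha> \<pi>') / real (root_degree N T) ^ card (image f ` \<pi>)"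
    using assms unfolding tree_coefficients_def nc_part_def by blast+
  have card: "card (image f ` \<pi>) = card \<pi>" by (rule card_image) (rule inj_on_subset[OF injF], simp)
  have inj2: "inj_on (image (image f)) A" for A
    by (rule inj_onI) (simp only: inj_image_eq_iff[OF injF])
  have "(\<Sum>\<kappa>\<in>weak_colorings N T (image f ` \<pi>). \<Prod>\<pi>'\<in>color_components (image f ` \<pi>) \<kappa>. \<alpha> \<pi>')
    = (\<Sum>\<kappa>\<in>weak_colorings N T \<pi>. \<Prod>\<pi>'\<in>color_components \<pi> \<kappa>. \<alpha> (image f ` \<pi>'))"
  proof (rule trans[OF _ sum.reindex_bij_betw[OF weak_colorings_relabel]])
    have "(\<Prod>\<pi>'\<in>color_components (image f ` \<pi>) \<kappa>. \<alpha> \<pi>')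
      = (\<Prod>\<pi>'\<in>color_components \<pi> (\<lambda>V\<in>\<pi>. \<kappa> (f ` V)). \<alpha> (image f ` \<pi>'))" for \<kappa>
    proof -
      have "color_components \<pi> (\<lambda>V\<in>\<pi>. \<kappa> (f ` V)) = color_components \<pi> (\<kappa> \<circ> image f)"
        by (rule color_components_cong) simp
      then show ?thesis unfolding color_components_relabel by (simp add: prod.reindex inj2)
    qed
    then show "(\<Sum>\<kappa>\<in>weak_colorings N T (image f ` \<pi>). \<Prod>\<pi>'\<in>color_components (image f ` \<pi>) \<kappa>. \<alpha> \<pi>')
      = (\<Sum>\<kappa>\<in>weak_colorings N T (image f ` \<pi>).
          \<Prod>\<pi>'\<in>color_components \<pi> (\<lambda>V\<in>\<pi>. \<kappa> (f ` V)). \<alpha> (image f ` \<pi>'))"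
      by simp
  qed
  then show "(card \<pi> = 1 \<longrightarrow> \<alpha> (image f ` \<pi>) = 1) \<and>
      \<alpha> (image f ` \<pi>) = (\<Sum>\<kappa>\<in>weak_colorings N T \<pi>. \<Prod>\<pi>'\<in>color_components \<pi> \<kappa>. \<alpha> (image f ` \<pi>'))
        / real (root_degree N T) ^ card \<pi>"
    using * unfolding card by (simp only:)
qed

lemma tree_coeff_relabel:
  assumes "root_degree N T \<ge> 2" "nc_part \<pi>"
  shows "tree_coeff N T (image f ` \<pi>) = tree_coeff N T \<pi>"
  using tree_coefficients_unique[OF assms(1) tree_coefficients_relabel[OF tree_coefficients_tree_coeff]
    tree_coefficients_tree_coeff] assms unfolding nc_part_def by blast

end

section \<open>Multiplicativity of the coefficients\<close>

lemma rtrancl_Un_separated: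
  assumes "(x, y) \<in> (A \<union> B)\<^sup>*" "x \<in> X" "A \<subseteq> X \<times> X" "B \<subseteq> Y \<times> Y" "X \<inter> Y = {}"
  shows "(x, y) \<in> A\<^sup>* \<and> y \<in> X"
  using assms(1)
proof induction
  case (step y z)
  then have "(y, z) \<in> A" using assms by blast
  then show ?case using step assms(3) by (auto intro: rtrancl.rtrancl_into_rtrancl)
qed (use assms in auto)

lemma color_components_Un:
  assumes "\<pi>\<^sub>1 \<inter> \<pi>\<^sub>2 = {}"
    and sep: "\<And>V W. V \<in> \<pi>\<^sub>1 \<Longrightarrow> W \<in> \<pi>\<^sub>2 \<Longrightarrow> \<not> encloses V W \<and> \<not> encloses W V"
  shows "color_components (\<pi>\<^sub>1 \<union> \<pi>\<^sub>2) \<kappa> = color_components \<pi>\<^sub>1 \<kappa> \<union> color_components \<pi>\<^sub>2 \<kappa>"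
proof -
  let ?M = "mono_edges (\<pi>\<^sub>1 \<union> \<pi>\<^sub>2) \<kappa>" and ?M1 = "mono_edges \<pi>\<^sub>1 \<kappa>" and ?M2 = "mono_edges \<pi>\<^sub>2 \<kappa>"
  have "covers (\<pi>\<^sub>1 \<union> \<pi>\<^sub>2) V W \<longleftrightarrow> covers \<pi>\<^sub>1 V W \<or> covers \<pi>\<^sub>2 V W" for V W
    using sep unfolding covers_def by blast
  then have M: "?M = ?M1 \<union> ?M2" by (auto simp: mono_edges_def)
  have M1: "?M1 \<subseteq> \<pi>\<^sub>1 \<times> \<pi>\<^sub>1" and M2: "?M2 \<subseteq> \<pi>\<^sub>2 \<times> \<pi>\<^sub>2" by (auto simp: mono_edges_def covers_def)
  have sub: "?M1\<^sup>* \<subseteq> ?M\<^sup>*" "?M2\<^sup>* \<subseteq> ?M\<^sup>*" unfolding M by (auto intro!: rtrancl_mono)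
  have 1: "{W. (V, W) \<in> ?M\<^sup>*} = {W. (V, W) \<in> ?M1\<^sup>*}" if "V \<in> \<pi>\<^sub>1" for V
    using rtrancl_Un_separated[OF _ that M1 M2 assms(1)] sub unfolding M by blast
  have 2: "{W. (V, W) \<in> ?M\<^sup>*} = {W. (V, W) \<in> ?M2\<^sup>*}" if "V \<in> \<pi>\<^sub>2" for V
    using rtrancl_Un_separated[OF _ that M2 M1] assms(1) sub unfolding M by (auto simp: Un_commute)
  show ?thesis unfolding color_components_def image_Un using 1 2 by simp
qed

text \<open>No block of one part is nested in a block of the other, so the chain of a block stays
  inside its own part and the conditions on the two restrictions are independent.\<close>

lemma weak_colorings_Un:
  assumes dis: "\<pi>\<^sub>1 \<inter> \<pi>\<^sub>2 = {}"
    and sep: "\<And>V W. V \<in> \<pi>\<^sub>1 \<Longrightarrow> W \<in> \<pi>\<^sub>2 \<Longrightarrow> \<not> encloses V W \<and> \<not> encloses W V"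
  shows "bij_betw (\<lambda>\<kappa>. (restrict \<kappa> \<pi>\<^sub>1, restrict \<kappa> \<pi>\<^sub>2)) (weak_colorings N T (\<pi>\<^sub>1 \<union> \<pi>\<^sub>2))
     (weak_colorings N T \<pi>\<^sub>1 \<times> weak_colorings N T \<pi>\<^sub>2)"
proof -
  have ch1: "is_chain (\<pi>\<^sub>1 \<union> \<pi>\<^sub>2) V Vs \<longleftrightarrow> is_chain \<pi>\<^sub>1 V Vs" if "V \<in> \<pi>\<^sub>1" for V Vs
  proof -
    have "{W \<in> \<pi>\<^sub>1 \<union> \<pi>\<^sub>2. encloses W V} = {W \<in> \<pi>\<^sub>1. encloses W V}" using sep that by blast
    then show ?thesis unfolding is_chain_def by blast
  qed
  have ch2: "is_chain (\<pi>\<^sub>1 \<union> \<pi>\<^sub>2) V Vs \<longleftrightarrow> is_chain \<pi>\<^sub>2 V Vs" if "V \<in> \<pi>\<^sub>2" for V Vs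
  proof -
    have "{W \<in> \<pi>\<^sub>1 \<union> \<pi>\<^sub>2. encloses W V} = {W \<in> \<pi>\<^sub>2. encloses W V}" using sep that by blast
    then show ?thesis unfolding is_chain_def by blast
  qed
  have m: "map (restrict \<kappa> \<pi>) (V # Vs) = map \<kappa> (V # Vs)" if "is_chain \<pi> V Vs" "V \<in> \<pi>" for \<pi> \<kappa> V Vs
    by (rule map_restrict) (use is_chain_subset[OF that(1)] that(2) in simp)
  have iff: "\<kappa> \<in> weak_colorings N T (\<pi>\<^sub>1 \<union> \<pi>\<^sub>2) \<longleftrightarrow> \<kappa> \<in> extensional (\<pi>\<^sub>1 \<union> \<pi>\<^sub>2) \<and>
    restrict \<kappa> \<pi>\<^sub>1 \<in> weak_colorings N T \<pi>\<^sub>1 \<and> restrict \<kappa> \<pi>\<^sub>2 \<in> weak_colorings N T \<pi>\<^sub>2" for \<kappa>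
  proof (intro iffI conjI)
    assume *: "\<kappa> \<in> weak_colorings N T (\<pi>\<^sub>1 \<union> \<pi>\<^sub>2)"
    note PiE = weak_coloringsD(2)[OF *]
    show "\<kappa> \<in> extensional (\<pi>\<^sub>1 \<union> \<pi>\<^sub>2)" using PiE by (simp add: PiE_iff)
    show "restrict \<kappa> \<pi>\<^sub>1 \<in> weak_colorings N T \<pi>\<^sub>1"
    proof (rule weak_coloringsI)
      show "remdups_adj (map (restrict \<kappa> \<pi>\<^sub>1) (V # Vs)) \<in> T" if "V \<in> \<pi>\<^sub>1" "is_chain \<pi>\<^sub>1 V Vs" for V Vs
        unfolding m[OF that(2,1)] by (rule weak_coloringsD(1)[OF *]) (use that ch1 in auto)
    qed (use PiE in \<open>auto simp: PiE_iff\<close>)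
    show "restrict \<kappa> \<pi>\<^sub>2 \<in> weak_colorings N T \<pi>\<^sub>2"
    proof (rule weak_coloringsI)
      show "remdups_adj (map (restrict \<kappa> \<pi>\<^sub>2) (V # Vs)) \<in> T" if "V \<in> \<pi>\<^sub>2" "is_chain \<pi>\<^sub>2 V Vs" for V Vs
        unfolding m[OF that(2,1)] by (rule weak_coloringsD(1)[OF *]) (use that ch2 in auto)
    qed (use PiE in \<open>auto simp: PiE_iff\<close>)
  next
    assume *: "\<kappa> \<in> extensional (\<pi>\<^sub>1 \<union> \<pi>\<^sub>2) \<and>
      restrict \<kappa> \<pi>\<^sub>1 \<in> weak_colorings N T \<pi>\<^sub>1 \<and> restrict \<kappa> \<pi>\<^sub>2 \<in> weak_colorings N T \<pi>\<^sub>2"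
    then have k1: "restrict \<kappa> \<pi>\<^sub>1 \<in> weak_colorings N T \<pi>\<^sub>1" and k2: "restrict \<kappa> \<pi>\<^sub>2 \<in> weak_colorings N T \<pi>\<^sub>2"
      by auto
    show "\<kappa> \<in> weak_colorings N T (\<pi>\<^sub>1 \<union> \<pi>\<^sub>2)"
    proof (rule weak_coloringsI)
      show "\<kappa> \<in> \<pi>\<^sub>1 \<union> \<pi>\<^sub>2 \<rightarrow>\<^sub>E {1..N}"
        using * weak_coloringsD(2)[OF k1] weak_coloringsD(2)[OF k2] by (auto simp: PiE_iff)
      fix V Vs assume V: "V \<in> \<pi>\<^sub>1 \<union> \<pi>\<^sub>2" "is_chain (\<pi>\<^sub>1 \<union> \<pi>\<^sub>2) V Vs"
      show "remdups_adj (map \<kappa> (V # Vs)) \<in> T"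
      proof (cases "V \<in> \<pi>\<^sub>1")
        case True
        then have ch: "is_chain \<pi>\<^sub>1 V Vs" using V(2) ch1 by blast
        from weak_coloringsD(1)[OF k1 True ch] show ?thesis unfolding m[OF ch True] .
      next
        case False
        then have "V \<in> \<pi>\<^sub>2" using V(1) by blast
        then have ch: "is_chain \<pi>\<^sub>2 V Vs" using V(2) ch2 by blast
        from weak_coloringsD(1)[OF k2 \<open>V \<in> \<pi>\<^sub>2\<close> ch] show ?thesis unfolding m[OF ch \<open>V \<in> \<pi>\<^sub>2\<close>] .
      qed
    qed
  qed
  let ?g = "\<lambda>(\<kappa>\<^sub>1, \<kappa>\<^sub>2). \<lambda>V\<in>\<pi>\<^sub>1 \<union> \<pi>\<^sub>2. if V \<in> \<pi>\<^sub>1 then \<kappa>\<^sub>1 V else \<kappa>\<^sub>2 V"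
  have r: "restrict (?g (\<kappa>\<^sub>1, \<kappa>\<^sub>2)) \<pi>\<^sub>1 = \<kappa>\<^sub>1 \<and> restrict (?g (\<kappa>\<^sub>1, \<kappa>\<^sub>2)) \<pi>\<^sub>2 = \<kappa>\<^sub>2"
    if "\<kappa>\<^sub>1 \<in> weak_colorings N T \<pi>\<^sub>1" "\<kappa>\<^sub>2 \<in> weak_colorings N T \<pi>\<^sub>2" for \<kappa>\<^sub>1 \<kappa>\<^sub>2
    using that dis by (auto simp: weak_colorings_def PiE_iff extensional_def restrict_def fun_eq_iff)
  show ?thesis
  proof (rule bij_betwI[where g = ?g])
    show "(\<lambda>\<kappa>. (restrict \<kappa> \<pi>\<^sub>1, restrict \<kappa> \<pi>\<^sub>2)) \<in> weak_colorings N T (\<pi>\<^sub>1 \<union> \<pi>\<^sub>2) \<rightarrow>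
       weak_colorings N T \<pi>\<^sub>1 \<times> weak_colorings N T \<pi>\<^sub>2" using iff by blast
    show "?g \<in> weak_colorings N T \<pi>\<^sub>1 \<times> weak_colorings N T \<pi>\<^sub>2 \<rightarrow> weak_colorings N T (\<pi>\<^sub>1 \<union> \<pi>\<^sub>2)"
    proof
      fix p assume p: "p \<in> weak_colorings N T \<pi>\<^sub>1 \<times> weak_colorings N T \<pi>\<^sub>2"
      obtain \<kappa>\<^sub>1 \<kappa>\<^sub>2 where [simp]: "p = (\<kappa>\<^sub>1, \<kappa>\<^sub>2)" by fastforce
      have k: "\<kappa>\<^sub>1 \<in> weak_colorings N T \<pi>\<^sub>1" "\<kappa>\<^sub>2 \<in> weak_colorings N T \<pi>\<^sub>2" using p by auto
      show "?g p \<in> weak_colorings N T (\<pi>\<^sub>1 \<union> \<pi>\<^sub>2)"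
        unfolding iff \<open>p = _\<close> r[OF k, THEN conjunct1] r[OF k, THEN conjunct2] using k by auto
    qed
    show "?g (restrict \<kappa> \<pi>\<^sub>1, restrict \<kappa> \<pi>\<^sub>2) = \<kappa>" if "\<kappa> \<in> weak_colorings N T (\<pi>\<^sub>1 \<union> \<pi>\<^sub>2)" for \<kappa>
      using that by (auto simp: iff extensional_def fun_eq_iff)
    show "(restrict (?g \<kappa>) \<pi>\<^sub>1, restrict (?g \<kappa>) \<pi>\<^sub>2) = \<kappa>"
      if "\<kappa> \<in> weak_colorings N T \<pi>\<^sub>1 \<times> weak_colorings N T \<pi>\<^sub>2" for \<kappa>
      using that r by (cases \<kappa>) auto
  qed
qed

lemma tree_coeff_eq:
  assumes "root_degree N T \<ge> 2" "nc_part \<pi>"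
  shows "tree_coeff N T \<pi> = (\<Sum>\<kappa>\<in>weak_colorings N T \<pi>. \<Prod>\<pi>'\<in>color_components \<pi> \<kappa>. tree_coeff N T \<pi>')
               / real (root_degree N T) ^ card \<pi>"
  using tree_coefficients_tree_coeff[OF assms(1)] assms(2)
  unfolding tree_coefficients_def nc_part_def by blast

lemma tree_coeff_single:
  assumes "root_degree N T \<ge> 2" "nc_part {V}"
  shows "tree_coeff N T {V} = 1"
proof -
  have "card {V} = 1" by simp
  then show ?thesis using tree_coefficients_tree_coeff[OF assms(1)] assms(2)
    unfolding tree_coefficients_def nc_part_def by blast
qed

lemma color_components_finite: "finite \<pi> \<Longrightarrow> finite (color_components \<pi> \<kappa>)"
  by (simp add: color_components_def)

lemma color_components_nonempty: "\<pi>' \<in> color_components \<pi> \<kappa> \<Longrightarrow> \<pi>' \<noteq> {}"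
  by (auto simp: color_components_def)

text \<open>The recursion is applied once to the union and once to each part: colorings form a
  product, components form a disjoint union, and the powers of n multiply. The components on both
  sides are literally the same sets, so no induction is involved.\<close>

lemma tree_coeff_Un:
  assumes n: "root_degree N T \<ge> 2" and nc: "nc_part (\<pi>\<^sub>1 \<union> \<pi>\<^sub>2)" and dis: "\<pi>\<^sub>1 \<inter> \<pi>\<^sub>2 = {}"
    and sep: "\<And>V W. V \<in> \<pi>\<^sub>1 \<Longrightarrow> W \<in> \<pi>\<^sub>2 \<Longrightarrow> \<not> encloses V W \<and> \<not> encloses W V"
  shows "tree_coeff N T (\<pi>\<^sub>1 \<union> \<pi>\<^sub>2) = tree_coeff N T \<pi>\<^sub>1 * tree_coeff N T \<pi>\<^sub>2"
proof -
  have nc1: "nc_part \<pi>\<^sub>1" and nc2: "nc_part \<pi>\<^sub>2" using nc nc_part_subset by auto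
  note fin = nc_part_finite[OF nc1] nc_part_finite[OF nc2]
  let ?\<alpha> = "tree_coeff N T" and ?n = "real (root_degree N T)"
  let ?p = "\<lambda>\<pi> \<kappa>. \<Prod>\<pi>'\<in>color_components \<pi> \<kappa>. ?\<alpha> \<pi>'"
  have p: "?p (\<pi>\<^sub>1 \<union> \<pi>\<^sub>2) \<kappa> = ?p \<pi>\<^sub>1 (restrict \<kappa> \<pi>\<^sub>1) * ?p \<pi>\<^sub>2 (restrict \<kappa> \<pi>\<^sub>2)" for \<kappa>
  proof -
    have "color_components \<pi>\<^sub>1 \<kappa> \<inter> color_components \<pi>\<^sub>2 \<kappa> = {}"
      using color_components_le color_components_nonempty dis by blast
    moreover have "color_components (\<pi>\<^sub>1 \<union> \<pi>\<^sub>2) \<kappa> = color_components \<pi>\<^sub>1 \<kappa> \<union> color_components \<pi>\<^sub>2 \<kappa>"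
      by (rule color_components_Un[OF dis]) (rule sep)
    ultimately have "?p (\<pi>\<^sub>1 \<union> \<pi>\<^sub>2) \<kappa> = ?p \<pi>\<^sub>1 \<kappa> * ?p \<pi>\<^sub>2 \<kappa>"
      using prod.union_disjoint[OF color_components_finite color_components_finite, OF fin] by simp
    moreover have "color_components \<pi>\<^sub>1 (restrict \<kappa> \<pi>\<^sub>1) = color_components \<pi>\<^sub>1 \<kappa>"
      "color_components \<pi>\<^sub>2 (restrict \<kappa> \<pi>\<^sub>2) = color_components \<pi>\<^sub>2 \<kappa>"
      by (simp_all cong: color_components_cong)
    ultimately show ?thesis by simp
  qed
  have bij: "bij_betw (\<lambda>\<kappa>. (restrict \<kappa> \<pi>\<^sub>1, restrict \<kappa> \<pi>\<^sub>2)) (weak_colorings N T (\<pi>\<^sub>1 \<union> \<pi>\<^sub>2))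
     (weak_colorings N T \<pi>\<^sub>1 \<times> weak_colorings N T \<pi>\<^sub>2)"
    by (rule weak_colorings_Un[OF dis]) (rule sep)
  have "(\<Sum>\<kappa>\<in>weak_colorings N T (\<pi>\<^sub>1 \<union> \<pi>\<^sub>2). ?p (\<pi>\<^sub>1 \<union> \<pi>\<^sub>2) \<kappa>)
    = (\<Sum>(\<kappa>\<^sub>1, \<kappa>\<^sub>2)\<in>weak_colorings N T \<pi>\<^sub>1 \<times> weak_colorings N T \<pi>\<^sub>2. ?p \<pi>\<^sub>1 \<kappa>\<^sub>1 * ?p \<pi>\<^sub>2 \<kappa>\<^sub>2)"
    unfolding sum.reindex_bij_betw[OF bij, symmetric] p by simp
  also have "\<dots> = (\<Sum>\<kappa>\<in>weak_colorings N T \<pi>\<^sub>1. ?p \<pi>\<^sub>1 \<kappa>) * (\<Sum>\<kappa>\<in>weak_colorings N T \<pi>\<^sub>2. ?p \<pi>\<^sub>2 \<kappa>)"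
    by (simp add: sum_product sum.cartesian_product)
  finally show ?thesis
    unfolding tree_coeff_eq[OF n nc] tree_coeff_eq[OF n nc1] tree_coeff_eq[OF n nc2]
      card_Un_disjoint[OF fin dis] by (simp add: power_add)
qed

section \<open>Boolean cumulants\<close>

lemma sorted_list_of_set_strict_mono:
  assumes "strict_mono f" "finite A"
  shows "sorted_list_of_set (f ` A) = map f (sorted_list_of_set A)"
proof (rule strict_sorted_equal)
  show "sorted_wrt (<) (map f (sorted_list_of_set A))"
    unfolding sorted_wrt_map strict_mono_less[OF assms(1)] by simp
qed (use assms in auto)

lemma sorted_list_of_set_insert_Min:
  assumes "finite A" "\<And>x. x \<in> A \<Longrightarrow> m < x"
  shows "sorted_list_of_set (insert m A) = m # sorted_list_of_set A"
proof -
  have "Min (insert m A) = m" using assms by (intro Min_eqI) (auto intro: less_imp_le)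
  moreover have "insert m A - {m} = A" using assms(2) by blast
  ultimately show ?thesis using sorted_list_of_set_nonempty[of "insert m A"] assms(1) by simp
qed

text \<open>The relabelling lemmas want a map that is strictly increasing on all naturals. Its value
  at 0 is 0, which must stay below the first element of \<open>S\<close>, whence
  \<open>0 \<notin> S\<close>; beyond \<open>card S\<close> the values continue above
  \<open>Max (insert 0 S)\<close>.\<close>

lemma exists_strict_mono_enum:
  fixes S :: "nat set"
  assumes "finite S" "0 \<notin> S"
  shows "\<exists>f. strict_mono f \<and> f ` {1..card S} = S"
proof -
  let ?l = "sorted_list_of_set S"
  define f where "f i = (if i = 0 then 0 else if i \<le> card S then ?l ! (i - 1) else Max (insert 0 S) + i)" for i
  have len: "length ?l = card S" by simp
  have nth: "?l ! i \<in> S" if "i < card S" for i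
    using that len assms(1) by (metis nth_mem set_sorted_list_of_set)
  have srt: "?l ! i < ?l ! j" if "i < j" "j < card S" for i j
    using that len by (metis sorted_wrt_nth_less strict_sorted_list_of_set)
  have "f i < f (Suc i)" for i
  proof -
    consider "i = 0" "card S = 0" | "i = 0" "card S > 0" | "i > 0" "Suc i \<le> card S"
      | "i > 0" "i = card S" | "i > card S" by linarith
    then show ?thesis
    proof cases
      case 2
      then have "?l ! 0 \<in> S" by (intro nth) simp
      then have "?l ! 0 \<noteq> 0" using assms(2) by metis
      then show ?thesis using 2 by (simp add: f_def)
    next
      case 3
      then show ?thesis using srt[of "i - 1" i] by (simp add: f_def)
    next
      case 4
      then have "?l ! (i - 1) \<in> S" by (intro nth) simp
      then have "?l ! (i - 1) \<le> Max (insert 0 S)" using assms(1) by simp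
      then show ?thesis using 4 by (simp add: f_def)
    qed (auto simp: f_def)
  qed
  then have "strict_mono f" by (simp add: strict_mono_Suc_iff)
  moreover have "f ` {1..card S} = S"
  proof -
    have "f ` {1..card S} = f ` Suc ` {..<card S}"
      by (simp add: image_Suc_lessThan)
    also have "\<dots> = (!) ?l ` {..<length ?l}"
      unfolding image_image len by (rule image_cong) (auto simp: f_def)
    also have "\<dots> = set ?l" by (auto simp: set_conv_nth)
    finally show ?thesis using assms(1) by simp
  qed
  ultimately show ?thesis by blast
qed

lemma nc_part_relabelD:
  assumes mono: "strict_mono f" and nc: "nc_part (image f ` \<pi>)"
  shows "nc_part \<pi>"
proof -
  have inj: "inj f" using mono by (rule strict_mono_imp_inj_on)
  have lt: "f x < f y \<longleftrightarrow> x < y" for x y using mono by (rule strict_mono_less)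
  have eq: "V = W" if "f ` V = f ` W" for V W using that inj by (simp add: inj_image_eq_iff)
  have "V = W" if "V \<in> \<pi>" "W \<in> \<pi>" "a \<in> V" "b \<in> W" "c \<in> V" "d \<in> W" "a < b" "b < c" "c < d" for V W a b c d
    by (rule eq, rule nc_part_crossing[OF nc, of _ _ "f a" "f b" "f c" "f d"]) (use that lt in auto)
  then have "noncrossing \<pi>" unfolding noncrossing_def by blast
  moreover have "V = W" if "V \<in> \<pi>" "W \<in> \<pi>" "x \<in> V" "x \<in> W" for V W x
    by (rule eq, rule nc_part_disjoint[OF nc, of _ _ "f x"]) (use that in auto)
  then have "disjoint \<pi>" unfolding disjoint_def by blast
  moreover have "finite (\<Union>\<pi>)"
    using nc_part_finite_Union[OF nc] inj unfolding Union_relabel[OF mono]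
    by (meson finite_imageD inj_on_subset subset_UNIV)
  moreover have "{} \<notin> \<pi>" using nc_part_nonempty[OF nc] by blast
  ultimately show ?thesis unfolding nc_part_iff by blast
qed

lemma NC_relabel:
  assumes mono: "strict_mono f" and fin: "finite S"
  shows "bij_betw (image (image f)) (NC S) (NC (f ` S))"
proof -
  have inj: "inj f" using mono by (rule strict_mono_imp_inj_on)
  have injF: "inj (image f)" by (rule injI) (simp only: inj_image_eq_iff[OF inj])
  have "inj_on (image (image f)) (NC S)"
    by (rule inj_onI) (simp only: inj_image_eq_iff[OF injF])
  moreover have "image (image f) ` NC S = NC (f ` S)"
  proof
    show "image (image f) ` NC S \<subseteq> NC (f ` S)"
    proof
      fix \<rho> assume "\<rho> \<in> image (image f) ` NC S"
      then obtain \<pi> where \<rho>: "\<rho> = image f ` \<pi>" and \<pi>: "\<pi> \<in> NC S" by blast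
      then have "nc_part \<pi>" "\<Union>\<pi> = S" using nc_part_NC[OF fin] by auto
      then show "\<rho> \<in> NC (f ` S)"
        unfolding \<rho> nc_part_NC[OF finite_imageI[OF fin]] Union_relabel[OF mono]
        using nc_part_relabel[OF mono] by blast
    qed
    show "NC (f ` S) \<subseteq> image (image f) ` NC S"
    proof
      fix \<rho> assume "\<rho> \<in> NC (f ` S)"
      then have \<rho>: "nc_part \<rho>" "\<Union>\<rho> = f ` S" using nc_part_NC[OF finite_imageI[OF fin]] by auto
      define \<pi> where "\<pi> = vimage f ` \<rho>"
      have "f ` (f -` V) = V" if "V \<in> \<rho>" for V
      proof -
        have "V \<subseteq> f ` S" using that \<rho>(2) by (metis Union_upper)
        then show ?thesis unfolding image_vimage_eq by auto
      qed
      then have eq: "image f ` \<pi> = \<rho>" unfolding \<pi>_def image_image by simp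
      have "nc_part \<pi>" using nc_part_relabelD[OF mono] \<rho>(1) eq by metis
      moreover have "\<Union>\<pi> = S"
        using \<rho>(2) unfolding eq[symmetric] Union_relabel[OF mono] by (simp only: inj_image_eq_iff[OF inj])
      ultimately show "\<rho> \<in> image (image f) ` NC S" using eq nc_part_NC[OF fin] by blast
    qed
  qed
  ultimately show ?thesis unfolding bij_betw_def ..
qed

text \<open>The irreducible non-crossing partitions: when the first and last points share a block,
  every other block is nested in it, so there is exactly one outer block. For empty \<open>S\<close>
  there are none.\<close>

definition NC_irr :: "nat set \<Rightarrow> nat set set set" where
  "NC_irr S = {\<pi> \<in> NC S. \<exists>W\<in>\<pi>. Min S \<in> W \<and> Max S \<in> W}"

lemma finite_NC: "finite S \<Longrightarrow> finite (NC S)"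
  by (rule finite_subset[of _ "Pow (Pow S)"]) (auto simp: NC_def partition_on_def)

lemma finite_NC_irr: "finite S \<Longrightarrow> finite (NC_irr S)"
  using finite_NC unfolding NC_irr_def by simp

lemma NC_append:
  assumes "finite S\<^sub>1" "finite S\<^sub>2" and less: "\<And>x y. x \<in> S\<^sub>1 \<Longrightarrow> y \<in> S\<^sub>2 \<Longrightarrow> x < y"
    and "\<tau> \<in> NC S\<^sub>1" "\<rho> \<in> NC S\<^sub>2"
  shows "\<tau> \<union> \<rho> \<in> NC (S\<^sub>1 \<union> S\<^sub>2)" "\<tau> \<inter> \<rho> = {}"
    "V \<in> \<tau> \<Longrightarrow> W \<in> \<rho> \<Longrightarrow> \<not> encloses V W \<and> \<not> encloses W V"
proof -
  have \<tau>: "nc_part \<tau>" "\<Union>\<tau> = S\<^sub>1" and \<rho>: "nc_part \<rho>" "\<Union>\<rho> = S\<^sub>2"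
    using assms(4,5) nc_part_NC[OF assms(1)] nc_part_NC[OF assms(2)] by auto
  have lt: "x < y" if "V \<in> \<tau>" "W \<in> \<rho>" "x \<in> V" "y \<in> W" for V W x y
    using that \<tau>(2) \<rho>(2) by (intro less) auto
  have "V = W" if VW: "V \<in> \<tau> \<union> \<rho>" "W \<in> \<tau> \<union> \<rho>" "a \<in> V" "b \<in> W" "c \<in> V" "d \<in> W" "a < b" "b < c" "c < d" for V W a b c d
  proof -
    consider "V \<in> \<tau>" "W \<in> \<tau>" | "V \<in> \<rho>" "W \<in> \<rho>" | "V \<in> \<tau>" "W \<in> \<rho>" | "V \<in> \<rho>" "W \<in> \<tau>"
      using VW(1,2) by blast
    then show ?thesis
    proof cases
      case 1 then show ?thesis using nc_part_crossing[OF \<tau>(1)] VW by blast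
    next
      case 2 then show ?thesis using nc_part_crossing[OF \<rho>(1)] VW by blast
    next
      case 3 then show ?thesis using lt[OF 3 \<open>c \<in> V\<close> \<open>b \<in> W\<close>] VW by simp
    next
      case 4 then show ?thesis using lt[OF 4(2,1) \<open>b \<in> W\<close> \<open>a \<in> V\<close>] VW by simp
    qed
  qed
  then have "noncrossing (\<tau> \<union> \<rho>)" unfolding noncrossing_def by blast
  moreover have "V = W" if VW: "V \<in> \<tau> \<union> \<rho>" "W \<in> \<tau> \<union> \<rho>" "x \<in> V" "x \<in> W" for V W x
  proof -
    consider "V \<in> \<tau>" "W \<in> \<tau>" | "V \<in> \<rho>" "W \<in> \<rho>" | "V \<in> \<tau>" "W \<in> \<rho>" | "V \<in> \<rho>" "W \<in> \<tau>"
      using VW(1,2) by blast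
    then show ?thesis
    proof cases
      case 1 then show ?thesis using nc_part_disjoint[OF \<tau>(1)] VW by blast
    next
      case 2 then show ?thesis using nc_part_disjoint[OF \<rho>(1)] VW by blast
    next
      case 3 then show ?thesis using lt[OF 3 VW(3,4)] by simp
    next
      case 4 then show ?thesis using lt[OF 4(2,1) VW(4,3)] by simp
    qed
  qed
  then have "disjoint (\<tau> \<union> \<rho>)" unfolding disjoint_def by blast
  ultimately have "nc_part (\<tau> \<union> \<rho>)"
    using nc_part_nonempty[OF \<tau>(1)] nc_part_nonempty[OF \<rho>(1)] \<tau>(2) \<rho>(2) assms(1,2)
    unfolding nc_part_iff by auto
  moreover have "\<Union>(\<tau> \<union> \<rho>) = S\<^sub>1 \<union> S\<^sub>2" using \<tau>(2) \<rho>(2) by auto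
  ultimately show "\<tau> \<union> \<rho> \<in> NC (S\<^sub>1 \<union> S\<^sub>2)"
    using nc_part_NC[of "S\<^sub>1 \<union> S\<^sub>2"] assms(1,2) by blast
  show "\<tau> \<inter> \<rho> = {}"
  proof (rule ccontr)
    assume "\<tau> \<inter> \<rho> \<noteq> {}"
    then obtain V where V: "V \<in> \<tau>" "V \<in> \<rho>" by blast
    then obtain x where "x \<in> V" using nc_part_nonempty[OF \<tau>(1)] by blast
    then show False using lt[OF V] by blast
  qed
  show "\<not> encloses V W \<and> \<not> encloses W V" if VW: "V \<in> \<tau>" "W \<in> \<rho>"
  proof -
    obtain x y where xy: "x \<in> V" "y \<in> W"
      using VW nc_part_nonempty[OF \<tau>(1)] nc_part_nonempty[OF \<rho>(1)] by blast
    have l: "v < w" if "v \<in> V" "w \<in> W" for v w by (rule lt[OF VW that])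
    have "\<not> encloses V W"
    proof
      assume "encloses V W"
      then obtain k where "k \<in> V" "\<forall>w\<in>W. w < k" unfolding encloses_def by blast
      then show False using l[OF _ xy(2), of k] xy(2) by (meson less_asym)
    qed
    moreover have "\<not> encloses W V"
    proof
      assume "encloses W V"
      then obtain j where "j \<in> W" "\<forall>v\<in>V. j < v" unfolding encloses_def by blast
      then show False using l[OF xy(1), of j] xy(1) by (meson less_asym)
    qed
    ultimately show ?thesis by blast
  qed
qed

text \<open>Here \<open>k\<close> is the last point of the block of \<open>Min S\<close>: what lies
  up to \<open>k\<close> is irreducible, and what lies beyond is arbitrary. This is the
  combinatorial counterpart of the recursion expressing moments through Boolean cumulants.\<close>

lemma sum_NC_first_component:
  fixes g :: "nat set set \<Rightarrow> 'c::comm_monoid_add"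
  assumes fin: "finite S" and ne: "S \<noteq> {}"
  shows "sum g (NC S) = (\<Sum>k\<in>S. \<Sum>\<tau>\<in>NC_irr (S \<inter> {..k}). \<Sum>\<rho>\<in>NC (S \<inter> {k<..}). g (\<tau> \<union> \<rho>))"
proof -
  define B where "B \<pi> = (THE W. W \<in> \<pi> \<and> Min S \<in> W)" for \<pi>
  have mS: "Min S \<in> S" and mle: "\<And>x. x \<in> S \<Longrightarrow> Min S \<le> x" using fin ne by auto
  have B: "B \<pi> = W" if "nc_part \<pi>" "W \<in> \<pi>" "Min S \<in> W" for \<pi> W
    unfolding B_def by (rule the_equality) (use that nc_part_disjoint[OF that(1)] in auto)
  let ?lo = "\<lambda>k. S \<inter> {..k}" and ?hi = "\<lambda>k. S \<inter> {k<..}"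
  have split: "?lo k \<union> ?hi k = S" for k by auto
  let ?X = "SIGMA k:S. NC_irr (?lo k) \<times> NC (?hi k)"
  have "sum g (NC S) = (\<Sum>(k, \<tau>, \<rho>)\<in>?X. g (\<tau> \<union> \<rho>))"
  proof (rule sum.reindex_bij_witness[where j = "\<lambda>\<pi>. (Max (B \<pi>), {U\<in>\<pi>. U \<subseteq> {..Max (B \<pi>)}}, {U\<in>\<pi>. U \<subseteq> {Max (B \<pi>)<..}})"
        and i = "\<lambda>(k, \<tau>, \<rho>). \<tau> \<union> \<rho>"])
    fix \<pi> assume "\<pi> \<in> NC S"
    then have nc: "nc_part \<pi>" and U: "\<Union>\<pi> = S" using nc_part_NC[OF fin] by auto
    obtain W where W: "W \<in> \<pi>" "Min S \<in> W" using mS U by blast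
    have BW: "B \<pi> = W" by (rule B[OF nc W])
    have finW: "finite W" using nc W nc_part_finite_block by blast
    define k where "k = Max W"
    have kW: "k \<in> W" unfolding k_def using finW W by (intro Max_in) auto
    have kS: "k \<in> S" using kW W U by blast
    \<comment> \<open>A block with points on both sides of \<open>k\<close> would cross the block
      \<open>W\<close>, which contains both \<open>Min S\<close> and \<open>k\<close>.\<close>
    have cases: "V \<subseteq> {..k} \<or> V \<subseteq> {k<..}" if V: "V \<in> \<pi>" for V
    proof (rule ccontr)
      assume "\<not> ?thesis"
      then obtain u v where uv: "u \<in> V" "v \<in> V" "u \<le> k" "k < v" by (auto simp: subset_iff not_le)
      have "V \<noteq> W" using uv(2,4) Max_ge[OF finW, of v] unfolding k_def by (auto simp: not_le[symmetric])
      then have "u \<noteq> k" "u \<noteq> Min S" using nc_part_disjoint[OF nc V W(1)] uv(1) kW W(2) by blast+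
      moreover have "Min S \<le> u" using mle uv(1) V U by blast
      ultimately have "W = V" using nc_part_crossing[OF nc W(1) V W(2) uv(1) kW uv(2)] uv by simp
      then show False using \<open>V \<noteq> W\<close> by simp
    qed
    have un: "{U\<in>\<pi>. U \<subseteq> {..k}} \<union> {U\<in>\<pi>. U \<subseteq> {k<..}} = \<pi>" using cases by blast
    then show "(case (Max (B \<pi>), {U\<in>\<pi>. U \<subseteq> {..Max (B \<pi>)}}, {U\<in>\<pi>. U \<subseteq> {Max (B \<pi>)<..}}) of (k, \<tau>, \<rho>) \<Rightarrow> \<tau> \<union> \<rho>) = \<pi>"
      unfolding BW k_def by simp
    show "(case (Max (B \<pi>), {U\<in>\<pi>. U \<subseteq> {..Max (B \<pi>)}}, {U\<in>\<pi>. U \<subseteq> {Max (B \<pi>)<..}}) of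
        (k, \<tau>, \<rho>) \<Rightarrow> g (\<tau> \<union> \<rho>)) = g \<pi>"
      using un unfolding BW k_def by simp
    have lo: "\<Union>{U\<in>\<pi>. U \<subseteq> {..k}} = ?lo k"
    proof
      show "?lo k \<subseteq> \<Union>{U\<in>\<pi>. U \<subseteq> {..k}}"
      proof
        fix x assume x: "x \<in> ?lo k"
        then obtain V where V: "V \<in> \<pi>" "x \<in> V" using U by blast
        then have "V \<subseteq> {..k}" using cases[OF V(1)] x by auto
        then show "x \<in> \<Union>{U\<in>\<pi>. U \<subseteq> {..k}}" using V by blast
      qed
    qed (use U in auto)
    have hi: "\<Union>{U\<in>\<pi>. U \<subseteq> {k<..}} = ?hi k"
    proof
      show "?hi k \<subseteq> \<Union>{U\<in>\<pi>. U \<subseteq> {k<..}}"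
      proof
        fix x assume x: "x \<in> ?hi k"
        then obtain V where V: "V \<in> \<pi>" "x \<in> V" using U by blast
        then have "V \<subseteq> {k<..}" using cases[OF V(1)] x by auto
        then show "x \<in> \<Union>{U\<in>\<pi>. U \<subseteq> {k<..}}" using V by blast
      qed
    qed (use U in auto)
    have nclo: "nc_part {U\<in>\<pi>. U \<subseteq> {..k}}" and nchi: "nc_part {U\<in>\<pi>. U \<subseteq> {k<..}}"
      using nc by (auto intro: nc_part_subset)
    have "Min (?lo k) = Min S" "Max (?lo k) = k"
      using kS mS mle fin by (auto intro!: Min_eqI Max_eqI)
    moreover have "W \<in> {U\<in>\<pi>. U \<subseteq> {..k}}" using W finW unfolding k_def by auto
    moreover have "{U\<in>\<pi>. U \<subseteq> {..k}} \<in> NC (?lo k)" using nc_part_NC[of "?lo k"] nclo lo fin by simp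
    ultimately have "{U\<in>\<pi>. U \<subseteq> {..k}} \<in> NC_irr (?lo k)"
      unfolding NC_irr_def using W kW by auto
    moreover have "{U\<in>\<pi>. U \<subseteq> {k<..}} \<in> NC (?hi k)" using nc_part_NC[of "?hi k"] nchi hi fin by simp
    ultimately show "(Max (B \<pi>), {U\<in>\<pi>. U \<subseteq> {..Max (B \<pi>)}}, {U\<in>\<pi>. U \<subseteq> {Max (B \<pi>)<..}}) \<in> ?X"
      unfolding BW k_def[symmetric] using kS by blast
  next
    fix p assume p: "p \<in> ?X"
    obtain k \<tau> \<rho> where p_eq: "p = (k, \<tau>, \<rho>)" by (cases p) auto
    have k: "k \<in> S" and irr: "\<tau> \<in> NC_irr (?lo k)" and \<rho>: "\<rho> \<in> NC (?hi k)" using p unfolding p_eq by auto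
    have \<tau>: "\<tau> \<in> NC (?lo k)" using irr by (simp add: NC_irr_def)
    have "\<tau> \<union> \<rho> \<in> NC (?lo k \<union> ?hi k)"
      by (rule NC_append(1)[OF _ _ _ \<tau> \<rho>]) (use fin in auto)
    then have mem: "\<tau> \<union> \<rho> \<in> NC S" unfolding split .
    then show "(case p of (k, \<tau>, \<rho>) \<Rightarrow> \<tau> \<union> \<rho>) \<in> NC S" unfolding p_eq by simp
    have nc: "nc_part (\<tau> \<union> \<rho>)" using mem nc_part_NC[OF fin] by blast
    have nct: "nc_part \<tau>" "\<Union>\<tau> = ?lo k" "nc_part \<rho>" "\<Union>\<rho> = ?hi k"
      using \<tau> \<rho> nc_part_NC fin by auto
    have MM: "Min (?lo k) = Min S" "Max (?lo k) = k"
      using k mS mle fin by (auto intro!: Min_eqI Max_eqI)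
    obtain W where W: "W \<in> \<tau>" "Min S \<in> W" "k \<in> W" using irr MM unfolding NC_irr_def by auto
    have BW: "B (\<tau> \<union> \<rho>) = W" by (rule B[OF nc]) (use W in auto)
    have "Max W = k"
      by (rule Max_eqI) (use W nct(2) nc_part_finite_block[OF nct(1)] in auto)
    then have MB: "Max (B (\<tau> \<union> \<rho>)) = k" unfolding BW .
    have t: "V \<subseteq> {..k}" "\<not> V \<subseteq> {k<..}" if "V \<in> \<tau>" for V
    proof -
      show "V \<subseteq> {..k}" using that nct(2) by blast
      then show "\<not> V \<subseteq> {k<..}" using nc_part_nonempty[OF nct(1) that] by fastforce
    qed
    have r: "V \<subseteq> {k<..}" "\<not> V \<subseteq> {..k}" if "V \<in> \<rho>" for V
    proof -
      show "V \<subseteq> {k<..}" using that nct(4) by blast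
      then show "\<not> V \<subseteq> {..k}" using nc_part_nonempty[OF nct(3) that] by fastforce
    qed
    have "U \<in> \<tau> \<union> \<rho> \<and> U \<subseteq> {..k} \<longleftrightarrow> U \<in> \<tau>" "U \<in> \<tau> \<union> \<rho> \<and> U \<subseteq> {k<..} \<longleftrightarrow> U \<in> \<rho>" for U
      using t[of U] r[of U] by blast+
    then have "{U \<in> \<tau> \<union> \<rho>. U \<subseteq> {..k}} = \<tau>" "{U \<in> \<tau> \<union> \<rho>. U \<subseteq> {k<..}} = \<rho>" by simp_all
    then show "(Max (B (case p of (k, \<tau>, \<rho>) \<Rightarrow> \<tau> \<union> \<rho>)),
        {U \<in> case p of (k, \<tau>, \<rho>) \<Rightarrow> \<tau> \<union> \<rho>. U \<subseteq> {..Max (B (case p of (k, \<tau>, \<rho>) \<Rightarrow> \<tau> \<union> \<rho>))}},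
        {U \<in> case p of (k, \<tau>, \<rho>) \<Rightarrow> \<tau> \<union> \<rho>. U \<subseteq> {Max (B (case p of (k, \<tau>, \<rho>) \<Rightarrow> \<tau> \<union> \<rho>))<..}}) = p"
      unfolding p_eq prod.case MB by simp
  qed
  also have "\<dots> = (\<Sum>k\<in>S. \<Sum>(\<tau>, \<rho>)\<in>NC_irr (?lo k) \<times> NC (?hi k). g (\<tau> \<union> \<rho>))"
    by (subst sum.Sigma) (use fin in \<open>auto simp: finite_NC finite_NC_irr split_def\<close>)
  also have "\<dots> = (\<Sum>k\<in>S. \<Sum>\<tau>\<in>NC_irr (?lo k). \<Sum>\<rho>\<in>NC (?hi k). g (\<tau> \<union> \<rho>))"
    by (simp add: sum.cartesian_product)
  finally show ?thesis .
qed

lemma Min_image_strict_mono: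
  fixes f :: "nat \<Rightarrow> nat"
  assumes "strict_mono f" "finite A" "A \<noteq> {}"
  shows "Min (f ` A) = f (Min A)"
  using mono_Min_commute[OF strict_mono_mono[OF assms(1)] assms(2,3)] by simp

context bvalued_prob_space
begin

text \<open>The interval block chosen for the image need not be the image of the one chosen for
  \<open>\<pi>\<close>; the freedom of \<open>part_eval_absorb\<close> allows corresponding blocks
  to be removed.\<close>

lemma part_eval_relabel:
  assumes lin: "left_multilinear \<Lambda>" and mono: "strict_mono f" and "nc_part \<pi>"
  shows "part_eval \<Lambda> (image f ` \<pi>) a = part_eval \<Lambda> \<pi> (a \<circ> f)"
  using assms(3)
proof (induction "card \<pi>" arbitrary: \<pi> a rule: less_induct)
  case less
  note nc = less.prems
  have inj: "inj f" using mono by (rule strict_mono_imp_inj_on)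
  have lt: "f x < f y \<longleftrightarrow> x < y" for x y using mono by (rule strict_mono_less)
  show ?case
  proof (cases "\<pi> = {}")
    case False
    define V where "V = first_block \<pi>"
    have V: "interval_block \<pi> V" unfolding V_def by (rule interval_first_block[OF nc False])
    have V\<pi>: "V \<in> \<pi>" using V by (simp add: interval_block_def)
    have finV: "finite V" using nc V\<pi> nc_part_finite_block by blast
    have U: "\<Union>(image f ` \<pi>) = f ` \<Union>\<pi>" by (rule Union_relabel[OF mono])
    have fV: "interval_block (image f ` \<pi>) (f ` V)"
      unfolding interval_block_def U
    proof (intro conjI ballI impI)
      show "f ` V \<in> image f ` \<pi>" using V\<pi> by blast
      fix x j k assume *: "x \<in> f ` \<Union>\<pi>" "j \<in> f ` V" "k \<in> f ` V" "j < x \<and> x < k"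
      then obtain x' j' k' where "x = f x'" "x' \<in> \<Union>\<pi>" "j = f j'" "j' \<in> V" "k = f k'" "k' \<in> V" by blast
      then show "x \<in> f ` V" using interval_blockD[OF V, of x' j' k'] * lt by auto
    qed
    have nc': "nc_part (image f ` \<pi>)" by (rule nc_part_relabel[OF mono nc])
    have card: "card (\<pi> - {V}) < card \<pi>"
      using V\<pi> nc_part_finite[OF nc] by (rule card_Diff1_less[rotated])
    have ncd: "nc_part (\<pi> - {V})" using nc by (rule nc_part_subset) auto
    have dif: "image f ` \<pi> - {f ` V} = image f ` (\<pi> - {V})"
      using inj by (auto simp: inj_image_eq_iff)
    have R: "right_of (image f ` \<pi>) (f ` V) = f ` right_of \<pi> V"
      unfolding right_of_def U using lt by auto
    have upd: "(a(f r := x)) \<circ> f = (a \<circ> f)(r := x)" for r x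
      using inj by (auto simp: fun_eq_iff inj_eq)
    show ?thesis
      unfolding part_eval_absorb[OF lin nc V] part_eval_absorb[OF lin nc' fV] absorb_block_def dif less.hyps[OF card ncd] R
        sorted_list_of_set_strict_mono[OF mono finV] map_map Let_def
      using Min_image_strict_mono[OF mono right_of_finite[OF nc]] by (simp add: upd)
  qed (simp add: nested_eval_empty)
qed

section \<open>Moments, Boolean cumulants and their expression by tree cumulants\<close>

definition moment :: "nat set \<Rightarrow> (nat \<Rightarrow> 'a) \<Rightarrow> 'b" where
  "moment S a = E (prod_list (map a (sorted_list_of_set S)))"

text \<open>The defining formula concerns the index sets {1..l}, while the pieces of a decomposed
  index set are arbitrary finite sets of positive integers. Both the coefficients and the
  evaluations are transported along an increasing enumeration.\<close>

lemma moment_cumulant: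
  assumes n: "root_degree N T \<ge> 2" and K: "tree_cumulants N T (type_algebra \<iota> E) K"
    and "finite S" "0 \<notin> S" "S \<noteq> {}"
  shows "moment S a = (\<Sum>\<pi>\<in>NC S. tree_coeff N T \<pi> *\<^sub>R part_eval K \<pi> a)"
proof -
  have lin: "left_multilinear K"
    using K quasi_multilinear_left_multilinear unfolding tree_cumulants_def by blast
  obtain f where f: "strict_mono f" "f ` {1..card S} = S"
    using exists_strict_mono_enum[OF assms(3,4)] by blast
  define l where "l = card S"
  have l: "l > 0" using assms(3,5) unfolding l_def by (simp add: card_gt_0_iff)
  define as where "as = map (a \<circ> f) [1..<Suc l]"
  have len: "length as = l" by (simp add: as_def)
  have as: "as = map a (sorted_list_of_set S)"
  proof -
    have "f ` {1..<Suc l} = S" using f(2) unfolding l_def atLeastLessThanSuc_atLeastAtMost .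
    then have "sorted_list_of_set S = map f [1..<Suc l]"
      using sorted_list_of_set_strict_mono[OF f(1), of "{1..<Suc l}"] by simp
    then show ?thesis by (simp add: as_def)
  qed
  have nth: "as ! (i - 1) = (a \<circ> f) i" if "i \<in> {1..l}" for i
    using that unfolding as_def by (auto simp: nth_append nth_Cons' simp del: upt_Suc)
  have "foldr (*) as 1 = prod_list as" by (induction as) auto
  then have "moment S a = expect (type_algebra \<iota> E) (foldr (mult_alg (type_algebra \<iota> E)) as (one_alg (type_algebra \<iota> E)))"
    unfolding moment_def as[symmetric] by (simp add: type_algebra_def)
  also have "\<dots> = (\<Sum>\<pi>\<in>NC {1..l}. tree_coeff N T \<pi> *\<^sub>R part_eval K \<pi> (\<lambda>i. as ! (i - 1)))"
    using K l len unfolding tree_cumulants_def by (auto simp: type_algebra_def)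
  also have "\<dots> = (\<Sum>\<pi>\<in>NC {1..l}. tree_coeff N T (image f ` \<pi>) *\<^sub>R part_eval K (image f ` \<pi>) a)"
  proof (rule sum.cong[OF refl])
    fix \<pi> assume "\<pi> \<in> NC {1..l}"
    then have nc: "nc_part \<pi>" "\<Union>\<pi> = {1..l}" using nc_part_NC[of "{1..l}"] by auto
    have "part_eval K \<pi> (\<lambda>i. as ! (i - 1)) = part_eval K \<pi> (a \<circ> f)"
      by (rule part_eval_cong[OF nc(1)]) (unfold nc(2), rule nth)
    then show "tree_coeff N T \<pi> *\<^sub>R part_eval K \<pi> (\<lambda>i. as ! (i - 1))
        = tree_coeff N T (image f ` \<pi>) *\<^sub>R part_eval K (image f ` \<pi>) a"
      by (simp add: tree_coeff_relabel[OF f(1) n nc(1)] part_eval_relabel[OF lin f(1) nc(1)])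
  qed
  also have "\<dots> = (\<Sum>\<pi>\<in>NC S. tree_coeff N T \<pi> *\<^sub>R part_eval K \<pi> a)"
    using sum.reindex_bij_betw[OF NC_relabel[OF f(1), of "{1..l}"]] f(2) unfolding l_def by simp
  finally show ?thesis .
qed

definition centre :: "'a \<Rightarrow> 'a" where
  "centre x = x - \<iota> (E x)"

text \<open>The product \<open>x\<^sub>1 Q x\<^sub>2 Q \<cdots> Q x\<^sub>m\<close>, where \<open>Q\<close> is the projection \<open>x \<mapsto> x - E[x]\<close>; its
  expectation is the Boolean cumulant.\<close>

fun centred_prod :: "'a list \<Rightarrow> 'a" where
  "centred_prod [] = 1"
| "centred_prod (x # xs) = (if xs = [] then x else x * centre (centred_prod xs))"

definition boolean_cumulant :: "'a list \<Rightarrow> 'b" where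
  "boolean_cumulant xs = E (centred_prod xs)"

lemma centre_add: "centre (x + y) = centre x + centre y"
  by (simp add: centre_def E_add incl_add)

lemma centre_scaleR: "centre (r *\<^sub>R x) = r *\<^sub>R centre x"
  by (simp add: centre_def E_scaleR incl_scaleR scaleR_right_diff_distrib)

lemma centre_right: "centre (x * \<iota> b) = centre x * \<iota> b"
  by (simp add: centre_def E_right incl_mult left_diff_distrib)

lemma centre_left: "centre (\<iota> b * x) = \<iota> b * centre x"
  by (simp add: centre_def E_left incl_mult right_diff_distrib)

lemma incl_0: "\<iota> 0 = 0"
  using incl_scaleR[of 0 0] by simp

lemma E_diff: "E (x - y) = E x - E y"
  using E_add[of "x - y" y] by simp

lemma E_incl: "E (\<iota> b) = b"
  using E_left[of b 1] E_one by simp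

lemma E_centre: "E (centre x) = 0"
  by (simp add: centre_def E_diff E_incl)

lemma centred_prod_add:
  "centred_prod (us @ (x + y) # vs) = centred_prod (us @ x # vs) + centred_prod (us @ y # vs)"
  by (induction us) (simp_all add: distrib_left distrib_right centre_add)

lemma centred_prod_scaleR:
  "centred_prod (us @ (r *\<^sub>R x) # vs) = r *\<^sub>R centred_prod (us @ x # vs)"
  by (induction us) (simp_all add: centre_scaleR)

lemma centred_prod_incl: "centred_prod (\<iota> b * x # xs) = \<iota> b * centred_prod (x # xs)"
  by (simp add: mult.assoc)

text \<open>At the end of the word this is the splitting of \<open>y\<close> into its centred part
  and its expectation; the second part moves through the centrings because they are right
  \<B>-linear.\<close>

lemma centred_prod_mult:
  "centred_prod (us @ [x * y]) = centred_prod (us @ [x, y]) + centred_prod (us @ [x]) * \<iota> (E y)"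
proof (induction us)
  case Nil
  show ?case by (simp add: centre_def right_diff_distrib)
next
  case (Cons u us)
  then show ?case by (simp add: centre_add centre_right distrib_left mult.assoc)
qed

lemma left_multilinear_boolean: "left_multilinear boolean_cumulant"
  unfolding left_multilinear_def boolean_cumulant_def centred_prod_add centred_prod_scaleR centred_prod_incl
  by (simp add: E_add E_scaleR E_left)

lemma boolean_cumulant_mult:
  "boolean_cumulant (us @ [x * y]) = boolean_cumulant (us @ [x, y]) + boolean_cumulant (us @ [x]) * E y"
  by (simp add: boolean_cumulant_def centred_prod_mult E_add E_right)

text \<open>The prefix \<open>us\<close> is what makes the induction run: the least index is split
  off the product by \<open>boolean_cumulant_mult\<close> and joins the prefix. The summand with the
  expectation is the term where \<open>k\<close> is that least index; the other summand yields the
  terms with larger \<open>k\<close>.\<close>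

lemma boolean_cumulant_prod:
  assumes "finite S" "S \<noteq> {}"
  shows "boolean_cumulant (us @ [prod_list (map a (sorted_list_of_set S))])
    = (\<Sum>k\<in>S. boolean_cumulant (us @ map a (sorted_list_of_set (S \<inter> {..k}))) * moment (S \<inter> {k<..}) a)"
  using assms
proof (induction "card S" arbitrary: S us)
  case 0
  then show ?case by simp
next
  case (Suc n)
  define m where "m = Min S"
  define S' where "S' = S - {m}"
  have m: "m \<in> S" "\<And>x. x \<in> S' \<Longrightarrow> m < x"
    using Suc.prems unfolding m_def S'_def by (auto simp: Min_less_iff le_neq_implies_less)
  have fin': "finite S'" using Suc.prems unfolding S'_def by simp
  have S: "S = insert m S'" and mS': "m \<notin> S'" using m unfolding S'_def by auto
  have sl: "sorted_list_of_set S = m # sorted_list_of_set S'"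
    unfolding S by (rule sorted_list_of_set_insert_Min[OF fin' m(2)])
  have lo: "S \<inter> {..k} = insert m (S' \<inter> {..k})" "S \<inter> {k<..} = S' \<inter> {k<..}" if "k \<in> S'" for k
    using m(2)[OF that] unfolding S by auto
  have lom: "S \<inter> {..m} = {m}" "S \<inter> {m<..} = S'" using m(2) unfolding S by (auto dest: leD)
  have sll: "sorted_list_of_set (S \<inter> {..k}) = m # sorted_list_of_set (S' \<inter> {..k})" if "k \<in> S'" for k
    unfolding lo[OF that] using fin' m(2) by (intro sorted_list_of_set_insert_Min) auto
  show ?case
  proof (cases "S' = {}")
    case True
    then show ?thesis using lom unfolding sl by (simp add: S moment_def E_one)
  next
    case False
    have "n = card S'" using Suc.hyps(2) Suc.prems m(1) by (simp add: S'_def)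
    note IH = Suc.hyps(1)[OF this fin' False, of "us @ [a m]"]
    have "boolean_cumulant (us @ [prod_list (map a (sorted_list_of_set S))])
      = boolean_cumulant ((us @ [a m]) @ [prod_list (map a (sorted_list_of_set S'))])
        + boolean_cumulant (us @ [a m]) * moment S' a"
      unfolding sl by (simp add: boolean_cumulant_mult moment_def)
    also have "\<dots> = (\<Sum>k\<in>S'. boolean_cumulant (us @ map a (sorted_list_of_set (S \<inter> {..k}))) * moment (S \<inter> {k<..}) a)
        + boolean_cumulant (us @ map a (sorted_list_of_set (S \<inter> {..m}))) * moment (S \<inter> {m<..}) a"
      unfolding IH lom by (intro arg_cong2[where f = "(+)"] sum.cong) (simp_all add: sll lo(2))
    also have "\<dots> = (\<Sum>k\<in>S. boolean_cumulant (us @ map a (sorted_list_of_set (S \<inter> {..k}))) * moment (S \<inter> {k<..}) a)"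
      unfolding sum.remove[OF Suc.prems(1) m(1), folded S'_def] by (rule add.commute)
    finally show ?thesis .
  qed
qed

text \<open>The case of an empty prefix, because the Boolean cumulant of a single element is its
  expectation.\<close>

lemma moment_boolean:
  assumes "finite S" "S \<noteq> {}"
  shows "moment S a = (\<Sum>k\<in>S. boolean_cumulant (map a (sorted_list_of_set (S \<inter> {..k}))) * moment (S \<inter> {k<..}) a)"
  using boolean_cumulant_prod[OF assms, of "[]" a]
  by (simp add: boolean_cumulant_def moment_def)

lemma NC_empty: "NC {} = {{}}"
  by (auto simp: NC_def partition_on_def noncrossing_def)

lemma tree_coeff_empty:
  assumes "root_degree N T \<ge> 2"
  shows "tree_coeff N T {} = 1"
proof -
  have "nc_part {}" by (simp add: nc_part_iff noncrossing_def)
  moreover have "weak_colorings N T {} = {\<lambda>x. undefined}" by (simp add: weak_colorings_def)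
  ultimately show ?thesis
    using tree_coeff_eq[OF assms, of "{}"] by (simp add: color_components_def)
qed

text \<open>Both sides solve the same triangular system. The moment of \<open>V\<close> splits
  according to its first component, with Boolean cumulants on one side and, by multiplicativity of
  coefficients and evaluations, with irreducible sums on the other. The terms for proper initial
  pieces agree by induction and cancel.\<close>

lemma boolean_eq_cumulants:
  assumes n: "root_degree N T \<ge> 2" and K: "tree_cumulants N T (type_algebra \<iota> E) K"
    and "finite V" "0 \<notin> V" "V \<noteq> {}"
  shows "boolean_cumulant (map a (sorted_list_of_set V)) = (\<Sum>\<tau>\<in>NC_irr V. tree_coeff N T \<tau> *\<^sub>R part_eval K \<tau> a)"
  using assms(3-5)
proof (induction "card V" arbitrary: V rule: less_induct)
  case less
  have lin: "left_multilinear K"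
    using K quasi_multilinear_left_multilinear unfolding tree_cumulants_def by blast
  let ?g = "\<lambda>\<pi>. tree_coeff N T \<pi> *\<^sub>R part_eval K \<pi> a"
  let ?B = "\<lambda>V. boolean_cumulant (map a (sorted_list_of_set V))"
  have mom: "moment S a = sum ?g (NC S)" if "finite S" "0 \<notin> S" for S
  proof (cases "S = {}")
    case True
    then show ?thesis
      by (simp add: moment_def E_one NC_empty tree_coeff_empty[OF n] nested_eval_empty)
  qed (rule moment_cumulant[OF n K that])
  have g: "?g (\<tau> \<union> \<rho>) = ?g \<tau> * ?g \<rho>" if "k \<in> V" "\<tau> \<in> NC_irr (V \<inter> {..k})" "\<rho> \<in> NC (V \<inter> {k<..})" for k \<tau> \<rho>
  proof -
    have \<tau>: "\<tau> \<in> NC (V \<inter> {..k})" using that by (simp add: NC_irr_def)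
    have less': "x < y" if "x \<in> V \<inter> {..k}" "y \<in> V \<inter> {k<..}" for x y using that by auto
    have fin: "finite (V \<inter> {..k})" "finite (V \<inter> {k<..})" using less.prems by auto
    have app: "\<tau> \<union> \<rho> \<in> NC ((V \<inter> {..k}) \<union> (V \<inter> {k<..}))" "\<tau> \<inter> \<rho> = {}"
      by (rule NC_append(1,2)[OF fin less' \<tau> that(3)]; assumption)+
    have sep: "\<not> encloses X Y \<and> \<not> encloses Y X" if "X \<in> \<tau>" "Y \<in> \<rho>" for X Y
      by (rule NC_append(3)[OF fin less' \<tau> \<open>\<rho> \<in> _\<close> that])
    have nc: "nc_part (\<tau> \<union> \<rho>)" using app(1) nc_part_NC[OF finite_UnI[OF fin]] by (rule iffD1[THEN conjunct1, rotated])
    have U: "\<Union>\<tau> = V \<inter> {..k}" "\<Union>\<rho> = V \<inter> {k<..}"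
      using \<tau> that(3) nc_part_NC[OF fin(1)] nc_part_NC[OF fin(2)] by simp_all
    have "tree_coeff N T (\<tau> \<union> \<rho>) = tree_coeff N T \<tau> * tree_coeff N T \<rho>"
      by (rule tree_coeff_Un[OF n nc app(2)]) (rule sep)
    moreover have "part_eval K (\<tau> \<union> \<rho>) a = part_eval K \<tau> a * part_eval K \<rho> a"
      by (rule part_eval_Un_right[OF lin nc app(2)]) (unfold U, rule less')
    ultimately show ?thesis by simp
  qed
  have "moment V a = (\<Sum>k\<in>V. \<Sum>\<tau>\<in>NC_irr (V \<inter> {..k}). \<Sum>\<rho>\<in>NC (V \<inter> {k<..}). ?g (\<tau> \<union> \<rho>))"
    using mom less.prems sum_NC_first_component[of V ?g] by simp
  also have "\<dots> = (\<Sum>k\<in>V. sum ?g (NC_irr (V \<inter> {..k})) * sum ?g (NC (V \<inter> {k<..})))"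
    unfolding sum_product by (intro sum.cong refl g)
  also have "\<dots> = (\<Sum>k\<in>V. sum ?g (NC_irr (V \<inter> {..k})) * moment (V \<inter> {k<..}) a)"
    using less.prems by (simp add: mom)
  finally have eq: "(\<Sum>k\<in>V. sum ?g (NC_irr (V \<inter> {..k})) * moment (V \<inter> {k<..}) a)
      = (\<Sum>k\<in>V. ?B (V \<inter> {..k}) * moment (V \<inter> {k<..}) a)"
    using moment_boolean[OF less.prems(1,3), of a] by simp
  \<comment> \<open>Only the term of the last point involves all of \<open>V\<close>, and its other
    factor is the moment of the empty set, which is 1.\<close>
  define m where "m = Max V"
  have m: "m \<in> V" "\<And>x. x \<in> V \<Longrightarrow> x \<le> m" using less.prems unfolding m_def by auto
  have Vm: "V \<inter> {..m} = V" "V \<inter> {m<..} = {}" using m(2) by (auto simp: not_less[symmetric])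
  have "?B (V \<inter> {..k}) = sum ?g (NC_irr (V \<inter> {..k}))" if "k \<in> V - {m}" for k
  proof (rule less.hyps)
    have "k < m" using that m(2) by (simp add: order.not_eq_order_implies_strict)
    then have "m \<notin> V \<inter> {..k}" by simp
    then have "V \<inter> {..k} \<subset> V" using m(1) by blast
    then show "card (V \<inter> {..k}) < card V" using less.prems(1) by (rule psubset_card_mono[rotated])
  qed (use less.prems that in auto)
  then have "(\<Sum>k\<in>V-{m}. sum ?g (NC_irr (V \<inter> {..k})) * moment (V \<inter> {k<..}) a)
      = (\<Sum>k\<in>V-{m}. ?B (V \<inter> {..k}) * moment (V \<inter> {k<..}) a)" by simp
  moreover have "(\<Sum>k\<in>V. h k) = h m + (\<Sum>k\<in>V-{m}. h k)" for h :: "nat \<Rightarrow> 'b"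
    using less.prems(1) m(1) by (rule sum.remove)
  ultimately have "sum ?g (NC_irr (V \<inter> {..m})) * moment (V \<inter> {m<..}) a
      = ?B (V \<inter> {..m}) * moment (V \<inter> {m<..}) a" using eq by simp
  then show ?case unfolding Vm by (simp add: moment_def E_one)
qed

end

section \<open>Refining every block by an irreducible partition\<close>

definition part_within :: "nat set set \<Rightarrow> nat set \<Rightarrow> nat set set" where
  "part_within \<sigma> V = {W \<in> \<sigma>. W \<subseteq> V}"

text \<open>Described block by block: only the restrictions to blocks of \<open>\<pi>\<close> are
  required to be non-crossing and irreducible. That \<open>\<sigma>\<close> itself is then a
  non-crossing partition of the same ground set is derived in \<open>irr_ref_nc\<close>.\<close>

definition irr_refinements :: "nat set set \<Rightarrow> nat set set set" where
  "irr_refinements \<pi> = {\<sigma>. (\<forall>W\<in>\<sigma>. \<exists>V\<in>\<pi>. W \<subseteq> V) \<and> (\<forall>V\<in>\<pi>. part_within \<sigma> V \<in> NC_irr V)}"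

lemma NC_irrD:
  assumes "finite V" "\<tau> \<in> NC_irr V"
  shows "nc_part \<tau>" "\<Union>\<tau> = V" "\<exists>W\<in>\<tau>. Min V \<in> W \<and> Max V \<in> W"
  using assms nc_part_NC[OF assms(1)] unfolding NC_irr_def by auto

lemma NC_irr_iff:
  "finite V \<Longrightarrow> \<tau> \<in> NC_irr V \<longleftrightarrow> nc_part \<tau> \<and> \<Union>\<tau> = V \<and> (\<exists>W\<in>\<tau>. Min V \<in> W \<and> Max V \<in> W)"
  using nc_part_NC unfolding NC_irr_def by auto

lemma interval_block_cases:
  assumes "interval_block \<pi> V" "x \<in> \<Union>\<pi>" "x \<notin> V"
  shows "(\<forall>v\<in>V. x < v) \<or> (\<forall>v\<in>V. v < x)"
proof (rule ccontr)
  assume "\<not> ?thesis"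
  then obtain v w where *: "v \<in> V" "\<not> x < v" "w \<in> V" "\<not> w < x" by blast
  have "v \<noteq> x" "w \<noteq> x" using * assms(3) by blast+
  then have "v < x" "x < w" using * by linarith+
  then show False using interval_blockD[OF assms(1,2) *(1,3)] assms(3) by blast
qed

context
  fixes \<pi> \<sigma> :: "nat set set"
  assumes nc: "nc_part \<pi>" and ref: "\<sigma> \<in> irr_refinements \<pi>"
begin

lemma irr_ref_block: "V \<in> \<pi> \<Longrightarrow> part_within \<sigma> V \<in> NC_irr V"
  using ref by (simp add: irr_refinements_def)

lemma irr_ref_within:
  assumes "V \<in> \<pi>"
  shows "nc_part (part_within \<sigma> V)" "\<Union>(part_within \<sigma> V) = V"
  using NC_irrD[OF nc_part_finite_block[OF nc assms] irr_ref_block[OF assms]] by auto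

lemma irr_ref_outer:
  assumes "V \<in> \<pi>"
  obtains W where "W \<in> \<sigma>" "W \<subseteq> V" "Min V \<in> W" "Max V \<in> W"
  using NC_irrD(3)[OF nc_part_finite_block[OF nc assms] irr_ref_block[OF assms]]
  unfolding part_within_def by blast

lemma irr_ref_parent:
  assumes "W \<in> \<sigma>"
  obtains V where "V \<in> \<pi>" "W \<subseteq> V" "W \<in> part_within \<sigma> V"
  using ref assms unfolding irr_refinements_def part_within_def by blast

lemma irr_ref_nonempty: "W \<in> \<sigma> \<Longrightarrow> W \<noteq> {}"
  by (metis irr_ref_parent irr_ref_within(1) nc_part_nonempty)

text \<open>A crossing of two blocks of \<open>\<sigma>\<close> inside one block of
  \<open>\<pi>\<close> contradicts its restriction to that block; inside two different blocks of
  \<open>\<pi>\<close> it would already be a crossing of \<open>\<pi>\<close>.\<close>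

lemma irr_ref_nc: "nc_part \<sigma>" "\<Union>\<sigma> = \<Union>\<pi>"
proof -
  show U: "\<Union>\<sigma> = \<Union>\<pi>"
  proof
    show "\<Union>\<sigma> \<subseteq> \<Union>\<pi>" using irr_ref_parent by (metis Sup_subset_mono Union_least Union_upper subset_trans)
    show "\<Union>\<pi> \<subseteq> \<Union>\<sigma>"
    proof
      fix x assume "x \<in> \<Union>\<pi>"
      then obtain V where V: "V \<in> \<pi>" "x \<in> V" by blast
      then have "x \<in> \<Union>(part_within \<sigma> V)" using irr_ref_within(2) by simp
      then show "x \<in> \<Union>\<sigma>" unfolding part_within_def by blast
    qed
  qed
  have same: "W = W'" if "W \<in> \<sigma>" "W' \<in> \<sigma>" "V \<in> \<pi>" "W \<subseteq> V" "W' \<subseteq> V"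
    "(\<exists>x. x \<in> W \<and> x \<in> W') \<or> (\<exists>a b c d. a \<in> W \<and> b \<in> W' \<and> c \<in> W \<and> d \<in> W' \<and> a < b \<and> b < c \<and> c < d)" for W W' V
  proof -
    have m: "W \<in> part_within \<sigma> V" "W' \<in> part_within \<sigma> V" using that by (auto simp: part_within_def)
    show ?thesis
      using that(6)
    proof (elim disjE exE conjE)
      fix x assume "x \<in> W" "x \<in> W'"
      then show ?thesis by (rule nc_part_disjoint[OF irr_ref_within(1)[OF that(3)] m])
    next
      fix a b c d assume "a \<in> W" "b \<in> W'" "c \<in> W" "d \<in> W'" "a < b" "b < c" "c < d"
      then show ?thesis by (rule nc_part_crossing[OF irr_ref_within(1)[OF that(3)] m])
    qed
  qed
  have "W = W'" if W: "W \<in> \<sigma>" "W' \<in> \<sigma>" "x \<in> W" "x \<in> W'" for W W' x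
  proof -
    obtain V V' where V: "V \<in> \<pi>" "W \<subseteq> V" "V' \<in> \<pi>" "W' \<subseteq> V'" using irr_ref_parent W(1,2) by metis
    then have "V = V'" using nc_part_disjoint[OF nc V(1,3), of x] W by blast
    then show ?thesis using same[OF W(1,2) V(1,2)] V(4) W by blast
  qed
  then have "disjoint \<sigma>" unfolding disjoint_def by blast
  moreover have "W = W'" if W: "W \<in> \<sigma>" "W' \<in> \<sigma>" "a \<in> W" "b \<in> W'" "c \<in> W" "d \<in> W'" "a < b" "b < c" "c < d" for W W' a b c d
  proof -
    obtain V V' where V: "V \<in> \<pi>" "W \<subseteq> V" "V' \<in> \<pi>" "W' \<subseteq> V'" using irr_ref_parent W(1,2) by metis
    then have "V = V'" using nc_part_crossing[OF nc V(1,3), of a b c d] W by blast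
    then show ?thesis using same[OF W(1,2) V(1,2)] V(4) W by blast
  qed
  then have "noncrossing \<sigma>" unfolding noncrossing_def by blast
  ultimately show "nc_part \<sigma>"
    using irr_ref_nonempty nc_part_finite_Union[OF nc] unfolding nc_part_iff U by blast
qed

end

lemma finite_irr_refinements: "nc_part \<pi> \<Longrightarrow> finite (irr_refinements \<pi>)"
proof (rule finite_subset)
  assume nc: "nc_part \<pi>"
  show "irr_refinements \<pi> \<subseteq> Pow (Pow (\<Union>\<pi>))"
    using irr_ref_nc(2)[OF nc] by blast
  show "finite (Pow (Pow (\<Union>\<pi>)))" using nc_part_finite_Union[OF nc] by simp
qed

lemma irr_refinements_empty: "irr_refinements {} = {{}}"
  by (auto simp: irr_refinements_def)

text \<open>Removing \<open>V\<close> splits a refinement into its part inside \<open>V\<close> and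
  the rest, and the two can be chosen freely. The statements on restrictions make the product of
  coefficients over the blocks of \<open>\<pi>\<close> factor accordingly.\<close>

lemma irr_refinements_insert:
  assumes nc: "nc_part \<pi>" and V: "V \<in> \<pi>"
  shows "bij_betw (\<lambda>(\<sigma>, \<tau>). \<sigma> \<union> \<tau>) (irr_refinements (\<pi> - {V}) \<times> NC_irr V) (irr_refinements \<pi>)"
    and "\<lbrakk>\<sigma> \<in> irr_refinements (\<pi> - {V}); \<tau> \<in> NC_irr V\<rbrakk> \<Longrightarrow> part_within (\<sigma> \<union> \<tau>) V = \<tau>"
    and "\<lbrakk>\<sigma> \<in> irr_refinements (\<pi> - {V}); \<tau> \<in> NC_irr V; V' \<in> \<pi> - {V}\<rbrakk> \<Longrightarrow> part_within (\<sigma> \<union> \<tau>) V' = part_within \<sigma> V'"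
    and "\<lbrakk>\<sigma> \<in> irr_refinements (\<pi> - {V}); \<tau> \<in> NC_irr V\<rbrakk> \<Longrightarrow> \<sigma> \<inter> \<tau> = {}"
proof -
  have ncd: "nc_part (\<pi> - {V})" using nc by (rule nc_part_subset) auto
  have finV: "finite V" using nc V nc_part_finite_block by blast
  have \<tau>: "W \<subseteq> V" "W \<noteq> {}" if "\<tau> \<in> NC_irr V" "W \<in> \<tau>" for W \<tau>
    using NC_irrD[OF finV that(1)] that(2) nc_part_nonempty by auto
  have dis: "V \<inter> V' = {}" if "V' \<in> \<pi> - {V}" for V' using nc_part_disjoint[OF nc V] that by blast
  have \<sigma>: "\<not> W \<subseteq> V" if st: "\<sigma> \<in> irr_refinements (\<pi> - {V})" "W \<in> \<sigma>" for \<sigma> W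
  proof -
    obtain V' where "V' \<in> \<pi> - {V}" "W \<subseteq> V'" using irr_ref_parent[OF ncd st] by metis
    then show ?thesis using dis[of V'] irr_ref_nonempty[OF ncd st] by blast
  qed
  have \<tau>': "\<not> W \<subseteq> V'" if "\<tau> \<in> NC_irr V" "W \<in> \<tau>" "V' \<in> \<pi> - {V}" for \<tau> W V'
    using \<tau>[OF that(1,2)] dis[OF that(3)] by blast
  show 1: "part_within (\<sigma> \<union> \<tau>) V = \<tau>" if "\<sigma> \<in> irr_refinements (\<pi> - {V})" "\<tau> \<in> NC_irr V" for \<sigma> \<tau>
    using \<sigma>[OF that(1)] \<tau>(1)[OF that(2)] unfolding part_within_def by auto
  show 2: "part_within (\<sigma> \<union> \<tau>) V' = part_within \<sigma> V'"
    if "\<sigma> \<in> irr_refinements (\<pi> - {V})" "\<tau> \<in> NC_irr V" "V' \<in> \<pi> - {V}" for \<sigma> \<tau> V'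
    using \<tau>'[OF that(2) _ that(3)] unfolding part_within_def by auto
  show "\<sigma> \<inter> \<tau> = {}" if "\<sigma> \<in> irr_refinements (\<pi> - {V})" "\<tau> \<in> NC_irr V" for \<sigma> \<tau>
    using \<sigma>[OF that(1)] \<tau>(1)[OF that(2)] by auto
  show "bij_betw (\<lambda>(\<sigma>, \<tau>). \<sigma> \<union> \<tau>) (irr_refinements (\<pi> - {V}) \<times> NC_irr V) (irr_refinements \<pi>)"
  proof (rule bij_betwI[where g = "\<lambda>\<sigma>. ({W\<in>\<sigma>. \<not> W \<subseteq> V}, part_within \<sigma> V)"])
    show "(\<lambda>(\<sigma>, \<tau>). \<sigma> \<union> \<tau>) \<in> irr_refinements (\<pi> - {V}) \<times> NC_irr V \<rightarrow> irr_refinements \<pi>"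
    proof
      fix p assume "p \<in> irr_refinements (\<pi> - {V}) \<times> NC_irr V"
      then obtain \<sigma> \<tau> where p: "p = (\<sigma>, \<tau>)" "\<sigma> \<in> irr_refinements (\<pi> - {V})" "\<tau> \<in> NC_irr V" by blast
      have "\<exists>V'\<in>\<pi>. W \<subseteq> V'" if "W \<in> \<sigma> \<union> \<tau>" for W
        using that irr_ref_parent[OF ncd p(2)] \<tau>(1)[OF p(3)] V by (metis DiffD1 UnE)
      moreover have "part_within (\<sigma> \<union> \<tau>) V' \<in> NC_irr V'" if "V' \<in> \<pi>" for V'
        using 1[OF p(2,3)] 2[OF p(2,3)] p(3) irr_ref_block[OF ncd p(2)] that by (cases "V' = V") auto
      ultimately show "(case p of (\<sigma>, \<tau>) \<Rightarrow> \<sigma> \<union> \<tau>) \<in> irr_refinements \<pi>"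
        unfolding p(1) prod.case irr_refinements_def by blast
    qed
    show "(\<lambda>\<sigma>. ({W\<in>\<sigma>. \<not> W \<subseteq> V}, part_within \<sigma> V)) \<in> irr_refinements \<pi> \<rightarrow> irr_refinements (\<pi> - {V}) \<times> NC_irr V"
    proof
      fix \<sigma> assume \<sigma>: "\<sigma> \<in> irr_refinements \<pi>"
      have "\<exists>V'\<in>\<pi> - {V}. W \<subseteq> V'" if "W \<in> \<sigma>" "\<not> W \<subseteq> V" for W
        using irr_ref_parent[OF nc \<sigma> that(1)] that(2) by (metis DiffI singletonD)
      moreover have "part_within {W\<in>\<sigma>. \<not> W \<subseteq> V} V' \<in> NC_irr V'" if "V' \<in> \<pi> - {V}" for V'
      proof -
        have "\<not> W \<subseteq> V" if "W \<in> \<sigma>" "W \<subseteq> V'" for W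
          using dis[OF \<open>V' \<in> _\<close>] irr_ref_nonempty[OF nc \<sigma> that(1)] that(2) by blast
        then have "part_within {W\<in>\<sigma>. \<not> W \<subseteq> V} V' = part_within \<sigma> V'" unfolding part_within_def by auto
        then show ?thesis using irr_ref_block[OF nc \<sigma>] that by simp
      qed
      ultimately have "{W\<in>\<sigma>. \<not> W \<subseteq> V} \<in> irr_refinements (\<pi> - {V})"
        unfolding irr_refinements_def by blast
      then show "({W\<in>\<sigma>. \<not> W \<subseteq> V}, part_within \<sigma> V) \<in> irr_refinements (\<pi> - {V}) \<times> NC_irr V"
        using irr_ref_block[OF nc \<sigma> V] by simp
    qed
    show "({W \<in> case p of (\<sigma>, \<tau>) \<Rightarrow> \<sigma> \<union> \<tau>. \<not> W \<subseteq> V}, part_within (case p of (\<sigma>, \<tau>) \<Rightarrow> \<sigma> \<union> \<tau>) V) = p"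
      if "p \<in> irr_refinements (\<pi> - {V}) \<times> NC_irr V" for p
    proof -
      from that obtain \<sigma>' \<tau>' where p: "p = (\<sigma>', \<tau>')" "\<sigma>' \<in> irr_refinements (\<pi> - {V})" "\<tau>' \<in> NC_irr V" by blast
      have "{W \<in> \<sigma>' \<union> \<tau>'. \<not> W \<subseteq> V} = \<sigma>'" using \<sigma>[OF p(2)] \<tau>(1)[OF p(3)] by auto
      then show ?thesis unfolding p(1) using 1[OF p(2,3)] by simp
    qed
    show "(case ({W\<in>\<sigma>. \<not> W \<subseteq> V}, part_within \<sigma> V) of (\<sigma>, \<tau>) \<Rightarrow> \<sigma> \<union> \<tau>) = \<sigma>" for \<sigma>
      unfolding part_within_def by auto
  qed
qed

context bvalued_prob_space
begin

text \<open>Induction by removing an interval block \<open>V\<close>. Its Boolean cumulant is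
  expanded over irreducible partitions of \<open>V\<close>, the rest by the induction hypothesis,
  and each pair of terms is recognised as an evaluation along a union: on the right if nothing
  follows \<open>V\<close>, in front of the next index otherwise.\<close>

lemma part_eval_boolean_refine:
  assumes n: "root_degree N T \<ge> 2" and K: "tree_cumulants N T (type_algebra \<iota> E) K"
    and "nc_part \<pi>" "0 \<notin> \<Union>\<pi>"
  shows "part_eval boolean_cumulant \<pi> a =
    (\<Sum>\<sigma>\<in>irr_refinements \<pi>. (\<Prod>V\<in>\<pi>. tree_coeff N T (part_within \<sigma> V)) *\<^sub>R part_eval K \<sigma> a)"
  using assms(3,4)
proof (induction "card \<pi>" arbitrary: \<pi> a rule: less_induct)
  case less
  note nc = less.prems(1)
  have lin: "left_multilinear K"
    using K quasi_multilinear_left_multilinear unfolding tree_cumulants_def by blast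
  show ?case
  proof (cases "\<pi> = {}")
    case False
    define V where "V = first_block \<pi>"
    have V: "interval_block \<pi> V" unfolding V_def by (rule interval_first_block[OF nc False])
    have eq: "part_eval boolean_cumulant \<pi> a = absorb_block boolean_cumulant \<pi> V (part_eval boolean_cumulant (\<pi> - {V})) a"
      by (rule part_eval_absorb[OF left_multilinear_boolean nc V])
    have V\<pi>: "V \<in> \<pi>" using V by (simp add: interval_block_def)
    have finV: "finite V" and Vne: "V \<noteq> {}" and V0: "0 \<notin> V"
      using nc V\<pi> nc_part_finite_block nc_part_nonempty less.prems(2) by auto
    have fin: "finite \<pi>" by (rule nc_part_finite[OF nc])
    have card: "card (\<pi> - {V}) < card \<pi>" using V\<pi> fin by (rule card_Diff1_less[rotated])
    have ncd: "nc_part (\<pi> - {V})" using nc by (rule nc_part_subset) auto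
    have "0 \<notin> \<Union>(\<pi> - {V})" using less.prems(2) by blast
    note IH = less.hyps[OF card ncd this]
    define c where "c \<sigma> = (\<Prod>V\<in>\<pi> - {V}. tree_coeff N T (part_within \<sigma> V))" for \<sigma>
    define b where "b = boolean_cumulant (map a (sorted_list_of_set V))"
    have b: "b = (\<Sum>\<tau>\<in>NC_irr V. tree_coeff N T \<tau> *\<^sub>R part_eval K \<tau> a)"
      unfolding b_def by (rule boolean_eq_cumulants[OF n K finV V0 Vne])
    note U = Union_remove_block[OF nc V\<pi>]
    have cases: "(\<forall>v\<in>V. x < v) \<or> x \<in> right_of \<pi> V" if "x \<in> \<Union>(\<pi> - {V})" for x
      using interval_block_cases[OF V, of x] that unfolding U right_of_def by blast
    have "part_eval boolean_cumulant \<pi> a =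
      (\<Sum>\<sigma>\<in>irr_refinements (\<pi> - {V}). \<Sum>\<tau>\<in>NC_irr V. (c \<sigma> * tree_coeff N T \<tau>) *\<^sub>R part_eval K (\<sigma> \<union> \<tau>) a)"
    proof (cases "right_of \<pi> V = {}")
      case True
      have *: "part_eval K (\<sigma> \<union> \<tau>) a = part_eval K \<sigma> a * part_eval K \<tau> a"
        if st: "\<sigma> \<in> irr_refinements (\<pi> - {V})" "\<tau> \<in> NC_irr V" for \<sigma> \<tau>
      proof (rule part_eval_Un_right[OF lin])
        have "\<sigma> \<union> \<tau> \<in> irr_refinements \<pi>"
          using irr_refinements_insert(1)[OF nc V\<pi>] st unfolding bij_betw_def by blast
        then show "nc_part (\<sigma> \<union> \<tau>)" by (rule irr_ref_nc[OF nc])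
        show "\<sigma> \<inter> \<tau> = {}" by (rule irr_refinements_insert(4)[OF nc V\<pi> st])
        show "s < t" if "s \<in> \<Union>\<sigma>" "t \<in> \<Union>\<tau>" for s t
          using cases[of s] that True
          unfolding irr_ref_nc(2)[OF ncd st(1)] NC_irrD(2)[OF finV st(2)] by blast
      qed
      have "part_eval boolean_cumulant \<pi> a = part_eval boolean_cumulant (\<pi> - {V}) a * b"
        unfolding eq absorb_block_def b_def by (simp add: True)
      also have "\<dots> = (\<Sum>\<sigma>\<in>irr_refinements (\<pi> - {V}). \<Sum>\<tau>\<in>NC_irr V.
          (c \<sigma> *\<^sub>R part_eval K \<sigma> a) * (tree_coeff N T \<tau> *\<^sub>R part_eval K \<tau> a))"
        unfolding IH b sum_product c_def ..
      also have "\<dots> = (\<Sum>\<sigma>\<in>irr_refinements (\<pi> - {V}). \<Sum>\<tau>\<in>NC_irr V. (c \<sigma> * tree_coeff N T \<tau>) *\<^sub>R part_eval K (\<sigma> \<union> \<tau>) a)"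
        by (intro sum.cong refl) (simp add: *)
      finally show ?thesis .
    next
      case False
      define r where "r = Min (right_of \<pi> V)"
      have rR: "r \<in> right_of \<pi> V" unfolding r_def using Min_in[OF right_of_finite[OF nc] False] .
      have r: "r \<in> \<Union>(\<pi> - {V})" unfolding r_def using Min_right_of(1)[OF nc V\<pi> False] .
      have *: "part_eval K (\<sigma> \<union> \<tau>) a = part_eval K \<sigma> (a(r := \<iota> (part_eval K \<tau> a) * a r))"
        if st: "\<sigma> \<in> irr_refinements (\<pi> - {V})" "\<tau> \<in> NC_irr V" for \<sigma> \<tau>
      proof (rule part_eval_Un_inner[OF lin])
        have "\<sigma> \<union> \<tau> \<in> irr_refinements \<pi>"
          using irr_refinements_insert(1)[OF nc V\<pi>] st unfolding bij_betw_def by blast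
        then show "nc_part (\<sigma> \<union> \<tau>)" by (rule irr_ref_nc[OF nc])
        show "\<sigma> \<inter> \<tau> = {}" by (rule irr_refinements_insert(4)[OF nc V\<pi> st])
        show "r \<in> \<Union>\<sigma>" using r unfolding irr_ref_nc(2)[OF ncd st(1)] .
        show "t < r" if "t \<in> \<Union>\<tau>" for t
          using rR that unfolding NC_irrD(2)[OF finV st(2)] right_of_def by blast
        \<comment> \<open>As \<open>r\<close> is the first index to the right of \<open>V\<close>,
          an index below \<open>r\<close> outside the interval \<open>V\<close> precedes all of
          \<open>V\<close>.\<close>
        show "s < t" if "s \<in> \<Union>\<sigma>" "s < r" "t \<in> \<Union>\<tau>" for s t
        proof -
          have "s \<notin> right_of \<pi> V"
            using Min_le[OF right_of_finite[OF nc], of s V] that(2) unfolding r_def by force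
          then show ?thesis using cases[of s] that
            unfolding irr_ref_nc(2)[OF ncd st(1)] NC_irrD(2)[OF finV st(2)] by blast
        qed
      qed
      \<comment> \<open>The whole expansion of \<open>b\<close> sits in the single argument at
        \<open>r\<close>, so linearity of the evaluation in that argument brings the sum over
        \<open>\<tau>\<close> outside.\<close>
      have ib: "\<iota> b * a r = (\<Sum>\<tau>\<in>NC_irr V. tree_coeff N T \<tau> *\<^sub>R (\<iota> (part_eval K \<tau> a) * a r))"
      proof -
        have "\<iota> (\<Sum>\<tau>\<in>X. tree_coeff N T \<tau> *\<^sub>R part_eval K \<tau> a) = (\<Sum>\<tau>\<in>X. tree_coeff N T \<tau> *\<^sub>R \<iota> (part_eval K \<tau> a))" for X
          by (induction X rule: infinite_finite_induct) (simp_all add: incl_0 incl_add incl_scaleR)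
        then show ?thesis unfolding b by (simp add: sum_distrib_right)
      qed
      have "part_eval boolean_cumulant \<pi> a = part_eval boolean_cumulant (\<pi> - {V}) (a(r := \<iota> b * a r))"
        unfolding eq absorb_block_def b_def r_def by (simp add: False Let_def)
      also have "\<dots> = (\<Sum>\<sigma>\<in>irr_refinements (\<pi> - {V}). c \<sigma> *\<^sub>R part_eval K \<sigma> (a(r := \<iota> b * a r)))"
        unfolding IH c_def ..
      also have "\<dots> = (\<Sum>\<sigma>\<in>irr_refinements (\<pi> - {V}). \<Sum>\<tau>\<in>NC_irr V. (c \<sigma> * tree_coeff N T \<tau>) *\<^sub>R part_eval K (\<sigma> \<union> \<tau>) a)"
      proof (rule sum.cong[OF refl])
        fix \<sigma> assume \<sigma>: "\<sigma> \<in> irr_refinements (\<pi> - {V})"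
        have "part_eval K \<sigma> (a(r := \<iota> b * a r)) = (\<Sum>\<tau>\<in>NC_irr V. tree_coeff N T \<tau> *\<^sub>R part_eval K \<sigma> (a(r := \<iota> (part_eval K \<tau> a) * a r)))"
          unfolding ib using r unfolding irr_ref_nc(2)[OF ncd \<sigma>, symmetric]
          by (rule part_eval_sum[OF lin irr_ref_nc(1)[OF ncd \<sigma>]])
        then show "c \<sigma> *\<^sub>R part_eval K \<sigma> (a(r := \<iota> b * a r)) = (\<Sum>\<tau>\<in>NC_irr V. (c \<sigma> * tree_coeff N T \<tau>) *\<^sub>R part_eval K (\<sigma> \<union> \<tau>) a)"
          by (simp add: scaleR_sum_right *[OF \<sigma>])
      qed
      finally show ?thesis .
    qed
    also have "\<dots> = (\<Sum>(\<sigma>, \<tau>)\<in>irr_refinements (\<pi> - {V}) \<times> NC_irr V. (c \<sigma> * tree_coeff N T \<tau>) *\<^sub>R part_eval K (\<sigma> \<union> \<tau>) a)"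
      by (rule sum.cartesian_product)
    also have "\<dots> = (\<Sum>p\<in>irr_refinements (\<pi> - {V}) \<times> NC_irr V.
        (\<Prod>V\<in>\<pi>. tree_coeff N T (part_within (case p of (\<sigma>, \<tau>) \<Rightarrow> \<sigma> \<union> \<tau>) V)) *\<^sub>R part_eval K (case p of (\<sigma>, \<tau>) \<Rightarrow> \<sigma> \<union> \<tau>) a)"
    proof (rule sum.cong[OF refl])
      fix p assume "p \<in> irr_refinements (\<pi> - {V}) \<times> NC_irr V"
      then obtain \<sigma> \<tau> where p: "p = (\<sigma>, \<tau>)" "\<sigma> \<in> irr_refinements (\<pi> - {V})" "\<tau> \<in> NC_irr V" by blast
      have "(\<Prod>V\<in>\<pi>. tree_coeff N T (part_within (\<sigma> \<union> \<tau>) V)) = c \<sigma> * tree_coeff N T \<tau>"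
        unfolding prod.remove[OF fin V\<pi>] c_def
        using irr_refinements_insert(2)[OF nc V\<pi> p(2,3)] irr_refinements_insert(3)[OF nc V\<pi> p(2,3)] by simp
      then show "(case p of (\<sigma>, \<tau>) \<Rightarrow> (c \<sigma> * tree_coeff N T \<tau>) *\<^sub>R part_eval K (\<sigma> \<union> \<tau>) a) =
        (\<Prod>V\<in>\<pi>. tree_coeff N T (part_within (case p of (\<sigma>, \<tau>) \<Rightarrow> \<sigma> \<union> \<tau>) V)) *\<^sub>R part_eval K (case p of (\<sigma>, \<tau>) \<Rightarrow> \<sigma> \<union> \<tau>) a"
        unfolding p(1) by simp
    qed
    also have "\<dots> = (\<Sum>\<sigma>\<in>irr_refinements \<pi>. (\<Prod>V\<in>\<pi>. tree_coeff N T (part_within \<sigma> V)) *\<^sub>R part_eval K \<sigma> a)"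
      by (rule sum.reindex_bij_betw[OF irr_refinements_insert(1)[OF nc V\<pi>]])
    finally show ?thesis .
  qed (simp add: nested_eval_empty irr_refinements_empty)
qed

end

section \<open>Weak colorings as refinements of strict colorings\<close>

text \<open>Weak colorings in which parent and child always differ. Their chain strings alternate
  and need no reduction, so each component is a single block.\<close>

definition strict_colorings :: "nat \<Rightarrow> nat list set \<Rightarrow> nat set set \<Rightarrow> (nat set \<Rightarrow> nat) set" where
  "strict_colorings N T \<pi> =
     {\<kappa> \<in> weak_colorings N T \<pi>. \<forall>V W. covers \<pi> V W \<longrightarrow> \<kappa> V \<noteq> \<kappa> W}"

definition parent_block :: "nat set set \<Rightarrow> nat set \<Rightarrow> nat set" where
  "parent_block \<pi> W = (THE V. V \<in> \<pi> \<and> W \<subseteq> V)"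

text \<open>Applied with the letters being parent blocks: collapsing runs of equal parents before
  coloring them does not change the reduced color string.\<close>

lemma remdups_adj_map_remdups_adj:
  "remdups_adj (map f (remdups_adj xs)) = remdups_adj (map f xs)"
proof (induction xs rule: remdups_adj.induct)
  case (3 x y xs)
  show ?case
  proof (cases "x = y")
    case False
    obtain zs where zs: "remdups_adj (y # xs) = y # zs" by (metis remdups_adj_Cons_alt)
    then show ?thesis using 3(2)[OF False] False by simp
  qed (use 3(1) in simp)
qed auto

context
  fixes \<pi> \<sigma> :: "nat set set"
  assumes nc: "nc_part \<pi>" and ref: "\<sigma> \<in> irr_refinements \<pi>"
begin

lemma parent_block_eq:
  assumes "V \<in> \<pi>" "W \<in> \<sigma>" "W \<subseteq> V"
  shows "parent_block \<pi> W = V"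
  unfolding parent_block_def
proof (rule the_equality)
  obtain x where x: "x \<in> W" using irr_ref_nonempty[OF nc ref assms(2)] by blast
  show "V' = V" if "V' \<in> \<pi> \<and> W \<subseteq> V'" for V'
    using nc_part_disjoint[OF nc _ assms(1), of V' x] that assms(3) x by blast
qed (use assms in blast)

lemma parent_block:
  assumes "W \<in> \<sigma>"
  shows "parent_block \<pi> W \<in> \<pi>" "W \<subseteq> parent_block \<pi> W"
proof -
  obtain V where "V \<in> \<pi>" "W \<subseteq> V" using irr_ref_parent[OF nc ref assms] by metis
  then show "parent_block \<pi> W \<in> \<pi>" "W \<subseteq> parent_block \<pi> W" using parent_block_eq[OF _ assms] by auto
qed

lemma encloses_parent_block:
  assumes "P \<in> \<sigma>" "W \<in> \<sigma>" "encloses P W" "parent_block \<pi> P \<noteq> parent_block \<pi> W"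
  shows "encloses (parent_block \<pi> P) (parent_block \<pi> W)"
proof -
  obtain w where w: "w \<in> W" using irr_ref_nonempty[OF nc ref assms(2)] by blast
  obtain j k where "j \<in> P" "k \<in> P" "j < w" "w < k" using assms(3) w unfolding encloses_def by blast
  then show ?thesis
    using encloses_between[OF nc parent_block(1)[OF assms(1)] parent_block(1)[OF assms(2)] assms(4)]
      parent_block(2)[OF assms(1)] parent_block(2)[OF assms(2)] w by blast
qed

text \<open>The outer block of the restriction to \<open>X\<close> contains \<open>Min X\<close> and
  \<open>Max X\<close>, hence surrounds everything that \<open>X\<close> surrounds.\<close>

lemma encloses_outer:
  assumes "X \<in> \<pi>" "W \<in> \<sigma>" "encloses X (parent_block \<pi> W)"
  shows "\<exists>Y\<in>\<sigma>. Y \<subseteq> X \<and> parent_block \<pi> Y = X \<and> encloses Y W"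
proof -
  obtain Y where Y: "Y \<in> \<sigma>" "Y \<subseteq> X" "Min X \<in> Y" "Max X \<in> Y"
    using irr_ref_outer[OF nc ref assms(1)] by metis
  obtain j k where jk: "j \<in> X" "k \<in> X" "\<forall>v\<in>parent_block \<pi> W. j < v \<and> v < k"
    using assms(3) unfolding encloses_def by blast
  have fin: "finite X" using nc assms(1) nc_part_finite_block by blast
  have "Min X < w \<and> w < Max X" if "w \<in> W" for w
  proof -
    have "j < w" "w < k" using jk(3) parent_block(2)[OF assms(2)] that by auto
    moreover have "Min X \<le> j" "k \<le> Max X" using fin jk by auto
    ultimately show ?thesis by linarith
  qed
  then have "encloses Y W" using Y(3,4) unfolding encloses_def by blast
  then show ?thesis using Y parent_block_eq[OF assms(1) Y(1,2)] by blast
qed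

text \<open>Suppose \<open>X\<close> lay strictly between the two parents. Its outer block
  \<open>Y\<close> in \<open>\<sigma>\<close> would surround \<open>W\<close>, hence surround the
  parent \<open>P\<close> of \<open>W\<close> as well, and then \<open>X\<close> would surround a
  block in which it is nested.\<close>

lemma covers_parent_block:
  assumes cov: "covers \<sigma> P W" and neq: "parent_block \<pi> P \<noteq> parent_block \<pi> W"
  shows "covers \<pi> (parent_block \<pi> P) (parent_block \<pi> W)"
proof -
  note nc\<sigma> = irr_ref_nc(1)[OF nc ref]
  have P: "P \<in> \<sigma>" "W \<in> \<sigma>" "encloses P W" using cov by (auto simp: covers_def)
  note pb = parent_block(1)[OF P(1)] parent_block(1)[OF P(2)]
  have enc: "encloses (parent_block \<pi> P) (parent_block \<pi> W)"
    by (rule encloses_parent_block[OF P neq])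
  have False if X: "X \<in> \<pi>" "encloses (parent_block \<pi> P) X" "encloses X (parent_block \<pi> W)" for X
  proof -
    obtain Y where Y: "Y \<in> \<sigma>" "parent_block \<pi> Y = X" "encloses Y W"
      using encloses_outer[OF X(1) P(2) X(3)] by blast
    have "X \<noteq> parent_block \<pi> P" using X(2) nc_encloses_irrefl[OF nc X(1)] by blast
    then have "Y \<noteq> P" using Y by blast
    then have "encloses Y P" using covers_encloses_cases[OF nc\<sigma> cov Y(1,3)] by blast
    then have "encloses X (parent_block \<pi> P)"
      using encloses_parent_block[OF Y(1) P(1)] Y(2) \<open>X \<noteq> _\<close> by blast
    then show False using nc_encloses_trans[OF nc _ X(2) X(1)] nc_encloses_irrefl[OF nc X(1)] by blast
  qed
  then show ?thesis unfolding covers_def using pb enc by blast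
qed

text \<open>Climbing from a block of \<open>\<sigma>\<close> to its parent either stays in the same
  block of \<open>\<pi>\<close> or moves to the parent of that block in \<open>\<pi>\<close>; the
  chain in \<open>\<pi>\<close> is therefore the chain in \<open>\<sigma>\<close> with its runs
  collapsed.\<close>

lemma is_chain_parent_block:
  assumes "W \<in> \<sigma>" "is_chain \<sigma> W Vs"
  shows "\<exists>Us. is_chain \<pi> (parent_block \<pi> W) Us \<and>
    remdups_adj (map (parent_block \<pi>) (W # Vs)) = parent_block \<pi> W # Us"
  using assms
proof (induction Vs arbitrary: W)
  case Nil
  note nc\<sigma> = irr_ref_nc(1)[OF nc ref]
  have "\<not> encloses P W" if "P \<in> \<sigma>" for P
    using Nil is_chain_Nil_iff[OF nc\<sigma> Nil(1)] that by blast
  then have "\<not> encloses X (parent_block \<pi> W)" if "X \<in> \<pi>" for X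
    using encloses_outer[OF that Nil(1)] by blast
  then show ?case using is_chain_Nil_iff[OF nc parent_block(1)[OF Nil(1)]] by auto
next
  case (Cons P Ps)
  note nc\<sigma> = irr_ref_nc(1)[OF nc ref]
  have P: "covers \<sigma> P W" "is_chain \<sigma> P Ps" using is_chain_Cons_iff[OF nc\<sigma> Cons.prems(1)] Cons.prems(2) by auto
  have "P \<in> \<sigma>" using P(1) by (simp add: covers_def)
  then obtain Us where Us: "is_chain \<pi> (parent_block \<pi> P) Us"
    "remdups_adj (map (parent_block \<pi>) (P # Ps)) = parent_block \<pi> P # Us"
    using Cons.IH P(2) by blast
  show ?case
  proof (cases "parent_block \<pi> P = parent_block \<pi> W")
    case True
    then show ?thesis using Us by auto
  next
    case False
    have "covers \<pi> (parent_block \<pi> P) (parent_block \<pi> W)" by (rule covers_parent_block[OF P(1) False])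
    then have "is_chain \<pi> (parent_block \<pi> W) (parent_block \<pi> P # Us)"
      using is_chain_Cons_iff[OF nc parent_block(1)[OF Cons.prems(1)]] Us(1) by blast
    then show ?thesis using Us(2) False by auto
  qed
qed

text \<open>Both membership conditions concern the same reduced strings. Every chain of
  \<open>\<pi>\<close> is obtained from a chain of \<open>\<sigma>\<close>, since each block of
  \<open>\<pi>\<close> contains a block of \<open>\<sigma>\<close> and chains are unique.\<close>

lemma weak_colorings_parent_block:
  assumes "\<kappa> \<in> extensional \<pi>"
  shows "(\<lambda>W\<in>\<sigma>. \<kappa> (parent_block \<pi> W)) \<in> weak_colorings N T \<sigma> \<longleftrightarrow> \<kappa> \<in> weak_colorings N T \<pi>"
    (is "?\<kappa> \<in> _ \<longleftrightarrow> _")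
proof -
  note nc\<sigma> = irr_ref_nc(1)[OF nc ref]
  have outer: "\<exists>W\<in>\<sigma>. parent_block \<pi> W = V" if "V \<in> \<pi>" for V
    using irr_ref_outer[OF nc ref that] parent_block_eq[OF that] by metis
  have red: "\<exists>Us. is_chain \<pi> (parent_block \<pi> W) Us \<and>
      remdups_adj (map ?\<kappa> (W # Vs)) = remdups_adj (map \<kappa> (parent_block \<pi> W # Us))"
    if W: "W \<in> \<sigma>" and ch: "is_chain \<sigma> W Vs" for W Vs
  proof -
    obtain Us where Us: "is_chain \<pi> (parent_block \<pi> W) Us"
      "remdups_adj (map (parent_block \<pi>) (W # Vs)) = parent_block \<pi> W # Us"
      using is_chain_parent_block[OF W ch] by blast
    have "set (W # Vs) \<subseteq> \<sigma>" using W is_chain_subset[OF ch] by simp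
    from map_restrict[OF this, of "\<lambda>W. \<kappa> (parent_block \<pi> W)"]
    have "map ?\<kappa> (W # Vs) = map \<kappa> (map (parent_block \<pi>) (W # Vs))"
      by (simp only: map_map comp_def)
    then have "remdups_adj (map ?\<kappa> (W # Vs)) = remdups_adj (map \<kappa> (parent_block \<pi> W # Us))"
      using remdups_adj_map_remdups_adj[of \<kappa> "map (parent_block \<pi>) (W # Vs)"] Us(2) by metis
    then show ?thesis using Us(1) by blast
  qed
  show ?thesis
  proof
    assume \<kappa>: "?\<kappa> \<in> weak_colorings N T \<sigma>"
    show "\<kappa> \<in> weak_colorings N T \<pi>"
    proof (rule weak_coloringsI)
      have "\<kappa> V \<in> {1..N}" if V: "V \<in> \<pi>" for V
      proof -
        obtain W where W: "W \<in> \<sigma>" "parent_block \<pi> W = V" using outer[OF V] by blast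
        have "?\<kappa> W \<in> {1..N}" using weak_coloringsD(2)[OF \<kappa>] W(1) by (rule PiE_mem)
        then show ?thesis using W by simp
      qed
      then show "\<kappa> \<in> \<pi> \<rightarrow>\<^sub>E {1..N}" using assms by (simp add: PiE_iff)
      fix V Us assume V: "V \<in> \<pi>" "is_chain \<pi> V Us"
      obtain W where W: "W \<in> \<sigma>" "parent_block \<pi> W = V" using outer[OF V(1)] by blast
      obtain Vs where Vs: "is_chain \<sigma> W Vs" using is_chain_exists[OF nc\<sigma> W(1)] by blast
      obtain Us' where Us': "is_chain \<pi> V Us'"
        "remdups_adj (map ?\<kappa> (W # Vs)) = remdups_adj (map \<kappa> (V # Us'))"
        using red[OF W(1) Vs] unfolding W(2) by blast
      have "Us' = Us" by (rule is_chain_unique[OF nc V(1) Us'(1) V(2)])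
      then show "remdups_adj (map \<kappa> (V # Us)) \<in> T"
        using weak_coloringsD(1)[OF \<kappa> W(1) Vs] Us'(2) by metis
    qed
  next
    assume \<kappa>: "\<kappa> \<in> weak_colorings N T \<pi>"
    show "?\<kappa> \<in> weak_colorings N T \<sigma>"
    proof (rule weak_coloringsI)
      show "?\<kappa> \<in> \<sigma> \<rightarrow>\<^sub>E {1..N}"
        using weak_coloringsD(2)[OF \<kappa>] parent_block(1) by (auto simp: PiE_iff)
      fix W Vs assume W: "W \<in> \<sigma>" "is_chain \<sigma> W Vs"
      obtain Us where Us: "is_chain \<pi> (parent_block \<pi> W) Us"
        "remdups_adj (map ?\<kappa> (W # Vs)) = remdups_adj (map \<kappa> (parent_block \<pi> W # Us))"
        using red[OF W] by blast
      show "remdups_adj (map ?\<kappa> (W # Vs)) \<in> T"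
        unfolding Us(2) by (rule weak_coloringsD(1)[OF \<kappa> parent_block(1)[OF W(1)] Us(1)])
    qed
  qed
qed

text \<open>Monochromatic edges of \<open>\<sigma>\<close> stay within a block of
  \<open>\<pi>\<close>, because an edge leaving it would cover an edge of \<open>\<pi>\<close> with
  equal colors at its ends. Conversely, inside a block \<open>V\<close> of \<open>\<pi>\<close>
  every block of \<open>\<sigma>\<close> is joined to the outer one by climbing from parent to
  parent.\<close>

lemma color_components_parent_block:
  assumes strict: "\<And>V W. covers \<pi> V W \<Longrightarrow> \<kappa> V \<noteq> \<kappa> W"
  shows "color_components \<sigma> (\<lambda>W\<in>\<sigma>. \<kappa> (parent_block \<pi> W)) = part_within \<sigma> ` \<pi>"
proof -
  note nc\<sigma> = irr_ref_nc(1)[OF nc ref]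
  let ?\<kappa> = "\<lambda>W\<in>\<sigma>. \<kappa> (parent_block \<pi> W)"
  let ?M = "mono_edges \<sigma> ?\<kappa>"
  have M\<sigma>: "P \<in> \<sigma> \<and> W \<in> \<sigma>" if "(P, W) \<in> ?M" for P W using that by (auto simp: mono_edges_def covers_def)
  have edge: "parent_block \<pi> P = parent_block \<pi> W" if "(P, W) \<in> ?M" for P W
  proof (rule ccontr)
    assume neq: "parent_block \<pi> P \<noteq> parent_block \<pi> W"
    have "\<kappa> (parent_block \<pi> P) = \<kappa> (parent_block \<pi> W)"
      using that M\<sigma>[OF that] by (auto simp: mono_edges_def)
    moreover have "covers \<sigma> P W \<or> covers \<sigma> W P" using that by (auto simp: mono_edges_def)
    ultimately show False using covers_parent_block strict neq by metis
  qed
  have reach: "W' \<in> \<sigma> \<and> parent_block \<pi> W' = parent_block \<pi> W" if "(W, W') \<in> ?M\<^sup>*" "W \<in> \<sigma>" for W W'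
    using that
  proof (induction rule: rtrancl_induct)
    case (step Y Z)
    then show ?case using edge[OF step.hyps(2)] M\<sigma>[OF step.hyps(2)] by simp
  qed simp
  have sym: "sym (?M\<^sup>*)" by (rule sym_rtrancl) (auto simp: sym_def mono_edges_def)
  have conn: "(W0, W) \<in> ?M\<^sup>*"
    if V: "V \<in> \<pi>" and W0: "W0 \<in> \<sigma>" "W0 \<subseteq> V" "Min V \<in> W0" "Max V \<in> W0" and W: "W \<in> \<sigma>" "W \<subseteq> V" for V W0 W
    using W
  proof (induction "card {U\<in>\<sigma>. encloses U W}" arbitrary: W rule: less_induct)
    case less
    have pW: "parent_block \<pi> W = V" "parent_block \<pi> W0 = V"
      using parent_block_eq[OF V] less.prems W0 by auto
    show ?case
    proof (cases "W = W0")
      case False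
      have fin: "finite V" using nc V nc_part_finite_block by blast
      obtain w where w: "w \<in> W" using irr_ref_nonempty[OF nc ref less.prems(1)] by blast
      have "w \<noteq> Min V" "w \<noteq> Max V" using nc_part_disjoint[OF nc\<sigma> less.prems(1) W0(1) w] W0(3,4) False by blast+
      moreover have "Min V \<le> w" "w \<le> Max V" using fin w less.prems(2) by auto
      ultimately have "encloses W0 W"
        using encloses_between[OF nc\<sigma> W0(1) less.prems(1) _ W0(3,4) w] False by simp
      then obtain P where P: "covers \<sigma> P W" "P = W0 \<or> encloses W0 P"
        using covers_exists[OF nc\<sigma> W0(1) less.prems(1)] by blast
      have P\<sigma>: "P \<in> \<sigma>" "encloses P W" using P(1) by (auto simp: covers_def)
      \<comment> \<open>A parent outside \<open>V\<close> would lie in a block of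
        \<open>\<pi>\<close> that is nested in \<open>V\<close>, being inside \<open>W0\<close>, and
        also surrounds \<open>V\<close>, being around \<open>W\<close>.\<close>
      have pP: "parent_block \<pi> P = V"
      proof (rule ccontr)
        assume neq: "parent_block \<pi> P \<noteq> V"
        then have "encloses W0 P" using P(2) pW by blast
        then have "encloses V (parent_block \<pi> P)"
          using encloses_parent_block[OF W0(1) P\<sigma>(1)] neq pW by metis
        moreover have "encloses (parent_block \<pi> P) V"
          using encloses_parent_block[OF P\<sigma>(1) less.prems(1) P\<sigma>(2)] neq pW by metis
        ultimately show False using nc_encloses_trans[OF nc _ _ V] nc_encloses_irrefl[OF nc V] by blast
      qed
      then have "(P, W) \<in> ?M" using P(1) P\<sigma>(1) less.prems(1) pW by (simp add: mono_edges_def)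
      moreover have "(W0, P) \<in> ?M\<^sup>*"
      proof (rule less.hyps)
        have "{U\<in>\<sigma>. encloses U P} \<subset> {U\<in>\<sigma>. encloses U W}"
          using P\<sigma> nc_encloses_trans[OF nc\<sigma> _ P\<sigma>(2) less.prems(1)] nc_encloses_irrefl[OF nc\<sigma> P\<sigma>(1)] by blast
        then show "card {U\<in>\<sigma>. encloses U P} < card {U\<in>\<sigma>. encloses U W}"
          using nc_part_finite[OF nc\<sigma>] by (intro psubset_card_mono) auto
        show "P \<in> \<sigma>" "P \<subseteq> V" using P\<sigma>(1) pP parent_block(2)[OF P\<sigma>(1)] by auto
      qed
      ultimately show ?thesis by (rule rtrancl.rtrancl_into_rtrancl[rotated])
    qed simp
  qed
  have comp: "{W'. (W, W') \<in> ?M\<^sup>*} = part_within \<sigma> (parent_block \<pi> W)" if W: "W \<in> \<sigma>" for W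
  proof
    show "{W'. (W, W') \<in> ?M\<^sup>*} \<subseteq> part_within \<sigma> (parent_block \<pi> W)"
    proof
      fix W' assume "W' \<in> {W'. (W, W') \<in> ?M\<^sup>*}"
      then have "W' \<in> \<sigma>" "parent_block \<pi> W' = parent_block \<pi> W" using reach[OF _ W] by blast+
      then show "W' \<in> part_within \<sigma> (parent_block \<pi> W)"
        using parent_block(2)[of W'] by (simp add: part_within_def)
    qed
    show "part_within \<sigma> (parent_block \<pi> W) \<subseteq> {W'. (W, W') \<in> ?M\<^sup>*}"
    proof
      fix W' assume "W' \<in> part_within \<sigma> (parent_block \<pi> W)"
      then have W': "W' \<in> \<sigma>" "W' \<subseteq> parent_block \<pi> W" by (auto simp: part_within_def)
      note V = parent_block(1)[OF W]
      obtain W0 where W0: "W0 \<in> \<sigma>" "W0 \<subseteq> parent_block \<pi> W" "Min (parent_block \<pi> W) \<in> W0" "Max (parent_block \<pi> W) \<in> W0"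
        using irr_ref_outer[OF nc ref V] by metis
      have "(W0, W) \<in> ?M\<^sup>*" "(W0, W') \<in> ?M\<^sup>*"
        using conn[OF V W0 W parent_block(2)[OF W]] conn[OF V W0 W'] by auto
      then show "W' \<in> {W'. (W, W') \<in> ?M\<^sup>*}" using sym by (auto dest: symD intro: rtrancl_trans)
    qed
  qed
  have "parent_block \<pi> ` \<sigma> = \<pi>"
  proof
    show "\<pi> \<subseteq> parent_block \<pi> ` \<sigma>"
      using irr_ref_outer[OF nc ref] parent_block_eq by (metis image_eqI subsetI)
  qed (use parent_block(1) in auto)
  then have eq: "part_within \<sigma> ` \<pi> = (\<lambda>W. part_within \<sigma> (parent_block \<pi> W)) ` \<sigma>" by (metis image_image)
  show ?thesis unfolding color_components_def eq by (rule image_cong[OF refl comp])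
qed

end

text \<open>The union of the restriction recovers the block. Products over color components are
  thereby reindexed as products over blocks of \<open>\<pi>\<close>.\<close>

lemma part_within_inj: 
  assumes "nc_part \<pi>" "\<sigma> \<in> irr_refinements \<pi>"
  shows "inj_on (part_within \<sigma>) \<pi>"
  by (rule inj_onI) (metis irr_ref_within(2)[OF assms])

section \<open>Merging the color components of a weak coloring\<close>

context
  fixes \<sigma> :: "nat set set" and \<psi> :: "nat set \<Rightarrow> nat"
  assumes nc: "nc_part \<sigma>"
begin

text \<open>The monochromatic edges oriented away from the root. Each block has at most one incoming
  edge, so every component is a rooted tree, namely \<open>below W\<close> for a unique kind of
  starting point: a block \<open>W\<close> without incoming edge.\<close>

definition down_edges :: "(nat set \<times> nat set) set" where
  "down_edges = {(P, W). covers \<sigma> P W \<and> \<psi> P = \<psi> W}"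

definition top_block :: "nat set \<Rightarrow> bool" where
  "top_block W \<longleftrightarrow> W \<in> \<sigma> \<and> (\<forall>P. (P, W) \<notin> down_edges)"

definition below :: "nat set \<Rightarrow> nat set set" where
  "below W = {W'. (W, W') \<in> down_edges\<^sup>*}"

lemma down_edgesD:
  assumes "(P, W) \<in> down_edges"
  shows "P \<in> \<sigma>" "W \<in> \<sigma>" "encloses P W" "covers \<sigma> P W" "\<psi> P = \<psi> W"
  using assms by (auto simp: down_edges_def covers_def)

lemma below_subset: "W \<in> \<sigma> \<Longrightarrow> W' \<in> below W \<Longrightarrow> W' \<in> \<sigma>"
proof -
  assume "W \<in> \<sigma>" "W' \<in> below W"
  then have "(W, W') \<in> down_edges\<^sup>*" by (simp add: below_def)
  then show "W' \<in> \<sigma>" by (induction rule: rtrancl_induct) (use \<open>W \<in> \<sigma>\<close> down_edgesD in auto)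
qed

lemma below_encloses:
  assumes "W \<in> \<sigma>" "W' \<in> below W"
  shows "W' = W \<or> encloses W W'"
proof -
  have "(W, W') \<in> down_edges\<^sup>*" using assms(2) by (simp add: below_def)
  then show ?thesis
  proof (induction rule: rtrancl_induct)
    case (step Y Z)
    note YZ = down_edgesD[OF step.hyps(2)]
    show ?case using step.IH YZ(3) nc_encloses_trans[OF nc _ YZ(3,2)] by blast
  qed simp
qed

lemma below_color:
  assumes "W' \<in> below W"
  shows "\<psi> W' = \<psi> W"
proof -
  have "(W, W') \<in> down_edges\<^sup>*" using assms by (simp add: below_def)
  then show ?thesis by (induction rule: rtrancl_induct) (auto simp: down_edges_def)
qed

text \<open>The path from \<open>W\<close> to \<open>A\<close> consists of coverings, so a block
  nested in \<open>W\<close> and surrounding \<open>A\<close> must occur on it.\<close>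

lemma below_convex:
  assumes "W \<in> \<sigma>" "A \<in> below W" "X \<in> \<sigma>" "encloses W X" "encloses X A"
  shows "X \<in> below W"
proof -
  have "(W, A) \<in> down_edges\<^sup>*" using assms(2) by (simp add: below_def)
  then show ?thesis using assms(5)
  proof (induction rule: rtrancl_induct)
    case base
    then show ?case using assms nc_encloses_trans[OF nc assms(4) base assms(1)] nc_encloses_irrefl[OF nc] by blast
  next
    case (step Y Z)
    show ?case
      using covers_encloses_cases[OF nc down_edgesD(4)[OF step.hyps(2)] assms(3) step.prems] step.IH step.hyps(1)
      by (auto simp: below_def)
  qed
qed

lemma exists_top_block:
  assumes "W \<in> \<sigma>"
  shows "\<exists>W0. top_block W0 \<and> W \<in> below W0"
  using assms
proof (induction "card {U\<in>\<sigma>. encloses U W}" arbitrary: W rule: less_induct)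
  case less
  show ?case
  proof (cases "top_block W")
    case False
    then obtain P where P: "(P, W) \<in> down_edges" using less.prems unfolding top_block_def by blast
    note P' = down_edgesD[OF P]
    have "{U\<in>\<sigma>. encloses U P} \<subset> {U\<in>\<sigma>. encloses U W}"
      using P'(1,3) nc_encloses_trans[OF nc _ P'(3) less.prems] nc_encloses_irrefl[OF nc P'(1)] by blast
    then have "card {U\<in>\<sigma>. encloses U P} < card {U\<in>\<sigma>. encloses U W}"
      using nc_part_finite[OF nc] by (intro psubset_card_mono) auto
    then obtain W0 where "top_block W0" "P \<in> below W0" using less.hyps P'(1) by blast
    then show ?thesis using P unfolding below_def by (auto intro: rtrancl.rtrancl_into_rtrancl)
  qed (auto simp: below_def)
qed

text \<open>An edge traversed upwards leads to the parent, which is unique; below a top block this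
  parent is the predecessor on the path from the top.\<close>

lemma below_closed:
  assumes "top_block W0" "(W, W') \<in> mono_edges \<sigma> \<psi>" "W \<in> below W0"
  shows "W' \<in> below W0"
proof -
  consider "(W, W') \<in> down_edges" | "(W', W) \<in> down_edges"
    using assms(2) by (auto simp: mono_edges_def down_edges_def)
  then show ?thesis
  proof cases
    case 1
    then show ?thesis using assms(3) unfolding below_def by (auto intro: rtrancl.rtrancl_into_rtrancl)
  next
    case 2
    then have "W \<noteq> W0" using assms(1) unfolding top_block_def by blast
    moreover have "(W0, W) \<in> down_edges\<^sup>*" using assms(3) by (simp add: below_def)
    ultimately obtain P where P: "(W0, P) \<in> down_edges\<^sup>*" "(P, W) \<in> down_edges"
      by (metis rtranclE)
    then have "P = W'" using covers_unique[OF nc] down_edgesD(4)[OF 2] down_edgesD(4)[OF P(2)] by blast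
    then show ?thesis using P(1) by (simp add: below_def)
  qed
qed

lemma component_eq_below:
  assumes W0: "top_block W0" and W: "W \<in> below W0"
  shows "{W'. (W, W') \<in> (mono_edges \<sigma> \<psi>)\<^sup>*} = below W0"
proof
  have sym: "sym ((mono_edges \<sigma> \<psi>)\<^sup>*)" by (rule sym_rtrancl) (auto simp: sym_def mono_edges_def)
  have sub: "down_edges \<subseteq> mono_edges \<sigma> \<psi>" by (auto simp: down_edges_def mono_edges_def)
  have "W' \<in> below W0" if "(W, W') \<in> (mono_edges \<sigma> \<psi>)\<^sup>*" for W'
    using that by (induction rule: rtrancl_induct) (use W below_closed[OF W0] in blast)+
  then show "{W'. (W, W') \<in> (mono_edges \<sigma> \<psi>)\<^sup>*} \<subseteq> below W0" by blast
  have reach: "(W0, W') \<in> (mono_edges \<sigma> \<psi>)\<^sup>*" if "W' \<in> below W0" for W'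
    using that rtrancl_mono[OF sub] unfolding below_def by blast
  show "below W0 \<subseteq> {W'. (W, W') \<in> (mono_edges \<sigma> \<psi>)\<^sup>*}"
    using rtrancl_trans[OF symD[OF sym reach[OF W]] reach] by blast
qed

lemma color_components_below: "color_components \<sigma> \<psi> = below ` Collect top_block"
proof
  show "color_components \<sigma> \<psi> \<subseteq> below ` Collect top_block"
  proof
    fix C assume "C \<in> color_components \<sigma> \<psi>"
    then obtain W where W: "W \<in> \<sigma>" "C = {W'. (W, W') \<in> (mono_edges \<sigma> \<psi>)\<^sup>*}"
      unfolding color_components_def by (rule imageE)
    then obtain W0 where "top_block W0" "W \<in> below W0" using exists_top_block by blast
    then show "C \<in> below ` Collect top_block" using component_eq_below W(2) by blast
  qed
  show "below ` Collect top_block \<subseteq> color_components \<sigma> \<psi>"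
  proof
    fix C assume "C \<in> below ` Collect top_block"
    then obtain W0 where W0: "top_block W0" "C = below W0" by blast
    have "C = {W'. (W0, W') \<in> (mono_edges \<sigma> \<psi>)\<^sup>*}"
      unfolding W0(2) by (rule component_eq_below[OF W0(1), symmetric]) (simp add: below_def)
    then show "C \<in> color_components \<sigma> \<psi>" unfolding color_components_def using W0(1)
      by (simp add: top_block_def)
  qed
qed

lemma below_eq:
  assumes "top_block W1" "top_block W2" "W \<in> below W1" "W \<in> below W2"
  shows "below W1 = below W2"
  using component_eq_below[OF assms(1,3)] component_eq_below[OF assms(2,4)] by simp

lemma below_hull:
  assumes "W \<in> \<sigma>" "x \<in> \<Union>(below W)"
  shows "Min W \<le> x" "x \<le> Max W"
proof -
  obtain A where A: "A \<in> below W" "x \<in> A" using assms(2) by blast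
  have fin: "finite W" using nc assms(1) nc_part_finite_block by blast
  have "Min W \<le> x \<and> x \<le> Max W"
  proof (cases "A = W")
    case False
    then have "encloses W A" using below_encloses[OF assms(1) A(1)] by blast
    then obtain j k where "j \<in> W" "k \<in> W" "j < x" "x < k" using A(2) unfolding encloses_def by blast
    then show ?thesis using fin by (meson Max_ge Min_le less_imp_le order_trans)
  qed (use A fin in auto)
  then show "Min W \<le> x" "x \<le> Max W" by auto
qed

text \<open>If two components crossed, the top block of one would be nested in the top block of the
  other; convexity of the components then identifies them.\<close>

lemma below_nested_eq:
  assumes W1: "top_block W1" and W2: "top_block W2" and enc: "encloses W1 W2"
    and x: "x \<in> \<Union>(below W1)" "Min W2 < x" "x < Max W2"
  shows "below W1 = below W2"
proof -
  have \<sigma>: "W1 \<in> \<sigma>" "W2 \<in> \<sigma>" using W1 W2 by (auto simp: top_block_def)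
  obtain A where A: "A \<in> below W1" "x \<in> A" using x(1) by blast
  have A\<sigma>: "A \<in> \<sigma>" by (rule below_subset[OF \<sigma>(1) A(1)])
  have fin: "finite W2" "W2 \<noteq> {}" using nc \<sigma>(2) nc_part_finite_block nc_part_nonempty by auto
  have self: "W2 \<in> below W2" by (simp add: below_def)
  show ?thesis
  proof (cases "A = W2")
    case True
    then show ?thesis using below_eq[OF W1 W2 _ self] A(1) by simp
  next
    case False
    have encA: "encloses W2 A"
      by (rule encloses_between[OF nc \<sigma>(2) A\<sigma> _ Min_in[OF fin] Max_in[OF fin] A(2) x(2,3)]) (use False in blast)
    have "W2 \<in> below W1" by (rule below_convex[OF \<sigma>(1) A(1) \<sigma>(2) enc encA])
    then show ?thesis using below_eq[OF W1 W2 _ self] by blast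
  qed
qed

text \<open>Compare the minima of the two top blocks. The block that begins first surrounds the
  other, because the crossing makes their hulls overlap, and then \<open>c\<close> or
  \<open>b\<close>, respectively, is a point of the outer component strictly inside the hull of the
  inner top block.\<close>

lemma below_noncrossing:
  assumes W1: "top_block W1" and W2: "top_block W2"
    and abcd: "a \<in> \<Union>(below W1)" "b \<in> \<Union>(below W2)" "c \<in> \<Union>(below W1)" "d \<in> \<Union>(below W2)" "a < b" "b < c" "c < d"
  shows "below W1 = below W2"
proof (cases "W1 = W2")
  case False
  have \<sigma>: "W1 \<in> \<sigma>" "W2 \<in> \<sigma>" using W1 W2 by (auto simp: top_block_def)
  have fin: "finite W1" "W1 \<noteq> {}" "finite W2" "W2 \<noteq> {}"
    using nc \<sigma> nc_part_finite_block nc_part_nonempty by auto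
  note hull = below_hull[OF \<sigma>(1) abcd(1)] below_hull[OF \<sigma>(2) abcd(2)]
    below_hull[OF \<sigma>(1) abcd(3)] below_hull[OF \<sigma>(2) abcd(4)]
  have neq: "Min W1 \<noteq> Min W2"
    using nc_part_disjoint[OF nc \<sigma> Min_in[OF fin(1,2)]] Min_in[OF fin(3,4)] False by metis
  show ?thesis
  proof (cases "Min W1 < Min W2")
    case True
    have "encloses W1 W2"
      by (rule encloses_between[OF nc \<sigma> False Min_in[OF fin(1,2)] Max_in[OF fin(1,2)] Min_in[OF fin(3,4)] True])
        (use hull abcd in linarith)
    then show ?thesis using below_nested_eq[OF W1 W2 _ abcd(3)] hull abcd by linarith
  next
    case F: False
    have "encloses W2 W1"
      by (rule encloses_between[OF nc \<sigma>(2,1) False[symmetric] Min_in[OF fin(3,4)] Max_in[OF fin(3,4)] Min_in[OF fin(1,2)]])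
        (use hull abcd neq F in linarith)+
    then show ?thesis using below_nested_eq[OF W2 W1 _ abcd(2)] hull abcd by (metis le_less_trans less_le_trans)
  qed
qed simp

definition merged :: "nat set set" where
  "merged = Union ` color_components \<sigma> \<psi>"

lemma merged_iff: "V \<in> merged \<longleftrightarrow> (\<exists>W. top_block W \<and> V = \<Union>(below W))"
  unfolding merged_def color_components_below by blast

lemma Union_merged: "\<Union>merged = \<Union>\<sigma>"
proof
  show "\<Union>merged \<subseteq> \<Union>\<sigma>"
    using color_components_le unfolding merged_def by blast
  show "\<Union>\<sigma> \<subseteq> \<Union>merged"
  proof
    fix x assume "x \<in> \<Union>\<sigma>"
    then obtain W where W: "W \<in> \<sigma>" "x \<in> W" by blast
    then obtain W0 where "top_block W0" "W \<in> below W0" using exists_top_block by blast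
    then show "x \<in> \<Union>merged" using W(2) merged_iff by blast
  qed
qed

lemma nc_part_merged: "nc_part merged"
proof -
  have "{} \<notin> merged"
  proof
    assume "{} \<in> merged"
    then obtain W where W: "top_block W" "\<Union>(below W) = {}" using merged_iff by metis
    have "W \<in> below W" by (simp add: below_def)
    then show False using W nc_part_nonempty[OF nc] unfolding top_block_def by blast
  qed
  moreover have "V = V'" if V: "V \<in> merged" "V' \<in> merged" "x \<in> V" "x \<in> V'" for V V' x
  proof -
    obtain W W' where W: "top_block W" "V = \<Union>(below W)" "top_block W'" "V' = \<Union>(below W')"
      using V(1,2) merged_iff by metis
    obtain A A' where A: "A \<in> below W" "x \<in> A" "A' \<in> below W'" "x \<in> A'" using V(3,4) W by blast
    have "A \<in> \<sigma>" "A' \<in> \<sigma>" using A below_subset W unfolding top_block_def by blast+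
    then have "A = A'" using nc_part_disjoint[OF nc] A by blast
    then show ?thesis using below_eq[OF W(1,3)] A W by metis
  qed
  then have "disjoint merged" unfolding disjoint_def by blast
  moreover have "V = V'" if V: "V \<in> merged" "V' \<in> merged" "a \<in> V" "b \<in> V'" "c \<in> V" "d \<in> V'" "a < b" "b < c" "c < d" for V V' a b c d
  proof -
    obtain W W' where W: "top_block W" "V = \<Union>(below W)" "top_block W'" "V' = \<Union>(below W')"
      using V(1,2) merged_iff by metis
    have "below W = below W'"
      by (rule below_noncrossing[OF W(1,3) _ _ _ _ V(7-9)]) (use V(3-6) W in auto)
    then show ?thesis using W by simp
  qed
  then have "noncrossing merged" unfolding noncrossing_def by blast
  ultimately show ?thesis
    unfolding nc_part_iff Union_merged using nc_part_finite_Union[OF nc] by blast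
qed

lemma part_within_merged:
  assumes "top_block W0"
  shows "part_within \<sigma> (\<Union>(below W0)) = below W0"
proof
  have W0: "W0 \<in> \<sigma>" using assms by (simp add: top_block_def)
  show "below W0 \<subseteq> part_within \<sigma> (\<Union>(below W0))"
    using below_subset[OF W0] unfolding part_within_def by blast
  show "part_within \<sigma> (\<Union>(below W0)) \<subseteq> below W0"
  proof
    fix W assume "W \<in> part_within \<sigma> (\<Union>(below W0))"
    then have W: "W \<in> \<sigma>" "W \<subseteq> \<Union>(below W0)" by (auto simp: part_within_def)
    obtain x where "x \<in> W" using nc_part_nonempty[OF nc W(1)] by blast
    then obtain A where A: "A \<in> below W0" "x \<in> A" using W(2) by blast
    then show "W \<in> below W0"
      using nc_part_disjoint[OF nc W(1) below_subset[OF W0 A(1)] \<open>x \<in> W\<close>] by metis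
  qed
qed

text \<open>Each component is irreducible as a partition of its union, since its top block contains
  both the minimum and the maximum.\<close>

lemma merged_refinement: "\<sigma> \<in> irr_refinements merged"
proof -
  have "\<exists>V\<in>merged. W \<subseteq> V" if W: "W \<in> \<sigma>" for W
  proof -
    obtain W0 where "top_block W0" "W \<in> below W0" using exists_top_block[OF W] by blast
    then show ?thesis using merged_iff by blast
  qed
  moreover have "part_within \<sigma> V \<in> NC_irr V" if V: "V \<in> merged" for V
  proof -
    obtain W0 where W0: "top_block W0" "V = \<Union>(below W0)" using V merged_iff by metis
    have \<sigma>: "W0 \<in> \<sigma>" using W0 by (simp add: top_block_def)
    have self: "W0 \<in> below W0" by (simp add: below_def)
    have fin: "finite V" by (rule nc_part_finite_block[OF nc_part_merged V])
    have pw: "part_within \<sigma> V = below W0" unfolding W0(2) by (rule part_within_merged[OF W0(1)])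
    have finW: "finite W0" "W0 \<noteq> {}" using nc \<sigma> nc_part_finite_block nc_part_nonempty by auto
    have "Min V = Min W0"
      using below_hull(1)[OF \<sigma>] Min_in[OF finW] self unfolding W0(2)
      by (intro Min_eqI) (use fin W0(2) in auto)
    moreover have "Max V = Max W0"
      using below_hull(2)[OF \<sigma>] Max_in[OF finW] self unfolding W0(2)
      by (intro Max_eqI) (use fin W0(2) in auto)
    moreover have "nc_part (below W0)" using below_subset[OF \<sigma>] by (intro nc_part_subset[OF nc]) blast
    ultimately show ?thesis
      unfolding pw NC_irr_iff[OF fin] using W0(2) self Min_in[OF finW] Max_in[OF finW] by auto
  qed
  ultimately show ?thesis unfolding irr_refinements_def by blast
qed

text \<open>Any block of \<open>\<sigma>\<close> inside \<open>V\<close> may be chosen, as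
  components are monochromatic. The restriction makes the coloring extensional, as colorings are
  required to be.\<close>

definition merged_coloring :: "nat set \<Rightarrow> nat" where
  "merged_coloring = (\<lambda>V\<in>merged. \<psi> (SOME W. W \<in> \<sigma> \<and> W \<subseteq> V))"

lemma merged_coloring_parent:
  assumes W: "W \<in> \<sigma>"
  shows "merged_coloring (parent_block merged W) = \<psi> W"
proof -
  let ?V = "parent_block merged W"
  have V: "?V \<in> merged" "W \<subseteq> ?V" using parent_block[OF nc_part_merged merged_refinement W] by auto
  obtain W0 where W0: "top_block W0" "?V = \<Union>(below W0)" using V(1) merged_iff by metis
  have col: "\<psi> W' = \<psi> W0" if "W' \<in> \<sigma> \<and> W' \<subseteq> ?V" for W'
  proof -
    have "W' \<in> part_within \<sigma> ?V" using that by (simp add: part_within_def)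
    then have "W' \<in> below W0" unfolding W0(2) part_within_merged[OF W0(1)] .
    then show ?thesis by (rule below_color)
  qed
  have "\<psi> (SOME W'. W' \<in> \<sigma> \<and> W' \<subseteq> ?V) = \<psi> W0"
    by (rule col, rule someI[of _ W]) (use W V in blast)
  then show ?thesis unfolding merged_coloring_def using V(1) col[of W] W V(2) by simp
qed

text \<open>Let \<open>W2\<close> be the top block of the inner component and \<open>P\<close> its
  parent in \<open>\<sigma>\<close>. Then \<open>P\<close> lies in \<open>V1\<close>, so equal
  colors would give an edge from \<open>P\<close> into a top block.\<close>

lemma merged_coloring_strict:
  assumes "covers merged V1 V2"
  shows "merged_coloring V1 \<noteq> merged_coloring V2"
proof
  assume eq: "merged_coloring V1 = merged_coloring V2"
  note ncm = nc_part_merged and ref = merged_refinement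
  have V: "V1 \<in> merged" "V2 \<in> merged" "encloses V1 V2" using assms by (auto simp: covers_def)
  obtain W2 where W2: "top_block W2" "V2 = \<Union>(below W2)" using V(2) merged_iff by metis
  have \<sigma>: "W2 \<in> \<sigma>" using W2 by (simp add: top_block_def)
  have "W2 \<in> below W2" by (simp add: below_def)
  then have p2: "parent_block merged W2 = V2"
    using W2(2) by (intro parent_block_eq[OF ncm ref V(2) \<sigma>]) blast
  \<comment> \<open>A block around \<open>W2\<close> is needed for the parent to exist; the outer
    block of the restriction to \<open>V1\<close> provides it.\<close>
  obtain Y where Y: "Y \<in> \<sigma>" "encloses Y W2"
    using encloses_outer[OF ncm ref V(1) \<sigma>] V(3) p2 by metis
  obtain P where P: "covers \<sigma> P W2" using covers_exists[OF nc Y(1) \<sigma> Y(2)] by blast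
  have P\<sigma>: "P \<in> \<sigma>" "encloses P W2" using P by (auto simp: covers_def)
  have "parent_block merged P \<noteq> parent_block merged W2"
  proof
    assume "parent_block merged P = parent_block merged W2"
    then have "P \<in> part_within \<sigma> V2"
      using p2 parent_block(2)[OF ncm ref P\<sigma>(1)] P\<sigma>(1) by (simp add: part_within_def)
    then have "P \<in> below W2" unfolding W2(2) part_within_merged[OF W2(1)] .
    then have "P = W2 \<or> encloses W2 P" by (rule below_encloses[OF \<sigma>])
    then show False
      using P\<sigma> nc_encloses_trans[OF nc _ P\<sigma>(2) \<sigma>] nc_encloses_irrefl[OF nc \<sigma>] by blast
  qed
  then have "covers merged (parent_block merged P) V2" using covers_parent_block[OF ncm ref P] p2 by simp
  then have "parent_block merged P = V1" using covers_unique[OF ncm _ assms] by blast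
  then have "\<psi> P = \<psi> W2"
    using merged_coloring_parent[OF P\<sigma>(1)] merged_coloring_parent[OF \<sigma>] p2 eq by simp
  then have "(P, W2) \<in> down_edges" using P by (simp add: down_edges_def)
  then show False using W2(1) by (simp add: top_block_def)
qed

end

lemma finite_strict_colorings: "finite \<pi> \<Longrightarrow> finite (strict_colorings N T \<pi>)"
  unfolding strict_colorings_def using finite_weak_colorings by simp

text \<open>The weights match because the components of the pulled back coloring are the
  restrictions of \<open>\<sigma>\<close> to the blocks of \<open>\<pi>\<close>. The summand
  \<open>F\<close> depends on \<open>\<sigma>\<close> alone, which both witness maps leave
  unchanged.\<close>

lemma sum_weak_colorings:
  fixes F :: "nat set set \<Rightarrow> 'v::real_vector" and \<alpha> :: "nat set set \<Rightarrow> real"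
  assumes fin: "finite S"
  shows "(\<Sum>\<sigma>\<in>NC S. \<Sum>\<psi>\<in>weak_colorings N T \<sigma>. (\<Prod>C\<in>color_components \<sigma> \<psi>. \<alpha> C) *\<^sub>R F \<sigma>) =
    (\<Sum>\<pi>\<in>NC S. \<Sum>\<kappa>\<in>strict_colorings N T \<pi>. \<Sum>\<sigma>\<in>irr_refinements \<pi>.
       (\<Prod>V\<in>\<pi>. \<alpha> (part_within \<sigma> V)) *\<^sub>R F \<sigma>)"
proof -
  let ?A = "SIGMA \<sigma>:NC S. weak_colorings N T \<sigma>"
  let ?B = "SIGMA \<pi>:NC S. strict_colorings N T \<pi> \<times> irr_refinements \<pi>"
  let ?i = "\<lambda>(\<pi>, \<kappa>, \<sigma>). (\<sigma>, \<lambda>W\<in>\<sigma>. (\<kappa> (parent_block \<pi> W) :: nat))"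
  let ?j = "\<lambda>(\<sigma>, \<psi>). (merged \<sigma> \<psi>, merged_coloring \<sigma> \<psi>, \<sigma>)"
  have ncD: "nc_part \<pi>" "\<Union>\<pi> = S" if "\<pi> \<in> NC S" for \<pi> using that nc_part_NC[OF fin] by auto
  have undo: "(\<lambda>W\<in>\<sigma>. merged_coloring \<sigma> \<psi> (parent_block (merged \<sigma> \<psi>) W)) = \<psi>"
    if nc: "nc_part \<sigma>" and ext: "\<psi> \<in> extensional \<sigma>" for \<sigma> \<psi>
    using merged_coloring_parent[OF nc] ext by (auto simp: fun_eq_iff extensional_def)
  have "(\<Sum>(\<sigma>, \<psi>)\<in>?A. (\<Prod>C\<in>color_components \<sigma> \<psi>. \<alpha> C) *\<^sub>R F \<sigma>) =
    (\<Sum>(\<pi>, \<kappa>, \<sigma>)\<in>?B. (\<Prod>V\<in>\<pi>. \<alpha> (part_within \<sigma> V)) *\<^sub>R F \<sigma>)"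
  proof (rule sum.reindex_bij_witness[where i = ?i and j = ?j])
    fix p assume p: "p \<in> ?A"
    obtain \<sigma> \<psi> where p_eq: "p = (\<sigma>, \<psi>)" by (cases p)
    have \<sigma>: "\<sigma> \<in> NC S" and \<psi>: "\<psi> \<in> weak_colorings N T \<sigma>" using p unfolding p_eq by auto
    note nc = ncD[OF \<sigma>]
    have ext: "\<psi> \<in> extensional \<sigma>" using weak_coloringsD(2)[OF \<psi>] by (simp add: PiE_iff)
    note bk = undo[OF nc(1) ext]
    show "?i (?j p) = p" unfolding p_eq prod.case bk ..
    have mext: "merged_coloring \<sigma> \<psi> \<in> extensional (merged \<sigma> \<psi>)"
      unfolding merged_coloring_def[OF nc(1)] by simp
    note ncm = nc_part_merged[OF nc(1), of \<psi>] and ref = merged_refinement[OF nc(1), of \<psi>]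
    have "merged \<sigma> \<psi> \<in> NC S"
      unfolding nc_part_NC[OF fin] using ncm Union_merged[OF nc(1)] nc(2) by simp
    moreover have "merged_coloring \<sigma> \<psi> \<in> strict_colorings N T (merged \<sigma> \<psi>)"
      unfolding strict_colorings_def
      using weak_colorings_parent_block[OF ncm ref mext] \<psi> merged_coloring_strict[OF nc(1)]
      unfolding bk by simp
    ultimately show "?j p \<in> ?B" unfolding p_eq using ref by simp
    have "color_components \<sigma> \<psi> = part_within \<sigma> ` merged \<sigma> \<psi>"
      by (subst bk[symmetric], rule color_components_parent_block[OF ncm ref], rule merged_coloring_strict[OF nc(1)])
    then have "(\<Prod>C\<in>color_components \<sigma> \<psi>. \<alpha> C) = (\<Prod>V\<in>merged \<sigma> \<psi>. \<alpha> (part_within \<sigma> V))"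
      by (simp add: prod.reindex[OF part_within_inj[OF ncm ref]])
    then show "(case ?j p of (\<pi>, \<kappa>, \<sigma>) \<Rightarrow> (\<Prod>V\<in>\<pi>. \<alpha> (part_within \<sigma> V)) *\<^sub>R F \<sigma>)
        = (case p of (\<sigma>, \<psi>) \<Rightarrow> (\<Prod>C\<in>color_components \<sigma> \<psi>. \<alpha> C) *\<^sub>R F \<sigma>)"
      unfolding p_eq by simp
  next
    fix q assume q: "q \<in> ?B"
    obtain \<pi> \<kappa> \<sigma> where q_eq: "q = (\<pi>, \<kappa>, \<sigma>)" by (cases q)
    have \<pi>: "\<pi> \<in> NC S" and \<kappa>: "\<kappa> \<in> strict_colorings N T \<pi>" and ref: "\<sigma> \<in> irr_refinements \<pi>"
      using q unfolding q_eq by auto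
    note nc = ncD[OF \<pi>]
    have w: "\<kappa> \<in> weak_colorings N T \<pi>" and strict: "\<And>V W. covers \<pi> V W \<Longrightarrow> \<kappa> V \<noteq> \<kappa> W"
      using \<kappa> unfolding strict_colorings_def by auto
    have ext: "\<kappa> \<in> extensional \<pi>" using weak_coloringsD(2)[OF w] by (simp add: PiE_iff)
    let ?\<psi> = "\<lambda>W\<in>\<sigma>. \<kappa> (parent_block \<pi> W)"
    have cc: "color_components \<sigma> ?\<psi> = part_within \<sigma> ` \<pi>"
      by (rule color_components_parent_block[OF nc(1) ref strict])
    note nc\<sigma> = irr_ref_nc(1)[OF nc(1) ref]
    have m: "merged \<sigma> ?\<psi> = \<pi>"
      unfolding merged_def[OF nc\<sigma>] cc image_image using irr_ref_within(2)[OF nc(1) ref] by simp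
    have "merged_coloring \<sigma> ?\<psi> V = \<kappa> V" for V
    proof (cases "V \<in> \<pi>")
      case True
      have ex: "\<exists>W. W \<in> \<sigma> \<and> W \<subseteq> V" using irr_ref_outer[OF nc(1) ref True] by metis
      define W where "W = (SOME W. W \<in> \<sigma> \<and> W \<subseteq> V)"
      have W: "W \<in> \<sigma>" "W \<subseteq> V" using someI_ex[OF ex] unfolding W_def by auto
      have "?\<psi> W = \<kappa> V" using W parent_block_eq[OF nc(1) ref True W] by simp
      then show ?thesis unfolding merged_coloring_def[OF nc\<sigma>] m using True W by (simp flip: W_def)
    next
      case False
      then show ?thesis using ext unfolding merged_coloring_def[OF nc\<sigma>] m by (simp add: extensional_def)
    qed
    then show "?j (?i q) = q" unfolding q_eq by (simp add: m fun_eq_iff)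
    have "\<sigma> \<in> NC S" unfolding nc_part_NC[OF fin] using irr_ref_nc[OF nc(1) ref] nc(2) by simp
    then show "?i q \<in> ?A"
      unfolding q_eq using weak_colorings_parent_block[OF nc(1) ref ext] w by simp
  qed
  moreover have "(\<Sum>(\<sigma>, \<psi>)\<in>?A. (\<Prod>C\<in>color_components \<sigma> \<psi>. \<alpha> C) *\<^sub>R F \<sigma>) =
    (\<Sum>\<sigma>\<in>NC S. \<Sum>\<psi>\<in>weak_colorings N T \<sigma>. (\<Prod>C\<in>color_components \<sigma> \<psi>. \<alpha> C) *\<^sub>R F \<sigma>)"
    using fin finite_NC finite_weak_colorings nc_part_finite ncD(1) by (subst sum.Sigma) auto
  moreover have "(\<Sum>(\<pi>, \<kappa>, \<sigma>)\<in>?B. (\<Prod>V\<in>\<pi>. \<alpha> (part_within \<sigma> V)) *\<^sub>R F \<sigma>) =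
    (\<Sum>\<pi>\<in>NC S. \<Sum>(\<kappa>, \<sigma>)\<in>strict_colorings N T \<pi> \<times> irr_refinements \<pi>. (\<Prod>V\<in>\<pi>. \<alpha> (part_within \<sigma> V)) *\<^sub>R F \<sigma>)"
    using fin finite_NC finite_strict_colorings nc_part_finite ncD(1) finite_irr_refinements
    by (subst sum.Sigma) (auto simp: split_def)
  ultimately show ?thesis by (simp add: sum.cartesian_product)
qed

section \<open>Reading a word from right to left with a stack of open blocks\<close>

text \<open>Reduction acts as the identity exactly on alternating strings, and all strings of
  \<open>T\<close> alternate. This replaces the two conditions of \<open>strict_colorings\<close> by
  one that a stack of colors can check directly.\<close>

lemma strict_colorings_iff:
  assumes nc: "nc_part \<pi>" and T: "T \<subseteq> free_tree N"
  shows "\<kappa> \<in> strict_colorings N T \<pi> \<longleftrightarrow> \<kappa> \<in> \<pi> \<rightarrow>\<^sub>E {1..N} \<and>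
    (\<forall>V\<in>\<pi>. \<forall>Vs. is_chain \<pi> V Vs \<longrightarrow> map \<kappa> (V # Vs) \<in> T)"
proof
  assume *: "\<kappa> \<in> strict_colorings N T \<pi>"
  then have w: "\<kappa> \<in> weak_colorings N T \<pi>" and strict: "\<And>V W. covers \<pi> V W \<Longrightarrow> \<kappa> V \<noteq> \<kappa> W"
    unfolding strict_colorings_def by auto
  have adj: "distinct_adj (map \<kappa> (V # Vs))" if "V \<in> \<pi>" "is_chain \<pi> V Vs" for V Vs
    using that
  proof (induction Vs arbitrary: V)
    case (Cons P Ps)
    have P: "covers \<pi> P V" "is_chain \<pi> P Ps" using is_chain_Cons_iff[OF nc Cons.prems(1)] Cons.prems(2) by auto
    then have "distinct_adj (map \<kappa> (P # Ps))" using Cons.IH by (simp add: covers_def)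
    moreover have "\<kappa> V \<noteq> \<kappa> P" using strict[OF P(1)] by simp
    ultimately show ?case by simp
  qed simp
  have "map \<kappa> (V # Vs) \<in> T" if "V \<in> \<pi>" "is_chain \<pi> V Vs" for V Vs
    using weak_coloringsD(1)[OF w that] adj[OF that] by (metis distinct_adj_altdef)
  then show "\<kappa> \<in> \<pi> \<rightarrow>\<^sub>E {1..N} \<and> (\<forall>V\<in>\<pi>. \<forall>Vs. is_chain \<pi> V Vs \<longrightarrow> map \<kappa> (V # Vs) \<in> T)"
    using weak_coloringsD(2)[OF w] by blast
next
  assume *: "\<kappa> \<in> \<pi> \<rightarrow>\<^sub>E {1..N} \<and> (\<forall>V\<in>\<pi>. \<forall>Vs. is_chain \<pi> V Vs \<longrightarrow> map \<kappa> (V # Vs) \<in> T)"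
  have adj: "distinct_adj (map \<kappa> (V # Vs))" if "V \<in> \<pi>" "is_chain \<pi> V Vs" for V Vs
    using * that T unfolding free_tree_def by blast
  have "\<kappa> \<in> weak_colorings N T \<pi>"
  proof (rule weak_coloringsI)
    show "remdups_adj (map \<kappa> (V # Vs)) \<in> T" if V: "V \<in> \<pi>" "is_chain \<pi> V Vs" for V Vs
    proof -
      have "remdups_adj (map \<kappa> (V # Vs)) = map \<kappa> (V # Vs)"
        using adj[OF V] by (metis distinct_adj_altdef)
      then show ?thesis using * V by metis
    qed
  qed (use * in blast)
  moreover have "\<kappa> V \<noteq> \<kappa> W" if cov: "covers \<pi> V W" for V W
  proof -
    have VW: "V \<in> \<pi>" "W \<in> \<pi>" using cov by (auto simp: covers_def)
    obtain Vs where "is_chain \<pi> V Vs" using is_chain_exists[OF nc VW(1)] by blast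
    then have "is_chain \<pi> W (V # Vs)" using is_chain_Cons_iff[OF nc VW(2)] cov by blast
    from adj[OF VW(2) this] show ?thesis by auto
  qed
  ultimately show "\<kappa> \<in> strict_colorings N T \<pi>" unfolding strict_colorings_def by blast
qed

section \<open>Stacks of open blocks and the partitions that complete them\<close>

definition stack_ground :: "(nat \<times> nat set) list \<Rightarrow> nat set" where
  "stack_ground stk = \<Union>(snd ` set stk)"

text \<open>The entries run from the innermost open block outwards. Open blocks are nested around
  the unread positions, so their parts beyond \<open>p\<close> follow each other from left to right
  in this order, and the colors spell a string of the tree.\<close>

definition stack_ok :: "nat list set \<Rightarrow> nat \<Rightarrow> (nat \<times> nat set) list \<Rightarrow> bool" where
  "stack_ok T p stk \<longleftrightarrow> map fst stk \<in> T \<and> (\<forall>(j, J)\<in>set stk. finite J \<and> J \<noteq> {} \<and> (\<forall>x\<in>J. p < x))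
     \<and> sorted_wrt (\<lambda>(_, I) (_, J). \<forall>x\<in>I. \<forall>y\<in>J. x < y) stk"

text \<open>An entry \<open>(j, J)\<close> of the stack is the part beyond \<open>p\<close> of a block of color \<open>j\<close> that
  also has elements below.\<close>

definition open_blocks :: "nat \<Rightarrow> (nat \<times> nat set) list \<Rightarrow> nat set set \<Rightarrow> (nat set \<Rightarrow> nat) \<Rightarrow> bool" where
  "open_blocks p stk \<pi> \<kappa> \<longleftrightarrow> (\<forall>(j, J)\<in>set stk. \<exists>V\<in>\<pi>. V - {..p} = J \<and> V \<noteq> J \<and> \<kappa> V = j)"

text \<open>All ways of finishing the open blocks when the positions 1 to \<open>p\<close> are still
  to be read. They index the terms that the remaining letters contribute to the vacuum
  expectation.\<close>

definition configs :: "nat \<Rightarrow> nat list set \<Rightarrow> nat \<Rightarrow> (nat \<times> nat set) list \<Rightarrow> (nat set set \<times> (nat set \<Rightarrow> nat)) set" where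
  "configs N T p stk = {(\<pi>, \<kappa>). \<pi> \<in> NC ({1..p} \<union> stack_ground stk) \<and>
     \<kappa> \<in> strict_colorings N T \<pi> \<and> open_blocks p stk \<pi> \<kappa>}"

lemma open_blocksD:
  "open_blocks p stk \<pi> \<kappa> \<Longrightarrow> (j, J) \<in> set stk \<Longrightarrow> \<exists>V\<in>\<pi>. V - {..p} = J \<and> V \<noteq> J \<and> \<kappa> V = j"
  unfolding open_blocks_def by (drule (1) bspec) simp

lemma stack_okD:
  assumes "stack_ok T p stk" "(j, J) \<in> set stk"
  shows "finite J" "J \<noteq> {}" "x \<in> J \<Longrightarrow> p < x"
proof -
  have "\<forall>(j, J)\<in>set stk. finite J \<and> J \<noteq> {} \<and> (\<forall>x\<in>J. p < x)" using assms(1) by (simp add: stack_ok_def)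
  from bspec[OF this assms(2)] show "finite J" "J \<noteq> {}" "x \<in> J \<Longrightarrow> p < x" by simp_all
qed

lemma stack_ground_iff: "x \<in> stack_ground stk \<longleftrightarrow> (\<exists>j J. (j, J) \<in> set stk \<and> x \<in> J)"
  unfolding stack_ground_def by force

lemma finite_stack_ground: "stack_ok T p stk \<Longrightarrow> finite (stack_ground stk)"
  unfolding stack_ground_def using stack_okD(1)[of T p stk] by auto

lemma stack_ground_gt: "stack_ok T p stk \<Longrightarrow> x \<in> stack_ground stk \<Longrightarrow> p < x"
  unfolding stack_ground_iff using stack_okD(3) by blast

text \<open>A block around \<open>V\<close> has a point beyond \<open>V\<close>, which must belong
  to an entry of the stack. Conversely the block of an entry has a point beyond \<open>q\<close>,
  and a point at most \<open>q\<close> because it differs from its remnant; the latter is not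
  \<open>q\<close>, which belongs to \<open>V\<close>. So the blocks around \<open>V\<close> are
  exactly the open ones, in the order of the stack.\<close>

lemma chain_of_stack:
  assumes nc: "nc_part \<pi>" and V: "V \<in> \<pi>" "q \<in> V"
    and ok: "stack_ok T q stk" and op: "open_blocks q stk \<pi> \<kappa>"
    and less: "\<And>x y. x \<in> V \<Longrightarrow> y \<in> stack_ground stk \<Longrightarrow> x < y"
    and ground: "\<And>x. x \<in> \<Union>\<pi> \<Longrightarrow> q < x \<Longrightarrow> x \<notin> V \<Longrightarrow> x \<in> stack_ground stk"
    and ch: "is_chain \<pi> V Vs"
  shows "map \<kappa> Vs = map fst stk"
proof -
  define blk where "blk = (\<lambda>(j, J). SOME B. B \<in> \<pi> \<and> B - {..q} = J \<and> B \<noteq> J \<and> \<kappa> B = j)"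
  have blk: "blk (j, J) \<in> \<pi>" "blk (j, J) - {..q} = J" "blk (j, J) \<noteq> J" "\<kappa> (blk (j, J)) = j"
    if "(j, J) \<in> set stk" for j J
  proof -
    have "\<exists>B. B \<in> \<pi> \<and> B - {..q} = J \<and> B \<noteq> J \<and> \<kappa> B = j" using open_blocksD[OF op that] by blast
    from someI_ex[OF this] show "blk (j, J) \<in> \<pi>" "blk (j, J) - {..q} = J" "blk (j, J) \<noteq> J" "\<kappa> (blk (j, J)) = j"
      unfolding blk_def by simp_all
  qed
  have elt: "\<exists>x y. x \<in> J \<and> q < x \<and> y \<in> blk (j, J) \<and> y < q \<and> x \<in> blk (j, J) \<and> blk (j, J) \<noteq> V"
    if jJ: "(j, J) \<in> set stk" for j J
  proof -
    obtain x where x: "x \<in> J" using stack_okD(2)[OF ok jJ] by blast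
    then have "x \<in> stack_ground stk" using jJ unfolding stack_ground_iff by blast
    then have xV: "x \<notin> V" using less by blast
    have xB: "x \<in> blk (j, J)" using blk(2)[OF jJ] x by blast
    obtain y where y: "y \<in> blk (j, J)" "y \<le> q" using blk(2,3)[OF jJ] by (metis Diff_triv atMost_iff disjoint_iff)
    have "blk (j, J) \<noteq> V" using xB xV by blast
    moreover from this have "y \<noteq> q" using nc_part_disjoint[OF nc blk(1)[OF jJ] V(1) y(1)] V(2) by blast
    ultimately show ?thesis using x xB y stack_okD(3)[OF ok jJ x] by (intro exI[of _ x] exI[of _ y]) simp
  qed
  have enc: "encloses (blk (j, J)) V" if jJ: "(j, J) \<in> set stk" for j J
  proof -
    obtain x y where "x \<in> J" "q < x" "y \<in> blk (j, J)" "y < q" "x \<in> blk (j, J)" "blk (j, J) \<noteq> V"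
      using elt[OF jJ] by blast
    then show ?thesis using encloses_between[OF nc blk(1)[OF jJ] V(1) _ _ _ V(2)] by blast
  qed
  have enc2: "encloses (blk (j', J')) (blk (j, J))"
    if jJ: "(j, J) \<in> set stk" "(j', J') \<in> set stk" and lt: "\<forall>x\<in>J. \<forall>y\<in>J'. x < y" for j J j' J'
  proof -
    obtain x where x: "x \<in> J" "q < x" "x \<in> blk (j, J)" using elt[OF jJ(1)] by blast
    obtain x' y' where x': "x' \<in> J'" "y' \<in> blk (j', J')" "y' < q" "x' \<in> blk (j', J')" using elt[OF jJ(2)] by blast
    have "x' \<notin> J" using lt x'(1) by blast
    moreover have "q < x'" by (rule stack_okD(3)[OF ok jJ(2) x'(1)])
    ultimately have "x' \<notin> blk (j, J)" using blk(2)[OF jJ(1)] by (metis DiffI atMost_iff leD)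
    then have "blk (j', J') \<noteq> blk (j, J)" using x'(4) by blast
    then show ?thesis
      using encloses_between[OF nc blk(1)[OF jJ(2)] blk(1)[OF jJ(1)] _ x'(2,4) x(3)] x(1,2) x' lt by force
  qed
  have "is_chain \<pi> V (map blk stk)"
  proof -
    have "sorted_wrt (\<lambda>X Y. encloses Y X) (map blk stk)"
    proof -
      have "sorted_wrt (\<lambda>(_, I) (_, J). \<forall>x\<in>I. \<forall>y\<in>J. x < y) stk" using ok unfolding stack_ok_def by blast
      then have "sorted_wrt (\<lambda>s t. encloses (blk t) (blk s)) stk"
        by (rule sorted_wrt_mono_rel[rotated]) (use enc2 in auto)
      then show ?thesis unfolding sorted_wrt_map .
    qed
    moreover have "set (map blk stk) = {W\<in>\<pi>. encloses W V}"
    proof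
      show "set (map blk stk) \<subseteq> {W\<in>\<pi>. encloses W V}" using enc blk(1) by auto
      show "{W\<in>\<pi>. encloses W V} \<subseteq> set (map blk stk)"
      proof
        fix W assume "W \<in> {W\<in>\<pi>. encloses W V}"
        then have W: "W \<in> \<pi>" "encloses W V" by auto
        obtain k where k: "k \<in> W" "\<forall>v\<in>V. v < k" using W(2) unfolding encloses_def by blast
        then have "k \<in> stack_ground stk" using ground[of k] W(1) V(2) by blast
        then obtain j J where jJ: "(j, J) \<in> set stk" "k \<in> J" unfolding stack_ground_iff by blast
        then have "k \<in> blk (j, J)" using blk(2) by blast
        then have "W = blk (j, J)" using nc_part_disjoint[OF nc W(1) blk(1)[OF jJ(1)] k(1)] by blast
        then show "W \<in> set (map blk stk)" using jJ(1) by auto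
      qed
    qed
    moreover have "\<forall>X\<in>set (map blk stk). encloses X V" using enc by auto
    ultimately show ?thesis unfolding is_chain_def sorted_wrt.simps(2)[of _ V] by blast
  qed
  then have "Vs = map blk stk" using is_chain_unique[OF nc V(1) ch] by blast
  then show ?thesis using blk(4) by (auto simp: split_beta)
qed

section \<open>Removing the block that closes at a given letter\<close>

context
  fixes N p j :: nat and T :: "nat list set" and I :: "nat set" and stk :: "(nat \<times> nat set) list"
  assumes T: "T \<subseteq> free_tree N"
    and ok: "stack_ok T (Suc p) stk" and finI: "finite I"
    and Igt: "\<And>x. x \<in> I \<Longrightarrow> Suc p < x"
    and Iless: "\<And>x y. x \<in> I \<Longrightarrow> y \<in> stack_ground stk \<Longrightarrow> x < y"
    and str: "j # map fst stk \<in> T"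
begin

private abbreviation (input) "V \<equiv> insert (Suc p) I"
private abbreviation (input) "G \<equiv> {1..p} \<union> stack_ground stk"

private lemma finG: "finite G" using finite_stack_ground[OF ok] by simp

private lemma Vless: "x \<in> V \<Longrightarrow> y \<in> stack_ground stk \<Longrightarrow> x < y"
  using Iless stack_ground_gt[OF ok] by blast

private lemma Vgt: "x \<in> V \<Longrightarrow> y \<in> {1..p} \<Longrightarrow> y < x"
  using Igt[of x] by (cases "x = Suc p") auto

private lemma cases: "x \<in> G \<Longrightarrow> (\<forall>v\<in>V. x < v) \<or> (\<forall>v\<in>V. v < x)"
  using Vless Vgt by blast

private lemma disj: "x \<in> V \<Longrightarrow> x \<notin> G"
  using cases by (metis less_irrefl)

private lemma between: "\<lbrakk>a \<in> V; c \<in> V; b \<in> G; a < b; b < c\<rbrakk> \<Longrightarrow> False"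
  using cases[of b] by (meson less_asym)

lemma insert_interval_nc:
  assumes \<pi>: "nc_part \<pi>" "\<Union>\<pi> = G"
  shows "nc_part (insert V \<pi>)"
proof -
  have sub: "W \<subseteq> G" if "W \<in> \<pi>" for W using that \<pi>(2) by blast
  have "X = Y" if X: "X \<in> insert V \<pi>" "Y \<in> insert V \<pi>" "a \<in> X" "b \<in> Y" "c \<in> X" "d \<in> Y" "a < b" "b < c" "c < d" for X Y a b c d
  proof (cases "X = V")
    case True
    then show ?thesis using between[of a c b] X sub[of Y] by blast
  next
    case False
    then have "X \<in> \<pi>" using X by blast
    show ?thesis
    proof (cases "Y = V")
      case True
      then show ?thesis using between[of b d c] X sub[OF \<open>X \<in> \<pi>\<close>] by blast
    next
      case False
      then have "Y \<in> \<pi>" using X by blast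
      then show ?thesis using nc_part_crossing[OF \<pi>(1) \<open>X \<in> \<pi>\<close> \<open>Y \<in> \<pi>\<close> X(3-9)] by blast
    qed
  qed
  then have "noncrossing (insert V \<pi>)" unfolding noncrossing_def by blast
  moreover have "X = Y" if X: "X \<in> insert V \<pi>" "Y \<in> insert V \<pi>" "x \<in> X" "x \<in> Y" for X Y x
  proof (cases "X = V")
    case True
    then show ?thesis using disj[of x] X sub[of Y] by blast
  next
    case False
    then have "X \<in> \<pi>" using X by blast
    show ?thesis
    proof (cases "Y = V")
      case True
      then show ?thesis using disj[of x] X sub[OF \<open>X \<in> \<pi>\<close>] by blast
    next
      case False
      then have "Y \<in> \<pi>" using X by blast
      then show ?thesis using nc_part_disjoint[OF \<pi>(1) \<open>X \<in> \<pi>\<close> \<open>Y \<in> \<pi>\<close> X(3,4)] by blast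
    qed
  qed
  then have "disjoint (insert V \<pi>)" unfolding disjoint_def by blast
  moreover have "{} \<notin> insert V \<pi>" using nc_part_nonempty[OF \<pi>(1)] by blast
  moreover have "finite (\<Union>(insert V \<pi>))" using \<pi>(2) finG finI by simp
  ultimately show ?thesis unfolding nc_part_iff by blast
qed

lemma interval_not_encloses:
  assumes "W \<subseteq> G" "W \<noteq> {}"
  shows "\<not> encloses V W"
proof
  assume enc: "encloses V W"
  obtain w where w: "w \<in> W" using assms(2) by blast
  obtain a c where "a \<in> V" "c \<in> V" "a < w" "w < c" using enc w unfolding encloses_def by blast
  then show False using between[of a c w] w assms(1) by blast
qed

lemma is_chain_insert_interval:
  assumes "nc_part \<pi>" "\<Union>\<pi> = G" "W \<in> \<pi>"
  shows "is_chain (insert V \<pi>) W Vs \<longleftrightarrow> is_chain \<pi> W Vs"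
proof -
  have "\<not> encloses V W"
    by (rule interval_not_encloses) (use assms nc_part_nonempty in auto)
  then have "{U \<in> insert V \<pi>. encloses U W} = {U \<in> \<pi>. encloses U W}" by blast
  then show ?thesis unfolding is_chain_def by simp
qed

text \<open>The other blocks do not contain \<open>Suc p\<close>, so cutting them at
  \<open>p\<close> or at \<open>Suc p\<close> is the same. The new block leaves the remnant
  \<open>I\<close>, which is not an entry, since entries are nonempty and lie beyond
  \<open>I\<close>.\<close>

lemma open_blocks_insert:
  assumes \<pi>: "nc_part \<pi>" "\<Union>\<pi> = G" and eq: "\<And>W. W \<in> \<pi> \<Longrightarrow> \<kappa> W = \<psi> W"
  shows "open_blocks (Suc p) stk (insert V \<pi>) \<kappa> \<longleftrightarrow> open_blocks p stk \<pi> \<psi>"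
proof -
  have *: "(\<exists>W\<in>insert V \<pi>. W - {..Suc p} = J \<and> W \<noteq> J \<and> \<kappa> W = i) \<longleftrightarrow>
      (\<exists>W\<in>\<pi>. W - {..p} = J \<and> W \<noteq> J \<and> \<psi> W = i)" if iJ: "(i, J) \<in> set stk" for i J
  proof -
    have "V - {..Suc p} = I" using Igt by (auto dest: Igt leD)
    moreover have "J \<noteq> I"
    proof -
      obtain x where "x \<in> J" using stack_okD(2)[OF ok iJ] by blast
      then have "x \<in> stack_ground stk" using iJ stack_ground_iff by blast
      then have "x \<notin> I" using Iless by blast
      then show ?thesis using \<open>x \<in> J\<close> by blast
    qed
    moreover have "W - {..Suc p} = W - {..p}" if "W \<in> \<pi>" for W
    proof -
      have "Suc p \<notin> W" using disj[of "Suc p"] that \<pi>(2) by blast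
      then show ?thesis by (auto simp: le_Suc_eq)
    qed
    ultimately show ?thesis using eq by auto
  qed
  show ?thesis
    unfolding open_blocks_def
  proof (rule ball_cong[OF refl])
    fix e assume e: "e \<in> set stk"
    obtain i J where "e = (i, J)" by (cases e)
    then show "(case e of (i, J) \<Rightarrow> \<exists>W\<in>insert V \<pi>. W - {..Suc p} = J \<and> W \<noteq> J \<and> \<kappa> W = i) \<longleftrightarrow>
        (case e of (i, J) \<Rightarrow> \<exists>W\<in>\<pi>. W - {..p} = J \<and> W \<noteq> J \<and> \<psi> W = i)"
      using *[of i J] e by (simp only: prod.case)
  qed
qed

text \<open>The interval block surrounds nothing, so the chains of the other blocks do not change.
  Its own chain has the colors of the stack by \<open>chain_of_stack\<close>, hence the string in
  question is the one assumed to lie in \<open>T\<close>.\<close>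

lemma strict_colorings_insert:
  assumes \<pi>: "nc_part \<pi>" "\<Union>\<pi> = G" and eq: "\<And>W. W \<in> \<pi> \<Longrightarrow> \<kappa> W = \<psi> W"
    and op: "open_blocks p stk \<pi> \<psi>" and ext: "\<kappa> \<in> extensional (insert V \<pi>)" "\<psi> \<in> extensional \<pi>"
    and \<kappa>V: "\<kappa> V = j"
  shows "\<kappa> \<in> strict_colorings N T (insert V \<pi>) \<longleftrightarrow> \<psi> \<in> strict_colorings N T \<pi>"
proof -
  note nc' = insert_interval_nc[OF \<pi>]
  have jN: "j \<in> {1..N}" using str T unfolding free_tree_def by auto
  have chV: "map \<kappa> (V # Vs) \<in> T" if "is_chain (insert V \<pi>) V Vs" for Vs
  proof -
    have "map \<kappa> Vs = map fst stk"
    proof (rule chain_of_stack[OF nc' _ _ ok _ _ _ that])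
      show "open_blocks (Suc p) stk (insert V \<pi>) \<kappa>" using open_blocks_insert[OF \<pi> eq] op by simp
      show "x < y" if "x \<in> V" "y \<in> stack_ground stk" for x y using that by (rule Vless)
      show "x \<in> stack_ground stk" if "x \<in> \<Union>(insert V \<pi>)" "Suc p < x" "x \<notin> V" for x
        using that \<pi>(2) by auto
    qed auto
    then show ?thesis using str \<kappa>V by simp
  qed
  have m: "map \<kappa> (W # Vs) = map \<psi> (W # Vs)" if "W \<in> \<pi>" "is_chain \<pi> W Vs" for W Vs
    using eq is_chain_subset[OF that(2)] that(1) by auto
  have PiE: "\<kappa> \<in> insert V \<pi> \<rightarrow>\<^sub>E {1..N} \<longleftrightarrow> \<psi> \<in> \<pi> \<rightarrow>\<^sub>E {1..N}"
    using ext eq jN \<kappa>V by (auto simp: PiE_iff)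
  have "(\<forall>W\<in>insert V \<pi>. \<forall>Vs. is_chain (insert V \<pi>) W Vs \<longrightarrow> map \<kappa> (W # Vs) \<in> T) \<longleftrightarrow>
      (\<forall>W\<in>\<pi>. \<forall>Vs. is_chain \<pi> W Vs \<longrightarrow> map \<psi> (W # Vs) \<in> T)"
    using chV is_chain_insert_interval[OF \<pi>] m by (metis insert_iff)
  then show ?thesis
    unfolding strict_colorings_iff[OF nc' T] strict_colorings_iff[OF \<pi>(1) T] PiE by blast
qed

lemma strict_colorings_extensional: "\<kappa> \<in> strict_colorings N T \<pi> \<Longrightarrow> \<kappa> \<in> extensional \<pi>"
  unfolding strict_colorings_def using weak_coloringsD(2)[of \<kappa> N T \<pi>] by (auto simp: PiE_iff)

text \<open>The closed block and its color are determined by \<open>p\<close>, \<open>I\<close> and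
  \<open>j\<close>, so deleting it loses no information; what remains is a completion of the smaller
  stack one letter earlier.\<close>

lemma remove_closed_block:
  "bij_betw (\<lambda>(\<pi>, \<kappa>). (\<pi> - {V}, restrict \<kappa> (\<pi> - {V})))
    {(\<pi>, \<kappa>). \<pi> \<in> NC (G \<union> V) \<and> \<kappa> \<in> strict_colorings N T \<pi> \<and> open_blocks (Suc p) stk \<pi> \<kappa> \<and> V \<in> \<pi> \<and> \<kappa> V = j}
    (configs N T p stk)"
    (is "bij_betw _ ?R _")
proof (rule bij_betwI[where g = "\<lambda>(\<pi>, \<kappa>). (insert V \<pi>, \<lambda>W\<in>insert V \<pi>. if W = V then j else \<kappa> W)"])
  have finGV: "finite (G \<union> V)" using finG finI by simp
  have R: "nc_part (\<pi> - {V})" "\<Union>(\<pi> - {V}) = G" "insert V (\<pi> - {V}) = \<pi>"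
    if "\<pi> \<in> NC (G \<union> V)" "V \<in> \<pi>" for \<pi>
  proof -
    have nc: "nc_part \<pi>" "\<Union>\<pi> = G \<union> V" using that(1) nc_part_NC[OF finGV] by auto
    show "nc_part (\<pi> - {V})" using nc(1) by (rule nc_part_subset) auto
    show "\<Union>(\<pi> - {V}) = G"
      unfolding Union_remove_block[OF nc(1) that(2)] nc(2) using disj by blast
    show "insert V (\<pi> - {V}) = \<pi>" using that(2) by blast
  qed
  have C: "nc_part \<pi>" "\<Union>\<pi> = G" "V \<notin> \<pi>" if "\<pi> \<in> NC G" for \<pi>
  proof -
    show nc: "nc_part \<pi>" "\<Union>\<pi> = G" using that nc_part_NC[OF finG] by auto
    show "V \<notin> \<pi>" using disj[of "Suc p"] nc(2) by blast
  qed
  show "(\<lambda>(\<pi>, \<kappa>). (\<pi> - {V}, restrict \<kappa> (\<pi> - {V}))) \<in> ?R \<rightarrow> configs N T p stk"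
  proof
    fix x assume "x \<in> ?R"
    then obtain \<pi> \<kappa> where x: "x = (\<pi>, \<kappa>)" "\<pi> \<in> NC (G \<union> V)" "\<kappa> \<in> strict_colorings N T \<pi>"
      "open_blocks (Suc p) stk \<pi> \<kappa>" "V \<in> \<pi>" "\<kappa> V = j" by blast
    note r = R[OF x(2,5)]
    let ?\<psi> = "restrict \<kappa> (\<pi> - {V})"
    have op: "open_blocks p stk (\<pi> - {V}) ?\<psi>"
      using open_blocks_insert[OF r(1,2), of \<kappa> ?\<psi>] x(4) unfolding r(3) by simp
    have "?\<psi> \<in> strict_colorings N T (\<pi> - {V})"
      using strict_colorings_insert[OF r(1,2), of \<kappa> ?\<psi>] op x(3,6) strict_colorings_extensional[OF x(3)]
      unfolding r(3) by simp
    then show "(case x of (\<pi>, \<kappa>) \<Rightarrow> (\<pi> - {V}, restrict \<kappa> (\<pi> - {V}))) \<in> configs N T p stk"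
      unfolding x(1) configs_def using op r(1,2) nc_part_NC[OF finG] by simp
  qed
  show "(\<lambda>(\<pi>, \<kappa>). (insert V \<pi>, \<lambda>W\<in>insert V \<pi>. if W = V then j else \<kappa> W)) \<in> configs N T p stk \<rightarrow> ?R"
  proof
    fix x assume "x \<in> configs N T p stk"
    then obtain \<pi> \<kappa> where x: "x = (\<pi>, \<kappa>)" "\<pi> \<in> NC G" "\<kappa> \<in> strict_colorings N T \<pi>" "open_blocks p stk \<pi> \<kappa>"
      unfolding configs_def by blast
    note c = C[OF x(2)]
    let ?\<kappa> = "\<lambda>W\<in>insert V \<pi>. if W = V then j else \<kappa> W"
    have eq: "?\<kappa> W = \<kappa> W" if "W \<in> \<pi>" for W using that c(3) by auto
    have "open_blocks (Suc p) stk (insert V \<pi>) ?\<kappa>"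
      by (rule iffD2[OF open_blocks_insert[OF c(1,2)] x(4)]) (rule eq)
    moreover have "?\<kappa> \<in> strict_colorings N T (insert V \<pi>)"
      by (rule iffD2[OF strict_colorings_insert[OF c(1,2) _ x(4)] x(3)])
        (use eq strict_colorings_extensional[OF x(3)] in simp_all)
    moreover have "insert V \<pi> \<in> NC (G \<union> V)"
      unfolding nc_part_NC[OF finGV] using insert_interval_nc[OF c(1,2)] c(2) by auto
    ultimately show "(case x of (\<pi>, \<kappa>) \<Rightarrow> (insert V \<pi>, \<lambda>W\<in>insert V \<pi>. if W = V then j else \<kappa> W)) \<in> ?R"
      unfolding x(1) by simp
  qed
  show "(case case x of (\<pi>, \<kappa>) \<Rightarrow> (\<pi> - {V}, restrict \<kappa> (\<pi> - {V})) of
      (\<pi>, \<kappa>) \<Rightarrow> (insert V \<pi>, \<lambda>W\<in>insert V \<pi>. if W = V then j else \<kappa> W)) = x" if xR: "x \<in> ?R" for x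
  proof -
    from xR obtain \<pi> \<kappa> where x: "x = (\<pi>, \<kappa>)" "\<pi> \<in> NC (G \<union> V)" "\<kappa> \<in> strict_colorings N T \<pi>" "V \<in> \<pi>" "\<kappa> V = j" by blast
    have "(\<lambda>W\<in>\<pi>. if W = V then j else restrict \<kappa> (\<pi> - {V}) W) = \<kappa>"
      using strict_colorings_extensional[OF x(3)] x(5) by (auto simp: fun_eq_iff extensional_def)
    then show ?thesis unfolding x(1) prod.case R(3)[OF x(2,4)] by simp
  qed
  show "(case case x of (\<pi>, \<kappa>) \<Rightarrow> (insert V \<pi>, \<lambda>W\<in>insert V \<pi>. if W = V then j else \<kappa> W) of
      (\<pi>, \<kappa>) \<Rightarrow> (\<pi> - {V}, restrict \<kappa> (\<pi> - {V}))) = x" if xC: "x \<in> configs N T p stk" for x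
  proof -
    from xC obtain \<pi> \<kappa> where x: "x = (\<pi>, \<kappa>)" "\<pi> \<in> NC G" "\<kappa> \<in> strict_colorings N T \<pi>"
      unfolding configs_def by blast
    have d: "insert V \<pi> - {V} = \<pi>" using C(3)[OF x(2)] by blast
    have "restrict (\<lambda>W\<in>insert V \<pi>. if W = V then j else \<kappa> W) \<pi> = \<kappa>"
      using strict_colorings_extensional[OF x(3)] C(3)[OF x(2)] by (auto simp: fun_eq_iff extensional_def)
    then show ?thesis unfolding x(1) prod.case d by simp
  qed
qed

lemma interval_block_closed:
  assumes "\<pi> \<in> NC (G \<union> V)" "V \<in> \<pi>"
  shows "nc_part \<pi>" "interval_block \<pi> V" "right_of \<pi> V = stack_ground stk"
proof -
  have finGV: "finite (G \<union> V)" using finG finI by simp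
  have nc: "nc_part \<pi>" "\<Union>\<pi> = G \<union> V" using assms(1) nc_part_NC[OF finGV] by auto
  show "nc_part \<pi>" by (rule nc(1))
  show "interval_block \<pi> V"
    unfolding interval_block_def nc(2) using assms(2) between by blast
  show "right_of \<pi> V = stack_ground stk"
  proof
    show "right_of \<pi> V \<subseteq> stack_ground stk"
    proof
      fix x assume x: "x \<in> right_of \<pi> V"
      then have xV: "\<forall>v\<in>V. v < x" and xG: "x \<in> G \<union> V" unfolding right_of_def nc(2) by auto
      have "x \<notin> V" using xV by blast
      moreover have "x \<notin> {1..p}" using xV by auto
      ultimately show "x \<in> stack_ground stk" using xG by blast
    qed
    show "stack_ground stk \<subseteq> right_of \<pi> V"
      unfolding right_of_def nc(2) using Vless by blast
  qed
qed

end

section \<open>Strings of a tree and moves of the stack\<close>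

lemma Tree_subset: "T \<in> Tree N \<Longrightarrow> T \<subseteq> free_tree N" and Tree_Nil: "T \<in> Tree N \<Longrightarrow> [] \<in> T"
  by (auto simp: Tree_def)

text \<open>A path in \<open>T\<close> from \<open>j # s\<close> to the root has to leave the
  strings ending in \<open>j # s\<close>, and the only exit from them is \<open>s\<close>.\<close>

lemma Tree_ConsD:
  assumes T: "T \<in> Tree N" and "j # s \<in> T"
  shows "s \<in> T"
proof -
  let ?R = "{(u, v). u \<in> T \<and> v \<in> T \<and> tree_edge u v}"
  have "(j # s, []) \<in> ?R\<^sup>*" using assms unfolding Tree_def by blast
  moreover have "(\<exists>w. v = w @ j # s) \<or> s \<in> T" if "(j # s, v) \<in> ?R\<^sup>*" for v
    using that
  proof (induction rule: rtrancl_induct)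
    case (step u v)
    show ?case
    proof (cases "s \<in> T")
      case False
      then obtain w where w: "u = w @ j # s" using step.IH by blast
      have uv: "v \<in> T" "tree_edge u v" using step.hyps(2) by auto
      then consider i where "v = i # u" | i where "u = i # v" unfolding tree_edge_def by blast
      then show ?thesis
      proof cases
        case (1 i)
        then have "v = (i # w) @ j # s" using w by simp
        then show ?thesis by blast
      next
        case (2 i)
        then show ?thesis using w uv(1) by (cases w) auto
      qed
    qed simp
  qed (rule disjI1, rule exI[of _ "[]"], simp)
  ultimately show ?thesis by blast
qed

lemma stack_ground_Cons: "stack_ground ((j, I) # stk) = I \<union> stack_ground stk"
  by (simp add: stack_ground_def)

text \<open>The ways in which a new position can be attached: it starts a block of a color
  \<open>j\<close> on top of the stack, with nothing beyond (the empty set), or it joins the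
  innermost open block. In \<open>(j, I, stk')\<close>, \<open>I\<close> is the part of its block
  beyond the position and \<open>stk'\<close> the stack underneath.\<close>

definition stack_moves :: "nat list set \<Rightarrow> (nat \<times> nat set) list \<Rightarrow> (nat \<times> nat set \<times> (nat \<times> nat set) list) set" where
  "stack_moves T stk = {(j, {}, stk) | j. j # map fst stk \<in> T}
     \<union> (case stk of [] \<Rightarrow> {} | (j, I) # rest \<Rightarrow> {(j, I, rest)})"

lemma finite_stack_moves:
  assumes "T \<subseteq> free_tree N"
  shows "finite (stack_moves T stk)"
proof -
  have "{(j, {}, stk) | j. j # map fst stk \<in> T} \<subseteq> (\<lambda>j. (j, {} :: nat set, stk)) ` {1..N}"
    using assms unfolding free_tree_def by auto
  then have "finite {(j, {} :: nat set, stk) | j. j # map fst stk \<in> T}" by (rule finite_subset) simp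
  then show ?thesis unfolding stack_moves_def by (auto split: list.split)
qed

lemma stack_ok_ConsD:
  assumes T: "T \<in> Tree N" and ok: "stack_ok T q ((j, I) # rest)"
  shows "stack_ok T q rest" "finite I" "I \<noteq> {}" "\<And>x. x \<in> I \<Longrightarrow> q < x"
    "\<And>x y. x \<in> I \<Longrightarrow> y \<in> stack_ground rest \<Longrightarrow> x < y" "j # map fst rest \<in> T"
proof -
  show str: "j # map fst rest \<in> T" using ok by (simp add: stack_ok_def)
  show "finite I" "I \<noteq> {}" "\<And>x. x \<in> I \<Longrightarrow> q < x" using stack_okD[OF ok, of j I] by auto
  show "stack_ok T q rest" using ok Tree_ConsD[OF T str] by (simp add: stack_ok_def)
  have "\<forall>(i, J)\<in>set rest. \<forall>x\<in>I. \<forall>y\<in>J. x < y" using ok by (simp add: stack_ok_def)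
  then show "x < y" if "x \<in> I" "y \<in> stack_ground rest" for x y
    using that unfolding stack_ground_def by (force simp: split_beta)
qed

text \<open>Collects the data for both continuations after a move: \<open>stk'\<close> is the stack
  if the block closes at this position, and \<open>(j, insert (Suc p) I) # stk'\<close> is the stack
  if the block remains open.\<close>

lemma stack_movesD:
  assumes T: "T \<in> Tree N" and ok: "stack_ok T (Suc p) stk" and opt: "(j, I, stk') \<in> stack_moves T stk"
  shows "stack_ok T (Suc p) stk'" "finite I" "\<And>x. x \<in> I \<Longrightarrow> Suc p < x"
    "\<And>x y. x \<in> I \<Longrightarrow> y \<in> stack_ground stk' \<Longrightarrow> x < y" "j # map fst stk' \<in> T"
    "{1..Suc p} \<union> stack_ground stk = {1..p} \<union> stack_ground stk' \<union> insert (Suc p) I"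
    "open_blocks (Suc p) stk \<pi> \<kappa> \<longleftrightarrow> open_blocks (Suc p) stk' \<pi> \<kappa> \<and>
      (I \<noteq> {} \<longrightarrow> (\<exists>V\<in>\<pi>. V - {..Suc p} = I \<and> V \<noteq> I \<and> \<kappa> V = j))"
    "if I = {} then stk' = stk else stk = (j, I) # stk'"
    "stack_ok T p ((j, insert (Suc p) I) # stk')"
proof -
  have atm: "{1..Suc p} = insert (Suc p) {1..p}" by auto
  have main: "stack_ok T (Suc p) stk' \<and> finite I \<and> (\<forall>x\<in>I. Suc p < x) \<and>
    (\<forall>x\<in>I. \<forall>y\<in>stack_ground stk'. x < y) \<and> j # map fst stk' \<in> T \<and>
    {1..Suc p} \<union> stack_ground stk = {1..p} \<union> stack_ground stk' \<union> insert (Suc p) I \<and>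
    (open_blocks (Suc p) stk \<pi> \<kappa> \<longleftrightarrow> open_blocks (Suc p) stk' \<pi> \<kappa> \<and>
      (I \<noteq> {} \<longrightarrow> (\<exists>V\<in>\<pi>. V - {..Suc p} = I \<and> V \<noteq> I \<and> \<kappa> V = j))) \<and>
    (if I = {} then stk' = stk else stk = (j, I) # stk')"
  proof (cases "(I, stk') = ({}, stk) \<and> j # map fst stk \<in> T")
    case True
    then show ?thesis using ok atm by auto
  next
    case False
    then have stk: "stk = (j, I) # stk'"
      using opt unfolding stack_moves_def by (auto split: list.splits)
    note d = stack_ok_ConsD[OF T ok[unfolded stk]]
    have "{1..Suc p} \<union> stack_ground stk = {1..p} \<union> stack_ground stk' \<union> insert (Suc p) I"
      unfolding stk atm stack_ground_def by auto
    moreover have "open_blocks (Suc p) stk \<pi> \<kappa> \<longleftrightarrow> open_blocks (Suc p) stk' \<pi> \<kappa> \<and>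
      (I \<noteq> {} \<longrightarrow> (\<exists>V\<in>\<pi>. V - {..Suc p} = I \<and> V \<noteq> I \<and> \<kappa> V = j))"
      unfolding stk open_blocks_def using d(3) by auto
    ultimately show ?thesis using d stk by simp
  qed
  note m = main[THEN conjunct1] main[THEN conjunct2, THEN conjunct1]
    main[THEN conjunct2, THEN conjunct2, THEN conjunct1]
    main[THEN conjunct2, THEN conjunct2, THEN conjunct2, THEN conjunct1]
    main[THEN conjunct2, THEN conjunct2, THEN conjunct2, THEN conjunct2, THEN conjunct1]
    main[THEN conjunct2, THEN conjunct2, THEN conjunct2, THEN conjunct2, THEN conjunct2, THEN conjunct1]
    main[THEN conjunct2, THEN conjunct2, THEN conjunct2, THEN conjunct2, THEN conjunct2, THEN conjunct2, THEN conjunct1]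
    main[THEN conjunct2, THEN conjunct2, THEN conjunct2, THEN conjunct2, THEN conjunct2, THEN conjunct2, THEN conjunct2]
  show "stack_ok T (Suc p) stk'" "finite I" "j # map fst stk' \<in> T"
    "{1..Suc p} \<union> stack_ground stk = {1..p} \<union> stack_ground stk' \<union> insert (Suc p) I"
    "open_blocks (Suc p) stk \<pi> \<kappa> \<longleftrightarrow> open_blocks (Suc p) stk' \<pi> \<kappa> \<and>
      (I \<noteq> {} \<longrightarrow> (\<exists>V\<in>\<pi>. V - {..Suc p} = I \<and> V \<noteq> I \<and> \<kappa> V = j))"
    "if I = {} then stk' = stk else stk = (j, I) # stk'" by (fact m)+
  show o3: "Suc p < x" if "x \<in> I" for x using bspec[OF m(3) that] .
  show o4: "x < y" if "x \<in> I" "y \<in> stack_ground stk'" for x y using bspec[OF bspec[OF m(4) that(1)] that(2)] .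
  have lt: "x < y" if "x \<in> insert (Suc p) I" "(i, J) \<in> set stk'" "y \<in> J" for x i J y
    using that o4[of x y] stack_okD(3)[OF m(1) that(2,3)] unfolding stack_ground_iff by blast
  have gt: "p < x" if "x \<in> insert (Suc p) I" for x using that o3[of x] by (cases "x = Suc p") auto
  have ok': "finite J \<and> J \<noteq> {} \<and> (\<forall>x\<in>J. p < x)" if "(i, J) \<in> set stk'" for i J
    using stack_okD[OF m(1) that] by (metis Suc_lessD)
  show "stack_ok T p ((j, insert (Suc p) I) # stk')"
    unfolding stack_ok_def
  proof (intro conjI)
    show "map fst ((j, insert (Suc p) I) # stk') \<in> T" using m(5) by simp
    show "\<forall>(j, J)\<in>set ((j, insert (Suc p) I) # stk'). finite J \<and> J \<noteq> {} \<and> (\<forall>x\<in>J. p < x)"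
      using ok' gt m(2) by auto
    have "sorted_wrt (\<lambda>(_, I) (_, J). \<forall>x\<in>I. \<forall>y\<in>J. x < y) stk'" using m(1) unfolding stack_ok_def by blast
    then show "sorted_wrt (\<lambda>(_, I) (_, J). \<forall>x\<in>I. \<forall>y\<in>J. x < y) ((j, insert (Suc p) I) # stk')"
      unfolding sorted_wrt.simps using lt by blast
  qed
qed

text \<open>Describes the completions in which the block of \<open>Suc p\<close> reaches further
  down: being strictly larger than its part beyond \<open>p\<close>, it stays open and becomes the
  top entry.\<close>

lemma configs_push:
  assumes T: "T \<in> Tree N" and ok: "stack_ok T (Suc p) stk" and opt: "(j, I, stk') \<in> stack_moves T stk"
  shows "(\<pi>, \<kappa>) \<in> configs N T p ((j, insert (Suc p) I) # stk') \<longleftrightarrow> (\<pi>, \<kappa>) \<in> configs N T (Suc p) stk \<and>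
     (\<exists>V\<in>\<pi>. V - {..p} = insert (Suc p) I \<and> V \<noteq> insert (Suc p) I \<and> \<kappa> V = j)"
proof -
  note o = stack_movesD[OF T ok opt]
  let ?G = "{1..Suc p} \<union> stack_ground stk"
  have finG: "finite ?G" using finite_stack_ground[OF ok] by simp
  have G: "{1..p} \<union> stack_ground ((j, insert (Suc p) I) # stk') = ?G"
    unfolding stack_ground_Cons o(6) by blast
  have step: "V - {..Suc p} = V - {..p} - {Suc p}" for V :: "nat set" by (auto simp: le_Suc_eq)
  have "open_blocks p stk' \<pi> \<kappa> \<longleftrightarrow> open_blocks (Suc p) stk \<pi> \<kappa>"
    if \<pi>: "\<pi> \<in> NC ?G" and V: "V \<in> \<pi>" "V - {..p} = insert (Suc p) I" "V \<noteq> insert (Suc p) I" "\<kappa> V = j" for V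
  proof -
    have nc: "nc_part \<pi>" using \<pi> nc_part_NC[OF finG] by blast
    have qI: "Suc p \<notin> I" using o(3) by blast
    have VI: "V - {..Suc p} = I" unfolding step V(2) using qI by blast
    have qV: "Suc p \<in> V" using V(2) by blast
    have "V \<noteq> I" using qV qI by blast
    then have extra: "\<exists>V\<in>\<pi>. V - {..Suc p} = I \<and> V \<noteq> I \<and> \<kappa> V = j" using V VI by blast
    \<comment> \<open>Cutting at \<open>p\<close> or at \<open>Suc p\<close> differs only for the
      block containing \<open>Suc p\<close>. That block is \<open>V\<close>, and neither of its two
      remnants is a lower entry: one contains \<open>Suc p\<close> and the other is
      \<open>I\<close>.\<close>
    have *: "W - {..p} = J \<longleftrightarrow> W - {..Suc p} = J" if iJ: "(i, J) \<in> set stk'" and W: "W \<in> \<pi>" for i J W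
    proof (cases "Suc p \<in> W")
      case True
      then have "W = V" using nc_part_disjoint[OF nc W V(1)] qV by blast
      have qJ: "Suc p \<notin> J" using stack_okD(3)[OF o(1) iJ] by blast
      obtain x where x: "x \<in> J" using stack_okD(2)[OF o(1) iJ] by blast
      then have "x \<in> stack_ground stk'" using iJ unfolding stack_ground_iff by blast
      then have "x \<notin> I" using o(4) by blast
      then have "J \<noteq> I" using x by blast
      then show ?thesis using qJ VI V(2) \<open>W = V\<close> by blast
    next
      case False
      then show ?thesis unfolding step by simp
    qed
    have "open_blocks p stk' \<pi> \<kappa> \<longleftrightarrow> open_blocks (Suc p) stk' \<pi> \<kappa>"
      unfolding open_blocks_def
    proof (rule ball_cong[OF refl])
      fix e assume e: "e \<in> set stk'"
      obtain i J where "e = (i, J)" by (cases e)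
      then show "(case e of (i, J) \<Rightarrow> \<exists>V\<in>\<pi>. V - {..p} = J \<and> V \<noteq> J \<and> \<kappa> V = i) \<longleftrightarrow>
          (case e of (i, J) \<Rightarrow> \<exists>V\<in>\<pi>. V - {..Suc p} = J \<and> V \<noteq> J \<and> \<kappa> V = i)"
        using *[of i J] e by auto
    qed
    then show ?thesis using o(7) extra by blast
  qed
  then show ?thesis
    unfolding configs_def G open_blocks_def[of p "(j, insert (Suc p) I) # stk'"] list.set ball_simps(7) prod.case
    unfolding open_blocks_def[of p stk', symmetric] mem_Collect_eq prod.case by blast
qed

text \<open>The block of \<open>Suc p\<close> determines the move. Without points beyond, its chain
  is the whole stack, so its color may be pushed. With points beyond, its remnant is an entry of the
  stack, and non-crossing leaves only the top one.\<close>

lemma configs_split: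
  assumes T: "T \<in> Tree N" and ok: "stack_ok T (Suc p) stk"
  shows "configs N T (Suc p) stk = (\<Union>(j, I, stk')\<in>stack_moves T stk.
      {(\<pi>, \<kappa>) \<in> configs N T (Suc p) stk. \<exists>V\<in>\<pi>. V - {..p} = insert (Suc p) I \<and> \<kappa> V = j})"
proof
  let ?q = "Suc p"
  show "configs N T ?q stk \<subseteq> (\<Union>(j, I, stk')\<in>stack_moves T stk.
      {(\<pi>, \<kappa>) \<in> configs N T ?q stk. \<exists>V\<in>\<pi>. V - {..p} = insert ?q I \<and> \<kappa> V = j})"
  proof
    fix x assume x: "x \<in> configs N T ?q stk"
    obtain \<pi> \<kappa> where x_eq: "x = (\<pi>, \<kappa>)" by (cases x)
    have \<pi>: "\<pi> \<in> NC ({1..?q} \<union> stack_ground stk)" and \<kappa>: "\<kappa> \<in> strict_colorings N T \<pi>"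
      and op: "open_blocks ?q stk \<pi> \<kappa>" using x unfolding x_eq configs_def by auto
    have nc: "nc_part \<pi>" and U: "\<Union>\<pi> = {1..?q} \<union> stack_ground stk"
      using \<pi> nc_part_NC[of "{1..?q} \<union> stack_ground stk"] finite_stack_ground[OF ok] by auto
    have "?q \<in> \<Union>\<pi>" unfolding U by simp
    then obtain V where V: "V \<in> \<pi>" "?q \<in> V" by blast
    have step: "V - {..p} = insert ?q (V - {..?q})" using V(2) by (auto simp: le_Suc_eq)
    have "\<exists>stk'. (\<kappa> V, V - {..?q}, stk') \<in> stack_moves T stk"
    proof (cases "V - {..?q} = {}")
      case True
      obtain Vs where Vs: "is_chain \<pi> V Vs" using is_chain_exists[OF nc V(1)] by blast
      have "map \<kappa> Vs = map fst stk"
      proof (rule chain_of_stack[OF nc V ok op _ _ Vs])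
        show "x < y" if "x \<in> V" "y \<in> stack_ground stk" for x y
          using that True stack_ground_gt[OF ok that(2)] by fastforce
        show "x \<in> stack_ground stk" if "x \<in> \<Union>\<pi>" "?q < x" for x using that unfolding U by auto
      qed
      moreover have "map \<kappa> (V # Vs) \<in> T"
        using \<kappa> V(1) Vs unfolding strict_colorings_iff[OF nc Tree_subset[OF T]] by blast
      ultimately have "\<kappa> V # map fst stk \<in> T" by simp
      then show ?thesis unfolding True stack_moves_def by blast
    next
      case False
      then obtain x where x: "x \<in> V" "?q < x" by (metis Diff_iff all_not_in_conv atMost_iff not_le)
      have "x \<in> \<Union>\<pi>" using x(1) V(1) by blast
      then have "x \<in> stack_ground stk" using x(2) unfolding U by auto
      then obtain i J where iJ: "(i, J) \<in> set stk" "x \<in> J" unfolding stack_ground_iff by blast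
      have blk: "V - {..?q} = J \<and> \<kappa> V = i" if iJ: "(i, J) \<in> set stk" "x \<in> J" "x \<in> V" for i J x
      proof -
        obtain B where B: "B \<in> \<pi>" "B - {..?q} = J" "\<kappa> B = i" using open_blocksD[OF op iJ(1)] by blast
        then have "B = V" using nc_part_disjoint[OF nc B(1) V(1), of x] iJ by blast
        then show ?thesis using B by blast
      qed
      obtain j1 I1 rest where stk: "stk = (j1, I1) # rest" using iJ(1) by (cases stk) auto
      note d = stack_ok_ConsD[OF T ok[unfolded stk]]
      have "(i, J) = (j1, I1)"
      proof (rule ccontr)
        \<comment> \<open>If the remnant were a lower entry, the block of the top entry would cross
          \<open>V\<close>: it has a point before \<open>Suc p\<close> and one after
          \<open>Suc p\<close> that still precedes \<open>x\<close>.\<close>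
        assume "(i, J) \<noteq> (j1, I1)"
        then have xg: "x \<in> stack_ground rest" using iJ unfolding stk stack_ground_iff by auto
        obtain z where z: "z \<in> I1" using d(3) by blast
        have "(j1, I1) \<in> set stk" unfolding stk by simp
        then obtain B where B: "B \<in> \<pi>" "B - {..?q} = I1" "B \<noteq> I1" using open_blocksD[OF op] by blast
        have zx: "?q < z" "z < x" using d(4)[OF z] d(5)[OF z xg] by auto
        have zB: "z \<in> B" using B(2) z by blast
        obtain y where y: "y \<in> B" "y \<le> ?q" using B(2,3) by (metis Diff_triv atMost_iff disjoint_iff)
        have "x \<notin> I1" using d(5)[OF _ xg] by blast
        then have "x \<notin> B" using B(2) x(2) by (metis DiffI atMost_iff leD)
        then have "B \<noteq> V" using x(1) by blast
        then have "y \<noteq> ?q" using nc_part_disjoint[OF nc B(1) V(1) y(1)] V(2) by blast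
        then show False
          using nc_part_crossing[OF nc B(1) V(1) y(1) V(2) zB x(1)] y(2) zx \<open>B \<noteq> V\<close> by simp
      qed
      then have "V - {..?q} = I1 \<and> \<kappa> V = j1" using blk[OF iJ x(1)] by simp
      then have "(\<kappa> V, V - {..?q}, rest) \<in> stack_moves T stk" unfolding stack_moves_def stk by simp
      then show ?thesis by blast
    qed
    then obtain stk' where "(\<kappa> V, V - {..?q}, stk') \<in> stack_moves T stk" by blast
    moreover have "x \<in> {(\<pi>, \<kappa>') \<in> configs N T ?q stk. \<exists>W\<in>\<pi>. W - {..p} = insert ?q (V - {..?q}) \<and> \<kappa>' W = \<kappa> V}"
      using x V(1) step unfolding x_eq by blast
    ultimately show "x \<in> (\<Union>(j, I, stk')\<in>stack_moves T stk.
      {(\<pi>, \<kappa>) \<in> configs N T ?q stk. \<exists>V\<in>\<pi>. V - {..p} = insert ?q I \<and> \<kappa> V = j})" by blast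
  qed
qed auto

lemma finite_configs:
  assumes "stack_ok T p stk"
  shows "finite (configs N T p stk)"
proof (rule finite_subset)
  let ?G = "{1..p} \<union> stack_ground stk"
  have fin: "finite ?G" using finite_stack_ground[OF assms] by simp
  show "configs N T p stk \<subseteq> (SIGMA \<pi>:NC ?G. strict_colorings N T \<pi>)" unfolding configs_def by blast
  show "finite (SIGMA \<pi>:NC ?G. strict_colorings N T \<pi>)"
    using finite_NC[OF fin] finite_strict_colorings nc_part_finite nc_part_NC[OF fin] by (intro finite_SigmaI) auto
qed

section \<open>The recursion for sums over completions of a stack\<close>

context bvalued_prob_space
begin

definition config_sum :: "nat \<Rightarrow> nat list set \<Rightarrow> nat \<Rightarrow> (nat \<times> nat set) list \<Rightarrow> (nat \<Rightarrow> 'a) \<Rightarrow> 'b" where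
  "config_sum N T p stk a = (\<Sum>(\<pi>, \<kappa>)\<in>configs N T p stk. part_eval boolean_cumulant \<pi> a)"

text \<open>The effect of closing the block of \<open>Suc p\<close>: its Boolean cumulant becomes a
  right factor if no open block remains, and otherwise multiplies the first index of the remaining
  stack from the left. This parallels left multiplication by \<B> on the vacuum and on elementary
  tensors.\<close>

definition close_sum :: "nat \<Rightarrow> nat list set \<Rightarrow> nat \<Rightarrow> nat set \<Rightarrow> (nat \<times> nat set) list \<Rightarrow> (nat \<Rightarrow> 'a) \<Rightarrow> 'b" where
  "close_sum N T p I stk a =
     (let b = boolean_cumulant (map a (sorted_list_of_set (insert (Suc p) I))); r = Min (stack_ground stk)
      in if stk = [] then config_sum N T p [] a * b else config_sum N T p stk (a(r := \<iota> b * a r)))"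

text \<open>The closing block is an interval and everything to its right is the ground of the
  smaller stack, so \<open>part_eval_absorb\<close> may remove it;
  \<open>remove_closed_block\<close> reindexes the sum.\<close>

lemma config_sum_close:
  assumes T: "T \<in> Tree N" and ok: "stack_ok T (Suc p) stk" and opt: "(j, I, stk') \<in> stack_moves T stk"
  shows "(\<Sum>(\<pi>, \<kappa>)\<in>{(\<pi>, \<kappa>) \<in> configs N T (Suc p) stk. insert (Suc p) I \<in> \<pi> \<and> \<kappa> (insert (Suc p) I) = j}.
      part_eval boolean_cumulant \<pi> a) = close_sum N T p I stk' a"
proof -
  note o = stack_movesD[OF T ok opt]
  note ctx = Tree_subset[OF T] o(1-5)
  let ?V = "insert (Suc p) I"
  let ?G = "{1..p} \<union> stack_ground stk'"
  let ?R = "{(\<pi>, \<kappa>). \<pi> \<in> NC (?G \<union> ?V) \<and> \<kappa> \<in> strict_colorings N T \<pi> \<and> open_blocks (Suc p) stk' \<pi> \<kappa> \<and> ?V \<in> \<pi> \<and> \<kappa> ?V = j}"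
  have bij: "bij_betw (\<lambda>(\<pi>, \<kappa>). (\<pi> - {?V}, restrict \<kappa> (\<pi> - {?V}))) ?R (configs N T p stk')"
    by (rule remove_closed_block) (use ctx in auto)
  have Req: "{(\<pi>, \<kappa>) \<in> configs N T (Suc p) stk. ?V \<in> \<pi> \<and> \<kappa> ?V = j} = ?R"
  proof -
    have "?V - {..Suc p} = I" using o(3) by (auto dest: o(3) leD)
    moreover have "?V \<noteq> I" using o(3) by blast
    ultimately show ?thesis unfolding configs_def o(6) o(7) by blast
  qed
  define b where "b = boolean_cumulant (map a (sorted_list_of_set ?V))"
  define a' where "a' = (if stk' = [] then a else a(Min (stack_ground stk') := \<iota> b * a (Min (stack_ground stk'))))"
  define c where "c = (if stk' = [] then b else 1)"
  have sg: "stack_ground stk' = {} \<longleftrightarrow> stk' = []"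
  proof
    assume "stack_ground stk' = {}"
    then show "stk' = []" using stack_okD(2)[OF o(1)] unfolding stack_ground_def by (cases stk') force+
  qed (simp add: stack_ground_def)
  have eval: "part_eval boolean_cumulant \<pi> a = part_eval boolean_cumulant (\<pi> - {?V}) a' * c" if "(\<pi>, \<kappa>) \<in> ?R" for \<pi> \<kappa>
  proof -
    have \<pi>: "\<pi> \<in> NC (?G \<union> ?V)" "?V \<in> \<pi>" using that by auto
    have nc: "nc_part \<pi>" and int: "interval_block \<pi> ?V" and R: "right_of \<pi> ?V = stack_ground stk'"
      using interval_block_closed[OF ctx \<pi>] by auto
    show ?thesis
      unfolding part_eval_absorb[OF left_multilinear_boolean nc int] absorb_block_def R sg a'_def c_def b_def Let_def by auto
  qed
  have "(\<Sum>(\<pi>, \<kappa>)\<in>?R. part_eval boolean_cumulant \<pi> a) = (\<Sum>x\<in>?R. (case (case x of (\<pi>, \<kappa>) \<Rightarrow> (\<pi> - {?V}, restrict \<kappa> (\<pi> - {?V}))) of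
      (\<pi>, \<kappa>) \<Rightarrow> part_eval boolean_cumulant \<pi> a' * c))"
    using eval by (intro sum.cong) auto
  also have "\<dots> = (\<Sum>(\<pi>, \<kappa>)\<in>configs N T p stk'. part_eval boolean_cumulant \<pi> a' * c)"
    by (rule sum.reindex_bij_betw[OF bij])
  also have "\<dots> = config_sum N T p stk' a' * c"
    unfolding config_sum_def by (simp add: sum_distrib_right split_beta)
  also have "\<dots> = close_sum N T p I stk' a"
    unfolding close_sum_def a'_def c_def b_def Let_def by simp
  finally show ?thesis unfolding Req .
qed

text \<open>Completions are sorted by the move of \<open>Suc p\<close>, and for each move by whether
  the block ends there or goes on below. Different moves give disjoint classes, because the block of
  \<open>Suc p\<close> fixes the color and the remnant, and these fix the smaller stack.\<close>

lemma config_sum_Suc: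
  assumes T: "T \<in> Tree N" and ok: "stack_ok T (Suc p) stk"
  shows "config_sum N T (Suc p) stk a = (\<Sum>(j, I, stk')\<in>stack_moves T stk.
     close_sum N T p I stk' a + config_sum N T p ((j, insert (Suc p) I) # stk') a)"
proof -
  let ?q = "Suc p"
  let ?C = "configs N T ?q stk"
  define F where "F = (\<lambda>(j, I, stk'::(nat \<times> nat set) list). {(\<pi>, \<kappa>) \<in> ?C. \<exists>V\<in>\<pi>. V - {..p} = insert ?q I \<and> \<kappa> V = j})"
  have finC: "finite ?C" by (rule finite_configs[OF ok])
  have ncC: "nc_part \<pi>" if "(\<pi>, \<kappa>) \<in> ?C" for \<pi> \<kappa>
    using that nc_part_NC[of "{1..?q} \<union> stack_ground stk"] finite_stack_ground[OF ok] unfolding configs_def by auto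
  have split: "?C = (\<Union>u\<in>stack_moves T stk. F u)"
    using configs_split[OF T ok] unfolding F_def by (simp add: split_beta)
  have disj: "F u \<inter> F v = {}" if uv: "u \<in> stack_moves T stk" "v \<in> stack_moves T stk" "u \<noteq> v" for u v
  proof (rule ccontr)
    assume "F u \<inter> F v \<noteq> {}"
    then obtain \<pi> \<kappa> where x: "(\<pi>, \<kappa>) \<in> F u" "(\<pi>, \<kappa>) \<in> F v" by auto
    obtain j I s where u: "u = (j, I, s)" by (cases u)
    obtain j' I' s' where v: "v = (j', I', s')" by (cases v)
    have C: "(\<pi>, \<kappa>) \<in> ?C" using x(1) unfolding F_def u by simp
    obtain V where V: "V \<in> \<pi>" "V - {..p} = insert ?q I" "\<kappa> V = j" using x(1) unfolding F_def u by auto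
    obtain W where W: "W \<in> \<pi>" "W - {..p} = insert ?q I'" "\<kappa> W = j'" using x(2) unfolding F_def v by auto
    have "V = W" using nc_part_disjoint[OF ncC[OF C] V(1) W(1), of ?q] V(2) W(2) by blast
    then have "j = j'" and ins: "insert ?q I = insert ?q I'" using V W by auto
    have qI: "?q \<notin> I" "?q \<notin> I'"
      using stack_movesD(3)[OF T ok uv(1)[unfolded u], of ?q] stack_movesD(3)[OF T ok uv(2)[unfolded v], of ?q]
      by (simp_all only: less_irrefl) blast+
    have "I = I'" using insert_ident[OF qI] ins by blast
    have 1: "if I = {} then s = stk else stk = (j, I) # s" by (rule stack_movesD(8)[OF T ok uv(1)[unfolded u]])
    have 2: "if I = {} then s' = stk else stk = (j', I) # s'"
      using stack_movesD(8)[OF T ok uv(2)[unfolded v]] unfolding \<open>I = I'\<close> .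
    have "s = s'"
    proof (cases "I = {}")
      case True
      then show ?thesis using 1 2 by (simp only: if_True)
    next
      case False
      then have "(j, I) # s = (j', I) # s'" using 1 2 by (simp only: if_False)
      then show ?thesis by simp
    qed
    then show False using uv(3) u v \<open>I = I'\<close> \<open>j = j'\<close> by simp
  qed
  have Feq: "(\<Sum>(\<pi>, \<kappa>)\<in>F (j, I, s). part_eval boolean_cumulant \<pi> a) =
      close_sum N T p I s a + config_sum N T p ((j, insert ?q I) # s) a" if opt: "(j, I, s) \<in> stack_moves T stk" for j I s
  proof -
    note o = stack_movesD[OF T ok opt]
    let ?V = "insert ?q I"
    let ?Rem = "{(\<pi>, \<kappa>) \<in> ?C. ?V \<in> \<pi> \<and> \<kappa> ?V = j}"
    let ?Push = "configs N T p ((j, ?V) # s)"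
    have Vp: "?V - {..p} = ?V"
    proof -
      have "p < x" if "x \<in> ?V" for x using that o(3)[of x] by (cases "x = Suc p") auto
      then show ?thesis by (auto dest: leD)
    qed
    have Vq: "?q \<in> ?V" by simp
    have "F (j, I, s) = ?Rem \<union> ?Push"
    proof
      show "F (j, I, s) \<subseteq> ?Rem \<union> ?Push"
      proof
        fix x assume x: "x \<in> F (j, I, s)"
        obtain \<pi> \<kappa> where x_eq: "x = (\<pi>, \<kappa>)" by (cases x)
        obtain V where V: "V \<in> \<pi>" "V - {..p} = ?V" "\<kappa> V = j" and C: "(\<pi>, \<kappa>) \<in> ?C"
          using x unfolding F_def x_eq by auto
        show "x \<in> ?Rem \<union> ?Push"
          unfolding x_eq Un_iff configs_push[OF T ok opt] using V C by (cases "V = ?V") auto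
      qed
      show "?Rem \<union> ?Push \<subseteq> F (j, I, s)"
      proof
        fix x assume x: "x \<in> ?Rem \<union> ?Push"
        obtain \<pi> \<kappa> where x_eq: "x = (\<pi>, \<kappa>)" by (cases x)
        show "x \<in> F (j, I, s)"
          using x Vp unfolding x_eq Un_iff configs_push[OF T ok opt] F_def by auto
      qed
    qed
    moreover have "?Rem \<inter> ?Push = {}"
    proof (rule ccontr)
      assume "?Rem \<inter> ?Push \<noteq> {}"
      then obtain \<pi> \<kappa> where x: "(\<pi>, \<kappa>) \<in> ?Rem" "(\<pi>, \<kappa>) \<in> ?Push" by auto
      have C: "(\<pi>, \<kappa>) \<in> ?C" and m: "?V \<in> \<pi>" using x(1) by auto
      obtain V where V: "V \<in> \<pi>" "V - {..p} = ?V" "V \<noteq> ?V" using x(2) configs_push[OF T ok opt] by blast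
      then have "V = ?V" using nc_part_disjoint[OF ncC[OF C] V(1) m, of ?q] by blast
      then show False using V(3) by blast
    qed
    moreover have "finite ?Rem" by (rule finite_subset[OF _ finC]) auto
    moreover have "finite ?Push" by (rule finite_configs[OF o(9)])
    ultimately have "(\<Sum>(\<pi>, \<kappa>)\<in>F (j, I, s). part_eval boolean_cumulant \<pi> a) =
        (\<Sum>(\<pi>, \<kappa>)\<in>?Rem. part_eval boolean_cumulant \<pi> a) + (\<Sum>(\<pi>, \<kappa>)\<in>?Push. part_eval boolean_cumulant \<pi> a)"
      by (simp only: sum.union_disjoint)
    then show ?thesis unfolding config_sum_close[OF T ok opt] config_sum_def .
  qed
  have "config_sum N T ?q stk a = (\<Sum>(\<pi>, \<kappa>)\<in>(\<Union>u\<in>stack_moves T stk. F u). part_eval boolean_cumulant \<pi> a)"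
    unfolding config_sum_def split[symmetric] ..
  also have "\<dots> = (\<Sum>u\<in>stack_moves T stk. \<Sum>(\<pi>, \<kappa>)\<in>F u. part_eval boolean_cumulant \<pi> a)"
  proof (rule sum.UNION_disjoint)
    show "finite (stack_moves T stk)" by (rule finite_stack_moves[OF Tree_subset[OF T]])
    show "\<forall>u\<in>stack_moves T stk. finite (F u)"
      unfolding F_def by (auto intro: finite_subset[OF _ finC])
  qed (use disj in blast)
  also have "\<dots> = (\<Sum>(j, I, s)\<in>stack_moves T stk. close_sum N T p I s a + config_sum N T p ((j, insert ?q I) # s) a)"
    using Feq by (intro sum.cong) auto
  finally show ?thesis .
qed

end

section \<open>Hilbert modules\<close>

lemma adj_0: "adj (0::'a::cstar_algebra) = 0"
  using adj_add[of 0 "0::'a"] by simp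

lemma adj_1: "adj (1::'a::cstar_algebra) = 1"
proof -
  have "adj (1 * adj 1) = adj (adj 1) * adj (1::'a)" by (rule adj_mult)
  then show ?thesis by (simp add: adj_adj)
qed

lemma scaleC_one: "scaleC 1 (x::'a::cstar_algebra) = x"
  using scaleC_of_real[of 1 x] by simp

lemma scaleC_minus: "scaleC (- c) (x::'a::cstar_algebra) = - scaleC c x"
proof -
  have "scaleC 0 x = 0" using scaleC_of_real[of 0 x] by simp
  then have "scaleC (- c) x + scaleC c x = 0" by (simp flip: scaleC_add_left)
  then show ?thesis by (simp add: add_eq_0_iff2)
qed

lemma bounded_linear_eq_closure_span:
  assumes "bounded_linear f" "bounded_linear g" "\<And>x. x \<in> X \<Longrightarrow> f x = g x" "x \<in> closure (span X)"
  shows "f x = g x"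
proof -
  let ?K = "{x. f x - g x = 0}"
  have bl: "bounded_linear (\<lambda>x. f x - g x)" by (rule bounded_linear_sub[OF assms(1,2)])
  note lin = bounded_linear.linear[OF assms(1)] bounded_linear.linear[OF assms(2)]
  have "subspace ?K"
    by (intro subspaceI)
      (simp_all add: linear_0[OF lin(1)] linear_0[OF lin(2)] linear_add[OF lin(1)] linear_add[OF lin(2)]
        linear_cmul[OF lin(1)] linear_cmul[OF lin(2)])
  moreover have "X \<subseteq> ?K" using assms(3) by auto
  ultimately have "span X \<subseteq> ?K" by (intro span_minimal)
  moreover have "closed ?K"
    by (intro closed_Collect_eq continuous_on_const linear_continuous_on bl)
  ultimately have "closure (span X) \<subseteq> ?K" by (rule closure_minimal)
  then show ?thesis using assms(4) by auto
qed

context hilbert_module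
begin

lemma ract_0: "ract M h 0 = 0" and ract_1: "ract M h 1 = h"
  using ract_of_real[of h 0] ract_of_real[of h 1] by simp_all

lemma ract_zero_left: "ract M 0 b = 0"
  using ract_add_left[of 0 0 b] by simp

lemma ip_zero_right: "ip M h 0 = 0"
  using ip_add_right[of h 0 0] by simp

lemma ip_minus_right: "ip M h (- k) = - ip M h k"
  using ip_add_right[of h k "- k"] by (simp add: ip_zero_right eq_neg_iff_add_eq_0 add.commute)

lemma ip_diff_right: "ip M h (k - l) = ip M h k - ip M h l"
  using ip_add_right[of h k "- l"] by (simp add: ip_minus_right)

lemma ip_add_left: "ip M (h + k) l = ip M h l + ip M k l"
proof -
  have "adj (ip M l (h + k)) = adj (ip M l h) + adj (ip M l k)" by (simp add: ip_add_right adj_add)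
  then show ?thesis by (simp add: ip_adj)
qed

lemma ip_scaleR_right: "ip M h (r *\<^sub>R k) = r *\<^sub>R ip M h k"
proof -
  have "ip M h (r *\<^sub>R k) = ip M h k * of_real r" by (simp flip: ract_of_real ip_ract_right)
  then show ?thesis by (simp add: of_real_def)
qed

lemma ip_minus_left: "ip M (- h) k = - ip M h k"
  using ip_add_left[of h "- h" k] ip_add_left[of 0 0 k] by (simp add: eq_neg_iff_add_eq_0 add.commute)

lemma norm_ip_self: "norm (ip M h h) = (norm h)\<^sup>2"
  by (simp add: norm_ip)

text \<open>Polarization gives a crude Cauchy--Schwarz bound, which is all that continuity needs.\<close>

lemma norm_ip_le: "norm (ip M h k) \<le> (norm h + norm k)\<^sup>2"
proof -
  define k' where "k' = ract M k (scaleC \<i> 1)"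
  have sym: "norm (ip M h k + ip M k h) \<le> (norm h + norm k)\<^sup>2" for h k
  proof -
    have "ip M (h + k) (h + k) = ip M h h + ip M h k + (ip M k h + ip M k k)"
      by (simp add: ip_add_left ip_add_right)
    moreover have "ip M (h + - k) (h + - k) = ip M h h - ip M h k + (- ip M k h + ip M k k)"
      unfolding ip_add_left ip_add_right ip_minus_left ip_minus_right by simp
    ultimately have "ip M (h + k) (h + k) - ip M (h + - k) (h + - k) = 2 *\<^sub>R (ip M h k + ip M k h)"
      by (simp add: scaleR_2)
    then have "2 * norm (ip M h k + ip M k h) = norm (ip M (h + k) (h + k) - ip M (h + - k) (h + - k))"
      by simp
    also have "\<dots> \<le> (norm (h + k))\<^sup>2 + (norm (h + - k))\<^sup>2"
      by (rule order.trans[OF norm_triangle_ineq4]) (simp add: norm_ip_self)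
    also have "\<dots> \<le> (norm h + norm k)\<^sup>2 + (norm h + norm k)\<^sup>2"
      by (intro add_mono power_mono norm_triangle_ineq norm_triangle_ineq4 norm_ge_zero) 
        (use norm_triangle_ineq4[of h k] in simp)
    finally show ?thesis by simp
  qed
  have ik': "ip M h k' = scaleC \<i> (ip M h k)"
    unfolding k'_def ip_ract_right mult_scaleC_right by simp
  have k'h: "ip M k' h = - scaleC \<i> (ip M k h)"
    using arg_cong[OF ik', of adj] by (simp add: ip_adj adj_scaleC scaleC_minus)
  have "ip M k' k' = scaleC \<i> (- scaleC \<i> (ip M k k))"
  proof -
    have "ip M k k' = scaleC \<i> (ip M k k)" unfolding k'_def ip_ract_right mult_scaleC_right by simp
    from arg_cong[OF this, of adj] have "ip M k' k = - scaleC \<i> (ip M k k)"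
      by (simp add: ip_adj adj_scaleC scaleC_minus)
    moreover have "ip M k' k' = scaleC \<i> (ip M k' k)"
      by (subst (2) k'_def) (simp add: ip_ract_right mult_scaleC_right)
    ultimately show ?thesis by simp
  qed
  then have "norm (ip M k' k') = norm (ip M k k)" by (simp add: norm_scaleC)
  then have nk': "norm k' = norm k" by (simp add: norm_ip)
  \<comment> \<open>The vector \<open>k'\<close> is \<open>k\<close> times the imaginary unit.
    Passing to it flips the relative sign of the two inner products, so both symmetric sums together
    isolate the one of \<open>h\<close> with \<open>k\<close>.\<close>
  have "2 *\<^sub>R ip M h k = (ip M h k + ip M k h) - scaleC \<i> (ip M h k' + ip M k' h)"
  proof -
    have "scaleC \<i> (ip M h k' + ip M k' h) = scaleC (\<i> * \<i>) (ip M h k) + scaleC \<i> (scaleC (- \<i>) (ip M k h))"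
      unfolding ik' k'h scaleC_add_right scaleC_scaleC scaleC_minus by simp
    also have "\<dots> = - ip M h k + ip M k h"
      unfolding scaleC_scaleC by (simp add: scaleC_minus scaleC_one)
    finally show ?thesis by (simp add: scaleR_2)
  qed
  then have "2 * norm (ip M h k) = norm ((ip M h k + ip M k h) - scaleC \<i> (ip M h k' + ip M k' h))"
    by (metis norm_scaleR abs_numeral)
  also have "\<dots> \<le> norm (ip M h k + ip M k h) + norm (ip M h k' + ip M k' h)"
    by (rule order.trans[OF norm_triangle_ineq4]) (simp add: norm_scaleC)
  also have "\<dots> \<le> (norm h + norm k)\<^sup>2 + (norm h + norm k)\<^sup>2"
    using sym[of h k] sym[of h k'] unfolding nk' by linarith
  finally show ?thesis by simp
qed

lemma bounded_linear_ip: "bounded_linear (ip M h)"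
proof (rule bounded_linear_intro)
  show "ip M h (x + y) = ip M h x + ip M h y" for x y by (rule ip_add_right)
  show "ip M h (r *\<^sub>R x) = r *\<^sub>R ip M h x" for r x by (rule ip_scaleR_right)
  show "norm (ip M h x) \<le> norm x * (norm h + 1)\<^sup>2" for x
  proof (cases "x = 0")
    case False
    let ?y = "(1 / norm x) *\<^sub>R x"
    \<comment> \<open>Rescaling to norm one turns the quadratic bound into the linear one required
      for bounded operators.\<close>
    have "norm (ip M h ?y) \<le> (norm h + 1)\<^sup>2" using norm_ip_le[of h ?y] False by simp
    then show ?thesis using False by (simp add: ip_scaleR_right field_simps)
  qed (simp add: ip_zero_right)
qed

end

lemma adjointableD:
  assumes "adjointable M f"
  shows "bounded_linear f" "f (ract M h b) = ract M (f h) b"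
  using assms by (auto simp: adjointable_def)

section \<open>The left action of the coefficient algebra and the copies of the algebra on the
  product module\<close>

locale tree_free_product = bvalued_prob_space \<iota> E + LM: L2_module \<iota> E L + HM: tree_product_module T \<iota> L H
  for N :: nat and T :: "nat list set"
    and \<iota> :: "'b::cstar_algebra \<Rightarrow> 'a::cstar_algebra" and E :: "'a \<Rightarrow> 'b"
    and L :: "('a, 'k::banach, 'b) L2_structure"
    and H :: "('k, 'h::banach, 'b) product_structure" +
  fixes \<Lambda> :: "nat \<Rightarrow> 'a \<Rightarrow> 'h \<Rightarrow> 'h"
  assumes T: "T \<in> Tree N"
    and lambda: "\<And>j a. j \<in> {1..N} \<Longrightarrow> tree_lambda T L H j (lmul L a) (\<Lambda> j a)"
begin

lemma cls_0: "cls L 0 = 0"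
  using LM.cls_add[of 0 0] by simp

lemma cls_diff: "cls L (x - y) = cls L x - cls L y"
  using LM.cls_add[of "x - y" y] by simp

text \<open>The structure \<open>L\<close> prescribes \<open>lmul\<close> only on the dense set of
  classes; the algebraic laws of \<open>lmul\<close> are extended from there by continuity.\<close>

lemma cls_eq_ext:
  assumes "bounded_linear f" "bounded_linear g" "\<And>x. f (cls L x) = g (cls L x)"
  shows "f h = g h"
proof (rule bounded_linear_eq_closure_span[OF assms(1,2)])
  have "closure (range (cls L)) \<subseteq> closure (span (range (cls L)))"
    by (intro closure_mono span_superset)
  then show "h \<in> closure (span (range (cls L)))" using LM.cls_dense by auto
qed (use assms(3) in auto)

lemma bounded_linear_lmul: "bounded_linear (lmul L x)"
  using adjointableD(1)[OF LM.lmul_adjointable] .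

lemma lmul_mult: "lmul L (x * y) h = lmul L x (lmul L y h)"
proof (rule cls_eq_ext[where f = "lmul L (x * y)" and g = "\<lambda>h. lmul L x (lmul L y h)"])
  show "bounded_linear (\<lambda>h. lmul L x (lmul L y h))"
    by (rule bounded_linear_compose[OF bounded_linear_lmul bounded_linear_lmul])
qed (simp_all add: bounded_linear_lmul LM.lmul_cls mult.assoc)

lemma lmul_1: "lmul L 1 h = h"
  by (rule cls_eq_ext[where f = "lmul L 1" and g = "\<lambda>h. h"])
    (simp_all add: bounded_linear_lmul bounded_linear_ident LM.lmul_cls)

lemma lmul_0: "lmul L 0 h = 0"
  by (rule cls_eq_ext[where f = "lmul L 0" and g = "\<lambda>h. 0"])
    (simp_all add: bounded_linear_lmul bounded_linear_zero LM.lmul_cls cls_0)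

definition vcoeff :: "'k \<Rightarrow> 'b" where
  "vcoeff h = ip L (cls L 1) h"

definition centred_part :: "'k \<Rightarrow> 'k" where
  "centred_part h = h - ract L (cls L 1) (vcoeff h)"

lemma attach_eq: "attach L H j h v = lact H (vcoeff h) v + tens H j (centred_part h) v"
  by (simp add: attach_def vcoeff_def centred_part_def)

lemma vcoeff_cls: "vcoeff (cls L x) = E x"
  by (simp add: vcoeff_def LM.cls_ip adj_1)

lemma centred_part_cls: "centred_part (cls L x) = cls L (centre x)"
proof -
  have "ract L (cls L 1) (E x) = cls L (\<iota> (E x))" using LM.cls_ract[of 1 "E x"] by simp
  then show ?thesis by (simp add: centred_part_def vcoeff_cls centre_def cls_diff)
qed

lemma centred_iff: "h \<in> centred L \<longleftrightarrow> vcoeff h = 0"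
proof -
  have "ip L h (cls L 1) = adj (vcoeff h)" by (simp add: vcoeff_def LM.ip_adj)
  then show ?thesis unfolding centred_def by (metis adj_0 adj_adj mem_Collect_eq)
qed

lemma centred_part_centred: "centred_part h \<in> centred L"
  unfolding centred_iff
  by (simp add: vcoeff_def centred_part_def LM.ip_diff_right LM.ip_ract_right LM.cls_ip adj_1 E_one)

lemma centred_part_id: "h \<in> centred L \<Longrightarrow> centred_part h = h"
  unfolding centred_iff by (simp add: centred_part_def LM.ract_0)

lemma centred_0: "0 \<in> centred L"
  unfolding centred_iff by (simp add: vcoeff_def LM.ip_zero_right)

lemma cls_centre_centred: "cls L (centre x) \<in> centred L"
  unfolding centred_iff vcoeff_cls by (rule E_centre)

lemma vcoeff_lmul_incl: "vcoeff (lmul L (\<iota> b) h) = b * vcoeff h"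
proof (rule cls_eq_ext[where f = "\<lambda>h. vcoeff (lmul L (\<iota> b) h)" and g = "\<lambda>h. b * vcoeff h"])
  show "bounded_linear (\<lambda>h. vcoeff (lmul L (\<iota> b) h))"
    unfolding vcoeff_def by (rule bounded_linear_compose[OF LM.bounded_linear_ip bounded_linear_lmul])
  show "bounded_linear (\<lambda>h. b * vcoeff h)"
    unfolding vcoeff_def
    by (rule bounded_linear_compose[OF bounded_linear_mult_right LM.bounded_linear_ip])
qed (simp add: LM.lmul_cls vcoeff_cls E_left)

lemma lmul_incl_centred: "h \<in> centred L \<Longrightarrow> lmul L (\<iota> b) h \<in> centred L"
  unfolding centred_iff vcoeff_lmul_incl by simp

text \<open>On the vacuum class, left multiplication by \<open>b\<close> agrees with the right
  action of \<open>b\<close>, both giving the class of \<open>\<iota> b\<close>. Hence the left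
  action commutes with the projection onto the vacuum part.\<close>

lemma centred_part_lmul_incl: "centred_part (lmul L (\<iota> b) h) = lmul L (\<iota> b) (centred_part h)"
proof -
  have "lmul L (\<iota> b) (ract L (cls L 1) c) = ract L (cls L 1) (b * c)" for c
  proof -
    have "lmul L (\<iota> b) (ract L (cls L 1) c) = ract L (cls L (1 * \<iota> b)) c"
      by (simp add: adjointableD(2)[OF LM.lmul_adjointable] LM.lmul_cls)
    also have "\<dots> = ract L (cls L 1) (b * c)" unfolding LM.cls_ract LM.ract_mult ..
    finally show ?thesis .
  qed
  then show ?thesis
    by (simp add: centred_part_def vcoeff_lmul_incl linear_diff[OF bounded_linear.linear[OF bounded_linear_lmul]])
qed

lemma tensD:
  assumes "j # s \<in> T"
  shows "\<lbrakk>h \<in> centred L; v \<in> summand H s\<rbrakk> \<Longrightarrow> tens H j h v \<in> summand H (j # s)"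
    and "summand H (j # s) = closure (span {tens H j h v |h v. h \<in> centred L \<and> v \<in> summand H s})"
    and "v \<in> summand H s \<Longrightarrow> tens H j 0 v = 0"
proof -
  note it = HM.summand_Cons[OF assms]
  show Q: "summand H (j # s) = closure (span {tens H j h v |h v. h \<in> centred L \<and> v \<in> summand H s})"
    using it unfolding interior_tensor_def by blast
  show "tens H j h v \<in> summand H (j # s)" if "h \<in> centred L" "v \<in> summand H s"
    unfolding Q using that by (intro subsetD[OF closure_subset] span_base) blast
  have "\<forall>h\<in>centred L. \<forall>k\<in>centred L. \<forall>v\<in>summand H s. tens H j (h + k) v = tens H j h v + tens H j k v"
    using it unfolding interior_tensor_def by blast
  from bspec[OF bspec[OF bspec[OF this centred_0] centred_0]]
  show "tens H j 0 v = 0" if "v \<in> summand H s" using that by simp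
qed

text \<open>A nontrivial summand is the closed span of its elementary tensors, and on those
  \<open>lact\<close> and the other operators are prescribed directly. A distinction between the
  vacuum summand and the others suffices, without induction on the string.\<close>

lemma eq_on_summand:
  assumes f: "bounded_linear f" and g: "bounded_linear g"
    and Nil: "\<And>b. f (ract H (vac H) b) = g (ract H (vac H) b)"
    and Cons: "\<And>j s h v. \<lbrakk>j # s \<in> T; h \<in> centred L; v \<in> summand H s\<rbrakk> \<Longrightarrow> f (tens H j h v) = g (tens H j h v)"
    and s: "s \<in> T" "v \<in> summand H s"
  shows "f v = g v"
proof (cases s)
  case Nil
  then show ?thesis using s HM.summand_Nil assms(3) by auto
next
  case (Cons j t)
  show ?thesis
    by (rule bounded_linear_eq_closure_span[OF f g, of "{tens H j h v |h v. h \<in> centred L \<and> v \<in> summand H t}"])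
      (use assms(4) s tensD(2) Cons in auto)
qed

lemma eq_ext:
  assumes f: "bounded_linear f" and g: "bounded_linear g"
    and eq: "\<And>s v. s \<in> T \<Longrightarrow> v \<in> summand H s \<Longrightarrow> f v = g v"
  shows "f v = g v"
  by (rule bounded_linear_eq_closure_span[OF f g, of "\<Union>s\<in>T. summand H s"])
    (use eq HM.summand_dense in auto)

lemma bounded_linear_lact: "bounded_linear (lact H b)"
  using adjointableD(1)[OF HM.lact_adjointable] .

lemma lact_mult: "lact H (b * c) v = lact H b (lact H c v)"
proof (rule eq_ext[where f = "lact H (b * c)" and g = "\<lambda>v. lact H b (lact H c v)"])
  show b: "bounded_linear (\<lambda>v. lact H b (lact H c v))"
    by (rule bounded_linear_compose[OF bounded_linear_lact bounded_linear_lact])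
  show "lact H (b * c) v = lact H b (lact H c v)" if "s \<in> T" "v \<in> summand H s" for s v
  proof (rule eq_on_summand[OF bounded_linear_lact b _ _ that])
    show "lact H (b * c) (tens H j h v) = lact H b (lact H c (tens H j h v))"
      if "j # s \<in> T" "h \<in> centred L" "v \<in> summand H s" for j s h v
      using that by (simp add: HM.lact_tens lmul_incl_centred incl_mult lmul_mult)
  qed (simp add: HM.lact_vac mult.assoc)
qed (rule bounded_linear_lact)

lemma lact_1: "lact H 1 v = v"
proof (rule eq_ext[where f = "lact H 1" and g = "\<lambda>v. v"])
  show "lact H 1 v = v" if "s \<in> T" "v \<in> summand H s" for s v
  proof (rule eq_on_summand[OF bounded_linear_lact bounded_linear_ident _ _ that])
    show "lact H 1 (tens H j h v) = tens H j h v"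
      if "j # s \<in> T" "h \<in> centred L" "v \<in> summand H s" for j s h v
      using that by (simp add: HM.lact_tens incl_one lmul_1)
  qed (simp add: HM.lact_vac)
qed (rule bounded_linear_lact bounded_linear_ident)+

lemma lact_0: "lact H 0 v = 0"
proof (rule eq_ext[where f = "lact H 0" and g = "\<lambda>v. 0"])
  show "lact H 0 v = 0" if "s \<in> T" "v \<in> summand H s" for s v
  proof (rule eq_on_summand[OF bounded_linear_lact bounded_linear_zero _ _ that])
    show "lact H 0 (tens H j h v) = 0"
      if "j # s \<in> T" "h \<in> centred L" "v \<in> summand H s" for j s h v
      using that by (simp add: HM.lact_tens incl_0 lmul_0 tensD(3))
  qed (simp add: HM.lact_vac HM.ract_0)
qed (rule bounded_linear_lact bounded_linear_zero)+

lemma not_begin: "j # s \<in> T \<Longrightarrow> \<not> (s \<noteq> [] \<and> hd s = j)"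
  using Tree_subset[OF T] unfolding free_tree_def by (auto simp: distinct_adj_Cons)

lemma letter_range: "j # s \<in> T \<Longrightarrow> j \<in> {1..N}"
  using Tree_subset[OF T] unfolding free_tree_def by auto

lemma lambda_attach:
  assumes "j # s \<in> T" "v \<in> summand H s"
  shows "\<Lambda> j a (attach L H j h v) = attach L H j (lmul L a h) v"
proof -
  note t = lambda[OF letter_range[OF assms(1)], of a, unfolded tree_lambda_def]
  show ?thesis using t Tree_ConsD[OF T assms(1)] not_begin[OF assms(1)] assms by auto
qed

lemma lambda_zero:
  assumes "j \<in> {1..N}" "s \<in> T" "\<not> (s \<noteq> [] \<and> hd s = j)" "j # s \<notin> T" "v \<in> summand H s"
  shows "\<Lambda> j a v = 0"
  using lambda[OF assms(1), of a, unfolded tree_lambda_def] assms by auto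

lemma bounded_linear_lambda: "j \<in> {1..N} \<Longrightarrow> bounded_linear (\<Lambda> j a)"
  using lambda[of j a] adjointableD(1) unfolding tree_lambda_def by blast

text \<open>The vacuum class in front of \<open>v\<close> is identified with \<open>v\<close>
  itself. This is how an elementary tensor not beginning with \<open>j\<close> is fed to the
  operator of the \<open>j\<close>-th factor.\<close>

lemma attach_cls_1:
  assumes "j # s \<in> T" "v \<in> summand H s"
  shows "attach L H j (cls L 1) v = v"
proof -
  have "centre 1 = 0" by (simp add: centre_def E_one incl_one)
  then show ?thesis
    by (simp add: attach_eq vcoeff_cls E_one centred_part_cls cls_0 lact_1 tensD(3)[OF assms])
qed

lemma attach_centred:
  assumes "h \<in> centred L"
  shows "attach L H j h v = tens H j h v"
  using assms centred_iff by (simp add: attach_eq centred_part_id lact_0)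

lemma attach_cls: "attach L H j (cls L x) v = lact H (E x) v + tens H j (cls L (centre x)) v"
  by (simp add: attach_eq vcoeff_cls centred_part_cls)

lemma lact_attach:
  assumes "j # s \<in> T" "v \<in> summand H s"
  shows "lact H b (attach L H j h v) = attach L H j (lmul L (\<iota> b) h) v"
  by (simp add: attach_eq linear_add[OF bounded_linear.linear[OF bounded_linear_lact]] lact_mult
      vcoeff_lmul_incl centred_part_lmul_incl HM.lact_tens[OF assms(1) centred_part_centred assms(2)])

text \<open>On attached tensors both operators are left multiplications in the first factor by the
  same element; on the remaining summands both vanish. It allows coefficients from \<B> to be
  absorbed into the argument of the embedding.\<close>

lemma lact_lambda:
  assumes j: "j \<in> {1..N}"
  shows "lact H b (\<Lambda> j a v) = \<Lambda> j (\<iota> b * a) v"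
proof (rule eq_ext[where f = "\<lambda>v. lact H b (\<Lambda> j a v)" and g = "\<Lambda> j (\<iota> b * a)"])
  show bl: "bounded_linear (\<lambda>v. lact H b (\<Lambda> j a v))"
    by (rule bounded_linear_compose[OF bounded_linear_lact bounded_linear_lambda[OF j]])
  have att: "lact H b (\<Lambda> j a (attach L H j h v)) = \<Lambda> j (\<iota> b * a) (attach L H j h v)"
    if "j # s \<in> T" "v \<in> summand H s" for s h v
    by (simp add: lambda_attach[OF that] lact_attach[OF that] lmul_mult)
  fix s v assume s: "s \<in> T" "v \<in> summand H s"
  show "lact H b (\<Lambda> j a v) = \<Lambda> j (\<iota> b * a) v"
  \<comment> \<open>The summands are of three kinds: strings beginning with \<open>j\<close>,
    strings that can be extended by \<open>j\<close> inside \<open>T\<close>, and strings on which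
    the operator is zero. The first two are covered by tensors of the form
    \<open>attach\<close>.\<close>
  proof (cases "s \<noteq> [] \<and> hd s = j")
    case True
    then obtain t where t: "s = j # t" by (cases s) auto
    show ?thesis
    proof (rule bounded_linear_eq_closure_span[where f = "\<lambda>v. lact H b (\<Lambda> j a v)" and g = "\<Lambda> j (\<iota> b * a)", OF bl bounded_linear_lambda[OF j]])
      show "v \<in> closure (span {tens H j h v |h v. h \<in> centred L \<and> v \<in> summand H t})"
        using s tensD(2) unfolding t by blast
      show "lact H b (\<Lambda> j a x) = \<Lambda> j (\<iota> b * a) x"
        if "x \<in> {tens H j h v |h v. h \<in> centred L \<and> v \<in> summand H t}" for x
      proof -
        from that obtain h w where x: "x = tens H j h w" "h \<in> centred L" "w \<in> summand H t" by blast
        show ?thesis using att[OF s(1)[unfolded t] x(3), of h] unfolding x(1) attach_centred[OF x(2)] .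
      qed
    qed
  next
    case False
    show ?thesis
    proof (cases "j # s \<in> T")
      case True
      from att[OF this s(2), of "cls L 1"] show ?thesis unfolding attach_cls_1[OF True s(2)] .
    next
      case F: False
      show ?thesis
        unfolding lambda_zero[OF j s(1) False F s(2)] by (rule linear_0[OF bounded_linear.linear[OF bounded_linear_lact]])
    qed
  qed
qed (rule bounded_linear_lambda[OF j])

end

section \<open>Words in the sums of the embeddings applied to the vacuum\<close>

context tree_free_product
begin

definition lambda_sum :: "'a \<Rightarrow> 'h \<Rightarrow> 'h" where
  "lambda_sum a v = (\<Sum>j=1..N. \<Lambda> j a v)"

lemma bounded_linear_lambda_sum: "bounded_linear (lambda_sum a)"
  unfolding lambda_sum_def[abs_def] by (intro bounded_linear_sum bounded_linear_lambda)

lemma lambda_sum_add: "lambda_sum a (v + w) = lambda_sum a v + lambda_sum a w"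
  by (rule linear_add[OF bounded_linear.linear[OF bounded_linear_lambda_sum]])

lemma lambda_ract: "j \<in> {1..N} \<Longrightarrow> \<Lambda> j a (ract H v b) = ract H (\<Lambda> j a v) b"
  by (rule adjointableD(2)[OF lambda[unfolded tree_lambda_def, THEN conjunct1]])

lemma lambda_sum_ract: "lambda_sum a (ract H v b) = ract H (lambda_sum a v) b"
proof -
  have "ract H (\<Sum>j\<in>X. f j) b = (\<Sum>j\<in>X. ract H (f j) b)" for X and f :: "nat \<Rightarrow> 'h"
    by (induction X rule: infinite_finite_induct) (simp_all add: HM.ract_add_left HM.ract_zero_left)
  then show ?thesis unfolding lambda_sum_def by (simp add: lambda_ract)
qed

lemma lact_lambda_sum: "lact H b (lambda_sum a v) = lambda_sum (\<iota> b * a) v"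
  unfolding lambda_sum_def
  by (simp add: linear_sum[OF bounded_linear.linear[OF bounded_linear_lact]] lact_lambda)

text \<open>The elementary tensor belonging to a stack: the slot of an open block holds the centred
  value of the alternating product of its letters read so far, with the innermost block in
  front.\<close>

fun stack_vec :: "(nat \<Rightarrow> 'a) \<Rightarrow> (nat \<times> nat set) list \<Rightarrow> 'h" where
  "stack_vec a [] = vac H"
| "stack_vec a ((j, I) # stk) =
     tens H j (cls L (centre (centred_prod (map a (sorted_list_of_set I))))) (stack_vec a stk)"

text \<open>The letters with indices 1 to \<open>p\<close> applied to \<open>v\<close>, the last
  index acting first, so \<open>p\<close> counts the letters that remain to be read.\<close>

fun word_op :: "(nat \<Rightarrow> 'a) \<Rightarrow> nat \<Rightarrow> 'h \<Rightarrow> 'h" where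
  "word_op a 0 v = v"
| "word_op a (Suc p) v = word_op a p (lambda_sum (a (Suc p)) v)"

lemma stack_vec_summand: "map fst stk \<in> T \<Longrightarrow> stack_vec a stk \<in> summand H (map fst stk)"
proof (induction stk)
  case Nil
  have "vac H = ract H (vac H) 1" by (simp add: HM.ract_1)
  then show ?case by (simp add: HM.summand_Nil)
next
  case (Cons e stk)
  obtain j I where e: "e = (j, I)" by (cases e)
  have "j # map fst stk \<in> T" using Cons.prems e by simp
  then show ?case
    using tensD(1)[of j "map fst stk"] Cons.IH Tree_ConsD[OF T] cls_centre_centred e by simp
qed

lemma stack_vec_cong:
  assumes "\<And>x. x \<in> stack_ground stk \<Longrightarrow> a x = a' x" "\<And>j J. (j, J) \<in> set stk \<Longrightarrow> finite J"
  shows "stack_vec a stk = stack_vec a' stk"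
  using assms
proof (induction stk)
  case (Cons e stk)
  obtain j I where e: "e = (j, I)" by (cases e)
  have "finite I" using Cons.prems(2)[of j I] e by simp
  then have "map a (sorted_list_of_set I) = map a' (sorted_list_of_set I)"
    using Cons.prems(1) e by (intro map_cong) (auto simp: stack_ground_Cons)
  moreover have "stack_vec a stk = stack_vec a' stk"
    using Cons.prems e by (intro Cons.IH) (auto simp: stack_ground_Cons)
  ultimately show ?case unfolding e stack_vec.simps by (simp only:)
qed simp

lemma word_op_add: "word_op a p (v + w) = word_op a p v + word_op a p w"
  by (induction p arbitrary: v w) (simp_all add: lambda_sum_add)

lemma word_op_0: "word_op a p 0 = 0"
  using word_op_add[of a p 0 0] by simp

lemma word_op_sum: "word_op a p (\<Sum>i\<in>X. f i) = (\<Sum>i\<in>X. word_op a p (f i))"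
  by (induction X rule: infinite_finite_induct) (simp_all add: word_op_0 word_op_add)

lemma word_op_ract: "word_op a p (ract H v b) = ract H (word_op a p v) b"
  by (induction p arbitrary: v) (simp_all add: lambda_sum_ract)

lemma word_op_cong: "(\<And>i. i \<in> {1..p} \<Longrightarrow> a i = a' i) \<Longrightarrow> word_op a p v = word_op a' p v"
  by (induction p arbitrary: v) auto

lemma ip_sum: "ip H h (\<Sum>i\<in>X. f i) = (\<Sum>i\<in>X. ip H h (f i))"
  by (rule linear_sum[OF bounded_linear.linear[OF HM.bounded_linear_ip]])

text \<open>For each move the vector is written as \<open>attach\<close> of a class
  \<open>u\<close>, and the letter replaces \<open>u\<close> by \<open>a (Suc p) * u\<close>. The
  expectation of this product is the Boolean cumulant of the closed block, acting from the left on
  the smaller stack; its centred part is the slot of the block that stays open.\<close>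

lemma lambda_sum_stack:
  assumes ok: "stack_ok T (Suc p) stk"
  shows "lambda_sum (a (Suc p)) (stack_vec a stk) = (\<Sum>(j, I, stk')\<in>stack_moves T stk.
      lact H (boolean_cumulant (map a (sorted_list_of_set (insert (Suc p) I)))) (stack_vec a stk')
      + stack_vec a ((j, insert (Suc p) I) # stk'))"
proof -
  let ?x = "a (Suc p)" and ?v = "stack_vec a stk" and ?s = "map fst stk" and ?O = "stack_moves T stk"
  let ?g = "\<lambda>(j, I, stk'). lact H (boolean_cumulant (map a (sorted_list_of_set (insert (Suc p) I)))) (stack_vec a stk')
      + stack_vec a ((j, insert (Suc p) I) # stk')"
  have s: "?s \<in> T" using ok by (simp add: stack_ok_def)
  have v: "?v \<in> summand H ?s" by (rule stack_vec_summand[OF s])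
  have act: "\<Lambda> j ?x ?v = ?g (j, I, stk')" if opt: "(j, I, stk') \<in> ?O" for j I stk'
  proof -
    note o = stack_movesD[OF T ok opt]
    have s': "map fst stk' \<in> T" using o(1) by (simp add: stack_ok_def)
    note v' = stack_vec_summand[OF s', of a]
    \<comment> \<open>The empty remnant stands for a block that starts with this letter; its slot is
      the vacuum class, which can be attached in front without changing the vector.\<close>
    define u where "u = (if I = {} then 1 else centre (centred_prod (map a (sorted_list_of_set I))))"
    have "sorted_list_of_set (insert (Suc p) I) = Suc p # sorted_list_of_set I"
      by (rule sorted_list_of_set_insert_Min) (use o(2,3) in auto)
    then have cp: "centred_prod (map a (sorted_list_of_set (insert (Suc p) I))) = ?x * u"
      using o(2) unfolding u_def by simp
    have "?v = attach L H j (cls L u) (stack_vec a stk')"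
    proof (cases "I = {}")
      case True
      then have "stk' = stk" using o(8) by simp
      then show ?thesis using True attach_cls_1[OF o(5) v'] by (simp add: u_def)
    next
      case False
      then have "stk = (j, I) # stk'" using o(8) by simp
      then show ?thesis using False by (simp add: u_def attach_centred[OF cls_centre_centred])
    qed
    then have "\<Lambda> j ?x ?v = attach L H j (cls L (?x * u)) (stack_vec a stk')"
      using lambda_attach[OF o(5) v'] by (simp add: LM.lmul_cls)
    then show ?thesis by (simp add: attach_cls boolean_cumulant_def cp)
  qed
  \<comment> \<open>Each color belongs to at most one move: the color of the top entry cannot be
    pushed again, since strings of \<open>T\<close> alternate.\<close>
  have inj: "inj_on fst ?O"
  proof (rule inj_onI)
    fix x y assume xy: "x \<in> ?O" "y \<in> ?O" "fst x = fst y"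
    have nb: "hd ?s # ?s \<notin> T" if "stk \<noteq> []"
      using not_begin[of "hd ?s" ?s] that by auto
    show "x = y" using xy nb unfolding stack_moves_def by (cases stk) auto
  qed
  have "(\<Sum>u\<in>?O. ?g u) = (\<Sum>u\<in>?O. \<Lambda> (fst u) ?x ?v)"
    using act by (intro sum.cong) auto
  also have "\<dots> = (\<Sum>j\<in>fst ` ?O. \<Lambda> j ?x ?v)"
    by (simp add: sum.reindex[OF inj])
  also have "\<dots> = lambda_sum ?x ?v"
    unfolding lambda_sum_def
  proof (rule sum.mono_neutral_left)
    show "fst ` ?O \<subseteq> {1..N}"
      using stack_movesD(5)[OF T ok] letter_range by fastforce
    \<comment> \<open>A color without a move neither begins the current string nor extends it within
      \<open>T\<close>, and on such summands the operator is zero.\<close>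
    show "\<forall>j\<in>{1..N} - fst ` ?O. \<Lambda> j ?x ?v = 0"
    proof
      fix j assume j: "j \<in> {1..N} - fst ` ?O"
      have "j # ?s \<notin> T"
      proof
        assume "j # ?s \<in> T"
        then have "(j, {}, stk) \<in> ?O" unfolding stack_moves_def by blast
        then show False using j by force
      qed
      moreover have "\<not> (?s \<noteq> [] \<and> hd ?s = j)"
      proof
        assume *: "?s \<noteq> [] \<and> hd ?s = j"
        then obtain I rest where "stk = (j, I) # rest" by (cases stk) auto
        then have "(j, I, rest) \<in> ?O" unfolding stack_moves_def by simp
        then show False using j by force
      qed
      ultimately show "\<Lambda> j ?x ?v = 0" using lambda_zero[OF _ s _ _ v] j by blast
    qed
  qed simp
  finally show ?thesis ..
qed

text \<open>The left action reaches the first slot only. The entries are ordered from left to right,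
  so the first index of that slot is the least index of the whole ground, the same one that receives
  the value in \<open>close_sum\<close>.\<close>

lemma lact_stack_vec:
  assumes ok: "stack_ok T q ((j, I) # stk)" and r: "r = Min (stack_ground ((j, I) # stk))"
  shows "lact H b (stack_vec a ((j, I) # stk)) = stack_vec (a(r := \<iota> b * a r)) ((j, I) # stk)"
proof -
  note d = stack_ok_ConsD[OF T ok]
  have fin: "finite I" by (rule d(2))
  have "r = Min I"
    unfolding r stack_ground_Cons
    using d(2,3,5) finite_stack_ground[OF d(1)] by (intro Min_eqI) (auto simp: Min_le_iff intro: less_imp_le)
  then have rI: "r \<in> I" using fin d(3) by simp
  let ?a = "a(r := \<iota> b * a r)"
  have s: "map fst stk \<in> T" using d(1) by (simp add: stack_ok_def)
  have sl: "sorted_list_of_set I = r # sorted_list_of_set (I - {r})"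
    unfolding \<open>r = Min I\<close> using fin d(3) by (rule sorted_list_of_set_nonempty)
  have m: "map ?a (sorted_list_of_set (I - {r})) = map a (sorted_list_of_set (I - {r}))"
    using fin by auto
  have cp: "centred_prod (map ?a (sorted_list_of_set I)) = \<iota> b * centred_prod (map a (sorted_list_of_set I))"
    unfolding sl list.map m by (simp add: mult.assoc)
  have "stack_vec ?a stk = stack_vec a stk"
  proof (rule stack_vec_cong)
    show "?a x = a x" if "x \<in> stack_ground stk" for x using d(5)[OF rI that] by simp
    show "finite J" if "(i, J) \<in> set stk" for i J by (rule stack_okD(1)[OF d(1) that])
  qed
  then show ?thesis
    using HM.lact_tens[OF d(6) cls_centre_centred stack_vec_summand[OF s]]
    by (simp only: stack_vec.simps cp centre_left LM.lmul_cls)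
qed

text \<open>Both sides obey the same recursion in the number of unread letters. With no letter left,
  a nonempty stack has no completion, since an open block would need a point at most 0, and its
  vector is orthogonal to the vacuum; the empty stack gives 1 on both sides.\<close>

lemma word_op_config_sum:
  assumes "stack_ok T p stk"
  shows "ip H (vac H) (word_op a p (stack_vec a stk)) = config_sum N T p stk a"
  using assms
proof (induction p arbitrary: stk a)
  case 0
  show ?case
  proof (cases "stk = []")
    case True
    have "configs N T 0 [] = {({}, \<lambda>_. undefined)}"
      by (auto simp: configs_def stack_ground_def NC_empty open_blocks_def strict_colorings_def
          weak_colorings_def covers_def)
    then show ?thesis using True by (simp add: config_sum_def nested_eval_empty HM.vac_ip)
  next
    case False
    obtain j I rest where stk: "stk = (j, I) # rest" using False by (cases stk) auto
    have "False" if "(\<pi>, \<kappa>) \<in> configs N T 0 stk" for \<pi> \<kappa>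
    proof -
      have op: "open_blocks 0 stk \<pi> \<kappa>" and \<pi>: "\<pi> \<in> NC (stack_ground stk)"
        using that unfolding configs_def by auto
      obtain V where V: "V \<in> \<pi>" "V - {..0} = I" "V \<noteq> I" using open_blocksD[OF op, of j I] stk by auto
      have "V \<subseteq> stack_ground stk"
        using \<pi> V(1) nc_part_NC[OF finite_stack_ground[OF 0]] by blast
      then have "0 \<notin> V" using stack_ground_gt[OF 0] by blast
      then have "V - {..0} = V" by auto
      then show False using V by simp
    qed
    then have "configs N T 0 stk = {}" by auto
    moreover have "ip H (vac H) (stack_vec a stk) = 0"
    proof (rule HM.summand_orthogonal)
      show "[] \<in> T" by (rule Tree_Nil[OF T])
      show s: "map fst stk \<in> T" using 0 by (simp add: stack_ok_def)
      show "[] \<noteq> map fst stk" using False by simp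
      show "vac H \<in> summand H []" using stack_vec_summand[of "[]" a] Tree_Nil[OF T] by simp
      show "stack_vec a stk \<in> summand H (map fst stk)" by (rule stack_vec_summand[OF s])
    qed
    ultimately show ?thesis by (simp add: config_sum_def)
  qed
next
  case (Suc p)
  let ?b = "\<lambda>I. boolean_cumulant (map a (sorted_list_of_set (insert (Suc p) I)))"
  have close: "ip H (vac H) (word_op a p (lact H (?b I) (stack_vec a stk'))) = close_sum N T p I stk' a"
    if opt: "(j, I, stk') \<in> stack_moves T stk" for j I stk'
  proof -
    note o = stack_movesD[OF T Suc.prems opt]
    have ok': "stack_ok T p stk'" by (rule stack_ok_ConsD(1)[OF T o(9)])
    show ?thesis
    proof (cases stk')
      case Nil
      have "lact H (?b I) (vac H) = ract H (vac H) (?b I)"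
        using HM.lact_vac[of "?b I" 1] by (simp add: HM.ract_1)
      then show ?thesis
        using Suc.IH[OF ok'[unfolded Nil], of a]
        by (simp add: Nil close_sum_def word_op_ract HM.ip_ract_right)
    next
      case (Cons e rest)
      obtain i J where e: "e = (i, J)" by (cases e)
      note stk' = Cons[unfolded e]
      define r where "r = Min (stack_ground stk')"
      let ?a = "a(r := \<iota> (?b I) * a r)"
      have "r \<in> stack_ground stk'"
        unfolding r_def using finite_stack_ground[OF ok'] stack_okD(2)[OF ok', of i J] stk'
        by (intro Min_in) (auto simp: stack_ground_Cons)
      \<comment> \<open>The modified index belongs to a letter already read, so the remaining word
        is the same for the modified arguments and the induction hypothesis applies to them.\<close>
      then have "p < r" by (rule stack_ground_gt[OF ok'])
      then have w: "word_op a p v = word_op ?a p v" for v by (intro word_op_cong) auto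
      have "lact H (?b I) (stack_vec a stk') = stack_vec ?a stk'"
        unfolding stk' by (rule lact_stack_vec[OF o(1)[unfolded stk']]) (simp only: r_def stk')
      then have "ip H (vac H) (word_op a p (lact H (?b I) (stack_vec a stk'))) = config_sum N T p stk' ?a"
        by (simp only: w Suc.IH[OF ok'])
      then show ?thesis using Cons by (simp add: close_sum_def Let_def r_def)
    qed
  qed
  have "ip H (vac H) (word_op a (Suc p) (stack_vec a stk)) = (\<Sum>u\<in>stack_moves T stk. ip H (vac H) (word_op a p
      (case u of (j, I, stk') \<Rightarrow> lact H (?b I) (stack_vec a stk') + stack_vec a ((j, insert (Suc p) I) # stk'))))"
    unfolding word_op.simps lambda_sum_stack[OF Suc.prems] word_op_sum ip_sum ..
  also have "\<dots> = (\<Sum>(j, I, stk')\<in>stack_moves T stk.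
      close_sum N T p I stk' a + config_sum N T p ((j, insert (Suc p) I) # stk') a)"
  proof (rule sum.cong[OF refl])
    fix u assume u: "u \<in> stack_moves T stk"
    obtain j I stk' where u_eq: "u = (j, I, stk')" by (cases u)
    have opt: "(j, I, stk') \<in> stack_moves T stk" using u u_eq by simp
    show "ip H (vac H) (word_op a p
      (case u of (j, I, stk') \<Rightarrow> lact H (?b I) (stack_vec a stk') + stack_vec a ((j, insert (Suc p) I) # stk'))) =
      (case u of (j, I, stk') \<Rightarrow> close_sum N T p I stk' a + config_sum N T p ((j, insert (Suc p) I) # stk') a)"
      unfolding u_eq prod.case word_op_add HM.ip_add_right close[OF opt]
        Suc.IH[OF stack_movesD(9)[OF T Suc.prems opt]] ..
  qed
  also have "\<dots> = config_sum N T (Suc p) stk a" by (rule config_sum_Suc[OF T Suc.prems, symmetric])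
  finally show ?case .
qed

text \<open>The factor n^|\<sigma>| is the normalisation in the recursion for \<alpha> read
  backwards: summing the component products over all weak colorings of \<open>\<sigma>\<close> gives
  \<alpha> at \<open>\<sigma>\<close> times this power.\<close>

lemma word_op_cumulants:
  assumes n: "root_degree N T \<ge> 2" and K: "tree_cumulants N T (type_algebra \<iota> E) K"
  shows "ip H (vac H) (word_op a l (vac H)) =
    (\<Sum>\<pi>\<in>NC {1..l}. (tree_coeff N T \<pi> * real (root_degree N T) ^ card \<pi>) *\<^sub>R part_eval K \<pi> a)"
proof -
  let ?S = "{1..l}" and ?\<alpha> = "tree_coeff N T"
  have ok: "stack_ok T l []" using Tree_Nil[OF T] by (simp add: stack_ok_def)
  have nc: "nc_part \<pi>" "0 \<notin> \<Union>\<pi>" if "\<pi> \<in> NC ?S" for \<pi> using that nc_part_NC[of ?S] by auto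
  have "configs N T l [] = (SIGMA \<pi>:NC ?S. strict_colorings N T \<pi>)"
    by (auto simp: configs_def stack_ground_def open_blocks_def)
  then have "ip H (vac H) (word_op a l (vac H)) = (\<Sum>(\<pi>, \<kappa>)\<in>(SIGMA \<pi>:NC ?S. strict_colorings N T \<pi>). part_eval boolean_cumulant \<pi> a)"
    using word_op_config_sum[OF ok, of a] by (simp add: config_sum_def)
  also have "\<dots> = (\<Sum>\<pi>\<in>NC ?S. \<Sum>\<kappa>\<in>strict_colorings N T \<pi>. part_eval boolean_cumulant \<pi> a)"
    by (subst sum.Sigma) (use finite_NC finite_strict_colorings nc_part_finite nc in auto)
  also have "\<dots> = (\<Sum>\<pi>\<in>NC ?S. \<Sum>\<kappa>\<in>strict_colorings N T \<pi>. \<Sum>\<sigma>\<in>irr_refinements \<pi>.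
       (\<Prod>V\<in>\<pi>. ?\<alpha> (part_within \<sigma> V)) *\<^sub>R part_eval K \<sigma> a)"
    by (intro sum.cong refl part_eval_boolean_refine[OF n K] nc)
  also have "\<dots> = (\<Sum>\<sigma>\<in>NC ?S. \<Sum>\<psi>\<in>weak_colorings N T \<sigma>. (\<Prod>C\<in>color_components \<sigma> \<psi>. ?\<alpha> C) *\<^sub>R part_eval K \<sigma> a)"
    by (rule sum_weak_colorings[symmetric]) simp
  also have "\<dots> = (\<Sum>\<sigma>\<in>NC ?S. (?\<alpha> \<sigma> * real (root_degree N T) ^ card \<sigma>) *\<^sub>R part_eval K \<sigma> a)"
  proof (rule sum.cong[OF refl])
    fix \<sigma> assume "\<sigma> \<in> NC ?S"
    from tree_coeff_eq[OF n nc(1)[OF this]] n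
    have "(\<Sum>\<psi>\<in>weak_colorings N T \<sigma>. \<Prod>C\<in>color_components \<sigma> \<psi>. ?\<alpha> C) = ?\<alpha> \<sigma> * real (root_degree N T) ^ card \<sigma>"
      by (simp add: field_simps)
    then show "(\<Sum>\<psi>\<in>weak_colorings N T \<sigma>. (\<Prod>C\<in>color_components \<sigma> \<psi>. ?\<alpha> C) *\<^sub>R part_eval K \<sigma> a)
      = (?\<alpha> \<sigma> * real (root_degree N T) ^ card \<sigma>) *\<^sub>R part_eval K \<sigma> a"
      by (simp flip: scaleR_sum_left)
  qed
  finally show ?thesis .
qed

section \<open>Comparison of the cumulants of the product with those of the factor\<close>

lemma foldr_word_op:
  "foldr (\<circ>) (map (lambda_sum \<circ> a) [1..<Suc l]) id = word_op a l"
proof (induction l)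
  case (Suc l)
  have "foldr (\<circ>) fs g = foldr (\<circ>) fs id \<circ> g" for fs and g :: "'h \<Rightarrow> 'h"
    by (induction fs) auto
  note fold = this
  have "[1..<Suc (Suc l)] = [1..<Suc l] @ [Suc l]" by simp
  then have "foldr (\<circ>) (map (lambda_sum \<circ> a) [1..<Suc (Suc l)]) id
      = foldr (\<circ>) (map (lambda_sum \<circ> a) [1..<Suc l]) (lambda_sum (a (Suc l)))"
    by (simp del: upt_Suc)
  also have "\<dots> = word_op a l \<circ> lambda_sum (a (Suc l))" by (subst fold) (simp only: Suc)
  also have "\<dots> = word_op a (Suc l)" by (simp add: fun_eq_iff)
  finally show ?case .
qed (simp add: fun_eq_iff)

text \<open>\<open>tree_cumulants\<close> speaks only about lists over the carrier, so the sums must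
  be shown to belong to the generated algebra.\<close>

lemma lambda_sum_carrier:
  assumes "N \<ge> 1"
  shows "lambda_sum a \<in> carr (tree_product_algebra N H \<Lambda>)"
proof -
  have "lambda_sum a \<in> S"
    if S: "operator_cstar_algebra H S" and G: "(\<Union>j\<in>{1..N}. range (\<Lambda> j)) \<union> range (lact H) \<subseteq> S" for S
  proof -
    have add: "\<forall>f\<in>S. \<forall>g\<in>S. (\<lambda>v. f v + g v) \<in> S" using S unfolding operator_cstar_algebra_def by blast
    have mem: "\<Lambda> j a \<in> S" if "j \<in> {1..N}" for j using G that by blast
    \<comment> \<open>The induction starts from one summand: the algebras provide closure under
      binary sums, and \<open>N \<ge> 1\<close> supplies the first term.\<close>
    have "(\<lambda>v. \<Sum>j=1..Suc m. \<Lambda> j a v) \<in> S" if "Suc m \<le> N" for m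
      using that
    proof (induction m)
      case 0
      then show ?case using mem[of 1] by simp
    next
      case (Suc m)
      then have "(\<lambda>v. (\<Sum>j=1..Suc m. \<Lambda> j a v) + \<Lambda> (Suc (Suc m)) a v) \<in> S"
        using bspec[OF bspec[OF add Suc.IH] mem[of "Suc (Suc m)"]] by simp
      then show ?case by (simp only: sum.cl_ivl_Suc) simp
    qed
    from this[of "N - 1"] assms show ?thesis unfolding lambda_sum_def[abs_def] by simp
  qed
  then show ?thesis unfolding tree_product_algebra_def generated_cstar_algebra_def by auto
qed

text \<open>Both evaluations remove the same block, as the choice depends on \<open>\<pi>\<close>
  alone, and each block contributes one factor \<open>c\<close>. The bound on block sizes restricts
  the comparison to cumulants of lengths already known.\<close>

lemma nested_eval_lambda_sum:
  assumes lin: "left_multilinear K"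
    and K': "\<And>xs. xs \<noteq> [] \<Longrightarrow> length xs < l \<Longrightarrow> K' (map lambda_sum xs) = c *\<^sub>R K xs"
    and "nc_part \<pi>" "\<And>V. V \<in> \<pi> \<Longrightarrow> card V < l"
  shows "nested_eval (tree_product_algebra N H \<Lambda>) K' \<pi> (lambda_sum \<circ> a) = c ^ card \<pi> *\<^sub>R part_eval K \<pi> a"
  using assms(3,4)
proof (induction "card \<pi>" arbitrary: \<pi> a rule: less_induct)
  case less
  note nc = less.prems(1)
  let ?A = "tree_product_algebra N H \<Lambda>"
  show ?case
  proof (cases "\<pi> = {}")
    case False
    define V where "V = first_block \<pi>"
    have "interval_block \<pi> V" unfolding V_def by (rule interval_first_block[OF nc False])
    then have V\<pi>: "V \<in> \<pi>" by (simp add: interval_block_def)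
    have eq: "nested_eval A \<Theta> \<pi> a = absorb A \<Theta> \<pi> V (nested_eval A \<Theta> (\<pi> - {V})) a" for A \<Theta> a
      unfolding V_def by (rule nested_eval_first_block[OF nc False])
    have eq': "part_eval \<Theta> \<pi> a = absorb_block \<Theta> \<pi> V (part_eval \<Theta> (\<pi> - {V})) a" for \<Theta> a
      unfolding V_def by (rule nested_eval_first_block[OF nc False])
    note fin = nc_part_finite[OF nc]
    have card: "card (\<pi> - {V}) < card \<pi>" using V\<pi> fin by (rule card_Diff1_less[rotated])
    have cardS: "card \<pi> = Suc (card (\<pi> - {V}))" using V\<pi> fin by (metis card.remove)
    have ncd: "nc_part (\<pi> - {V})" using nc by (rule nc_part_subset) auto
    have IH: "nested_eval ?A K' (\<pi> - {V}) (lambda_sum \<circ> a) = c ^ card (\<pi> - {V}) *\<^sub>R part_eval K (\<pi> - {V}) a" for a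
      by (rule less.hyps[OF card ncd]) (use less.prems(2) in auto)
    have finV: "finite V" "V \<noteq> {}" using nc V\<pi> nc_part_finite_block nc_part_nonempty by auto
    define b where "b = K (map a (sorted_list_of_set V))"
    have len: "length (map a (sorted_list_of_set V)) < l" using less.prems(2)[OF V\<pi>] by simp
    have nonempty: "map a (sorted_list_of_set V) \<noteq> []" using finV by simp
    have b': "K' (map (lambda_sum \<circ> a) (sorted_list_of_set V)) = c *\<^sub>R b"
      using K'[OF nonempty len] by (simp add: b_def)
    show ?thesis
    proof (cases "right_of \<pi> V = {}")
      case True
      then show ?thesis
        unfolding eq[of ?A] eq' absorb_def[of ?A] absorb_block_def b' IH cardS by (simp add: b_def)
    next
      case False
      define r where "r = Min (right_of \<pi> V)"
      have r: "r \<in> \<Union>(\<pi> - {V})" unfolding r_def by (rule Min_right_of(1)[OF nc V\<pi> False])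
      \<comment> \<open>Left multiplication of a sum of embeddings by an element of \<B> is again a
        sum of embeddings, so the arguments keep the form required by the induction
        hypothesis.\<close>
      have upd: "(lambda_sum \<circ> a)(r := mult_alg ?A (incl_alg ?A (c *\<^sub>R b)) ((lambda_sum \<circ> a) r))
          = lambda_sum \<circ> (a(r := \<iota> (c *\<^sub>R b) * a r))"
        by (auto simp: tree_product_algebra_def fun_eq_iff lact_lambda_sum)
      have "part_eval K (\<pi> - {V}) (a(r := \<iota> (c *\<^sub>R b) * a r)) = c *\<^sub>R part_eval K (\<pi> - {V}) (a(r := \<iota> b * a r))"
        using part_eval_scaleR[OF lin ncd r, of a c "\<iota> b * a r"] by (simp add: incl_scaleR)
      then show ?thesis using False
        unfolding eq[of ?A] eq' absorb_def[of ?A] absorb_block_def b' Let_def r_def[symmetric] upd IH cardS b_def[symmetric]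
        by simp
    qed
  qed (simp add: nested_eval_empty)
qed

text \<open>Induction on the length. The moment of the word is expanded once with \<open>K'\<close>
  and once with the rescaled evaluations of \<open>K\<close>; every partition other than the
  one-block partition has only shorter blocks, so its two terms agree and cancel. What remains is
  the top cumulant with coefficient 1 on one side and n^1 times the top cumulant of \<open>K\<close>
  on the other.\<close>

lemma cumulants_lambda_sum:
  assumes n: "root_degree N T \<ge> 2"
    and K: "tree_cumulants N T (type_algebra \<iota> E) K"
    and K': "tree_cumulants N T (tree_product_algebra N H \<Lambda>) K'"
    and "xs \<noteq> []"
  shows "K' (map lambda_sum xs) = real (root_degree N T) *\<^sub>R K xs"
  using assms(4)
proof (induction "length xs" arbitrary: xs rule: less_induct)
  case less
  let ?A = "tree_product_algebra N H \<Lambda>" and ?n = "real (root_degree N T)" and ?\<alpha> = "tree_coeff N T"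
  define l where "l = length xs"
  have l: "l > 0" using less.prems by (simp add: l_def)
  define a where "a i = xs ! (i - 1)" for i
  have lin: "left_multilinear K"
    using K quasi_multilinear_left_multilinear unfolding tree_cumulants_def by blast
  have "N \<ge> 1"
  proof (rule ccontr)
    assume "\<not> N \<ge> 1"
    then have "root_degree N T = 0" by (simp add: root_degree_def)
    then show False using n by simp
  qed
  have xs: "xs = map a [1..<Suc l]"
    by (rule nth_equalityI) (simp_all add: l_def a_def del: upt_Suc)
  have "map lambda_sum xs \<in> lists (carr ?A)" using lambda_sum_carrier[OF \<open>N \<ge> 1\<close>] by auto
  then have mom: "expect ?A (foldr (mult_alg ?A) (map lambda_sum xs) (one_alg ?A)) =
      (\<Sum>\<pi>\<in>NC {1..l}. ?\<alpha> \<pi> *\<^sub>R nested_eval ?A K' \<pi> (\<lambda>i. map lambda_sum xs ! (i - 1)))"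
    using K' less.prems unfolding tree_cumulants_def by (auto simp: l_def)
  have nc: "nc_part \<pi>" "\<Union>\<pi> = {1..l}" if "\<pi> \<in> NC {1..l}" for \<pi> using that nc_part_NC[of "{1..l}"] by auto
  have nth: "nested_eval ?A K' \<pi> (\<lambda>i. map lambda_sum xs ! (i - 1)) = nested_eval ?A K' \<pi> (lambda_sum \<circ> a)"
    if "\<pi> \<in> NC {1..l}" for \<pi>
  proof (rule nested_eval_cong[OF nc(1)[OF that]])
    show "map lambda_sum xs ! (i - 1) = (lambda_sum \<circ> a) i" if "i \<in> \<Union>\<pi>" for i
      using that nc(2)[OF \<open>\<pi> \<in> _\<close>] by (auto simp: a_def l_def)
  qed
  have lhs: "expect ?A (foldr (mult_alg ?A) (map lambda_sum xs) (one_alg ?A)) = ip H (vac H) (word_op a l (vac H))"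
    using foldr_word_op[of a l] by (simp add: tree_product_algebra_def xs del: upt_Suc)
  let ?one = "{{1..l}}"
  have one: "?one \<in> NC {1..l}"
    unfolding nc_part_NC[OF finite_atLeastAtMost] nc_part_iff noncrossing_def using l by auto
  have fin: "finite (NC {1..l})" by (rule finite_NC) simp
  have other: "nested_eval ?A K' \<pi> (lambda_sum \<circ> a) = ?n ^ card \<pi> *\<^sub>R part_eval K \<pi> a" if \<pi>: "\<pi> \<in> NC {1..l} - {?one}" for \<pi>
  proof (rule nested_eval_lambda_sum[OF lin _ nc(1)])
    show "K' (map lambda_sum ys) = ?n *\<^sub>R K ys" if "ys \<noteq> []" "length ys < l" for ys
      using less.hyps[of ys] that by (simp add: l_def)
    show "\<pi> \<in> NC {1..l}" using \<pi> by simp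
    show "card V < l" if V: "V \<in> \<pi>" for V
    proof -
      have p: "nc_part \<pi>" "\<Union>\<pi> = {1..l}" using nc \<pi> by auto
      have sub: "V \<subseteq> {1..l}" using V p(2) by blast
      moreover have "V \<noteq> {1..l}"
      proof
        assume V1: "V = {1..l}"
        have "W = V" if W: "W \<in> \<pi>" for W
        proof -
          obtain x where "x \<in> W" using nc_part_nonempty[OF p(1) W] by blast
          then show ?thesis using nc_part_disjoint[OF p(1) W V, of x] W V1 p(2) by blast
        qed
        then have "\<pi> = {V}" using V by blast
        then show False using \<pi> V1 by simp
      qed
      ultimately have "card V < card {1..l}" by (intro psubset_card_mono) auto
      then show ?thesis by simp
    qed
  qed
  have ncone: "nc_part ?one" by (rule nc(1)[OF one])
  have single: "nested_eval A \<Theta> ?one f = \<Theta> (map f [1..<Suc l])" for A :: "('x, 'b) valued_algebra" and \<Theta> f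
  proof -
    have ib: "interval_block ?one (first_block ?one)" by (rule interval_first_block[OF ncone]) simp
    then have "first_block ?one = {1..l}" by (simp add: interval_block_def)
    moreover have "right_of ?one {1..l} = {}" using l by (auto simp: right_of_def)
    moreover have "sorted_list_of_set {1..l} = [1..<Suc l]" by (metis atLeastLessThanSuc_atLeastAtMost sorted_list_of_set_range)
    ultimately show ?thesis
      using nested_eval_first_block[OF ncone, of A \<Theta> f]
      by (simp add: absorb_def nested_eval_empty del: upt_Suc)
  qed
  have \<alpha>1: "?\<alpha> ?one = 1" by (rule tree_coeff_single[OF n ncone])
  have "(\<Sum>\<pi>\<in>NC {1..l}. ?\<alpha> \<pi> *\<^sub>R nested_eval ?A K' \<pi> (lambda_sum \<circ> a)) =
      (\<Sum>\<pi>\<in>NC {1..l}. (?\<alpha> \<pi> * ?n ^ card \<pi>) *\<^sub>R part_eval K \<pi> a)"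
    using mom nth unfolding lhs word_op_cumulants[OF n K] by simp
  then have "?\<alpha> ?one *\<^sub>R nested_eval ?A K' ?one (lambda_sum \<circ> a) = (?\<alpha> ?one * ?n ^ card ?one) *\<^sub>R part_eval K ?one a"
    unfolding sum.remove[OF fin one] using other by simp
  then show ?case unfolding single \<alpha>1 by (simp add: xs del: upt_Suc)
qed

end

theorem theorem7p8:
  fixes N :: nat and T :: "nat list set"
    and \<iota> :: "'b::cstar_algebra \<Rightarrow> 'a::cstar_algebra" and E :: "'a \<Rightarrow> 'b"
    and L :: "('a, 'k::banach, 'b) L2_structure"
    and H :: "('k, 'h::banach, 'b) product_structure"
    and \<Lambda> :: "nat \<Rightarrow> 'a \<Rightarrow> 'h \<Rightarrow> 'h"
    and K :: "'a list \<Rightarrow> 'b" and K' :: "('h \<Rightarrow> 'h) list \<Rightarrow> 'b"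
    and as :: "'a list"
  assumes "T \<in> Tree N" and "root_degree N T \<ge> 2"
    and "bvalued_prob_space \<iota> E"
    and "L2_module \<iota> E L"
    and "tree_product_module T \<iota> L H"
    and "\<And>j a. j \<in> {1..N} \<Longrightarrow> tree_lambda T L H j (lmul L a) (\<Lambda> j a)"
    and "tree_cumulants N T (type_algebra \<iota> E) K"
    and "tree_cumulants N T (tree_product_algebra N H \<Lambda>) K'"
    and "length as \<ge> 1"
  shows "K' (map (\<lambda>a v. \<Sum>j=1..N. \<Lambda> j a v) as) = real (root_degree N T) *\<^sub>R K as"
proof -
  interpret bvalued_prob_space \<iota> E by (rule assms(3))
  interpret LM: L2_module \<iota> E L by (rule assms(4))
  interpret HM: tree_product_module T \<iota> L H by (rule assms(5))
  interpret tree_free_product N T \<iota> E L H \<Lambda> by unfold_locales (use assms(1,6) in auto)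
  have "as \<noteq> []" using assms(9) by auto
  from cumulants_lambda_sum[OF assms(2,7,8) this] show ?thesis
    unfolding lambda_sum_def[abs_def] .
qed

end
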